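(* Let $Z_0\subset\mathbb{R}^n$ be the zero cell of a Poisson hyperplane process in $\mathbb{R}^n$ with distance exponent $r>0$ (and some intensity $\gamma>0$), and let $f_\ell(Z_0)$ be its number of $\ell$-dimensional faces. Let $\ell\in\mathbb{N}_0$ be fixed. If $r$ is fixed (independent of $n$), then $$\lim_{n\to\infty}\sqrt[n]{\mathbb{E} f_\ell(Z_0)}=\frac{\omega_{r+1}}{\kappa_r}.$$ If $r=b\,n$ for some fixed $b>0$, then $$\lim_{n\to\infty}n^{-1/2}\sqrt[n]{\mathbb{E} f_\ell(Z_0)}=\sqrt{2\pi b}.$$
   Context: For real $s>0$ put $\omega_s=2\pi^{s/2}/\Gamma(s/2)$ and $\kappa_s=\pi^{s/2}/\Gamma(s/2+1)$. For $n\ge2$, $r>0$ (distance exponent) and $\gamma>0$ (intensity), let $H(u,t)=\{x\in\mathbb{R}^n:\langle x,u\rangle=t\}$ for $u\in\mathbb{S}^{n-1}$, $t\in\mathbb{R}$, and let $\Theta$ be the measure on the space $A(n,n-1)$ of affine hyperplanes of $\mathbb{R}^n$ given by $$\Theta(\,\cdot\,)=\frac{\gamma}{\omega_n}\int_{\mathbb{S}^{n-1}}\int_{\mathbb{R}}\mathbf{1}\{H(u,t)\in\,\cdot\,\}\,|t|^{r-1}\,dt\,\mathcal{H}^{n-1}(du),$$ where $\mathcal{H}^s$ is $s$-dimensional Hausdorff measure. The Poisson hyperplane process $X$ with distance exponent $r$ and intensity $\gamma$ is the Poisson process on $A(n,n-1)$ with intensity measure $\Theta$. Its zero cell is $Z_0=\bigcap_{H\in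 X}H^-$, where $H^-$ is the closed half-space bounded by $H$ containing the origin; almost surely $Z_0$ is a polytope. *)

theory Defs
  imports "HOL-Probability.Probability" "HOL-Library.Poly_Mapping"
begin

section \<open>Euclidean spaces of variable dimension\<close>

text \<open>
  The dimension \<open>n\<close> tends to infinity, so it cannot be a type. All the spaces \<open>\<real>\<^sup>n\<close> are taken inside
  one inner product space, the finitely supported sequences of reals \<open>nat \<Rightarrow>\<^sub>0 real\<close>, as the
  subspaces of the sequences that vanish from index \<open>n\<close> on. Convexity, faces, diameters, linear
  dimension and the Borel sets of \<open>\<real>\<^sup>n\<close> are those inherited from the ambient space.
\<close>

instantiation poly_mapping :: (type, real_vector) real_vector
begin

lift_definition scaleR_poly_mapping :: "real \<Rightarrow> ('a \<Rightarrow>\<^sub>0 'b) \<Rightarrow> 'a \<Rightarrow>\<^sub>0 'b"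
  is "\<lambda>c f k. c *\<^sub>R f k"
  by (erule rev_finite_subset) auto

instance
  by standard (transfer; simp add: fun_eq_iff scaleR_add_right scaleR_add_left)+

end

instantiation poly_mapping :: (type, real_inner) real_inner
begin

definition inner_poly_mapping :: "('a \<Rightarrow>\<^sub>0 'b) \<Rightarrow> ('a \<Rightarrow>\<^sub>0 'b) \<Rightarrow> real"
  where "inner_poly_mapping f g = (\<Sum>k\<in>Poly_Mapping.keys f. inner (Poly_Mapping.lookup f k) (Poly_Mapping.lookup g k))"

definition norm_poly_mapping :: "('a \<Rightarrow>\<^sub>0 'b) \<Rightarrow> real"
  where "norm_poly_mapping f = sqrt (inner f f)"

definition sgn_poly_mapping :: "('a \<Rightarrow>\<^sub>0 'b) \<Rightarrow> 'a \<Rightarrow>\<^sub>0 'b"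
  where "sgn_poly_mapping f = f /\<^sub>R norm f"

definition dist_poly_mapping :: "('a \<Rightarrow>\<^sub>0 'b) \<Rightarrow> ('a \<Rightarrow>\<^sub>0 'b) \<Rightarrow> real"
  where "dist_poly_mapping f g = norm (f - g)"

definition uniformity_poly_mapping :: "(('a \<Rightarrow>\<^sub>0 'b) \<times> ('a \<Rightarrow>\<^sub>0 'b)) filter"
  where "uniformity_poly_mapping = (INF e\<in>{0<..}. principal {(f, g). dist f g < e})"

definition open_poly_mapping :: "('a \<Rightarrow>\<^sub>0 'b) set \<Rightarrow> bool"
  where "open_poly_mapping U \<longleftrightarrow>
    (\<forall>f\<in>U. eventually (\<lambda>(f', g). f' = f \<longrightarrow> g \<in> U) uniformity)"

lemma inner_poly_mapping_superset:
  fixes f g :: "'a \<Rightarrow>\<^sub>0 'b"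
  assumes "finite A" "Poly_Mapping.keys f \<subseteq> A"
  shows "inner f g = (\<Sum>k\<in>A. inner (Poly_Mapping.lookup f k) (Poly_Mapping.lookup g k))"
  unfolding inner_poly_mapping_def
  by (rule sum.mono_neutral_left) (use assms in \<open>auto simp: in_keys_iff\<close>)

instance
proof
  fix f g h :: "'a \<Rightarrow>\<^sub>0 'b" and c :: real
  define A where "A = Poly_Mapping.keys f \<union> Poly_Mapping.keys g \<union> Poly_Mapping.keys (f + g)"
  have A: "finite A" "Poly_Mapping.keys f \<subseteq> A" "Poly_Mapping.keys g \<subseteq> A" "Poly_Mapping.keys (f + g) \<subseteq> A"
    unfolding A_def by auto
  show "inner f g = inner g f"
    using A by (simp add: inner_poly_mapping_superset[of A] inner_commute)
  show "inner (f + g) h = inner f h + inner g h"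
    using A by (simp add: inner_poly_mapping_superset[of A] lookup_add inner_add_left sum.distrib)
  have "Poly_Mapping.keys (c *\<^sub>R f) \<subseteq> Poly_Mapping.keys f"
    by (auto simp: in_keys_iff scaleR_poly_mapping.rep_eq)
  then show "inner (c *\<^sub>R f) g = c * inner f g"
    using inner_poly_mapping_superset[of "Poly_Mapping.keys f" "c *\<^sub>R f" g]
      inner_poly_mapping_superset[of "Poly_Mapping.keys f" f g]
    by (simp add: scaleR_poly_mapping.rep_eq sum_distrib_left)
  show "0 \<le> inner f f"
    by (simp add: inner_poly_mapping_def sum_nonneg)
  show "inner f f = 0 \<longleftrightarrow> f = 0"
    by (auto simp: inner_poly_mapping_def sum_nonneg_eq_0_iff in_keys_iff intro!: poly_mapping_eqI)
  show "norm f = sqrt (inner f f)" "sgn f = f /\<^sub>R norm f" "dist f g = norm (f - g)"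
    by (fact norm_poly_mapping_def sgn_poly_mapping_def dist_poly_mapping_def)+
next
  show "uniformity = (INF e\<in>{0<..}. principal {(f, g). dist f g < e} ::
      (('a \<Rightarrow>\<^sub>0 'b) \<times> ('a \<Rightarrow>\<^sub>0 'b)) filter)"
    by (fact uniformity_poly_mapping_def)
  fix U :: "('a \<Rightarrow>\<^sub>0 'b) set"
  show "open U \<longleftrightarrow> (\<forall>f\<in>U. eventually (\<lambda>(f', g). f' = f \<longrightarrow> g \<in> U) uniformity)"
    by (fact open_poly_mapping_def)
qed

end

definition Rn :: "nat \<Rightarrow> (nat \<Rightarrow>\<^sub>0 real) set"
  where "Rn n = {x. Poly_Mapping.keys x \<subseteq> {..<n}}"

definition unit_sphere :: "nat \<Rightarrow> (nat \<Rightarrow>\<^sub>0 real) set"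
  where "unit_sphere n = Rn n \<inter> sphere 0 1"


section \<open>Constants and Hausdorff measure\<close>

definition omega :: "real \<Rightarrow> real"
  where "omega s = 2 * pi powr (s / 2) / Gamma (s / 2)"

definition kappa :: "real \<Rightarrow> real"
  where "kappa s = pi powr (s / 2) / Gamma (s / 2 + 1)"

text \<open>
  Normalised so that on \<open>\<real>\<^sup>n\<close> it is Lebesgue measure for \<open>s = n\<close>. To be used for \<open>s > 0\<close> only, since
  \<open>0 powr 0 = 0\<close>. The covering sets must be bounded because \<^const>\<open>diameter\<close> is meaningful only
  for these.
\<close>

definition hausdorff_outer :: "real \<Rightarrow> 'a::metric_space set \<Rightarrow> ennreal"
  where "hausdorff_outer s A =
    (SUP \<delta>\<in>{0<..}. INF C\<in>{C :: nat \<Rightarrow> 'a set.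
        A \<subseteq> (\<Union>i. C i) \<and> (\<forall>i. bounded (C i) \<and> diameter (C i) \<le> \<delta>)}.
      suminf (\<lambda>i. ennreal (kappa s * (diameter (C i) / 2) powr s)))"

definition hausdorff_measure :: "real \<Rightarrow> 'a::metric_space measure"
  where "hausdorff_measure s = measure_of UNIV (sets borel) (hausdorff_outer s)"


section \<open>Hyperplanes\<close>

definition hyperplane :: "nat \<Rightarrow> (nat \<Rightarrow>\<^sub>0 real) \<Rightarrow> real \<Rightarrow> (nat \<Rightarrow>\<^sub>0 real) set"
  where "hyperplane n u t = {x \<in> Rn n. inner x u = t}"

definition hyperplanes :: "nat \<Rightarrow> (nat \<Rightarrow>\<^sub>0 real) set set"
  where "hyperplanes n = {hyperplane n u t | u t. u \<in> unit_sphere n}"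

text \<open>
  The \<open>\<sigma>\<close>-algebra is the Borel \<open>\<sigma>\<close>-algebra of the usual topology of the space of hyperplanes, the
  quotient topology of the parametrisation \<open>(u, t) \<mapsto> H(u, t)\<close>.
\<close>

definition hyperplane_borel :: "nat \<Rightarrow> (nat \<Rightarrow>\<^sub>0 real) set measure"
  where "hyperplane_borel n = sigma (hyperplanes n)
    {U. U \<subseteq> hyperplanes n \<and>
      openin (top_of_set (unit_sphere n \<times> UNIV))
        {(u, t). u \<in> unit_sphere n \<and> hyperplane n u t \<in> U}}"

definition hyperplane_intensity :: "nat \<Rightarrow> real \<Rightarrow> real \<Rightarrow> (nat \<Rightarrow>\<^sub>0 real) set measure"
  where "hyperplane_intensity n r \<gamma> =
    measure_of (hyperplanes n) (sets (hyperplane_borel n))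
      (\<lambda>B. ennreal (\<gamma> / omega (real n)) *
        (\<integral>\<^sup>+u\<in>unit_sphere n.
           (\<integral>\<^sup>+t. indicator B (hyperplane n u t) * ennreal (\<bar>t\<bar> powr (r - 1)) \<partial>lborel)
         \<partial>hausdorff_measure (real n - 1)))"


section \<open>Poisson processes\<close>

text \<open>Cardinality with value \<open>\<infinity>\<close> for infinite sets.\<close>

definition ecard :: "'a set \<Rightarrow> ennreal"
  where "ecard A = emeasure (count_space UNIV) A"

text \<open>
  A Poisson process with \<open>\<sigma>\<close>-finite diffuse intensity measure \<open>\<Theta>\<close> is almost surely simple, so it is
  described by the random set \<open>X\<close> of its points. The intensity measures used here are of this kind.
\<close>

locale poisson_process = prob_space M
  for M :: "'w measure" +
  fixes \<Theta> :: "'a measure" and X :: "'w \<Rightarrow> 'a set"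
  assumes points: "\<omega> \<in> space M \<Longrightarrow> X \<omega> \<subseteq> space \<Theta>"
    and count_measurable:
      "B \<in> sets \<Theta> \<Longrightarrow> (\<lambda>\<omega>. ecard (X \<omega> \<inter> B)) \<in> borel_measurable M"
    and count_poisson:
      "B \<in> sets \<Theta> \<Longrightarrow> emeasure \<Theta> B < \<infinity> \<Longrightarrow>
        prob {\<omega> \<in> space M. ecard (X \<omega> \<inter> B) = of_nat k} =
          measure \<Theta> B ^ k / fact k * exp (- measure \<Theta> B)"
    and count_indep:
      "finite I \<Longrightarrow> (\<And>i. i \<in> I \<Longrightarrow> D i \<in> sets \<Theta>) \<Longrightarrow> disjoint_family_on D I \<Longrightarrow>
        indep_vars (\<lambda>_. borel) (\<lambda>i \<omega>. ecard (X \<omega> \<inter> D i)) (I :: nat set)"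

abbreviation poisson_hyperplane_process ::
    "nat \<Rightarrow> real \<Rightarrow> real \<Rightarrow> 'w measure \<Rightarrow> ('w \<Rightarrow> (nat \<Rightarrow>\<^sub>0 real) set set) \<Rightarrow> bool"
  where "poisson_hyperplane_process n r \<gamma> M X \<equiv> poisson_process M (hyperplane_intensity n r \<gamma>) X"


section \<open>Zero cell and face numbers\<close>

definition halfspaces :: "nat \<Rightarrow> (nat \<Rightarrow>\<^sub>0 real) set \<Rightarrow> (nat \<Rightarrow>\<^sub>0 real) set set"
  where "halfspaces n H =
    {{x \<in> Rn n. inner x u \<le> t} | u t. u \<in> unit_sphere n \<and> H = hyperplane n u t}"

text \<open>
  For \<open>0 \<notin> H\<close>, which almost surely holds for all hyperplanes of the process, exactly one of the two
  half-spaces bounded by \<open>H\<close> contains \<open>0\<close>.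
\<close>

definition zero_cell :: "nat \<Rightarrow> (nat \<Rightarrow>\<^sub>0 real) set set \<Rightarrow> (nat \<Rightarrow>\<^sub>0 real) set"
  where "zero_cell n \<H> = {x \<in> Rn n. \<forall>H\<in>\<H>. \<forall>S\<in>halfspaces n H. 0 \<in> S \<longrightarrow> x \<in> S}"

text \<open>
  \<^const>\<open>aff_dim\<close> needs a Euclidean space type; the dimension of a face is the linear dimension of
  its direction space.
\<close>

definition face_number :: "nat \<Rightarrow> (nat \<Rightarrow>\<^sub>0 real) set \<Rightarrow> ennreal"
  where "face_number l P =
    ecard {F. F face_of P \<and> F \<noteq> {} \<and> dim {x - y | x y. x \<in> F \<and> y \<in> F} = l}"

definition expected_face_number ::
    "nat \<Rightarrow> nat \<Rightarrow> 'w measure \<Rightarrow> ('w \<Rightarrow> (nat \<Rightarrow>\<^sub>0 real) set set) \<Rightarrow> ennreal"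
  where "expected_face_number n l M X = (\<integral>\<^sup>+\<omega>. face_number l (zero_cell n (X \<omega>)) \<partial>M)"

end

theory Submission
  imports Defs "Jordan_Normal_Form.Determinant" "HOL-Real_Asymp.Real_Asymp"
begin

text \<open>
  A hyperplane \<open>H(u, t)\<close> with \<open>t \<noteq> 0\<close> is the set of all \<open>x\<close> with \<open>\<langle>x, y\<rangle> = 1\<close> for the dual point \<open>y = u / t\<close>,
  and the zero cell is the polar set of the dual points. These form a Poisson process whose intensity
  is, up to a factor, the image of a Gaussian vector \<open>g\<close> and the measure \<open>|s|\<^sup>r\<^sup>-\<^sup>1 ds\<close> under \<open>g / s\<close>.

  Almost surely the vertices are the solutions \<open>x\<close> of \<open>\<langle>x, y\<^sub>i\<rangle> = 1\<close> for linearly independent dual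
  points \<open>y\<^sub>1, \<dots>, y\<^sub>n\<close> such that no dual point satisfies \<open>\<langle>x, y\<rangle> > 1\<close>. By the Mecke formula, applied on
  small cells for \<open>x\<close>, their mean number is an integral of \<open>exp (- \<kappa> |x|\<^sup>r)\<close> over \<open>n\<close>-tuples of dual points. Since
  an orthogonal transformation that mixes the rows of a Gaussian matrix preserves its law, \<open>|x|\<close> is
  distributed like \<open>|s| / |N|\<close> with \<open>N\<close> standard normal and \<open>s\<close> the vector of distances, and the integral becomes
  \<open>\<rho>\<^sup>n \<Gamma>((n r + 1) / 2) / (\<surd>\<pi> \<Gamma>(n r / 2 + 1))\<close> with \<open>\<rho> = \<omega>\<^sub>r\<^sub>+\<^sub>1 / \<kappa>\<^sub>r\<close>.

  Fixing the coordinates from \<open>n - l\<close> on to be zero cuts the cell by a subspace, and a vertex of the section is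
  the unique point of an \<open>l\<close>-face in it; hence \<open>\<bbbE> f\<^sub>l\<close> is at least the mean number of vertices
  in dimension \<open>n - l\<close>. It is at most \<open>n choose l\<close> times that in dimension \<open>n\<close>, because a vertex lies on at
  most so many \<open>l\<close>-faces. Log-convexity of \<open>\<Gamma>\<close> controls the quotient of Gamma functions.
\<close>

section \<open>Coordinates and topology of the ambient space\<close>

text \<open>The dimension is a variable, so rotation invariance has to be derived inside one ambient
  space. Only reflections are used: any two vectors of equal norm are exchanged by one, and as
  involutions they preserve Lebesgue measure by a uniqueness argument. Hausdorff measure on the
  sphere enters through this invariance alone; it is proportional to a directional law of Gaussian
  vectors, with a factor left unspecified. That factor, and with it \<open>\<gamma>\<close>, drops
  out by homogeneity: a multiple c of the intensity contributes c^m to the density of m-tuples and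
  c^-m through the exponential. The obstacle in counting vertices is that the region required to be
  free of dual points depends on the tuple. On a small cell of positions it is enclosed between two
  fixed conical regions: an empty inner one gives the upper bound, an outer one containing exactly
  the points of the tuple the lower bound, and both agree in the limit. The constant
  omega_(r+1)/kappa_r arises as the quotient of the mass of exp(-s^2/2) under |s|^(r-1) ds and the
  number E|N|^r / r, the mass of the half-space cut off by a unit vector.\<close>

abbreviation coord :: "('a \<Rightarrow>\<^sub>0 'b::zero) \<Rightarrow> 'a \<Rightarrow> 'b"
  where "coord \<equiv> Poly_Mapping.lookup"

lemma lookup_scaleR [simp]: "coord (c *\<^sub>R f) k = c *\<^sub>R coord f k"
  by (simp add: scaleR_poly_mapping.rep_eq)

lemma lookup_sum_poly_mapping:
  "coord (\<Sum>i\<in>A. f i) k = (\<Sum>i\<in>A. coord (f i) k)"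
  by (induction A rule: infinite_finite_induct) (auto simp: lookup_add)

lemma norm_single_poly_mapping [simp]:
  "norm (Poly_Mapping.single k a :: 'a \<Rightarrow>\<^sub>0 'b::real_inner) = norm a"
  by (cases "a = 0")
     (auto simp: norm_poly_mapping_def inner_poly_mapping_def norm_eq_sqrt_inner)

lemma poly_mapping_eq_sum_single:
  assumes "finite A" "Poly_Mapping.keys f \<subseteq> A"
  shows "f = (\<Sum>k\<in>A. Poly_Mapping.single k (coord f k))"
  using assms by (intro poly_mapping_eqI)
    (auto simp: lookup_sum_poly_mapping lookup_single when_def in_keys_iff)

lemma norm_poly_mapping_le_sum:
  fixes f :: "'a \<Rightarrow>\<^sub>0 'b::real_inner"
  assumes "finite A" "Poly_Mapping.keys f \<subseteq> A"
  shows "norm f \<le> (\<Sum>k\<in>A. norm (coord f k))"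
  using norm_sum[of "\<lambda>k. Poly_Mapping.single k (coord f k)" A]
  by (simp add: poly_mapping_eq_sum_single[OF assms, symmetric])

section \<open>Second countability of the ambient space\<close>

lemma countable_dense_poly_mapping:
  fixes D :: "'b::real_inner set"
  assumes D: "\<And>a e. 0 < e \<Longrightarrow> \<exists>d\<in>D. dist a d < e" and e: "0 < e"
  shows "\<exists>g\<in>{g. \<forall>k. coord g k \<in> insert 0 D}. dist (f :: 'a \<Rightarrow>\<^sub>0 'b) g < e"
proof -
  define A where "A = Poly_Mapping.keys f"
  \<comment> \<open>The summand 1 covers an empty support and makes the final estimate
    strict.\<close>
  have "0 < e / (1 + real (card A))" using e by simp
  then have "\<forall>k. \<exists>d\<in>D. dist (coord f k) d < e / (1 + real (card A))"
    using D by blast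
  then obtain d where d: "\<And>k. d k \<in> D" "\<And>k. dist (coord f k) (d k) < e / (1 + real (card A))"
    by metis
  define g where "g = (\<Sum>k\<in>A. Poly_Mapping.single k (d k))"
  have A: "finite A" by (simp add: A_def)
  have g: "coord g k = (if k \<in> A then d k else 0)" for k
    using A by (simp add: g_def lookup_sum_poly_mapping lookup_single when_def)
  have "dist f g = norm (f - g)" by (simp add: dist_norm)
  also have "\<dots> \<le> (\<Sum>k\<in>A. norm (coord (f - g) k))"
    by (rule norm_poly_mapping_le_sum[OF A])
       (auto simp: in_keys_iff lookup_minus g A_def split: if_splits)
  also have "\<dots> \<le> (\<Sum>k\<in>A. e / (1 + real (card A)))"
    by (rule sum_mono) (use d(2) in \<open>auto simp: lookup_minus g dist_norm less_imp_le\<close>)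
  also have "\<dots> < e"
    using e by (simp add: field_simps)
  finally show ?thesis using d(1) by (intro bexI[of _ g]) (auto simp: g)
qed

text \<open>A finitely supported function is determined by its support and its restriction to it;
  there are countably many finite supports, with countably many restrictions each.\<close>

lemma countable_poly_mapping_range:
  assumes "countable D"
  shows "countable {g :: 'a::countable \<Rightarrow>\<^sub>0 'b::zero. \<forall>k. coord g k \<in> insert 0 D}"
proof -
  define h where "h = (\<lambda>g :: 'a \<Rightarrow>\<^sub>0 'b. (Poly_Mapping.keys g, restrict (coord g) (Poly_Mapping.keys g)))"
  have "inj h"
  proof (rule injI, rule poly_mapping_eqI)
    fix f g :: "'a \<Rightarrow>\<^sub>0 'b" and k assume "h f = h g"
    then have *: "Poly_Mapping.keys f = Poly_Mapping.keys g"
      "restrict (coord f) (Poly_Mapping.keys f) = restrict (coord g) (Poly_Mapping.keys g)"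
      by (auto simp: h_def)
    show "coord f k = coord g k"
    proof (cases "k \<in> Poly_Mapping.keys f")
      case True then show ?thesis using * by (metis restrict_apply')
    next
      case False then show ?thesis using *(1) by (metis in_keys_iff)
    qed
  qed
  moreover have "countable (SIGMA A : Collect (finite :: 'a set \<Rightarrow> bool). A \<rightarrow>\<^sub>E insert 0 D)"
    using assms by (intro countable_SIGMA countable_PiE) (auto simp: countable_Collect_finite)
  then have "countable (h ` {g :: 'a \<Rightarrow>\<^sub>0 'b. \<forall>k. coord g k \<in> insert 0 D})"
    by (rule countable_subset[rotated]) (auto simp: h_def)
  ultimately show ?thesis
    by (meson countable_image_inj_on inj_on_subset subset_UNIV)
qed

text \<open>Second countability identifies the Borel sets of a product with the product
  sigma-algebra, on which the measurability of sums, scalar products and distances rests; it also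
  supplies the countable bases and dense sets of the covering arguments. The basis consists of balls
  of radius 1/(k+1) around functions with values in a countable dense set.\<close>

instance poly_mapping :: (countable, "{real_inner, second_countable_topology}") second_countable_topology
proof
  obtain D :: "'b set" where D: "countable D" "\<And>X. open X \<Longrightarrow> X \<noteq> {} \<Longrightarrow> \<exists>d\<in>D. d \<in> X"
    using countable_dense_exists[where 'a='b] by blast
  have dense: "\<exists>d\<in>D. dist a d < e" if "0 < e" for a e
    using D(2)[of "ball a e"] that by auto
  define G where "G = {g :: 'a \<Rightarrow>\<^sub>0 'b. \<forall>k. coord g k \<in> insert 0 D}"
  define B where "B = (\<lambda>(g, k). ball g (1 / Suc k)) ` (G \<times> (UNIV :: nat set))"
  have "countable B"
    unfolding B_def G_def using countable_poly_mapping_range[OF D(1)] by auto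
  moreover have "topological_basis B"
  proof (rule topological_basisI)
    fix U :: "('a \<Rightarrow>\<^sub>0 'b) set" and x assume "open U" "x \<in> U"
    then obtain e where e: "0 < e" "ball x e \<subseteq> U" by (auto simp: open_contains_ball)
    obtain k where k: "1 / Suc k < e / 2"
      using e(1) by (metis half_gt_zero nat_approx_posE)
    obtain g where g: "g \<in> G" "dist x g < 1 / Suc k"
      using countable_dense_poly_mapping[OF dense, of "1 / Suc k" x] unfolding G_def by auto
    have "ball g (1 / Suc k) \<subseteq> ball x e"
    proof
      fix y assume "y \<in> ball g (1 / Suc k)"
      then have "dist x y < e" using g(2) k dist_triangle[of x y g] by auto
      then show "y \<in> ball x e" by simp
    qed
    then show "\<exists>B'\<in>B. x \<in> B' \<and> B' \<subseteq> U"
      using g e(2) unfolding B_def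
      by (intro bexI[of _ "ball g (1 / Suc k)"]) (auto simp: dist_commute)
  qed (auto simp: B_def)
  ultimately show "\<exists>B :: ('a \<Rightarrow>\<^sub>0 'b) set set. countable B \<and> open = generate_topology B"
    by (auto simp: topological_basis_imp_subbasis)
qed

section \<open>Euclidean subspaces and their coordinates\<close>

abbreviation unit_vec_pm :: "nat \<Rightarrow> nat \<Rightarrow>\<^sub>0 real" (\<open>\<e>\<close>)
  where "\<e> i \<equiv> Poly_Mapping.single i 1"

type_synonym seq = "nat \<Rightarrow>\<^sub>0 real"

text \<open>Only the values of \<open>c\<close> below \<open>n\<close> enter, so the extensional
  tuples that make up the space of a product measure over \<open>{..<n}\<close> can be inserted
  directly.\<close>

definition emb :: "nat \<Rightarrow> (nat \<Rightarrow> real) \<Rightarrow> seq"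
  where "emb n c = (\<Sum>i<n. Poly_Mapping.single i (c i))"

lemma inner_Rn: "x \<in> Rn n \<Longrightarrow> inner x y = (\<Sum>i<n. coord x i * coord y i)"
  using inner_poly_mapping_superset[of "{..<n}" x y] by (simp add: Rn_def)

lemma inner_Rn': "y \<in> Rn n \<Longrightarrow> inner x y = (\<Sum>i<n. coord x i * coord y i)"
  using inner_Rn[of y n x] by (simp add: inner_commute mult.commute)

lemma Rn_iff: "x \<in> Rn n \<longleftrightarrow> (\<forall>i\<ge>n. coord x i = 0)"
  by (auto simp: Rn_def in_keys_iff) (metis not_le)

lemma subspace_Rn: "subspace (Rn n)"
  by (auto simp: subspace_def Rn_iff lookup_add)

lemma Rn_0 [simp]: "0 \<in> Rn n" and Rn_add: "x \<in> Rn n \<Longrightarrow> y \<in> Rn n \<Longrightarrow> x + y \<in> Rn n"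
  and Rn_diff: "x \<in> Rn n \<Longrightarrow> y \<in> Rn n \<Longrightarrow> x - y \<in> Rn n"
  and Rn_scale: "x \<in> Rn n \<Longrightarrow> c *\<^sub>R x \<in> Rn n" and Rn_uminus: "x \<in> Rn n \<Longrightarrow> - x \<in> Rn n"
  and Rn_sum: "(\<And>i. i \<in> A \<Longrightarrow> f i \<in> Rn n) \<Longrightarrow> sum f A \<in> Rn n"
  using subspace_Rn[of n] by (auto intro: subspace_0 subspace_add subspace_diff subspace_scale subspace_neg subspace_sum)

lemma Rn_mono: "m \<le> n \<Longrightarrow> Rn m \<subseteq> Rn n"
  by (auto simp: Rn_iff)

lemma inner_single [simp]: "inner (Poly_Mapping.single i c) x = c * coord x i" for c :: real
  by (cases "c = 0") (auto simp: inner_poly_mapping_def)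

lemma inner_single' [simp]: "inner x (Poly_Mapping.single i c) = c * coord x i" for c :: real
  using inner_single[of i c x] by (simp add: inner_commute)

lemma single_in_Rn [simp]: "i < n \<Longrightarrow> Poly_Mapping.single i c \<in> Rn n"
  by (auto simp: Rn_iff lookup_single when_def)

lemma lookup_emb: "coord (emb n c) i = (if i < n then c i else 0)"
  by (simp add: emb_def lookup_sum_poly_mapping lookup_single when_def)

lemma emb_in_Rn [simp]: "emb n c \<in> Rn n"
  by (simp add: Rn_iff lookup_emb)

lemma emb_lookup: "x \<in> Rn n \<Longrightarrow> emb n (coord x) = x"
  by (intro poly_mapping_eqI) (simp add: lookup_emb Rn_iff)

lemma emb_cong: "(\<And>i. i < n \<Longrightarrow> c i = d i) \<Longrightarrow> emb n c = emb n d"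
  by (simp add: emb_def)

lemma abs_lookup_le_norm: "\<bar>coord x i\<bar> \<le> norm x" for x :: seq
  using Cauchy_Schwarz_ineq2[of x "\<e> i"] by simp

lemma norm_Rn_le: "x \<in> Rn n \<Longrightarrow> norm x \<le> (\<Sum>i<n. \<bar>coord x i\<bar>)"
  using norm_poly_mapping_le_sum[of "{..<n}" x] by (simp add: Rn_def)

lemma norm_Rn: "x \<in> Rn n \<Longrightarrow> norm x = sqrt (\<Sum>i<n. (coord x i)\<^sup>2)"
  by (simp add: norm_eq_sqrt_inner inner_Rn power2_eq_square)

lemma continuous_lookup: "continuous_on A (\<lambda>x :: seq. coord x i)"
proof -
  have "continuous_on A (\<lambda>x :: seq. inner (\<e> i) x)"
    by (intro continuous_intros)
  then show ?thesis by simp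
qed

lemma measurable_lookup [measurable]: "(\<lambda>x :: seq. coord x i) \<in> borel_measurable borel"
  by (intro borel_measurable_continuous_onI continuous_lookup)

lemma closed_Rn: "closed (Rn n)"
proof -
  have "Rn n = (\<Inter>i\<in>{n..}. {x. coord x i = 0})"
    by (auto simp: Rn_iff)
  moreover have "closed {x :: seq. coord x i = 0}" for i
    by (intro closed_Collect_eq continuous_lookup continuous_intros)
  ultimately show ?thesis by auto
qed

lemma Rn_borel [measurable]: "Rn n \<in> sets borel"
  using closed_Rn by (rule borel_closed)

lemma measurable_emb [measurable]: "emb n \<in> measurable (Pi\<^sub>M {..<n} (\<lambda>_. borel)) borel"
proof -
  have s: "(\<lambda>c. Poly_Mapping.single i c :: seq) \<in> borel_measurable borel" for i
  proof -
    have *: "Poly_Mapping.single i c = c *\<^sub>R \<e> i" for c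
      by (intro poly_mapping_eqI) (simp add: lookup_single when_def)
    have "(\<lambda>c. c *\<^sub>R \<e> i) \<in> borel_measurable borel"
      by (intro borel_measurable_continuous_onI continuous_intros)
    then show ?thesis by (simp only: *[symmetric])
  qed
  have "(\<lambda>c. \<Sum>i<n. Poly_Mapping.single i (c i) :: seq) \<in> borel_measurable (Pi\<^sub>M {..<n} (\<lambda>_. borel))"
    by (intro borel_measurable_sum measurable_compose[OF _ s]) auto
  then show ?thesis by (simp add: emb_def[abs_def])
qed

section \<open>Gaussian measures\<close>

lemma distr_PiM_componentwise:
  assumes I: "finite I" and M: "product_sigma_finite M"
    and D: "product_sigma_finite (\<lambda>i. distr (M i) (N i) (f i))"
    and f [measurable]: "\<And>i. i \<in> I \<Longrightarrow> f i \<in> measurable (M i) (N i)"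
  shows "distr (Pi\<^sub>M I M) (Pi\<^sub>M I N) (\<lambda>x. \<lambda>i\<in>I. f i (x i)) = Pi\<^sub>M I (\<lambda>i. distr (M i) (N i) (f i))"
proof -
  interpret M: product_sigma_finite M by fact
  interpret D: product_sigma_finite "\<lambda>i. distr (M i) (N i) (f i)" by fact
  have meas [measurable]: "(\<lambda>x. \<lambda>i\<in>I. f i (x i)) \<in> measurable (Pi\<^sub>M I M) (Pi\<^sub>M I N)"
    by (rule measurable_restrict) (auto intro!: measurable_compose[OF measurable_component_singleton])
  show ?thesis
  proof (rule D.PiM_eqI[OF I])
    show "sets (distr (Pi\<^sub>M I M) (Pi\<^sub>M I N) (\<lambda>x. \<lambda>i\<in>I. f i (x i))) = sets (Pi\<^sub>M I (\<lambda>i. distr (M i) (N i) (f i)))"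
      by (simp cong: sets_PiM_cong)
  next
    fix A assume A: "\<And>i. i \<in> I \<Longrightarrow> A i \<in> sets (distr (M i) (N i) (f i))"
    then have [measurable]: "\<And>i. i \<in> I \<Longrightarrow> A i \<in> sets (N i)" by simp
    have "(\<lambda>x. \<lambda>i\<in>I. f i (x i)) -` Pi\<^sub>E I A \<inter> space (Pi\<^sub>M I M) = Pi\<^sub>E I (\<lambda>i. f i -` A i \<inter> space (M i))"
      by (auto simp: space_PiM PiE_iff)
    then show "emeasure (distr (Pi\<^sub>M I M) (Pi\<^sub>M I N) (\<lambda>x. \<lambda>i\<in>I. f i (x i))) (Pi\<^sub>E I A) =
        (\<Prod>i\<in>I. emeasure (distr (M i) (N i) (f i)) (A i))"
      using I A by (simp add: emeasure_distr M.emeasure_PiM sets_PiM_I_finite)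
  qed
qed

lemma PiM_density_eq:
  assumes I: "finite I" and M: "product_sigma_finite M"
    and D: "product_sigma_finite (\<lambda>i. density (M i) (f i))"
    and f [measurable]: "\<And>i. i \<in> I \<Longrightarrow> f i \<in> borel_measurable (M i)"
  shows "Pi\<^sub>M I (\<lambda>i. density (M i) (f i)) = density (Pi\<^sub>M I M) (\<lambda>x. \<Prod>i\<in>I. f i (x i))"
proof -
  interpret M: product_sigma_finite M by fact
  interpret D: product_sigma_finite "\<lambda>i. density (M i) (f i)" by fact
  have fm [measurable]: "(\<lambda>x. f i (x i)) \<in> borel_measurable (Pi\<^sub>M I M)" if "i \<in> I" for i
    by (rule measurable_compose[where N="M i"]) (use that in auto)
  show ?thesis
  proof (rule D.PiM_eqI[OF I, symmetric])
    show "sets (density (Pi\<^sub>M I M) (\<lambda>x. \<Prod>i\<in>I. f i (x i))) = sets (Pi\<^sub>M I (\<lambda>i. density (M i) (f i)))"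
      by (simp cong: sets_PiM_cong)
  next
    fix A assume "\<And>i. i \<in> I \<Longrightarrow> A i \<in> sets (density (M i) (f i))"
    then have A [measurable]: "\<And>i. i \<in> I \<Longrightarrow> A i \<in> sets (M i)" by simp
    have "emeasure (density (Pi\<^sub>M I M) (\<lambda>x. \<Prod>i\<in>I. f i (x i))) (Pi\<^sub>E I A) =
        (\<integral>\<^sup>+x. (\<Prod>i\<in>I. f i (x i)) * indicator (Pi\<^sub>E I A) x \<partial>Pi\<^sub>M I M)"
      using I A by (intro emeasure_density sets_PiM_I_finite) auto
    also have "\<dots> = (\<integral>\<^sup>+x. (\<Prod>i\<in>I. f i (x i) * indicator (A i) (x i)) \<partial>Pi\<^sub>M I M)"
    proof (rule nn_integral_cong)
      fix x assume x: "x \<in> space (Pi\<^sub>M I M)"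
      have "indicator (Pi\<^sub>E I A) x = (\<Prod>i\<in>I. indicator (A i) (x i) :: ennreal)"
      proof (cases "x \<in> Pi\<^sub>E I A")
        case True then show ?thesis by (auto simp: PiE_iff indicator_def)
      next
        case False
        then obtain i where "i \<in> I" "x i \<notin> A i" using x by (auto simp: space_PiM PiE_iff)
        then have "(\<Prod>i\<in>I. indicator (A i) (x i) :: ennreal) = 0"
          using I by (intro prod_zero) (auto intro!: bexI[of _ i])
        then show ?thesis using False by simp
      qed
      then show "(\<Prod>i\<in>I. f i (x i)) * indicator (Pi\<^sub>E I A) x = (\<Prod>i\<in>I. f i (x i) * indicator (A i) (x i))"
        by (simp add: prod.distrib)
    qed
    also have "\<dots> = (\<Prod>i\<in>I. \<integral>\<^sup>+x. f i x * indicator (A i) x \<partial>M i)"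
      using I by (intro M.product_nn_integral_prod) auto
    also have "\<dots> = (\<Prod>i\<in>I. emeasure (density (M i) (f i)) (A i))"
      by (intro prod.cong refl emeasure_density[symmetric]) auto
    finally show "emeasure (density (Pi\<^sub>M I M) (\<lambda>x. \<Prod>i\<in>I. f i (x i))) (Pi\<^sub>E I A) =
        (\<Prod>i\<in>I. emeasure (density (M i) (f i)) (A i))" .
  qed
qed

text \<open>
  Uniqueness of translation-invariant measures up to a factor, which the weight \<open>W\<close>
  identifies as \<open>1\<close>. \<open>N\<close> is a set of full measure on which the group structure is available.
\<close>

lemma involution_preserves_measure:
  fixes L :: "'a measure" and W :: "'a \<Rightarrow> ennreal"
  assumes "sigma_finite_measure L"
    and pl [measurable]: "(\<lambda>(x, y). pl x y) \<in> measurable (L \<Otimes>\<^sub>M L) L"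
    and mi [measurable]: "(\<lambda>(x, y). mi x y) \<in> measurable (L \<Otimes>\<^sub>M L) L"
    and R [measurable]: "R \<in> measurable L L"
    and W [measurable]: "W \<in> borel_measurable L"
    and N: "AE x in L. x \<in> N" "N \<subseteq> space L"
    and RN: "\<And>x. x \<in> N \<Longrightarrow> R x \<in> N" "\<And>x. x \<in> N \<Longrightarrow> R (R x) = x"
    and Radd: "\<And>x y. x \<in> N \<Longrightarrow> y \<in> N \<Longrightarrow> R (pl x y) = pl (R x) (R y)"
    and comm: "\<And>x y. x \<in> N \<Longrightarrow> y \<in> N \<Longrightarrow> pl x y = pl y x"
    and subadd: "\<And>x y. x \<in> N \<Longrightarrow> y \<in> N \<Longrightarrow> mi (pl x y) y = x"
    and trans: "\<And>y. y \<in> N \<Longrightarrow> distr L L (\<lambda>x. pl x y) = L"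
    and Wsym: "\<And>x y. x \<in> N \<Longrightarrow> y \<in> N \<Longrightarrow> W (mi y (R x)) = W (mi x (R y))"
    and Wpos: "(\<integral>\<^sup>+x. W x \<partial>L) \<noteq> 0" "(\<integral>\<^sup>+x. W x \<partial>L) \<noteq> \<infinity>"
  shows "distr L L R = L"
proof (rule measure_eqI)
  interpret sigma_finite_measure L by fact
  interpret P: pair_sigma_finite L L by standard
  fix A assume "A \<in> sets (distr L L R)"
  then have A [measurable]: "A \<in> sets L" by simp
  define f where "f = (indicator A :: 'a \<Rightarrow> ennreal)"
  have [measurable]: "f \<in> borel_measurable L" by (simp add: f_def)
  \<comment> \<open>Each translation below is an instance of \<open>tr\<close>. In additive
    notation, translating \<open>x\<close> by R y turns the double integral of W(y) f(R x) into that
    of W(y) f(y + R x), and translating \<open>y\<close> turns this into that of W(y - R x) f(y). By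
    \<open>Wsym\<close> the first factor equals W(x - R y), whose integral over \<open>x\<close> is
    again the mass of \<open>W\<close>.\<close>
  have tr: "(\<integral>\<^sup>+x. h (pl x y) \<partial>L) = (\<integral>\<^sup>+x. h x \<partial>L)"
    if [measurable]: "h \<in> borel_measurable L" and y: "y \<in> N" for h :: "'a \<Rightarrow> ennreal" and y
  proof -
    have [measurable]: "y \<in> space L" using y N by auto
    have "(\<integral>\<^sup>+x. h x \<partial>distr L L (\<lambda>x. pl x y)) = (\<integral>\<^sup>+x. h (pl x y) \<partial>L)"
      by (rule nn_integral_distr) auto
    then show ?thesis by (simp add: trans[OF y])
  qed
  have sp [measurable]: "\<And>x. x \<in> N \<Longrightarrow> x \<in> space L" using N by auto
  have "(\<integral>\<^sup>+x. f (R x) \<partial>L) * (\<integral>\<^sup>+x. W x \<partial>L) = (\<integral>\<^sup>+y. W y * (\<integral>\<^sup>+x. f (R x) \<partial>L) \<partial>L)"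
    by (subst nn_integral_multc) (auto simp: mult.commute)
  also have "\<dots> = (\<integral>\<^sup>+y. (\<integral>\<^sup>+x. W y * f (pl y (R x)) \<partial>L) \<partial>L)"
  proof (rule nn_integral_cong_AE, use N(1) in eventually_elim)
    fix y assume y: "y \<in> N"
    then have ys [measurable]: "y \<in> space L" using N by auto
    have "(\<integral>\<^sup>+x. f (R x) \<partial>L) = (\<integral>\<^sup>+x. f (R (pl x (R y))) \<partial>L)"
      using RN y by (subst tr) auto
    also have "\<dots> = (\<integral>\<^sup>+x. f (pl y (R x)) \<partial>L)"
      by (rule nn_integral_cong_AE, use N(1) in eventually_elim)
         (use RN Radd comm y in auto)
    finally show "W y * (\<integral>\<^sup>+x. f (R x) \<partial>L) = (\<integral>\<^sup>+x. W y * f (pl y (R x)) \<partial>L)"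
      by (subst nn_integral_cmult) auto
  qed
  also have "\<dots> = (\<integral>\<^sup>+x. (\<integral>\<^sup>+y. W y * f (pl y (R x)) \<partial>L) \<partial>L)"
    by (rule P.Fubini') auto
  also have "\<dots> = (\<integral>\<^sup>+x. (\<integral>\<^sup>+y. W (mi y (R x)) * f y \<partial>L) \<partial>L)"
  proof (rule nn_integral_cong_AE, use N(1) in eventually_elim)
    fix x assume x: "x \<in> N"
    then have [measurable]: "R x \<in> space L" using N RN by auto
    have "(\<integral>\<^sup>+y. W y * f (pl y (R x)) \<partial>L) = (\<integral>\<^sup>+y. W (mi (pl y (R x)) (R x)) * f (pl y (R x)) \<partial>L)"
      by (rule nn_integral_cong_AE, use N(1) in eventually_elim) (use RN subadd x in auto)
    also have "\<dots> = (\<integral>\<^sup>+y. W (mi y (R x)) * f y \<partial>L)"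
      using RN x by (intro tr) auto
    finally show "(\<integral>\<^sup>+y. W y * f (pl y (R x)) \<partial>L) = (\<integral>\<^sup>+y. W (mi y (R x)) * f y \<partial>L)" .
  qed
  also have "\<dots> = (\<integral>\<^sup>+y. (\<integral>\<^sup>+x. W (mi y (R x)) * f y \<partial>L) \<partial>L)"
    by (rule P.Fubini') auto
  also have "\<dots> = (\<integral>\<^sup>+y. f y * (\<integral>\<^sup>+x. W x \<partial>L) \<partial>L)"
  proof (rule nn_integral_cong_AE, use N(1) in eventually_elim)
    fix y assume y: "y \<in> N"
    then have [measurable]: "R y \<in> space L" "y \<in> space L" using N RN by auto
    have "(\<integral>\<^sup>+x. W (mi y (R x)) * f y \<partial>L) = (\<integral>\<^sup>+x. W (mi x (R y)) * f y \<partial>L)"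
      by (rule nn_integral_cong_AE, use N(1) in eventually_elim) (use Wsym y in auto)
    also have "\<dots> = (\<integral>\<^sup>+x. W (mi x (R y)) \<partial>L) * f y"
      by (rule nn_integral_multc) auto
    also have "(\<integral>\<^sup>+x. W (mi x (R y)) \<partial>L) = (\<integral>\<^sup>+x. W (mi (pl x (R y)) (R y)) \<partial>L)"
      using RN y by (intro tr[symmetric]) auto
    also have "\<dots> = (\<integral>\<^sup>+x. W x \<partial>L)"
      by (rule nn_integral_cong_AE, use N(1) in eventually_elim) (use RN subadd y in auto)
    finally show "(\<integral>\<^sup>+x. W (mi y (R x)) * f y \<partial>L) = f y * (\<integral>\<^sup>+x. W x \<partial>L)"
      by (simp add: mult.commute)
  qed
  also have "\<dots> = (\<integral>\<^sup>+y. f y \<partial>L) * (\<integral>\<^sup>+x. W x \<partial>L)"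
    by (rule nn_integral_multc) auto
  finally have "(\<integral>\<^sup>+x. f (R x) \<partial>L) = (\<integral>\<^sup>+y. f y \<partial>L)"
    using Wpos by (metis mult_divide_eq_ennreal infinity_ennreal_def)
  moreover have "(\<integral>\<^sup>+x. f (R x) \<partial>L) = emeasure (distr L L R) A"
    unfolding f_def by (subst emeasure_distr)
      (auto simp flip: nn_integral_indicator intro!: nn_integral_cong split: split_indicator)
  moreover have "(\<integral>\<^sup>+x. f x \<partial>L) = emeasure L A"
    by (simp add: f_def)
  ultimately show "emeasure (distr L L R) A = emeasure L A" by simp
qed simp

section \<open>Gaussian laws and reflections\<close>

definition std_normal :: "real measure"
  where "std_normal = density lborel (\<lambda>x. ennreal (std_normal_density x))"

lemma prob_space_std_normal: "prob_space std_normal"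
  unfolding std_normal_def by (rule prob_space_normal_density) simp

lemma sets_std_normal [simp, measurable_cong]: "sets std_normal = sets borel"
  by (simp add: std_normal_def)

lemma space_std_normal [simp]: "space std_normal = UNIV"
  by (simp add: std_normal_def)

interpretation std_normal: prob_space std_normal
  by (rule prob_space_std_normal)

interpretation std_normal_PiM: product_prob_space "\<lambda>_. std_normal" I for I
  by standard

text \<open>The law is carried by \<open>Rn n\<close> but defined on all Borel sets of the ambient
  space, so that the measures of all dimensions have one type.\<close>

definition gauss :: "nat \<Rightarrow> seq measure"
  where "gauss n = distr (Pi\<^sub>M {..<n} (\<lambda>_. std_normal)) borel (emb n)"

lemma measurable_emb_std_normal [measurable]:
  "emb n \<in> measurable (Pi\<^sub>M {..<n} (\<lambda>_. std_normal)) borel"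
proof -
  have "sets (Pi\<^sub>M {..<n} (\<lambda>_. std_normal)) = sets (Pi\<^sub>M {..<n} (\<lambda>_. borel))"
    by (intro sets_PiM_cong) auto
  then show ?thesis by (simp cong: measurable_cong_sets)
qed

lemma sets_gauss [simp, measurable_cong]: "sets (gauss n) = sets borel"
  by (simp add: gauss_def)

lemma space_gauss [simp]: "space (gauss n) = UNIV"
  by (simp add: gauss_def)

lemma prob_space_gauss: "prob_space (gauss n)"
  unfolding gauss_def by (intro std_normal_PiM.P.prob_space_distr) measurable

interpretation gauss: prob_space "gauss n" for n
  by (rule prob_space_gauss)

lemma AE_gauss_Rn: "AE g in gauss n. g \<in> Rn n"
  unfolding gauss_def by (subst AE_distr_iff) auto

text \<open>For a unit vector \<open>a\<close> this is the reflection in the hyperplane orthogonal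
  to \<open>a\<close>. Being an involutive isometry, it fits
  \<open>involution_preserves_measure\<close>, and reflections already act transitively on
  spheres.\<close>

definition reflect :: "'a::real_inner \<Rightarrow> 'a \<Rightarrow> 'a"
  where "reflect a x = x - (2 * inner x a) *\<^sub>R a"

lemma reflect_reflect: "norm a = 1 \<Longrightarrow> reflect a (reflect a x) = x"
  by (simp add: reflect_def inner_diff_left norm_eq_1 algebra_simps flip: scaleR_add_left)

lemma inner_reflect: "norm a = 1 \<Longrightarrow> inner (reflect a x) (reflect a y) = inner x y"
  by (simp add: reflect_def inner_diff_left inner_diff_right norm_eq_1 inner_commute algebra_simps)

lemma norm_reflect: "norm a = 1 \<Longrightarrow> norm (reflect a x) = norm x"
  by (simp add: norm_eq_sqrt_inner inner_reflect)

lemma reflect_add: "reflect a (x + y) = reflect a x + reflect a y"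
  by (simp add: reflect_def inner_add_left algebra_simps)

lemma reflect_diff: "reflect a (x - y) = reflect a x - reflect a y"
  by (simp add: reflect_def inner_diff_left algebra_simps)

lemma dist_reflect: "norm a = 1 \<Longrightarrow> dist (reflect a x) (reflect a y) = dist x y"
  by (simp add: dist_norm norm_reflect flip: reflect_diff)

lemma reflect_Rn: "a \<in> Rn n \<Longrightarrow> x \<in> Rn n \<Longrightarrow> reflect a x \<in> Rn n"
  by (simp add: reflect_def Rn_diff Rn_scale)

text \<open>The mirror is the bisecting hyperplane: for vectors of equal norm, 2 <x, x - y> = |x -
  y|^2, so subtracting the component along x - y twice removes exactly x - y.\<close>

lemma reflect_swap:
  assumes "norm x = norm y" "x \<noteq> y"
  shows "reflect ((x - y) /\<^sub>R norm (x - y)) x = y"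
proof -
  have xy: "inner x x = inner y y" using assms(1) by (simp add: norm_eq)
  have "(norm (x - y))\<^sup>2 = inner x x - 2 * inner x y + inner y y"
    by (simp add: power2_norm_eq_inner inner_diff inner_commute algebra_simps)
  also have "\<dots> = 2 * inner x (x - y)"
    using xy by (simp add: inner_diff_right algebra_simps)
  finally have *: "2 * inner x (x - y) = (norm (x - y))\<^sup>2" by simp
  have "(2 * inner x ((x - y) /\<^sub>R norm (x - y))) *\<^sub>R ((x - y) /\<^sub>R norm (x - y)) =
      ((2 * inner x (x - y)) / (norm (x - y))\<^sup>2) *\<^sub>R (x - y)"
    by (simp add: divide_simps power2_eq_square)
  also have "\<dots> = x - y" unfolding * using assms(2) by simp
  finally show ?thesis by (simp add: reflect_def)
qed

lemma reflect_exists: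
  assumes "norm x = norm y" "x \<noteq> y" "x \<in> Rn n" "y \<in> Rn n"
  obtains a where "a \<in> Rn n" "norm a = 1" "reflect a x = y" "reflect a y = x"
proof -
  let ?a = "(x - y) /\<^sub>R norm (x - y)"
  have a: "norm ?a = 1" using assms by simp
  have "reflect ?a x = y" by (rule reflect_swap[OF assms(1,2)])
  then show ?thesis using that[of ?a] a assms reflect_reflect[OF a, of x]
    by (auto intro!: Rn_scale Rn_diff)
qed

lemma measurable_reflect [measurable]: "reflect a \<in> borel_measurable borel" for a :: seq
  unfolding reflect_def[abs_def] by (intro borel_measurable_continuous_onI continuous_intros)

lemma prod_std_normal_density:
  assumes "finite I"
  shows "(\<Prod>i\<in>I. ennreal (std_normal_density (x i))) =
    ennreal ((1 / sqrt (2 * pi)) ^ card I * exp (- (\<Sum>i\<in>I. (x i)\<^sup>2) / 2))"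
  using assms
  by (simp add: prod_ennreal std_normal_density_def exp_sum prod.distrib power_one_over flip: sum_negf sum_divide_distrib)
     (simp add: sum_divide_distrib exp_sum prod_dividef power_divide flip: sum_negf)

lemma norm_emb: "(norm (emb n c))\<^sup>2 = (\<Sum>i<n. (c i)\<^sup>2)"
  by (simp add: norm_Rn[OF emb_in_Rn] lookup_emb sum_nonneg)

interpretation lborel_PiM: product_sigma_finite "\<lambda>_. lborel :: real measure"
  by standard

lemma PiM_std_normal:
  "finite I \<Longrightarrow> Pi\<^sub>M I (\<lambda>_. std_normal) = density (Pi\<^sub>M I (\<lambda>_. lborel)) (\<lambda>x. \<Prod>i\<in>I. ennreal (std_normal_density (x i)))"
  unfolding std_normal_def
  by (rule PiM_density_eq) (use std_normal_PiM.product_sigma_finite_axioms in \<open>auto simp: std_normal_def intro!: lborel_PiM.product_sigma_finite_axioms\<close>)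

lemma PiM_lborel_translate:
  assumes "finite I"
  shows "distr (Pi\<^sub>M I (\<lambda>_. lborel)) (Pi\<^sub>M I (\<lambda>_. lborel)) (\<lambda>x. \<lambda>i\<in>I. x i + y i :: real) = Pi\<^sub>M I (\<lambda>_. lborel)"
proof -
  have *: "distr lborel lborel (\<lambda>x. x + c) = lborel" for c :: real
    using lborel_distr_plus[of c] by (simp add: add.commute cong: distr_cong)
  show ?thesis
    using distr_PiM_componentwise[OF assms, of "\<lambda>_. lborel" "\<lambda>_. lborel" "\<lambda>i x. x + y i"]
    by (simp add: * lborel_PiM.product_sigma_finite_axioms)
qed

lemma distr_density_invariant:
  assumes R [measurable]: "R \<in> measurable L L" and L: "distr L L R = L"
    and W [measurable]: "W \<in> borel_measurable L" and inv: "\<And>x. x \<in> space L \<Longrightarrow> W (R x) = W x"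
  shows "distr (density L W) L R = density L W"
proof (rule measure_eqI)
  fix A assume "A \<in> sets (distr (density L W) L R)"
  then have A [measurable]: "A \<in> sets L" by simp
  have "emeasure (distr (density L W) L R) A = (\<integral>\<^sup>+x. indicator A (R x) \<partial>density L W)"
    by (subst emeasure_distr) (auto simp flip: nn_integral_indicator intro!: nn_integral_cong split: split_indicator)
  also have "\<dots> = (\<integral>\<^sup>+x. W x * indicator A (R x) \<partial>L)"
    by (rule nn_integral_density) auto
  also have "\<dots> = (\<integral>\<^sup>+x. W (R x) * indicator A (R x) \<partial>L)"
    by (rule nn_integral_cong) (simp add: inv)
  also have "\<dots> = (\<integral>\<^sup>+x. W x * indicator A x \<partial>distr L L R)"
    by (rule nn_integral_distr[symmetric]) auto
  also have "\<dots> = emeasure (density L W) A"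
    unfolding L by (rule emeasure_density[symmetric]) auto
  finally show "emeasure (distr (density L W) L R) A = emeasure (density L W) A" .
qed simp

lemma emb_diff: "emb n (\<lambda>i\<in>{..<n}. x i - y i) = emb n x - emb n y"
  by (intro poly_mapping_eqI) (simp add: lookup_emb lookup_minus)

lemma emb_add: "emb n (\<lambda>i\<in>{..<n}. x i + y i) = emb n x + emb n y"
  by (intro poly_mapping_eqI) (simp add: lookup_emb lookup_add)

lemma emb_restrict_lookup: "x \<in> Rn n \<Longrightarrow> emb n (\<lambda>i\<in>{..<n}. coord x i) = x"
  by (intro poly_mapping_eqI) (simp add: lookup_emb Rn_iff)

lemma restrict_lookup_emb: "x \<in> extensional {..<n} \<Longrightarrow> (\<lambda>i\<in>{..<n}. coord (emb n x) i) = x"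
  by (auto simp: lookup_emb fun_eq_iff extensional_def)

lemma sets_PiM_lborel: "sets (Pi\<^sub>M I (\<lambda>_. lborel :: real measure)) = sets (Pi\<^sub>M I (\<lambda>_. borel))"
  by (intro sets_PiM_cong) auto

text \<open>The Gaussian density depends on the norm only, so it is enough that Lebesgue measure on
  coordinate tuples is invariant under the reflection. This is the uniqueness argument for
  translation-invariant measures, with the Gaussian density itself as the integrable weight
  \<open>W\<close>.\<close>

theorem gauss_reflect:
  assumes a: "a \<in> Rn n" "norm a = 1"
  shows "distr (gauss n) borel (reflect a) = gauss n"
proof -
  define I where "I = {..<n}"
  define L where "L = Pi\<^sub>M I (\<lambda>_. lborel :: real measure)"
  define W where "W = (\<lambda>x. \<Prod>i\<in>I. ennreal (std_normal_density (x i)))"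
  define R where "R = (\<lambda>x. \<lambda>i\<in>I. coord (reflect a (emb n x)) i)"
  have fin: "finite I" by (simp add: I_def)
  have sL [measurable_cong]: "sets L = sets (Pi\<^sub>M {..<n} (\<lambda>_. borel))" by (simp add: L_def I_def sets_PiM_lborel)
  have [measurable]: "R \<in> measurable L L"
    unfolding R_def I_def measurable_cong_sets[OF refl sL] by measurable
  have embR: "emb n (R x) = reflect a (emb n x)" for x
    unfolding R_def I_def by (rule emb_restrict_lookup) (simp add: reflect_Rn a)
  have W: "W x = ennreal ((1 / sqrt (2 * pi)) ^ n * exp (- (norm (emb n x))\<^sup>2 / 2))" for x
    unfolding W_def norm_emb using prod_std_normal_density[OF fin, of x] by (simp add: I_def)
  have [measurable]: "W \<in> borel_measurable L"
    unfolding W_def L_def by measurable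
  have std: "Pi\<^sub>M I (\<lambda>_. std_normal) = density L W"
    using PiM_std_normal[OF fin] by (simp add: L_def W_def)
  have sp: "space L = extensional I" by (auto simp: L_def space_PiM PiE_def)
  have "distr L L R = L"
  proof (rule involution_preserves_measure[where W = W and N = "space L"
        and pl = "\<lambda>x y. \<lambda>i\<in>I. x i + y i" and mi = "\<lambda>x y. \<lambda>i\<in>I. x i - y i"])
    show "sigma_finite_measure L" unfolding L_def by (rule lborel_PiM.sigma_finite[OF fin])
    show "(\<lambda>(x, y). \<lambda>i\<in>I. x i + y i) \<in> measurable (L \<Otimes>\<^sub>M L) L"
      "(\<lambda>(x, y). \<lambda>i\<in>I. x i - y i) \<in> measurable (L \<Otimes>\<^sub>M L) L"
      unfolding L_def by measurable
    show "distr L L (\<lambda>x. \<lambda>i\<in>I. x i + y i) = L" for y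
      unfolding L_def by (rule PiM_lborel_translate[OF fin])
    have "(\<integral>\<^sup>+x. W x \<partial>L) = emeasure (density L W) (space L)"
      by (subst emeasure_density) (auto intro!: nn_integral_cong)
    also have "\<dots> = 1"
      using prob_space.emeasure_space_1[OF prob_space_PiM[of I "\<lambda>_. std_normal"]] std
      by (simp add: prob_space_std_normal)
    finally have "(\<integral>\<^sup>+x. W x \<partial>L) = 1" .
    then show "(\<integral>\<^sup>+x. W x \<partial>L) \<noteq> 0" "(\<integral>\<^sup>+x. W x \<partial>L) \<noteq> \<infinity>" by auto
    show "R x \<in> space L" "R (R x) = x" if "x \<in> space L" for x
    proof -
      show "R x \<in> space L" by (simp add: sp R_def)
      have "R (R x) = (\<lambda>i\<in>I. coord (reflect a (emb n (R x))) i)"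
        by (simp add: R_def)
      then show "R (R x) = x"
        using that unfolding embR reflect_reflect[OF a(2)] by (simp add: I_def restrict_lookup_emb sp)
    qed
    show "W (\<lambda>i\<in>I. y i - R x i) = W (\<lambda>i\<in>I. x i - R y i)" for x y
    proof -
      have "norm (emb n y - reflect a (emb n x)) = norm (reflect a (emb n y - reflect a (emb n x)))"
        by (simp add: norm_reflect a)
      also have "\<dots> = norm (emb n x - reflect a (emb n y))"
        by (simp add: reflect_diff reflect_reflect a norm_minus_commute)
      finally show ?thesis unfolding W I_def emb_diff embR by simp
    qed
  qed (auto simp: sp R_def I_def emb_add reflect_add lookup_add add.commute extensional_def fun_eq_iff)
  then have inv: "distr (density L W) L R = density L W"
    by (intro distr_density_invariant) (auto simp: W embR norm_reflect a)
  have E [measurable]: "emb n \<in> measurable L borel" by (simp add: L_def I_def)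
  have "gauss n = distr (density L W) borel (emb n)"
    unfolding gauss_def I_def[symmetric] std ..
  also have "\<dots> = distr (distr (density L W) L R) borel (emb n)" unfolding inv ..
  also have "\<dots> = distr (density L W) borel (emb n \<circ> R)" by (rule distr_distr) auto
  also have "\<dots> = distr (density L W) borel (reflect a \<circ> emb n)"
    by (simp add: embR comp_def)
  also have "\<dots> = distr (distr (density L W) borel (emb n)) borel (reflect a)"
    by (rule distr_distr[symmetric]) auto
  also have "distr (density L W) borel (emb n) = gauss n"
    unfolding gauss_def I_def[symmetric] std ..
  finally show ?thesis ..
qed

lemma nn_integral_gauss_reflect:
  assumes "a \<in> Rn n" "norm a = 1" and [measurable]: "f \<in> borel_measurable borel"
  shows "(\<integral>\<^sup>+g. f (reflect a g) \<partial>gauss n) = (\<integral>\<^sup>+g. f g \<partial>gauss n)"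
  using nn_integral_distr[of "reflect a" "gauss n" borel f] gauss_reflect[OF assms(1,2)] by simp

lemma gauss_component:
  assumes "i < n"
  shows "distr (gauss n) borel (\<lambda>g. coord g i) = std_normal"
proof -
  have "distr (gauss n) borel (\<lambda>g. coord g i) =
      distr (Pi\<^sub>M {..<n} (\<lambda>_. std_normal)) borel ((\<lambda>g. coord g i) \<circ> emb n)"
    unfolding gauss_def by (rule distr_distr) auto
  also have "\<dots> = distr (Pi\<^sub>M {..<n} (\<lambda>_. std_normal)) std_normal (\<lambda>x. x i)"
    using assms by (intro distr_cong) (auto simp: lookup_emb)
  also have "\<dots> = std_normal"
    using assms by (intro std_normal_PiM.PiM_component) auto
  finally show ?thesis .
qed

text \<open>A reflection carries \<open>v\<close> to a multiple of a coordinate vector without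
  changing the Gaussian law, and each coordinate is standard normal.\<close>

lemma nn_integral_gauss_inner:
  assumes v: "v \<in> Rn n" and n: "0 < n" and f [measurable]: "f \<in> borel_measurable borel"
  shows "(\<integral>\<^sup>+g. f (inner g v) \<partial>gauss n) = (\<integral>\<^sup>+x. f (norm v * x) \<partial>std_normal)"
proof -
  define i where "i = n - 1"
  have i: "i < n" using n by (simp add: i_def)
  have "(\<integral>\<^sup>+g. f (inner g v) \<partial>gauss n) = (\<integral>\<^sup>+g. f (inner g (norm v *\<^sub>R \<e> i)) \<partial>gauss n)"
  proof (cases "v = norm v *\<^sub>R \<e> i")
    case False
    then obtain a where a: "a \<in> Rn n" "norm a = 1" "reflect a v = norm v *\<^sub>R \<e> i"
      using v i by (elim reflect_exists[rotated]) (auto intro!: Rn_scale)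
    have "(\<integral>\<^sup>+g. f (inner g v) \<partial>gauss n) = (\<integral>\<^sup>+g. f (inner (reflect a g) (reflect a v)) \<partial>gauss n)"
      by (simp only: inner_reflect[OF a(2)])
    also have "\<dots> = (\<integral>\<^sup>+g. f (inner g (reflect a v)) \<partial>gauss n)"
      by (rule nn_integral_gauss_reflect[OF a(1,2), of "\<lambda>g. f (inner g (reflect a v))"]) measurable
    finally show ?thesis by (simp add: a)
  qed simp
  also have "\<dots> = (\<integral>\<^sup>+x. f (norm v * x) \<partial>distr (gauss n) borel (\<lambda>g. coord g i))"
    by (subst nn_integral_distr) auto
  finally show ?thesis using gauss_component[OF i] by simp
qed

text \<open>The reflection of R^m along the unit vector \<open>w\<close>, acting on the index: if
  the \<open>u i\<close> are the rows of a matrix, this is multiplication from the left by I - 2 w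
  w^T. The formula makes sense for rows in any real vector space, in particular for scalars on the
  right-hand side of a linear system.\<close>

definition mix :: "nat \<Rightarrow> (nat \<Rightarrow> real) \<Rightarrow> (nat \<Rightarrow> 'a::real_vector) \<Rightarrow> nat \<Rightarrow> 'a"
  where "mix m w u = (\<lambda>i\<in>{..<m}. u i - (2 * w i) *\<^sub>R (\<Sum>k<m. w k *\<^sub>R u k))"

lemma sum_mix:
  assumes "(\<Sum>i<m. (w i)\<^sup>2) = 1"
  shows "(\<Sum>k<m. w k *\<^sub>R mix m w u k) = - (\<Sum>k<m. w k *\<^sub>R u k)"
proof -
  define q where "q = (\<Sum>k<m. w k *\<^sub>R u k)"
  have "(\<Sum>k<m. w k *\<^sub>R mix m w u k) = (\<Sum>k<m. w k *\<^sub>R u k - (2 * (w k)\<^sup>2) *\<^sub>R q)"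
    by (rule sum.cong) (auto simp: mix_def q_def power2_eq_square algebra_simps)
  also have "\<dots> = q - (2 * (\<Sum>k<m. (w k)\<^sup>2)) *\<^sub>R q"
    by (simp add: sum_subtractf q_def[symmetric] sum_distrib_left scaleR_sum_left)
  finally show ?thesis by (simp add: assms q_def algebra_simps scaleR_2)
qed

lemma mix_mix:
  assumes "(\<Sum>i<m. (w i)\<^sup>2) = 1" "i < m"
  shows "mix m w (mix m w u) i = u i"
  using assms(2) sum_mix[OF assms(1), of u] by (subst mix_def) (simp add: mix_def)

lemma sum_norm_mix:
  fixes u :: "nat \<Rightarrow> 'a::real_inner"
  assumes "(\<Sum>i<m. (w i)\<^sup>2) = 1"
  shows "(\<Sum>i<m. (norm (mix m w u i))\<^sup>2) = (\<Sum>i<m. (norm (u i))\<^sup>2)"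
proof -
  define q where "q = (\<Sum>k<m. w k *\<^sub>R u k)"
  have "(\<Sum>i<m. (norm (mix m w u i))\<^sup>2) =
      (\<Sum>i<m. (norm (u i))\<^sup>2 - 4 * inner (w i *\<^sub>R u i) q + 4 * (w i)\<^sup>2 * inner q q)"
    by (rule sum.cong)
       (auto simp: mix_def q_def[symmetric] power2_norm_eq_inner inner_diff inner_commute algebra_simps,
        simp add: power2_eq_square algebra_simps)
  also have "\<dots> = (\<Sum>i<m. (norm (u i))\<^sup>2) - 4 * inner q q + 4 * (\<Sum>i<m. (w i)\<^sup>2) * inner q q"
    by (simp add: sum.distrib sum_subtractf sum_distrib_left sum_distrib_right q_def[symmetric] flip: inner_sum_left)
       (simp add: q_def inner_sum_left sum_distrib_left)
  finally show ?thesis by (simp add: assms)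
qed

lemma mix_diff: "mix m w (\<lambda>i. u i - v i) i = (if i < m then mix m w u i - mix m w v i else undefined)"
  by (simp add: mix_def scaleR_right_diff_distrib sum_subtractf algebra_simps)

lemma mix_cong: "(\<And>i. i < m \<Longrightarrow> u i = v i) \<Longrightarrow> mix m w u = mix m w v"
  by (auto simp: mix_def fun_eq_iff)

lemma mix_Rn: "(\<And>i. i < m \<Longrightarrow> u i \<in> Rn n) \<Longrightarrow> i < m \<Longrightarrow> mix m w u i \<in> Rn n"
  by (auto simp: mix_def intro!: Rn_diff Rn_scale Rn_sum)

lemma measurable_mix [measurable]:
  "mix m w \<in> measurable (Pi\<^sub>M {..<m} (\<lambda>_. borel :: seq measure)) (Pi\<^sub>M {..<m} (\<lambda>_. borel))"
  unfolding mix_def[abs_def] by measurable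

text \<open>The joint density of the rows is a function of the sum of their squared norms, which
  mixing preserves; the Lebesgue measure of the matrix entries is treated by the same uniqueness
  argument as for a single vector. \<open>E\<close> converts a matrix of reals into a tuple of
  vectors, and \<open>R\<close> is \<open>mix\<close> expressed in the entries.\<close>

theorem gauss_PiM_mix:
  assumes w: "(\<Sum>i<m. (w i)\<^sup>2) = 1"
  shows "distr (Pi\<^sub>M {..<m} (\<lambda>_. gauss n)) (Pi\<^sub>M {..<m} (\<lambda>_. gauss n)) (mix m w) = Pi\<^sub>M {..<m} (\<lambda>_. gauss n)"
proof -
  define I J where "I = {..<m}" and "J = {..<n}"
  have fin: "finite I" "finite J" by (simp_all add: I_def J_def)
  define K where "K = Pi\<^sub>M J (\<lambda>_. lborel :: real measure)"
  define V where "V = (\<lambda>x. \<Prod>j\<in>J. ennreal (std_normal_density (x j)))"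
  define L where "L = Pi\<^sub>M I (\<lambda>_. K)"
  define W where "W = (\<lambda>A. \<Prod>i\<in>I. V (A i))"
  define E where "E = (\<lambda>A. \<lambda>i\<in>I. emb n (A i))"
  define R where "R = (\<lambda>A. \<lambda>i\<in>I. \<lambda>j\<in>J. coord (mix m w (\<lambda>k. emb n (A k)) i) j)"
  interpret K: sigma_finite_measure K
    unfolding K_def by (rule lborel_PiM.sigma_finite[OF fin(2)])
  interpret K: product_sigma_finite "\<lambda>_. K" by standard
  have sK [measurable_cong]: "sets K = sets (Pi\<^sub>M J (\<lambda>_. borel))" by (simp add: K_def sets_PiM_lborel)
  have [measurable]: "emb n \<in> measurable K borel" using measurable_emb[of n] by (simp add: J_def[symmetric])
  have [measurable]: "V \<in> borel_measurable K" unfolding V_def by measurable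
  have [measurable]: "W \<in> borel_measurable L" unfolding W_def L_def by measurable
  have [measurable]: "E \<in> measurable L (Pi\<^sub>M I (\<lambda>_. borel))" unfolding E_def L_def by measurable
  have std: "Pi\<^sub>M J (\<lambda>_. std_normal) = density K V"
    using PiM_std_normal[OF fin(2)] by (simp add: K_def V_def)
  interpret S: prob_space "density K V"
    unfolding std[symmetric] by (rule prob_space_PiM) (rule prob_space_std_normal)
  interpret SP: product_prob_space "\<lambda>_. density K V" I by standard
  have PS: "Pi\<^sub>M I (\<lambda>_. density K V) = density L W"
    unfolding L_def W_def
    by (rule PiM_density_eq[OF fin(1)]) (auto intro: K.product_sigma_finite_axioms SP.product_sigma_finite_axioms)
  have gJ: "gauss n = distr (density K V) borel (emb n)"
    unfolding gauss_def std[symmetric] J_def ..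
  have pG: "product_sigma_finite (\<lambda>i :: nat. distr (density K V) borel (emb n))"
    unfolding gJ[symmetric] product_sigma_finite_def by (simp add: gauss.sigma_finite_measure_axioms)
  have pS: "product_sigma_finite (\<lambda>i :: nat. density K V)"
    unfolding product_sigma_finite_def by (simp add: S.sigma_finite_measure_axioms)
  have PG: "Pi\<^sub>M I (\<lambda>_. gauss n) = distr (density L W) (Pi\<^sub>M I (\<lambda>_. borel)) E"
    unfolding PS[symmetric] E_def gJ
    by (rule distr_PiM_componentwise[symmetric, OF fin(1) pS pG]) simp
  have cij: "(\<lambda>A. A i j) \<in> borel_measurable L" if "i \<in> I" "j \<in> J" for i j
    using measurable_compose[where f = "\<lambda>A. A i" and g = "\<lambda>x. x j" and M = L and N = K and L = borel] that
    by (auto simp: L_def K_def)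
  have gen: "(\<lambda>p. \<lambda>i\<in>I. \<lambda>j\<in>J. h p i j) \<in> measurable N L"
    if "\<And>i j. i \<in> I \<Longrightarrow> j \<in> J \<Longrightarrow> (\<lambda>p. h p i j) \<in> borel_measurable N"
    for h :: "'p \<Rightarrow> nat \<Rightarrow> nat \<Rightarrow> real" and N
    unfolding L_def K_def by (intro measurable_restrict) (use that in auto)
  have ER: "E (R A) = mix m w (E A)" for A
  proof -
    have "E (R A) = (\<lambda>i\<in>I. mix m w (\<lambda>k. emb n (A k)) i)"
      unfolding E_def R_def J_def
      by (rule restrict_ext) (simp add: emb_restrict_lookup mix_Rn I_def)
    also have "\<dots> = mix m w (\<lambda>k. emb n (A k))" by (auto simp: mix_def I_def)
    also have "\<dots> = mix m w (E A)" by (rule mix_cong) (simp add: E_def I_def)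
    finally show ?thesis .
  qed
  have Rm [measurable]: "R \<in> measurable L L"
  proof -
    have "(\<lambda>A. mix m w (\<lambda>k. emb n (A k)) i) \<in> borel_measurable L" if i: "i \<in> I" for i
    proof -
      have "(\<lambda>A. mix m w (E A) i) \<in> borel_measurable L"
        by (rule measurable_compose[OF _ measurable_component_singleton[of i "{..<m}"]],
            rule measurable_compose[OF _ measurable_mix]) (use i in \<open>auto simp flip: I_def\<close>)
      moreover have "mix m w (E A) = mix m w (\<lambda>k. emb n (A k))" for A
        by (rule mix_cong) (simp add: E_def I_def)
      ultimately show ?thesis by simp
    qed
    then show ?thesis
      unfolding R_def by (subst (2) L_def) (intro measurable_restrict, unfold K_def, intro measurable_restrict, auto)
  qed
  define F where "F = (\<lambda>U :: nat \<Rightarrow> seq. \<Sum>i\<in>I. (norm (U i))\<^sup>2)"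
  have W: "W A = ennreal (((1 / sqrt (2 * pi)) ^ n) ^ m * exp (- F (E A) / 2))" for A
  proof -
    have "V x = ennreal ((1 / sqrt (2 * pi)) ^ n * exp (- (norm (emb n x))\<^sup>2 / 2))" for x
      unfolding V_def norm_emb using prod_std_normal_density[OF fin(2), of x] by (simp add: J_def)
    then have "W A = (\<Prod>i\<in>I. ennreal ((1 / sqrt (2 * pi)) ^ n * exp (- (norm (emb n (A i)))\<^sup>2 / 2)))"
      unfolding W_def by simp
    also have "\<dots> = ennreal (((1 / sqrt (2 * pi)) ^ n) ^ m * exp (- F (E A) / 2))"
      using fin(1) by (subst prod_ennreal)
        (auto simp: prod.distrib F_def E_def I_def exp_sum[symmetric] sum_divide_distrib sum_negf)
    finally show ?thesis .
  qed
  have Fmix: "F (mix m w U) = F U" for U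
    unfolding F_def I_def by (rule sum_norm_mix[OF w])
  have sp: "space L = (I \<rightarrow>\<^sub>E extensional J)" by (auto simp: L_def K_def space_PiM PiE_def)
  \<comment> \<open>Embedding the rows is injective on the space of \<open>L\<close>, so identities
    between matrices may be checked between tuples of vectors.\<close>
  have ext: "x = y" if "x \<in> space L" "y \<in> space L" "E x = E y" for x y
  proof -
    have "x i = y i" if i: "i \<in> I" for i
    proof -
      have "emb n (x i) = emb n (y i)" using \<open>E x = E y\<close> i by (auto simp: E_def fun_eq_iff split: if_splits dest: spec[of _ i])
      moreover have "x i \<in> extensional J" "y i \<in> extensional J" using that(1) \<open>x \<in> space L\<close> \<open>y \<in> space L\<close> by (auto simp: sp PiE_iff)
      ultimately show ?thesis by (metis J_def restrict_lookup_emb)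
    qed
    then show ?thesis using \<open>x \<in> space L\<close> \<open>y \<in> space L\<close> by (auto simp: sp intro: PiE_ext)
  qed
  have E_add: "E (\<lambda>i\<in>I. \<lambda>j\<in>J. x i j + y i j) = (\<lambda>i\<in>I. E x i + E y i)" for x y
    unfolding E_def J_def by (auto simp: emb_add)
  have E_diff: "E (\<lambda>i\<in>I. \<lambda>j\<in>J. x i j - y i j) = (\<lambda>i\<in>I. E x i - E y i)" for x y
    unfolding E_def J_def by (auto simp: emb_diff)
  have Rsp: "R x \<in> space L" for x by (auto simp: sp R_def)
  have "distr L L R = L"
  proof (rule involution_preserves_measure[where W = W and N = "space L"
        and pl = "\<lambda>x y. \<lambda>i\<in>I. \<lambda>j\<in>J. x i j + y i j" and mi = "\<lambda>x y. \<lambda>i\<in>I. \<lambda>j\<in>J. x i j - y i j"])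
    show "sigma_finite_measure L" unfolding L_def by (rule K.sigma_finite[OF fin(1)])
    show "(\<lambda>(x, y). \<lambda>i\<in>I. \<lambda>j\<in>J. x i j + y i j) \<in> measurable (L \<Otimes>\<^sub>M L) L"
      "(\<lambda>(x, y). \<lambda>i\<in>I. \<lambda>j\<in>J. x i j - y i j) \<in> measurable (L \<Otimes>\<^sub>M L) L"
      unfolding split_beta'
      by (intro gen borel_measurable_add borel_measurable_diff measurable_compose[OF measurable_fst cij]
          measurable_compose[OF measurable_snd cij]; assumption)+
    show "distr L L (\<lambda>x. \<lambda>i\<in>I. \<lambda>j\<in>J. x i j + y i j) = L" for y
    proof -
      have *: "distr K K (\<lambda>x. \<lambda>j\<in>J. x j + y i j) = K" for i
        unfolding K_def by (rule PiM_lborel_translate[OF fin(2)])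
      have "(\<lambda>x. \<lambda>j\<in>J. x j + y i j) \<in> measurable K K" for i
        unfolding K_def by measurable
      then show ?thesis
        using distr_PiM_componentwise[OF fin(1), of "\<lambda>_. K" "\<lambda>_. K" "\<lambda>i x. \<lambda>j\<in>J. x j + y i j"]
        by (simp add: * K.product_sigma_finite_axioms L_def)
    qed
    have "(\<integral>\<^sup>+x. W x \<partial>L) = emeasure (density L W) (space L)"
      by (subst emeasure_density) (auto intro!: nn_integral_cong)
    also have "\<dots> = emeasure (Pi\<^sub>M I (\<lambda>_. density K V)) (space (Pi\<^sub>M I (\<lambda>_. density K V)))"
      unfolding PS by simp
    also have "\<dots> = 1"
      by (rule prob_space.emeasure_space_1) (rule prob_space_PiM, rule S.prob_space_axioms)
    finally have "(\<integral>\<^sup>+x. W x \<partial>L) = 1" .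
    then show "(\<integral>\<^sup>+x. W x \<partial>L) \<noteq> 0" "(\<integral>\<^sup>+x. W x \<partial>L) \<noteq> \<infinity>" by auto
    show RR: "R (R x) = x" if "x \<in> space L" for x
    proof (rule ext[OF Rsp that])
      have "mix m w (mix m w (E x)) i = E x i" for i
        by (cases "i < m") (simp_all add: mix_mix[OF w], simp add: mix_def E_def I_def)
      then show "E (R (R x)) = E x" unfolding ER by (simp add: fun_eq_iff)
    qed
    show "W (\<lambda>i\<in>I. \<lambda>j\<in>J. y i j - R x i j) = W (\<lambda>i\<in>I. \<lambda>j\<in>J. x i j - R y i j)" for x y
    proof -
      have "F (\<lambda>i\<in>I. E y i - mix m w (E x) i) = F (mix m w (\<lambda>i\<in>I. E y i - mix m w (E x) i))"
        by (rule Fmix[symmetric])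
      also have "mix m w (\<lambda>i\<in>I. E y i - mix m w (E x) i) = mix m w (\<lambda>i. E y i - mix m w (E x) i)"
        by (rule mix_cong) (simp add: I_def)
      also have "F \<dots> = F (\<lambda>i\<in>I. E x i - mix m w (E y) i)"
        unfolding F_def by (rule sum.cong) (auto simp: I_def mix_diff mix_mix[OF w] norm_minus_commute)
      finally show ?thesis unfolding W E_diff ER by (simp only:)
    qed
    show "R (\<lambda>i\<in>I. \<lambda>j\<in>J. x i j + y i j) = (\<lambda>i\<in>I. \<lambda>j\<in>J. R x i j + R y i j)" for x y
    proof (rule ext[OF Rsp])
      show "(\<lambda>i\<in>I. \<lambda>j\<in>J. R x i j + R y i j) \<in> space L" by (auto simp: sp)
      have "mix m w (\<lambda>i\<in>I. E x i + E y i) = mix m w (\<lambda>i. E x i + E y i)"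
        by (rule mix_cong) (simp add: I_def)
      moreover have "mix m w (\<lambda>i. E x i + E y i) = (\<lambda>i\<in>I. mix m w (E x) i + mix m w (E y) i)"
        by (rule HOL.ext) (simp add: mix_def I_def scaleR_right_distrib sum.distrib algebra_simps)
      ultimately show "E (R (\<lambda>i\<in>I. \<lambda>j\<in>J. x i j + y i j)) = E (\<lambda>i\<in>I. \<lambda>j\<in>J. R x i j + R y i j)"
        unfolding ER E_add by (simp only:)
    qed
    show "(\<lambda>i\<in>I. \<lambda>j\<in>J. (\<lambda>i\<in>I. \<lambda>j\<in>J. x i j + y i j) i j - y i j) = x" if "x \<in> space L" for x y
    proof -
      have x: "x i \<in> extensional J" if "i \<in> I" for i using \<open>x \<in> space L\<close> that by (auto simp: sp PiE_iff)
      show ?thesis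
      proof (intro HOL.ext)
        fix i j
        show "(\<lambda>i\<in>I. \<lambda>j\<in>J. (\<lambda>i\<in>I. \<lambda>j\<in>J. x i j + y i j) i j - y i j) i j = x i j"
        proof (cases "i \<in> I")
          case True then show ?thesis using x[OF True] by (simp add: extensional_def)
        next
          case False
          then have "x i = undefined" using that by (auto simp: sp PiE_iff extensional_def)
          then show ?thesis using False by simp
        qed
      qed
    qed
  qed (auto simp: Rsp add.commute)
  then have inv: "distr (density L W) L R = density L W"
    by (intro distr_density_invariant) (auto simp: W ER Fmix)
  have [measurable]: "mix m w \<in> measurable (Pi\<^sub>M I (\<lambda>_. borel)) (Pi\<^sub>M I (\<lambda>_. borel :: seq measure))"
    unfolding I_def by measurable
  have "Pi\<^sub>M I (\<lambda>_. gauss n) = distr (distr (density L W) L R) (Pi\<^sub>M I (\<lambda>_. borel)) E"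
    unfolding inv PG ..
  also have "\<dots> = distr (density L W) (Pi\<^sub>M I (\<lambda>_. borel)) (E \<circ> R)" by (rule distr_distr) auto
  also have "\<dots> = distr (density L W) (Pi\<^sub>M I (\<lambda>_. borel)) (mix m w \<circ> E)" by (simp add: ER comp_def)
  also have "\<dots> = distr (distr (density L W) (Pi\<^sub>M I (\<lambda>_. borel)) E) (Pi\<^sub>M I (\<lambda>_. borel)) (mix m w)"
    by (rule distr_distr[symmetric]) auto
  also have "\<dots> = distr (Pi\<^sub>M I (\<lambda>_. gauss n)) (Pi\<^sub>M I (\<lambda>_. borel)) (mix m w)"
    unfolding PG[symmetric] ..
  also have "\<dots> = distr (Pi\<^sub>M I (\<lambda>_. gauss n)) (Pi\<^sub>M I (\<lambda>_. gauss n)) (mix m w)"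
    by (intro distr_cong refl sets_PiM_cong) auto
  finally show ?thesis unfolding I_def ..
qed

section \<open>Hausdorff measure\<close>

lemma kappa_pos: "0 < s \<Longrightarrow> 0 < kappa s"
  by (simp add: kappa_def Gamma_real_pos)

definition hausdorff_covers :: "real \<Rightarrow> 'a::metric_space set \<Rightarrow> (nat \<Rightarrow> 'a set) set"
  where "hausdorff_covers \<delta> A = {C. A \<subseteq> (\<Union>i. C i) \<and> (\<forall>i. bounded (C i) \<and> diameter (C i) \<le> \<delta>)}"

definition hausdorff_weight :: "real \<Rightarrow> 'a::metric_space set \<Rightarrow> ennreal"
  where "hausdorff_weight s C = ennreal (kappa s * (diameter C / 2) powr s)"

definition hausdorff_pre :: "real \<Rightarrow> real \<Rightarrow> 'a::metric_space set \<Rightarrow> ennreal"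
  where "hausdorff_pre s \<delta> A = (INF C\<in>hausdorff_covers \<delta> A. suminf (\<lambda>i. hausdorff_weight s (C i)))"

lemma hausdorff_outer_eq: "hausdorff_outer s A = (SUP \<delta>\<in>{0<..}. hausdorff_pre s \<delta> A)"
  by (simp add: hausdorff_outer_def hausdorff_pre_def hausdorff_covers_def hausdorff_weight_def)

lemma hausdorff_weight_empty [simp]: "hausdorff_weight s {} = 0"
  by (simp add: hausdorff_weight_def diameter_def)

lemma hausdorff_pre_le: "C \<in> hausdorff_covers \<delta> A \<Longrightarrow> hausdorff_pre s \<delta> A \<le> (suminf (\<lambda>i. hausdorff_weight s (C i)))"
  unfolding hausdorff_pre_def by (rule INF_lower)

lemma hausdorff_pre_le_outer: "0 < \<delta> \<Longrightarrow> hausdorff_pre s \<delta> A \<le> hausdorff_outer s A"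
  unfolding hausdorff_outer_eq by (rule SUP_upper) auto

lemma hausdorff_pre_mono: "A \<subseteq> B \<Longrightarrow> hausdorff_pre s \<delta> A \<le> hausdorff_pre s \<delta> B"
  unfolding hausdorff_pre_def by (rule INF_superset_mono) (auto simp: hausdorff_covers_def)

lemma hausdorff_pre_antimono:
  assumes "\<delta> \<le> \<delta>'"
  shows "hausdorff_pre s \<delta>' A \<le> hausdorff_pre s \<delta> A"
proof -
  have "hausdorff_covers \<delta> A \<subseteq> hausdorff_covers \<delta>' A"
    using assms by (fastforce simp: hausdorff_covers_def intro: order_trans)
  then show ?thesis unfolding hausdorff_pre_def by (rule INF_superset_mono) simp
qed

lemma hausdorff_outer_mono: "A \<subseteq> B \<Longrightarrow> hausdorff_outer s A \<le> hausdorff_outer s B"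
  unfolding hausdorff_outer_eq by (rule SUP_mono) (auto intro: hausdorff_pre_mono)

lemma hausdorff_outer_empty [simp]: "hausdorff_outer s ({} :: 'a::metric_space set) = 0"
proof -
  have "hausdorff_pre s \<delta> ({} :: 'a set) = 0" if "0 < \<delta>" for \<delta>
    using hausdorff_pre_le[of "\<lambda>_. {}" \<delta> "{} :: 'a set" s] that
    by (simp add: hausdorff_covers_def diameter_def)
  then have "hausdorff_outer s ({} :: 'a set) = (SUP \<delta>\<in>{0::real<..}. 0)"
    unfolding hausdorff_outer_eq by (intro SUP_cong) auto
  moreover have "(1::real) \<in> {0<..}" by simp
  then have "{0::real<..} \<noteq> {}" by blast
  ultimately show ?thesis by simp
qed

text \<open>Nearly optimal covers of the single sets, with errors e/2^(n+1) that sum to e, are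
  arranged in one sequence through \<open>prod_decode\<close>.\<close>

lemma hausdorff_pre_countable_subadditive:
  "hausdorff_pre s \<delta> (\<Union>i. A i) \<le> (suminf (\<lambda>i. hausdorff_pre s \<delta> (A i)))"
proof (rule ennreal_le_epsilon)
  fix e :: real assume fin: "(suminf (\<lambda>i. hausdorff_pre s \<delta> (A i))) < (Orderings.top :: ennreal)" and e: "0 < e"
  have "\<exists>C\<in>hausdorff_covers \<delta> (A n). (suminf (\<lambda>i. hausdorff_weight s (C i))) < hausdorff_pre s \<delta> (A n) + ennreal (e * (1 / 2) ^ Suc n)" for n
  proof -
    have "hausdorff_pre s \<delta> (A n) \<noteq> \<infinity>"
      using ennreal_suminf_lessD[OF fin, of n] by auto
    moreover have "0 < e * (1 / 2) ^ Suc n" using e by simp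
    ultimately show ?thesis
      using INF_approx_ennreal[of "e * (1 / 2) ^ Suc n" "hausdorff_pre s \<delta> (A n)"] unfolding hausdorff_pre_def by blast
  qed
  then obtain C where C: "\<And>n. C n \<in> hausdorff_covers \<delta> (A n)"
    "\<And>n. (suminf (\<lambda>i. hausdorff_weight s (C n i))) < hausdorff_pre s \<delta> (A n) + ennreal (e * (1 / 2) ^ Suc n)"
    by metis
  define D where "D k = (case prod_decode k of (n, i) \<Rightarrow> C n i)" for k
  have "D \<in> hausdorff_covers \<delta> (\<Union>i. A i)"
  proof -
    have "(\<Union>i. A i) \<subseteq> (\<Union>k. D k)"
    proof
      fix x assume "x \<in> (\<Union>i. A i)"
      then obtain n i where "x \<in> C n i" using C(1) by (fastforce simp: hausdorff_covers_def)
      then have "x \<in> D (prod_encode (n, i))" by (simp add: D_def)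
      then show "x \<in> (\<Union>k. D k)" by blast
    qed
    then show ?thesis using C(1) by (auto simp: hausdorff_covers_def D_def split: prod.split)
  qed
  then have "hausdorff_pre s \<delta> (\<Union>i. A i) \<le> (suminf (\<lambda>k. hausdorff_weight s (D k)))"
    by (rule hausdorff_pre_le)
  also have "\<dots> = (suminf (\<lambda>k. (\<lambda>(n, i). hausdorff_weight s (C n i)) (prod_decode k)))"
    by (rule suminf_cong) (simp add: D_def split: prod.split)
  also have "\<dots> = (suminf (\<lambda>n. suminf (\<lambda>i. hausdorff_weight s (C n i))))"
    by (rule suminf_ennreal_2dimen) simp
  also have "\<dots> \<le> (suminf (\<lambda>n. hausdorff_pre s \<delta> (A n) + ennreal (e * (1 / 2) ^ Suc n)))"
    using C(2) by (intro suminf_le) (auto intro: less_imp_le)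
  also have "\<dots> = (suminf (\<lambda>n. hausdorff_pre s \<delta> (A n))) + (suminf (\<lambda>n. ennreal (e * (1 / 2) ^ Suc n)))"
    by (rule suminf_add[symmetric]) auto
  also have "(\<lambda>n. e * (1 / 2) ^ Suc n) sums (e * 1)"
    by (intro sums_mult power_half_series)
  then have "(suminf (\<lambda>n. ennreal (e * (1 / 2) ^ Suc n))) = ennreal e"
    using e by (subst suminf_ennreal2) (auto simp: sums_iff)
  finally show "hausdorff_pre s \<delta> (\<Union>i. A i) \<le> (suminf (\<lambda>i. hausdorff_pre s \<delta> (A i))) + ennreal e" .
qed

lemma hausdorff_outer_countable_subadditive:
  "hausdorff_outer s (\<Union>i. A i) \<le> (suminf (\<lambda>i. hausdorff_outer s (A i)))"
proof -
  have "hausdorff_pre s \<delta> (\<Union>i. A i) \<le> (suminf (\<lambda>i. hausdorff_outer s (A i)))" if "0 < \<delta>" for \<delta>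
  proof -
    have "hausdorff_pre s \<delta> (\<Union>i. A i) \<le> (suminf (\<lambda>i. hausdorff_pre s \<delta> (A i)))"
      by (rule hausdorff_pre_countable_subadditive)
    also have "\<dots> \<le> (suminf (\<lambda>i. hausdorff_outer s (A i)))"
      using that by (intro suminf_le hausdorff_pre_le_outer) auto
    finally show ?thesis .
  qed
  then show ?thesis unfolding hausdorff_outer_eq[of s "\<Union>i. A i"] by (intro SUP_least) auto
qed

lemma hausdorff_outer_subadditive: "hausdorff_outer s (A \<union> B) \<le> hausdorff_outer s A + hausdorff_outer s B"
proof -
  have "hausdorff_outer s (\<Union>i. binaryset A B i) \<le> (suminf (\<lambda>i. hausdorff_outer s (binaryset A B i)))"
    by (rule hausdorff_outer_countable_subadditive)
  then show ?thesis
    by (simp add: UN_binaryset_eq suminf_binaryset_eq)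
qed

text \<open>For a mesh below \<open>d\<close> no covering set meets both \<open>A\<close> and
  \<open>B\<close>, so every cover of the union splits into a cover of each.\<close>

lemma hausdorff_outer_metric:
  assumes d: "0 < d" and AB: "\<And>a b. a \<in> A \<Longrightarrow> b \<in> B \<Longrightarrow> d \<le> dist a b"
  shows "hausdorff_outer s A + hausdorff_outer s B \<le> hausdorff_outer s (A \<union> B)"
proof -
  have *: "hausdorff_pre s \<delta> A + hausdorff_pre s \<delta> B \<le> hausdorff_pre s \<delta> (A \<union> B)" if "\<delta> < d" for \<delta>
    unfolding hausdorff_pre_def[of s \<delta> "A \<union> B"]
  proof (rule INF_greatest)
    fix C assume C: "C \<in> hausdorff_covers \<delta> (A \<union> B)"
    define CA CB where "CA i = (if C i \<inter> A = {} then {} else C i)" and "CB i = (if C i \<inter> B = {} then {} else C i)" for i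
    have dis: "C i \<inter> A = {} \<or> C i \<inter> B = {}" for i
    proof (rule ccontr)
      assume "\<not> ?thesis"
      then obtain a b where ab: "a \<in> C i" "a \<in> A" "b \<in> C i" "b \<in> B" by blast
      have "dist a b \<le> diameter (C i)"
        using C ab by (intro diameter_bounded_bound) (auto simp: hausdorff_covers_def)
      also have "\<dots> \<le> \<delta>" using C by (auto simp: hausdorff_covers_def)
      finally show False using AB[of a b] ab that by simp
    qed
    have dz: "diameter (C i) \<le> \<delta>" "bounded (C i)" for i using C by (auto simp: hausdorff_covers_def)
    have cA: "CA \<in> hausdorff_covers \<delta> A" if "0 \<le> \<delta>"
      using C dz that by (fastforce simp: hausdorff_covers_def CA_def)
    have cB: "CB \<in> hausdorff_covers \<delta> B" if "0 \<le> \<delta>"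
      using C dz that by (fastforce simp: hausdorff_covers_def CB_def)
    have "0 \<le> diameter (C 0)" by (rule diameter_ge_0) (rule dz)
    then have "0 \<le> \<delta>" using dz(1)[of 0] by simp
    then have "hausdorff_pre s \<delta> A + hausdorff_pre s \<delta> B \<le> (suminf (\<lambda>i. hausdorff_weight s (CA i))) + (suminf (\<lambda>i. hausdorff_weight s (CB i)))"
      using cA cB by (intro add_mono hausdorff_pre_le)
    also have "\<dots> = (suminf (\<lambda>i. hausdorff_weight s (CA i) + hausdorff_weight s (CB i)))"
      by (rule suminf_add) auto
    also have "\<dots> \<le> (suminf (\<lambda>i. hausdorff_weight s (C i)))"
      by (rule suminf_le) (use dis in \<open>auto simp: CA_def CB_def\<close>)
    finally show "hausdorff_pre s \<delta> A + hausdorff_pre s \<delta> B \<le> (suminf (\<lambda>i. hausdorff_weight s (C i)))" .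
  qed
  have le: "hausdorff_pre s \<delta>1 A + hausdorff_pre s \<delta>2 B \<le> hausdorff_outer s (A \<union> B)" if "0 < \<delta>1" "0 < \<delta>2" for \<delta>1 \<delta>2
  proof -
    define \<delta> where "\<delta> = min (d / 2) (min \<delta>1 \<delta>2)"
    have \<delta>: "0 < \<delta>" "\<delta> < d" "\<delta> \<le> \<delta>1" "\<delta> \<le> \<delta>2" using d that by (auto simp: \<delta>_def)
    have "hausdorff_pre s \<delta>1 A + hausdorff_pre s \<delta>2 B \<le> hausdorff_pre s \<delta> A + hausdorff_pre s \<delta> B"
      using \<delta> by (intro add_mono hausdorff_pre_antimono)
    also have "\<dots> \<le> hausdorff_pre s \<delta> (A \<union> B)" by (rule *) fact
    also have "\<dots> \<le> hausdorff_outer s (A \<union> B)" by (rule hausdorff_pre_le_outer) fact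
    finally show ?thesis .
  qed
  have "(1::real) \<in> {0<..}" by simp
  then have ne: "{0::real<..} \<noteq> {}" by blast
  have "hausdorff_outer s A + hausdorff_outer s B = (SUP \<delta>1\<in>{0<..}. SUP \<delta>2\<in>{0<..}. hausdorff_pre s \<delta>1 A + hausdorff_pre s \<delta>2 B)"
    unfolding hausdorff_outer_eq by (simp add: ennreal_SUP_add_left[OF ne, symmetric] ennreal_SUP_add_right[OF ne])
       (rule SUP_commute)
  also have "\<dots> \<le> hausdorff_outer s (A \<union> B)"
    by (intro SUP_least) (auto intro: le)
  finally show ?thesis .
qed

text \<open>In the application \<open>g\<close> is the distance from a closed set and the
  \<open>R j\<close> are annuli around it. Two annuli whose indices have the same parity are
  separated by the one in between, so additivity for sets at positive distance applies step by step;
  \<open>c\<close> selects the parity.\<close>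

lemma hausdorff_outer_annuli:
  assumes R: "\<And>j x. x \<in> R j \<Longrightarrow> g x < 1 / real (Suc j) \<and> 1 / real (Suc (Suc j)) \<le> g x \<and> x \<in> E"
    and g: "\<And>x y. g x \<le> g y + dist x y"
  shows "(\<Sum>j<N. hausdorff_outer s (R (2 * j + c))) \<le> hausdorff_outer s ((\<Union>j<N. R (2 * j + c)) \<inter> E)"
proof (induction N)
  case (Suc N)
  have sub: "(\<Union>j<k. R (2 * j + c)) \<inter> E = (\<Union>j<k. R (2 * j + c))" for k using R by auto
  show ?case
  proof (cases "N = 0")
    case True then show ?thesis using R by (auto intro!: hausdorff_outer_mono)
  next
    case False
    \<comment> \<open>On the new annulus \<open>g\<close> is below 1/(2N+c+1), on the earlier ones
      at least 1/(2N+c); \<open>d\<close> is the difference. The case N = 0 is split off because the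
      second denominator could vanish.\<close>
    define d where "d = 1 / real (2 * N + c) - 1 / real (Suc (2 * N + c))"
    have "1 / real (Suc (2 * N + c)) < 1 / real (2 * N + c)"
      using False by (intro divide_strict_left_mono) auto
    then have "0 < d" by (simp add: d_def)
    moreover have "d \<le> dist x y" if "x \<in> (\<Union>j<N. R (2 * j + c))" "y \<in> R (2 * N + c)" for x y
    proof -
      from that(1) obtain j where j: "j < N" "x \<in> R (2 * j + c)" by auto
      have "1 / real (2 * N + c) \<le> 1 / real (Suc (Suc (2 * j + c)))"
        using j(1) by (intro divide_left_mono) auto
      also have "\<dots> \<le> g x" using R[OF j(2)] by simp
      finally show ?thesis using R[OF that(2)] g[of x y] by (simp add: d_def)
    qed
    ultimately have "hausdorff_outer s (\<Union>j<N. R (2 * j + c)) + hausdorff_outer s (R (2 * N + c))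
        \<le> hausdorff_outer s ((\<Union>j<N. R (2 * j + c)) \<union> R (2 * N + c))"
      by (rule hausdorff_outer_metric)
    then have D: "hausdorff_outer s (\<Union>j<N. R (2 * j + c)) + hausdorff_outer s (R (2 * N + c))
        \<le> hausdorff_outer s (\<Union>j<Suc N. R (2 * j + c))"
      by (simp add: lessThan_Suc Un_commute)
    have IH: "(\<Sum>j<N. hausdorff_outer s (R (2 * j + c))) \<le> hausdorff_outer s (\<Union>j<N. R (2 * j + c))"
      using Suc.IH unfolding sub .
    show ?thesis
      unfolding sub sum.lessThan_Suc by (rule order_trans[OF add_right_mono[OF IH] D])
  qed
qed simp

text \<open>Caratheodory's criterion for closed sets. The part \<open>D k\<close> of
  \<open>E\<close> at distance at least 1/(k+1) from \<open>F\<close> is separated from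
  \<open>F\<close>, so the outer measures of \<open>E \<inter> F\<close> and \<open>D k\<close> add
  up; the rest of \<open>E - F\<close> is covered by annuli whose outer measures have a finite
  sum.\<close>

lemma hausdorff_outer_closed_split:
  fixes F :: "'a::metric_space set"
  assumes F: "closed F"
  shows "hausdorff_outer s (E \<inter> F) + hausdorff_outer s (E - F) \<le> hausdorff_outer s E"
proof (cases "F = {} \<or> hausdorff_outer s E = \<infinity>")
  case True then show ?thesis by auto
next
  case False
  then have ne: "F \<noteq> {}" and fin: "hausdorff_outer s E < \<infinity>" by (auto simp: less_top)
  define g where "g x = infdist x F" for x
  have g: "g x \<le> g y + dist x y" for x y unfolding g_def by (rule infdist_triangle)
  define D where "D k = {x \<in> E. 1 / real (Suc k) \<le> g x}" for k
  define R where "R j = D (Suc j) - D j" for j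
  have Rj: "g x < 1 / real (Suc j) \<and> 1 / real (Suc (Suc j)) \<le> g x \<and> x \<in> E" if "x \<in> R j" for j x
    using that by (auto simp: R_def D_def)
  have half: "(\<Sum>j<N. hausdorff_outer s (R (2 * j + c))) \<le> hausdorff_outer s E" for N c
    using hausdorff_outer_annuli[where R = R and g = g and E = E and N = N and c = c and s = s, OF Rj g]
    by (rule order_trans) (auto intro: hausdorff_outer_mono)
  have "(\<Sum>j<N. hausdorff_outer s (R j)) \<le> 2 * hausdorff_outer s E" for N
  proof -
    have "(\<Sum>j<N. hausdorff_outer s (R j)) \<le> (\<Sum>j<2 * N. hausdorff_outer s (R j))"
      by (rule sum_mono2) auto
    also have "\<dots> = (\<Sum>j<N. hausdorff_outer s (R (2 * j + 0))) + (\<Sum>j<N. hausdorff_outer s (R (2 * j + 1)))"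
      by (induction N) (auto simp: algebra_simps)
    also have "\<dots> \<le> hausdorff_outer s E + hausdorff_outer s E"
      by (intro add_mono half)
    finally show ?thesis by (simp add: mult_2)
  qed
  then have "(suminf (\<lambda>j. hausdorff_outer s (R j))) \<le> 2 * hausdorff_outer s E"
    by (intro suminf_le_const) auto
  then have sfin: "(suminf (\<lambda>j. hausdorff_outer s (R j))) < \<infinity>"
    by (rule le_less_trans) (use fin in \<open>simp add: ennreal_mult_less_top\<close>)
  \<comment> \<open>Instead of letting the tail of the annuli tend to zero, the first k terms are
    added on the left and the whole series on the right; the finite series is cancelled at the
    end.\<close>
  define X where "X = hausdorff_outer s (E \<inter> F) + hausdorff_outer s (E - F)"
  have step: "X + (\<Sum>j<k. hausdorff_outer s (R j)) \<le> hausdorff_outer s E + (suminf (\<lambda>j. hausdorff_outer s (R j)))" for k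
  proof -
    have "E - F \<subseteq> D k \<union> (\<Union>j. R (j + k))"
    proof
      fix x assume x: "x \<in> E - F"
      then have "0 < g x" unfolding g_def using F ne infdist_nonneg[of x F] in_closed_iff_infdist_zero[OF F ne, of x] by force
      then obtain i where i: "1 / real (Suc i) < g x" using nat_approx_posE by blast
      then have xi: "x \<in> D i" using x by (simp add: D_def)
      show "x \<in> D k \<union> (\<Union>j. R (j + k))"
      proof (rule ccontr)
        assume n: "\<not> ?thesis"
        have "x \<notin> D (j + k)" for j
          by (induction j) (use n in \<open>auto simp: R_def\<close>)
        moreover have "1 / real (Suc (i + k)) \<le> 1 / real (Suc i)"
          by (intro divide_left_mono) auto
        then have "D i \<subseteq> D (i + k)"
          unfolding D_def by (blast intro: order_trans)
        ultimately show False using xi by blast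
      qed
    qed
    then have "hausdorff_outer s (E - F) \<le> hausdorff_outer s (D k \<union> (\<Union>j. R (j + k)))"
      by (rule hausdorff_outer_mono)
    also have "\<dots> \<le> hausdorff_outer s (D k) + (suminf (\<lambda>j. hausdorff_outer s (R (j + k))))"
      by (rule order_trans[OF hausdorff_outer_subadditive]) (intro add_mono order_refl hausdorff_outer_countable_subadditive)
    finally have 1: "hausdorff_outer s (E - F) \<le> hausdorff_outer s (D k) + (suminf (\<lambda>j. hausdorff_outer s (R (j + k))))" .
    have "hausdorff_outer s (E \<inter> F) + hausdorff_outer s (D k) \<le> hausdorff_outer s (E \<inter> F \<union> D k)"
    proof (rule hausdorff_outer_metric[of "1 / real (Suc k)"])
      show "1 / real (Suc k) \<le> dist a b" if "a \<in> E \<inter> F" "b \<in> D k" for a b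
        using that g[of b a] by (auto simp: D_def g_def dist_commute)
    qed simp
    also have "\<dots> \<le> hausdorff_outer s E" by (rule hausdorff_outer_mono) (auto simp: D_def)
    finally have 2: "hausdorff_outer s (E \<inter> F) + hausdorff_outer s (D k) \<le> hausdorff_outer s E" .
    have "X + (\<Sum>j<k. hausdorff_outer s (R j)) \<le>
        (hausdorff_outer s (E \<inter> F) + hausdorff_outer s (D k)) + ((suminf (\<lambda>j. hausdorff_outer s (R (j + k)))) + (\<Sum>j<k. hausdorff_outer s (R j)))"
      unfolding X_def using add_mono[OF add_left_mono[OF 1, of "hausdorff_outer s (E \<inter> F)"] order_refl]
      by (simp only: add.assoc)
    also have "\<dots> = (hausdorff_outer s (E \<inter> F) + hausdorff_outer s (D k)) + (suminf (\<lambda>j. hausdorff_outer s (R j)))"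
      by (subst suminf_offset[of _ k, symmetric]) auto
    also have "\<dots> \<le> hausdorff_outer s E + (suminf (\<lambda>j. hausdorff_outer s (R j)))"
      using 2 by (rule add_right_mono)
    finally show ?thesis .
  qed
  have "X + (suminf (\<lambda>j. hausdorff_outer s (R j))) \<le> hausdorff_outer s E + (suminf (\<lambda>j. hausdorff_outer s (R j)))"
    unfolding suminf_eq_SUP[of "\<lambda>j. hausdorff_outer s (R j)"]
    by (subst ennreal_SUP_add_right) (use step in \<open>auto intro!: SUP_least simp: suminf_eq_SUP\<close>)
  moreover have "suminf (\<lambda>j. hausdorff_outer s (R j)) \<noteq> \<infinity>" using sfin by simp
  ultimately show ?thesis
    unfolding X_def add.commute[of _ "suminf _"] ennreal_add_left_cancel_le by blast
qed

text \<open>\<open>measure_of\<close> returns the zero measure unless the given set function is a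
  measure on the sigma-algebra. Caratheodory's theorem provides this: closed sets belong to the
  lambda system of the outer measure, hence so do all Borel sets.\<close>

theorem hausdorff_measure_space: "measure_space UNIV (sets borel) (hausdorff_outer s :: 'a::metric_space set \<Rightarrow> ennreal)"
proof -
  let ?H = "hausdorff_outer s :: 'a set \<Rightarrow> ennreal"
  define L where "L = lambda_system UNIV (Pow (UNIV :: 'a set)) ?H"
  have oms: "outer_measure_space (Pow (UNIV :: 'a set)) ?H"
    unfolding outer_measure_space_def positive_def increasing_def countably_subadditive_def
    by (auto intro: hausdorff_outer_mono hausdorff_outer_countable_subadditive)
  have ms: "measure_space UNIV L ?H"
    unfolding L_def by (rule sigma_algebra.caratheodory_lemma[OF sigma_algebra_Pow oms])
  then have sa: "sigma_algebra UNIV L" by (simp add: measure_space_def)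
  have "F \<in> L" if "closed F" for F
  proof -
    have "?H (F \<inter> E) + ?H ((UNIV - F) \<inter> E) = ?H E" for E
    proof (rule antisym)
      show "?H (F \<inter> E) + ?H ((UNIV - F) \<inter> E) \<le> ?H E"
        using hausdorff_outer_closed_split[OF that, of s E] by (simp add: Int_commute Diff_eq)
      have "?H E \<le> ?H ((F \<inter> E) \<union> ((UNIV - F) \<inter> E))" by (rule hausdorff_outer_mono) auto
      then show "?H E \<le> ?H (F \<inter> E) + ?H ((UNIV - F) \<inter> E)"
        using hausdorff_outer_subadditive order_trans by blast
    qed
    then show ?thesis by (auto simp: L_def lambda_system_def)
  qed
  then have "sigma_sets UNIV (Collect closed) \<subseteq> L"
    by (intro sigma_algebra.sigma_sets_subset[OF sa]) auto
  then have sub: "sets (borel :: 'a measure) \<subseteq> L"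
    by (simp add: borel_eq_closed)
  show ?thesis
    using ms sub unfolding measure_space_def countably_additive_def
    using sets.sigma_algebra_axioms[of "borel :: 'a measure"]
    by (auto simp: positive_def)
qed

lemma sets_hausdorff_measure [simp, measurable_cong]: "sets (hausdorff_measure s) = sets borel"
  unfolding hausdorff_measure_def
  using sets.sigma_sets_eq[of borel] by (simp add: sets_measure_of_conv)

lemma space_hausdorff_measure [simp]: "space (hausdorff_measure s) = UNIV"
  unfolding hausdorff_measure_def by (simp add: space_measure_of_conv)

lemma emeasure_hausdorff_measure:
  assumes "A \<in> sets borel"
  shows "emeasure (hausdorff_measure s) A = hausdorff_outer s A"
proof -
  have "sigma_sets UNIV (sets borel) = sets (borel :: 'a measure)"
    using sets.sigma_sets_eq[of "borel :: 'a measure"] by simp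
  then show ?thesis
    unfolding hausdorff_measure_def
    using hausdorff_measure_space[of s, where 'a='a] assms
    by (intro emeasure_measure_of_sigma) (auto simp: measure_space_def)
qed

lemma hausdorff_outer_involution:
  fixes f :: "'a::metric_space \<Rightarrow> 'a"
  assumes iso: "\<And>x y. dist (f x) (f y) = dist x y" and inv: "\<And>x. f (f x) = x"
  shows "hausdorff_outer s (f ` A) = hausdorff_outer s A"
proof -
  have diam: "diameter (f ` C) = diameter C" for C
    by (simp add: diameter_def iso image_paired_Times[symmetric] image_comp comp_def case_prod_unfold)
  have bd: "bounded (f ` C)" if "bounded C" for C
  proof -
    from that obtain x e where "\<And>y. y \<in> C \<Longrightarrow> dist x y \<le> e" by (auto simp: bounded_def)
    then show ?thesis unfolding bounded_def by (intro exI[of _ "f x"] exI[of _ e]) (auto simp: iso)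
  qed
  have le: "hausdorff_pre s \<delta> (f ` A) \<le> hausdorff_pre s \<delta> A" for \<delta> A
    unfolding hausdorff_pre_def[of s \<delta> A]
  proof (rule INF_greatest)
    fix C assume C: "C \<in> hausdorff_covers \<delta> A"
    then have "f ` A \<subseteq> (\<Union>i. f ` C i)" unfolding hausdorff_covers_def by blast
    with C have "(\<lambda>i. f ` C i) \<in> hausdorff_covers \<delta> (f ` A)"
      by (auto simp: hausdorff_covers_def diam bd)
    from hausdorff_pre_le[OF this, of s] show "hausdorff_pre s \<delta> (f ` A) \<le> (suminf (\<lambda>i. hausdorff_weight s (C i)))"
      by (simp add: hausdorff_weight_def diam)
  qed
  have le': "hausdorff_outer s (f ` A) \<le> hausdorff_outer s A" for A
    unfolding hausdorff_outer_eq by (rule SUP_mono) (use le in auto)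
  have "f ` f ` A = A" by (auto simp: inv image_image)
  then show ?thesis using le'[of A] le'[of "f ` A"] by (intro antisym) simp_all
qed

section \<open>The surface measure of the sphere is positive and finite\<close>

lemma unit_sphere_iff: "x \<in> unit_sphere n \<longleftrightarrow> x \<in> Rn n \<and> norm x = 1"
  by (auto simp: unit_sphere_def)

lemma closed_unit_sphere: "closed (unit_sphere n)"
proof -
  have "closed {x :: seq. norm x = 1}" by (intro closed_Collect_eq continuous_intros)
  moreover have "unit_sphere n = Rn n \<inter> {x. norm x = 1}" by (auto simp: unit_sphere_iff)
  ultimately show ?thesis by (simp add: closed_Rn closed_Int)
qed

lemma unit_sphere_borel [measurable]: "unit_sphere n \<in> sets borel"
  by (rule borel_closed) (rule closed_unit_sphere)

lemma reflect_unit_sphere: "norm a = 1 \<Longrightarrow> a \<in> Rn n \<Longrightarrow> x \<in> unit_sphere n \<Longrightarrow> reflect a x \<in> unit_sphere n"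
  by (simp add: unit_sphere_iff norm_reflect reflect_Rn)

lemma std_normal_interval_le:
  assumes "a \<le> b" shows "emeasure std_normal {a..b} \<le> ennreal (b - a)"
proof -
  have "std_normal_density x \<le> 1" for x
  proof -
    have "1 \<le> sqrt (2 * pi)" using pi_gt3 by simp
    then have "1 / sqrt (2 * pi) \<le> 1" by simp
    then have "1 / sqrt (2 * pi) * exp (- x\<^sup>2 / 2) \<le> 1 * 1" by (intro mult_mono) auto
    then show ?thesis by (simp add: std_normal_density_def)
  qed
  then have "(\<integral>\<^sup>+x. ennreal (std_normal_density x) * indicator {a..b} x \<partial>lborel) \<le> (\<integral>\<^sup>+x. 1 * indicator {a..b} x \<partial>lborel)"
    by (intro nn_integral_mono mult_right_mono) auto
  then have "emeasure std_normal {a..b} \<le> (\<integral>\<^sup>+x. indicator {a..b} x \<partial>lborel)"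
    unfolding std_normal_def by (subst emeasure_density) auto
  also have "\<dots> = ennreal (b - a)" using assms by simp
  finally show ?thesis .
qed

lemma std_normal_interval_pos:
  assumes "0 < a" shows "0 < emeasure std_normal {-a..a}"
proof -
  define c where "c = 1 / sqrt (2 * pi) * exp (- a\<^sup>2 / 2)"
  have c: "0 < c" by (simp add: c_def)
  have "c \<le> std_normal_density x" if "x \<in> {-a..a}" for x
  proof -
    have "x\<^sup>2 \<le> a\<^sup>2" using that abs_le_square_iff[of x a] by auto
    then show ?thesis unfolding c_def std_normal_density_def by (intro mult_left_mono) auto
  qed
  then have "(\<integral>\<^sup>+x. ennreal c * indicator {-a..a} x \<partial>lborel) \<le> emeasure std_normal {-a..a}"
    unfolding std_normal_def by (subst emeasure_density) (auto intro!: nn_integral_mono ennreal_leI split: split_indicator)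
  moreover have "(\<integral>\<^sup>+x. ennreal c * indicator {-a..a} x \<partial>lborel) = ennreal c * ennreal (2 * a)"
    using assms by (subst nn_integral_cmult) auto
  moreover have "0 < ennreal c * ennreal (2 * a)" using c assms by (simp add: ennreal_zero_less_mult_iff)
  ultimately show ?thesis by simp
qed

lemma gauss_box:
  assumes [measurable]: "\<And>j. j < m \<Longrightarrow> A j \<in> sets borel"
  shows "emeasure (gauss m) {y. \<forall>j<m. coord y j \<in> A j} = (\<Prod>j<m. emeasure std_normal (A j))"
proof -
  have "{y :: seq. \<forall>j<m. coord y j \<in> A j} = (\<Inter>j\<in>{..<m}. {y \<in> space borel. coord y j \<in> A j})"
    by auto
  also have "\<dots> \<in> sets borel"
    by (cases "m = 0") (auto intro!: sets.finite_INT)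
  finally have [measurable]: "{y :: seq. \<forall>j<m. coord y j \<in> A j} \<in> sets borel" .
  have "emb m -` {y. \<forall>j<m. coord y j \<in> A j} \<inter> space (Pi\<^sub>M {..<m} (\<lambda>_. std_normal)) = Pi\<^sub>E {..<m} A"
    by (auto simp: space_PiM lookup_emb PiE_iff)
  then show ?thesis
    unfolding gauss_def by (subst emeasure_distr) (auto intro!: std_normal_PiM.emeasure_PiM)
qed

text \<open>The projection to the first n - 1 coordinates maps the sphere onto a set that contains a
  small cube. A covering set of diameter d projects into a cube of side 2d, of Gaussian measure at
  most (2d)^m, and (d/2)^m = (2d)^m / 4^m. Hence every cover has weight at least the positive
  constant kappa / 4^m times the Gaussian mass of the small cube.\<close>

lemma hausdorff_sphere_pos:
  assumes n: "2 \<le> n"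
  shows "0 < hausdorff_outer (real n - 1) (unit_sphere n)"
proof -
  define m where "m = n - 1"
  have m: "0 < m" "n = Suc m" using n by (auto simp: m_def)
  have s: "real n - 1 = real m" by (simp add: m)
  \<comment> \<open>With this half-side the cube lies in the unit ball, since the norm is at most
    the sum of m absolute values.\<close>
  define a where "a = 1 / real (Suc m)"
  have a: "0 < a" "real m * a \<le> 1" by (auto simp: a_def)
  define B where "B = {y :: seq. \<forall>j<m. coord y j \<in> {-a..a}}"
  define p where "p x = emb m (coord x)" for x :: seq
  define \<kappa> where "\<kappa> = kappa (real m)"
  have \<kappa>: "0 < \<kappa>" using m by (simp add: \<kappa>_def kappa_pos)
  have Bpos: "0 < emeasure (gauss m) B"
  proof -
    have ne: "emeasure std_normal {-a..a} \<noteq> 0" using std_normal_interval_pos[OF a(1)] by (metis less_irrefl)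
    have "emeasure (gauss m) B = (\<Prod>j<m. emeasure std_normal {-a..a})"
      unfolding B_def by (rule gauss_box) simp
    then have "emeasure (gauss m) B \<noteq> 0" using ne by (simp only: prod_constant power_eq_0_iff) auto
    then show ?thesis by (metis zero_less_iff_neq_zero)
  qed
  have Bp: "\<exists>x\<in>unit_sphere n. p x = emb m (coord y)" if "y \<in> B" for y
  proof -
    define y' where "y' = p y"
    have y'Rn: "y' \<in> Rn m" by (simp add: y'_def p_def)
    have "norm y' \<le> (\<Sum>j<m. \<bar>coord y' j\<bar>)" by (rule norm_Rn_le[OF y'Rn])
    also have "\<dots> \<le> (\<Sum>j<m. a)"
    proof (rule sum_mono)
      fix j assume "j \<in> {..<m}"
      then have "coord y j \<in> {-a..a}" "coord y' j = coord y j"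
        using that by (auto simp: B_def y'_def p_def lookup_emb)
      then show "\<bar>coord y' j\<bar> \<le> a" by (simp add: abs_le_iff)
    qed
    also have "\<dots> \<le> 1" using a by simp
    finally have le: "norm y' \<le> 1" .
    \<comment> \<open>The missing coordinate that lifts \<open>y'\<close> to the sphere.\<close>
    define t where "t = sqrt (1 - (norm y')\<^sup>2)"
    have ym: "coord y' m = 0" using y'Rn by (simp add: Rn_iff)
    have "(norm (y' + t *\<^sub>R \<e> m))\<^sup>2 = (norm y')\<^sup>2 + t\<^sup>2"
      unfolding power2_norm_eq_inner
      by (simp only: inner_add_left inner_add_right inner_scaleR_left inner_scaleR_right inner_single inner_single'
          ym lookup_single_eq) (simp add: power2_eq_square lookup_add ym)
    also have "\<dots> = 1" using le by (simp add: t_def power_le_one)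
    finally have "norm (y' + t *\<^sub>R \<e> m) = 1" by (simp add: norm_eq_1 power2_norm_eq_inner)
    moreover have "y' + t *\<^sub>R \<e> m \<in> Rn n"
      using y'Rn Rn_mono[of m n] by (intro Rn_add Rn_scale) (auto simp: m)
    moreover have "p (y' + t *\<^sub>R \<e> m) = y'"
      unfolding p_def by (intro poly_mapping_eqI) (use y'Rn in \<open>auto simp: lookup_emb lookup_add lookup_single when_def Rn_iff\<close>)
    ultimately show ?thesis by (intro bexI[of _ "y' + t *\<^sub>R \<e> m"]) (auto simp: unit_sphere_iff y'_def p_def)
  qed
  have "ennreal (\<kappa> / 4 ^ m) * emeasure (gauss m) B \<le> hausdorff_pre (real m) 1 (unit_sphere n)"
    unfolding hausdorff_pre_def
  proof (rule INF_greatest)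
    fix C assume C: "C \<in> hausdorff_covers 1 (unit_sphere n)"
    define c where "c i = (SOME x. x \<in> C i)" for i
    define d where "d i = diameter (C i)" for i
    define Q where "Q i = (if C i = {} then {} else
        {y :: seq. \<forall>j<m. coord y j \<in> {coord (c i) j - d i..coord (c i) j + d i}})" for i
    have bd: "bounded (C i)" for i using C by (auto simp: hausdorff_covers_def)
    have d0: "0 \<le> d i" for i unfolding d_def by (rule diameter_ge_0[OF bd])
    have Qm [measurable]: "Q i \<in> sets borel" for i
    proof -
      have "{y :: seq. \<forall>j<m. coord y j \<in> {coord (c i) j - d i..coord (c i) j + d i}}
         = (\<Inter>j\<in>{..<m}. {y \<in> space borel. coord y j \<in> {coord (c i) j - d i..coord (c i) j + d i}})"
        by auto
      also have "\<dots> \<in> sets borel" using m by (intro sets.finite_INT) auto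
      finally show ?thesis by (simp add: Q_def)
    qed
    have Qle: "ennreal (\<kappa> / 4 ^ m) * emeasure (gauss m) (Q i) \<le> hausdorff_weight (real m) (C i)" for i
    proof (cases "C i = {}")
      case False
      have "emeasure (gauss m) (Q i) \<le> (\<Prod>j<m. ennreal (2 * d i))"
        unfolding Q_def if_not_P[OF False]
        by (subst gauss_box, simp, rule prod_mono_ennreal, rule order_trans[OF std_normal_interval_le])
          (auto intro: ennreal_leI simp: d0)
      also have "\<dots> = ennreal ((2 * d i) ^ m)" by (simp add: ennreal_power d0)
      finally have "ennreal (\<kappa> / 4 ^ m) * emeasure (gauss m) (Q i) \<le> ennreal (\<kappa> / 4 ^ m) * ennreal ((2 * d i) ^ m)"
        by (rule mult_left_mono) simp
      also have "\<dots> = ennreal (\<kappa> / 4 ^ m * (2 * d i) ^ m)" using \<kappa> d0 by (intro ennreal_mult[symmetric]) auto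
      also have "\<kappa> / 4 ^ m * (2 * d i) ^ m = \<kappa> * (d i / 2) ^ m"
        using power_mult_distrib[of "2::real" 2 m] by (simp add: power_divide power_mult_distrib)
      also have "(d i / 2) ^ m = (d i / 2) powr real m"
        using d0[of i] m by (cases "d i = 0") (auto simp: powr_realpow)
      finally show ?thesis by (simp add: hausdorff_weight_def \<kappa>_def d_def)
    qed (simp add: Q_def)
    have "B \<inter> Rn m \<subseteq> (\<Union>i. Q i)"
    proof
      fix y assume y: "y \<in> B \<inter> Rn m"
      then obtain x where x: "x \<in> unit_sphere n" "p x = y"
        using Bp[of y] emb_lookup[of y m] by auto
      then obtain i where i: "x \<in> C i" using C by (auto simp: hausdorff_covers_def)
      then have ci: "c i \<in> C i" unfolding c_def by (rule someI)
      have "\<bar>coord y j - coord (c i) j\<bar> \<le> d i" if "j < m" for j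
      proof -
        have "\<bar>coord y j - coord (c i) j\<bar> = \<bar>coord (x - c i) j\<bar>"
          using that unfolding x(2)[symmetric] p_def by (simp add: lookup_emb lookup_minus)
        also have "\<dots> \<le> norm (x - c i)" by (rule abs_lookup_le_norm)
        also have "\<dots> \<le> d i" unfolding d_def dist_norm[symmetric] by (rule diameter_bounded_bound[OF bd i ci])
        finally show ?thesis .
      qed
      then have "coord (c i) j - d i \<le> coord y j \<and> coord y j \<le> coord (c i) j + d i"
        if "j < m" for j using that by (fastforce simp: abs_le_iff)
      then have "y \<in> Q i" using i unfolding Q_def by auto
      then show "y \<in> (\<Union>i. Q i)" by blast
    qed
    moreover have [measurable]: "B \<in> sets borel"
      using Bpos emeasure_notin_sets[of B "gauss m"] by (metis less_irrefl sets_gauss)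
    ultimately have "emeasure (gauss m) (B \<inter> Rn m) \<le> emeasure (gauss m) (\<Union>i. Q i)"
      by (intro emeasure_mono) auto
    moreover have "emeasure (gauss m) (B \<inter> Rn m) = emeasure (gauss m) B"
      using AE_gauss_Rn[of m] by (intro emeasure_eq_AE) auto
    moreover have "emeasure (gauss m) (\<Union>i. Q i) \<le> (suminf (\<lambda>i. emeasure (gauss m) (Q i)))"
      by (rule emeasure_subadditive_countably) auto
    ultimately have "ennreal (\<kappa> / 4 ^ m) * emeasure (gauss m) B \<le> ennreal (\<kappa> / 4 ^ m) * (suminf (\<lambda>i. emeasure (gauss m) (Q i)))"
      by (intro mult_left_mono) auto
    also have "\<dots> = (suminf (\<lambda>i. ennreal (\<kappa> / 4 ^ m) * emeasure (gauss m) (Q i)))"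
      by simp
    also have "\<dots> \<le> (suminf (\<lambda>i. hausdorff_weight (real m) (C i)))"
      by (intro suminf_le Qle) auto
    finally show "ennreal (\<kappa> / 4 ^ m) * emeasure (gauss m) B \<le> (suminf (\<lambda>i. hausdorff_weight (real m) (C i)))" .
  qed
  also have "\<dots> \<le> hausdorff_outer (real m) (unit_sphere n)" by (rule hausdorff_pre_le_outer) simp
  finally have "ennreal (\<kappa> / 4 ^ m) * emeasure (gauss m) B \<le> hausdorff_outer (real m) (unit_sphere n)" .
  moreover have "0 < ennreal (\<kappa> / 4 ^ m) * emeasure (gauss m) B"
    using Bpos \<kappa> by (simp add: ennreal_zero_less_mult_iff)
  ultimately show ?thesis unfolding s by (rule less_le_trans[rotated])
qed

text \<open>The finite cover is padded to a sequence by empty sets, which have weight 0.\<close>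

lemma hausdorff_pre_finite_cover:
  fixes F :: "'b \<Rightarrow> 'a::metric_space set"
  assumes J: "finite J" and cov: "A \<subseteq> (\<Union>j\<in>J. F j)" and b: "\<And>j. j \<in> J \<Longrightarrow> bounded (F j)"
    and d: "\<And>j. j \<in> J \<Longrightarrow> diameter (F j) \<le> d" "0 \<le> d" "d \<le> \<delta>" and s: "0 < s"
  shows "hausdorff_pre s \<delta> A \<le> ennreal (real (card J) * kappa s * (d / 2) powr s)"
proof -
  obtain h where h: "bij_betw h {..<card J} J" using J by (metis ex_bij_betw_nat_finite atLeast0LessThan)
  define C where "C i = (if i < card J then F (h i) else {})" for i
  have hJ: "h i \<in> J" if "i < card J" for i using h that by (auto simp: bij_betw_def)
  have "C \<in> hausdorff_covers \<delta> A"
  proof -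
    have "A \<subseteq> (\<Union>i. C i)"
    proof
      fix x assume "x \<in> A"
      then obtain j where "j \<in> J" "x \<in> F j" using cov by auto
      then obtain i where "i < card J" "h i = j" using h unfolding bij_betw_def by (metis imageE lessThan_iff)
      then have "x \<in> C i" using \<open>x \<in> F j\<close> by (simp add: C_def)
      then show "x \<in> (\<Union>i. C i)" by blast
    qed
    moreover have "bounded (C i) \<and> diameter (C i) \<le> \<delta>" for i
    proof (cases "i < card J")
      case True
      then show ?thesis using b[OF hJ] order_trans[OF d(1)[OF hJ] d(3)] by (simp add: C_def)
    next
      case False
      then show ?thesis using d by (simp add: C_def diameter_def)
    qed
    ultimately show ?thesis by (auto simp: hausdorff_covers_def)
  qed
  then have "hausdorff_pre s \<delta> A \<le> (suminf (\<lambda>i. hausdorff_weight s (C i)))" by (rule hausdorff_pre_le)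
  also have "\<dots> = (\<Sum>i<card J. hausdorff_weight s (C i))"
    by (rule suminf_finite) (auto simp: C_def)
  also have "\<dots> \<le> (\<Sum>i<card J. ennreal (kappa s * (d / 2) powr s))"
  proof (rule sum_mono)
    fix i assume "i \<in> {..<card J}"
    then have i: "diameter (C i) \<le> d" "0 \<le> diameter (C i)"
      using d(1)[OF hJ] b[OF hJ] by (auto simp: C_def intro!: diameter_ge_0)
    have "(diameter (C i) / 2) powr s \<le> (d / 2) powr s"
      using i s by (intro powr_mono2) auto
    then show "hausdorff_weight s (C i) \<le> ennreal (kappa s * (d / 2) powr s)"
      unfolding hausdorff_weight_def using kappa_pos[OF s] by (intro ennreal_leI mult_left_mono) auto
  qed
  also have "\<dots> = ennreal (real (card J) * kappa s * (d / 2) powr s)"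
    using kappa_pos[OF s] by (simp add: ennreal_of_nat_eq_real_of_nat ennreal_mult mult.assoc)
  finally show ?thesis .
qed

text \<open>On a cap where the i-th coordinate is bounded away from zero, it is a Lipschitz function
  of the others: the squares of all coordinates sum to 1, so the difference of the i-th squares is
  at most 2nh, and it is divided by |x_i + y_i|, which is at least 2/sqrt n.\<close>

lemma sphere_chart_close:
  fixes x y :: seq
  assumes n: "1 \<le> n" and x: "x \<in> unit_sphere n" and y: "y \<in> unit_sphere n" and i: "i < n" and \<sigma>: "\<sigma> \<in> {-1, 1}"
    and xi: "1 / sqrt n \<le> \<sigma> * coord x i" and yi: "1 / sqrt n \<le> \<sigma> * coord y i"
    and h: "0 \<le> h" "\<And>j. j < n \<Longrightarrow> j \<noteq> i \<Longrightarrow> \<bar>coord x j - coord y j\<bar> \<le> h"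
  shows "norm (x - y) \<le> (real n + real n * sqrt n) * h"
proof -
  let ?x = "coord x" and ?y = "coord y"
  have sq: "(\<Sum>j<n. (?x j)\<^sup>2) = 1" "(\<Sum>j<n. (?y j)\<^sup>2) = 1"
    using x y by (auto simp: unit_sphere_iff norm_Rn)
  have bx: "\<bar>?x j\<bar> \<le> 1" "\<bar>?y j\<bar> \<le> 1" for j
    using abs_lookup_le_norm[of x j] abs_lookup_le_norm[of y j] x y by (auto simp: unit_sphere_iff)
  have each: "\<bar>(?y j)\<^sup>2 - (?x j)\<^sup>2\<bar> \<le> 2 * h" if "j \<in> {..<n} - {i}" for j
  proof -
    have "\<bar>(?y j)\<^sup>2 - (?x j)\<^sup>2\<bar> = \<bar>?x j - ?y j\<bar> * \<bar>?x j + ?y j\<bar>"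
      by (simp add: abs_mult[symmetric] power2_eq_square algebra_simps abs_minus_commute)
    also have "\<dots> \<le> h * 2" using h that bx[of j] by (intro mult_mono) auto
    finally show ?thesis by simp
  qed
  have "(?x i)\<^sup>2 - (?y i)\<^sup>2 = (\<Sum>j\<in>{..<n} - {i}. (?y j)\<^sup>2 - (?x j)\<^sup>2)"
    using sq i by (simp add: sum_subtractf sum.remove[of "{..<n}" i])
  also have "\<bar>\<dots>\<bar> \<le> (\<Sum>j\<in>{..<n} - {i}. 2 * h)"
    by (rule order_trans[OF sum_abs sum_mono]) (rule each)
  also have "\<dots> \<le> 2 * real n * h" using i h(1) by (auto simp: card_Diff_singleton intro!: mult_right_mono)
  finally have d: "\<bar>(?x i)\<^sup>2 - (?y i)\<^sup>2\<bar> \<le> 2 * real n * h" .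
  have "2 / sqrt n \<le> \<bar>?x i + ?y i\<bar>" using xi yi \<sigma> by auto
  then have "\<bar>?x i - ?y i\<bar> * (2 / sqrt n) \<le> \<bar>?x i - ?y i\<bar> * \<bar>?x i + ?y i\<bar>"
    by (rule mult_left_mono) simp
  also have "\<dots> = \<bar>(?x i)\<^sup>2 - (?y i)\<^sup>2\<bar>" by (simp add: abs_mult[symmetric] power2_eq_square algebra_simps)
  also note d
  finally have di: "\<bar>?x i - ?y i\<bar> \<le> real n * sqrt n * h" using n by (simp add: field_simps)
  have "norm (x - y) \<le> (\<Sum>j<n. \<bar>coord (x - y) j\<bar>)"
    using x y by (intro norm_Rn_le Rn_diff) (auto simp: unit_sphere_iff)
  also have "\<dots> = \<bar>?x i - ?y i\<bar> + (\<Sum>j\<in>{..<n} - {i}. \<bar>?x j - ?y j\<bar>)"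
    using i by (simp add: lookup_minus sum.remove[of "{..<n}" i])
  also have "\<dots> \<le> real n * sqrt n * h + (\<Sum>j\<in>{..<n} - {i}. h)"
    using di h by (intro add_mono sum_mono) auto
  also have "(\<Sum>j\<in>{..<n} - {i}. h) \<le> real n * h" using i h(1) by (auto simp: card_Diff_singleton intro!: mult_right_mono)
  finally show ?thesis by (simp add: algebra_simps)
qed

text \<open>Every point of the sphere has a coordinate of modulus at least 1/sqrt n. On each of the
  2n resulting caps the other m coordinates are cut by a grid of width 1/N, which gives (2N+1)^m
  pieces of diameter at most L/N. The total weight stays bounded as N grows.\<close>

lemma hausdorff_sphere_finite:
  assumes n: "2 \<le> n"
  shows "hausdorff_outer (real n - 1) (unit_sphere n) < \<infinity>"
proof -
  define m where "m = n - 1"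
  have m: "0 < m" "n = Suc m" using n by (auto simp: m_def)
  have s: "real n - 1 = real m" by (simp add: m)
  define L where "L = real n + real n * sqrt n"
  have L: "0 < L" using n by (simp add: L_def add_pos_nonneg)
  \<comment> \<open>The factor 2n counts coordinates and signs; 3L/2 bounds (2N+1) L / (2N) for N at
    least 1.\<close>
  define K where "K = real (2 * n) * kappa (real m) * (3 * L / 2) ^ m"
  have pre: "hausdorff_pre (real m) \<delta> (unit_sphere n) \<le> ennreal K" if \<delta>: "0 < \<delta>" for \<delta>
  proof -
    obtain N0 where N0: "L / \<delta> < real N0" using reals_Archimedean2 by blast
    define N where "N = Suc N0"
    have N: "L / real N \<le> \<delta>" "0 < N"
      using N0 \<delta> L by (auto simp: N_def field_simps)
    define J where "J = {..<n} \<times> {-1, 1 :: real} \<times> ({..<n} \<rightarrow>\<^sub>E {- int N..int N})"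
    define F where "F = (\<lambda>(i, \<sigma>, k). {x \<in> unit_sphere n. 1 / sqrt n \<le> \<sigma> * coord x i \<and>
        (\<forall>j<n. j \<noteq> i \<longrightarrow> \<lfloor>real N * coord x j\<rfloor> = k j)})"
    \<comment> \<open>A piece is labelled by the large coordinate, its sign and the grid indices of
      the remaining coordinates.\<close>
    define J' where "J' = (SIGMA i:{..<n}. {-1, 1 :: real} \<times> (({..<n} - {i}) \<rightarrow>\<^sub>E {- int N..int N}))"
    have finJ: "finite J'" unfolding J'_def by (intro finite_SigmaI finite_cartesian_product finite_PiE) auto
    have cardJ: "card J' = n * (2 * (2 * N + 1) ^ m)"
    proof -
      have "card J' = (\<Sum>i<n. card ({-1, 1 :: real} \<times> (({..<n} - {i}) \<rightarrow>\<^sub>E {- int N..int N})))"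
        unfolding J'_def by (rule card_SigmaI) (auto intro!: finite_PiE)
      also have "\<dots> = (\<Sum>i<n. 2 * (2 * N + 1) ^ m)"
        proof (rule sum.cong)
        fix i assume "i \<in> {..<n}"
        moreover have "card {- int N..int N} = 2 * N + 1" by simp
        ultimately show "card ({-1, 1 :: real} \<times> (({..<n} - {i}) \<rightarrow>\<^sub>E {- int N..int N})) = 2 * (2 * N + 1) ^ m"
          by (simp add: card_cartesian_product card_PiE m card_Diff_singleton del: card_atLeastAtMost_int)
      qed simp
      finally show ?thesis by simp
    qed
    have cov: "unit_sphere n \<subseteq> (\<Union>j\<in>J'. F j)"
    proof
      fix x assume x: "x \<in> unit_sphere n"
      have sq: "(\<Sum>j<n. (coord x j)\<^sup>2) = 1" using x by (auto simp: unit_sphere_iff norm_Rn)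
      obtain i where i: "i < n" "1 / real n \<le> (coord x i)\<^sup>2"
      proof (rule ccontr)
        assume nt: "\<not> thesis"
        have "(coord x j)\<^sup>2 < 1 / real n" if "j < n" for j
          using nt that \<open>\<And>i. i < n \<Longrightarrow> 1 / real n \<le> (coord x i)\<^sup>2 \<Longrightarrow> thesis\<close> not_le by blast
        then have "(\<Sum>j<n. (coord x j)\<^sup>2) < (\<Sum>j<n. 1 / real n)"
          using n by (intro sum_strict_mono) (auto simp: lessThan_empty_iff)
        then show False using sq n by simp
      qed
      define \<sigma> where "\<sigma> = (if 0 \<le> coord x i then 1 else -1 :: real)"
      have "sqrt (1 / real n) \<le> sqrt ((coord x i)\<^sup>2)" using i(2) by (rule real_sqrt_le_mono)
      then have \<sigma>: "1 / sqrt n \<le> \<sigma> * coord x i" by (auto simp: \<sigma>_def real_sqrt_divide)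
      define k where "k = (\<lambda>j\<in>{..<n} - {i}. \<lfloor>real N * coord x j\<rfloor>)"
      have "\<lfloor>real N * coord x j\<rfloor> \<in> {- int N..int N}" for j
      proof -
        have "\<bar>coord x j\<bar> \<le> 1" using abs_lookup_le_norm[of x j] x by (simp add: unit_sphere_iff)
        then have "\<bar>real N * coord x j\<bar> \<le> real N * 1"
          unfolding abs_mult by (intro mult_mono) auto
        then show ?thesis by (auto simp: le_floor_iff floor_le_iff abs_le_iff)
      qed
      then have "(i, \<sigma>, k) \<in> J'" using i by (auto simp: J'_def k_def \<sigma>_def)
      moreover have "x \<in> F (i, \<sigma>, k)" using x \<sigma> by (auto simp: F_def k_def)
      ultimately show "x \<in> (\<Union>j\<in>J'. F j)" by blast
    qed
    have close: "norm (x - y) \<le> L / real N" if j: "j \<in> J'" and xy: "x \<in> F j" "y \<in> F j" for j x y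
    proof -
      obtain i \<sigma> k where ik: "j = (i, \<sigma>, k)" "i < n" "\<sigma> \<in> {-1, 1}" using j by (auto simp: J'_def)
      have "norm (x - y) \<le> (real n + real n * sqrt n) * (1 / real N)"
      proof (rule sphere_chart_close[where i = i and \<sigma> = \<sigma>])
        fix j assume j: "j < n" "j \<noteq> i"
        then have "\<lfloor>real N * coord x j\<rfloor> = \<lfloor>real N * coord y j\<rfloor>"
          using xy by (simp add: ik F_def)
        then have "\<bar>real N * coord x j - real N * coord y j\<bar> \<le> 1" by linarith
        then have "real N * \<bar>coord x j - coord y j\<bar> \<le> 1"
          using abs_mult[of "real N" "coord x j - coord y j"] by (simp add: algebra_simps)
        then show "\<bar>coord x j - coord y j\<bar> \<le> 1 / real N"
          using N by (simp add: field_simps)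
      qed (use xy ik n in \<open>auto simp: F_def\<close>)
      then show ?thesis by (simp add: L_def)
    qed
    have "hausdorff_pre (real m) \<delta> (unit_sphere n) \<le> ennreal (real (card J') * kappa (real m) * (L / real N / 2) powr real m)"
    proof (rule hausdorff_pre_finite_cover[where F = F])
      show "bounded (F j)" if "j \<in> J'" for j
        unfolding bounded_iff by (intro exI[of _ 1]) (auto simp: F_def unit_sphere_iff split: prod.splits)
      show "diameter (F j) \<le> L / real N" if "j \<in> J'" for j
        using L close[OF that] by (intro diameter_le) auto
    qed (use finJ cov N L m in auto)
    also have "real (card J') * kappa (real m) * (L / real N / 2) powr real m =
        real (2 * n) * kappa (real m) * ((2 * real N + 1) * (L / real N / 2)) ^ m"
    proof -
      have "(L / real N / 2) powr real m = (L / real N / 2) ^ m" using L N by (intro powr_realpow) auto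
      moreover have "real (card J') = real (2 * n) * (2 * real N + 1) ^ m" unfolding cardJ by (simp add: add.commute)
      moreover have "((2 * real N + 1) * (L / real N / 2)) ^ m = (2 * real N + 1) ^ m * (L / real N / 2) ^ m"
        by (rule power_mult_distrib)
      ultimately show ?thesis by (simp only: mult.assoc mult.left_commute mult.commute)
    qed
    also have "\<dots> \<le> K"
      unfolding K_def
    proof (intro mult_left_mono power_mono)
      have "(2 * real N + 1) * (L / real N / 2) \<le> (3 * real N) * (L / real N / 2)"
        using N L by (intro mult_right_mono) auto
      then show "(2 * real N + 1) * (L / real N / 2) \<le> 3 * L / 2" using N by simp
    qed (use L m kappa_pos[of "real m"] in auto)
    finally show ?thesis by (simp add: ennreal_leI order_trans)
  qed
  have "hausdorff_outer (real m) (unit_sphere n) \<le> ennreal K"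
    unfolding hausdorff_outer_eq by (rule SUP_least) (auto intro: pre)
  then show ?thesis unfolding s by (rule le_less_trans) simp
qed

section \<open>Uniformly distributed measures and power weights\<close>

text \<open>For a point of the open set \<open>U\<close> all small balls lie in \<open>U\<close>, so
  the quotient is eventually 1; outside \<open>U\<close> the indicator vanishes. The constant 1 is
  an integrable bound.\<close>

lemma uniformly_distributed_measures_limit:
  fixes \<mu> \<nu> :: "'a::{metric_space, second_countable_topology} measure"
  assumes "finite_measure \<mu>" "finite_measure \<nu>"
    and s [measurable_cong]: "sets \<mu> = sets borel" "sets \<nu> = sets borel"
    and S: "AE x in \<mu>. x \<in> S"
    and h: "\<And>k x. x \<in> S \<Longrightarrow> emeasure \<nu> (ball x (1 / real (Suc k))) = h k" "\<And>k. h k \<noteq> 0"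
    and U: "open U"
  shows "(\<lambda>k. \<integral>\<^sup>+x. indicator U x * emeasure \<nu> (U \<inter> ball x (1 / real (Suc k))) / h k \<partial>\<mu>) \<longlonglongrightarrow> emeasure \<mu> U"
proof -
  interpret \<mu>: finite_measure \<mu> by fact
  interpret \<nu>: finite_measure \<nu> by fact
  have [measurable]: "U \<in> sets borel" using U by (rule borel_open)
  have meas [measurable]: "(\<lambda>x. emeasure \<nu> (U \<inter> ball x e)) \<in> borel_measurable borel" for e
  proof -
    have "(\<lambda>x. emeasure \<nu> (Pair x -` {p \<in> space (borel \<Otimes>\<^sub>M borel). snd p \<in> U \<and> dist (fst p) (snd p) < e})) \<in> borel_measurable borel"
      by (rule \<nu>.measurable_emeasure_Pair) measurable
    moreover have "Pair x -` {p \<in> space (borel \<Otimes>\<^sub>M borel). snd p \<in> U \<and> dist (fst p) (snd p) < e} = U \<inter> ball x e" for x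
      by (auto simp: space_pair_measure)
    ultimately show ?thesis by simp
  qed
  have "emeasure \<mu> U = (\<integral>\<^sup>+x. indicator U x \<partial>\<mu>)" by simp
  moreover have "(\<lambda>k. \<integral>\<^sup>+x. indicator U x * emeasure \<nu> (U \<inter> ball x (1 / real (Suc k))) / h k \<partial>\<mu>) \<longlonglongrightarrow> (\<integral>\<^sup>+x. indicator U x \<partial>\<mu>)"
  proof (rule nn_integral_dominated_convergence[where w = "\<lambda>_. 1"])
    show "(\<integral>\<^sup>+x. 1 \<partial>\<mu>) < \<infinity>" using \<mu>.emeasure_finite[of "space \<mu>"] by (simp add: less_top[symmetric])
    show "AE x in \<mu>. indicator U x * emeasure \<nu> (U \<inter> ball x (1 / real (Suc k))) / h k \<le> 1" for k
      using S
    proof eventually_elim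
      case (elim x)
      have "emeasure \<nu> (U \<inter> ball x (1 / real (Suc k))) \<le> h k"
        unfolding h(1)[OF elim, symmetric] by (rule emeasure_mono) auto
      moreover have "h k \<noteq> \<infinity>" unfolding h(1)[OF elim, symmetric] by simp
      ultimately have "emeasure \<nu> (U \<inter> ball x (1 / real (Suc k))) / h k \<le> 1"
        using h(2)[of k] by (metis divide_right_mono_ennreal ennreal_divide_self infinity_ennreal_def less_top)
      then show ?case by (simp split: split_indicator)
    qed
    show "AE x in \<mu>. (\<lambda>k. indicator U x * emeasure \<nu> (U \<inter> ball x (1 / real (Suc k))) / h k) \<longlonglongrightarrow> indicator U x"
      using S
    proof eventually_elim
      case (elim x)
      show ?case
      proof (cases "x \<in> U")
        case True
        then obtain e where e: "0 < e" "ball x e \<subseteq> U" using U open_contains_ball by blast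
        obtain N where N: "1 / real (Suc N) < e" using e(1) nat_approx_posE by blast
        have "emeasure \<nu> (U \<inter> ball x (1 / real (Suc k))) / h k = 1" if "N \<le> k" for k
        proof -
          have "1 / real (Suc k) \<le> 1 / real (Suc N)" using that by (intro divide_left_mono) auto
          then have "ball x (1 / real (Suc k)) \<subseteq> ball x e" using N by (intro subset_ball) auto
          then have "U \<inter> ball x (1 / real (Suc k)) = ball x (1 / real (Suc k))" using e by auto
          moreover have "h k \<noteq> \<infinity>" unfolding h(1)[OF elim, symmetric] by simp
          ultimately show ?thesis using h(1)[OF elim] h(2)[of k] by (simp add: ennreal_divide_self less_top)
        qed
        then have "eventually (\<lambda>k. indicator U x * emeasure \<nu> (U \<inter> ball x (1 / real (Suc k))) / h k = indicator U x) sequentially"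
          using True by (auto simp: eventually_sequentially)
        then show ?thesis by (rule tendsto_eventually)
      qed simp
    qed
  qed measurable
  ultimately show ?thesis by simp
qed

text \<open>Christensen's argument.\<close>

theorem uniformly_distributed_measures_proportional:
  fixes \<mu> \<nu> :: "'a::{metric_space, second_countable_topology} measure"
  assumes "finite_measure \<mu>" "finite_measure \<nu>"
    and s [measurable_cong]: "sets \<mu> = sets borel" "sets \<nu> = sets borel"
    and S: "AE x in \<mu>. x \<in> S" "AE x in \<nu>. x \<in> S"
    and g: "\<And>k x. x \<in> S \<Longrightarrow> emeasure \<mu> (ball x (1 / real (Suc k))) = g k" "\<And>k. g k \<noteq> 0"
    and h: "\<And>k x. x \<in> S \<Longrightarrow> emeasure \<nu> (ball x (1 / real (Suc k))) = h k" "\<And>k. h k \<noteq> 0"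
    and ne: "S \<noteq> {}"
  shows "scale_measure (emeasure \<nu> UNIV) \<mu> = scale_measure (emeasure \<mu> UNIV) \<nu>"
proof -
  interpret \<mu>: finite_measure \<mu> by fact
  interpret \<nu>: finite_measure \<nu> by fact
  interpret P: pair_sigma_finite \<mu> \<nu> by standard
  have fin: "g k \<noteq> \<infinity>" "h k \<noteq> \<infinity>" for k
    using ne g(1)[symmetric] h(1)[symmetric] by auto
  have mm: "{p :: 'a \<times> 'a. snd p \<in> U \<and> fst p \<in> U \<and> dist (fst p) (snd p) < e} \<in> sets (\<mu> \<Otimes>\<^sub>M \<nu>)" if [measurable]: "U \<in> sets borel" for U :: "'a set" and e
  proof -
    have "{p \<in> space (borel \<Otimes>\<^sub>M borel). snd p \<in> U \<and> fst p \<in> U \<and> dist (fst p) (snd p) < e} \<in> sets (borel \<Otimes>\<^sub>M borel :: ('a \<times> 'a) measure)"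
      by measurable
    moreover have "sets (\<mu> \<Otimes>\<^sub>M \<nu>) = sets (borel \<Otimes>\<^sub>M borel)" by (rule sets_pair_measure_cong) (auto simp: s)
    ultimately show ?thesis by (simp add: space_pair_measure)
  qed
  \<comment> \<open>Both sides are the product measure of the pairs of points of \<open>U\<close> at
    distance less than \<open>e\<close>.\<close>
  have swap: "(\<integral>\<^sup>+x. indicator U x * emeasure \<nu> (U \<inter> ball x e) \<partial>\<mu>) = (\<integral>\<^sup>+y. indicator U y * emeasure \<mu> (U \<inter> ball y e) \<partial>\<nu>)"
    if [measurable]: "U \<in> sets borel" for U e
  proof -
    let ?A = "{p :: 'a \<times> 'a. snd p \<in> U \<and> fst p \<in> U \<and> dist (fst p) (snd p) < e}"
    have "(\<integral>\<^sup>+x. emeasure \<nu> (Pair x -` ?A) \<partial>\<mu>) = (\<integral>\<^sup>+y. emeasure \<mu> ((\<lambda>x. (x, y)) -` ?A) \<partial>\<nu>)"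
      using P.emeasure_pair_measure_alt2[OF mm[OF that, of e]] \<nu>.emeasure_pair_measure_alt[OF mm[OF that, of e]] by simp
    moreover have "emeasure \<nu> (Pair x -` ?A) = indicator U x * emeasure \<nu> (U \<inter> ball x e)" for x
      by (auto split: split_indicator intro!: arg_cong[where f = "emeasure \<nu>"])
    moreover have "emeasure \<mu> ((\<lambda>x. (x, y)) -` ?A) = indicator U y * emeasure \<mu> (U \<inter> ball y e)" for y
      by (auto split: split_indicator simp: dist_commute intro!: arg_cong[where f = "emeasure \<mu>"])
    ultimately show ?thesis by simp
  qed
  have le: "emeasure \<mu> U * emeasure \<nu> V \<le> emeasure \<nu> U * emeasure \<mu> V" if U: "open U" and V: "open V" for U V
  proof -
    have [measurable]: "U \<in> sets borel" "V \<in> sets borel" using U V by auto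
    define p where "p k = (\<integral>\<^sup>+x. indicator U x * emeasure \<nu> (U \<inter> ball x (1 / real (Suc k))) / h k \<partial>\<mu>)" for k
    define q where "q k = (\<integral>\<^sup>+x. indicator V x * emeasure \<mu> (V \<inter> ball x (1 / real (Suc k))) / g k \<partial>\<nu>)" for k
    have p: "p \<longlonglongrightarrow> emeasure \<mu> U"
      unfolding p_def by (rule uniformly_distributed_measures_limit[OF assms(1,2) s S(1) h U])
    have q: "q \<longlonglongrightarrow> emeasure \<nu> V"
      unfolding q_def by (rule uniformly_distributed_measures_limit[OF assms(2,1) s(2,1) S(2) g V])
    have bd: "(\<integral>\<^sup>+x. indicator W x * emeasure \<mu>' (W \<inter> ball x (1 / real (Suc k))) \<partial>\<nu>') \<le> G k * emeasure \<nu>' W"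
      if [measurable]: "W \<in> sets borel" and s'[measurable_cong]: "sets \<nu>' = sets borel" "sets \<mu>' = sets borel" and "AE x in \<nu>'. x \<in> S"
        and G: "\<And>x. x \<in> S \<Longrightarrow> emeasure \<mu>' (ball x (1 / real (Suc k))) = G k" for W \<mu>' \<nu>' G k
    proof -
      have "(\<integral>\<^sup>+x. indicator W x * emeasure \<mu>' (W \<inter> ball x (1 / real (Suc k))) \<partial>\<nu>') \<le> (\<integral>\<^sup>+x. G k * indicator W x \<partial>\<nu>')"
        using that(4)
      proof (intro nn_integral_mono_AE, eventually_elim)
        case (elim x)
        have "emeasure \<mu>' (W \<inter> ball x (1 / real (Suc k))) \<le> G k"
          unfolding G[OF elim(2), symmetric] by (rule emeasure_mono) auto
        then show ?case by (simp split: split_indicator)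
      qed
      also have "\<dots> = G k * emeasure \<nu>' W" by (rule nn_integral_cmult_indicator) measurable
      finally show ?thesis .
    qed
    \<comment> \<open>The quotient g k / h k of ball masses, whose behaviour is unknown, enters the
      bound for \<open>p k\<close> and its inverse the bound for \<open>q k\<close>, so it cancels
      in the product.\<close>
    have "p k * q k \<le> emeasure \<nu> U * emeasure \<mu> V" for k
    proof -
      have [measurable]: "(\<lambda>x. emeasure \<nu> (U \<inter> ball x e)) \<in> borel_measurable borel"
        "(\<lambda>x. emeasure \<mu> (V \<inter> ball x e)) \<in> borel_measurable borel" for e
      proof -
        have *: "(\<lambda>x. emeasure \<mu>' (W \<inter> ball x e)) \<in> borel_measurable borel" if f: "finite_measure \<mu>'" and [measurable_cong]: "sets \<mu>' = sets borel" and [measurable]: "W \<in> sets borel" for \<mu>' and W :: "'a set"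
        proof -
          have "(\<lambda>x. emeasure \<mu>' (Pair x -` {p \<in> space (borel \<Otimes>\<^sub>M borel). snd p \<in> W \<and> dist (fst p) (snd p) < e})) \<in> borel_measurable borel"
            using f by (intro sigma_finite_measure.measurable_emeasure_Pair) (auto simp: finite_measure_def)
          moreover have "Pair x -` {p \<in> space (borel \<Otimes>\<^sub>M borel). snd p \<in> W \<and> dist (fst p) (snd p) < e} = W \<inter> ball x e" for x
            by (auto simp: space_pair_measure)
          ultimately show ?thesis by simp
        qed
        show "(\<lambda>x. emeasure \<nu> (U \<inter> ball x e)) \<in> borel_measurable borel"
          by (rule *[OF assms(2) s(2) \<open>U \<in> sets borel\<close>])
        show "(\<lambda>x. emeasure \<mu> (V \<inter> ball x e)) \<in> borel_measurable borel"
          by (rule *[OF assms(1) s(1) \<open>V \<in> sets borel\<close>])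
      qed
      have "p k = (\<integral>\<^sup>+x. indicator U x * emeasure \<nu> (U \<inter> ball x (1 / real (Suc k))) \<partial>\<mu>) / h k"
        unfolding p_def by (rule nn_integral_divide) measurable
      also have "\<dots> \<le> g k * emeasure \<nu> U / h k"
        unfolding swap[OF \<open>U \<in> sets borel\<close>] by (intro divide_right_mono_ennreal bd) (use s S g in auto)
      finally have p': "p k \<le> g k * emeasure \<nu> U / h k" .
      have "q k = (\<integral>\<^sup>+x. indicator V x * emeasure \<mu> (V \<inter> ball x (1 / real (Suc k))) \<partial>\<nu>) / g k"
        unfolding q_def by (rule nn_integral_divide) measurable
      also have "\<dots> \<le> h k * emeasure \<mu> V / g k"
        unfolding swap[OF \<open>V \<in> sets borel\<close>, symmetric] by (intro divide_right_mono_ennreal bd) (use s S h in auto)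
      finally have q': "q k \<le> h k * emeasure \<mu> V / g k" .
      have "p k * q k \<le> (g k * emeasure \<nu> U / h k) * (h k * emeasure \<mu> V / g k)"
        using p' q' by (intro mult_mono) auto
      also have "\<dots> = (emeasure \<nu> U * emeasure \<mu> V) * ((g k / g k) * (h k / h k))"
        by (simp add: divide_ennreal_def ac_simps)
      also have "\<dots> = emeasure \<nu> U * emeasure \<mu> V"
        using fin[of k] g(2)[of k] h(2)[of k] by (simp add: ennreal_divide_self less_top)
      finally show ?thesis .
    qed
    moreover have "(\<lambda>k. p k * q k) \<longlonglongrightarrow> emeasure \<mu> U * emeasure \<nu> V"
      using \<mu>.emeasure_finite \<nu>.emeasure_finite by (intro tendsto_mult_ennreal p q) auto
    ultimately show ?thesis by (intro LIMSEQ_le_const2) auto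
  qed
  show ?thesis
  proof (rule measure_eqI_generator_eq[where E = "Collect open" and \<Omega> = UNIV and A = "\<lambda>_. UNIV"])
    show "Int_stable (Collect open)" by (auto simp: Int_stable_def)
    \<comment> \<open>The inequality is used in both orders with one of the two open sets equal to
      the whole space.\<close>
    show "emeasure (scale_measure (emeasure \<nu> UNIV) \<mu>) U = emeasure (scale_measure (emeasure \<mu> UNIV) \<nu>) U"
      if "U \<in> Collect open" for U
      using le[of U UNIV] le[of UNIV U] that by (auto simp: mult.commute intro: antisym)
    show "sets (scale_measure (emeasure \<nu> UNIV) \<mu>) = sigma_sets UNIV (Collect open)"
      "sets (scale_measure (emeasure \<mu> UNIV) \<nu>) = sigma_sets UNIV (Collect open)"
      by (simp_all add: s borel_def)
  qed (auto simp: ennreal_mult_eq_top_iff)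
qed

section \<open>The layer-cake formula\<close>

lemma exp_minus_nn_integral:
  fixes y :: real assumes "0 \<le> y"
  shows "ennreal (exp (- y)) = (\<integral>\<^sup>+t. ennreal (exp (- t)) * indicator {y<..} t \<partial>lborel)"
proof -
  have "(\<integral>\<^sup>+t. ennreal (exp (- t)) * indicator {y..} t \<partial>lborel) = ennreal (0 - (- exp (- y)))"
  proof (rule nn_integral_FTC_atLeast)
    show "((\<lambda>t :: real. - exp (- t)) \<longlongrightarrow> 0) at_top" by real_asymp
  qed (auto intro!: derivative_eq_intros)
  moreover have "(\<integral>\<^sup>+t. ennreal (exp (- t)) * indicator {y..} t \<partial>lborel) = (\<integral>\<^sup>+t. ennreal (exp (- t)) * indicator {y<..} t \<partial>lborel)"
    by (rule nn_integral_cong_AE, use AE_lborel_singleton[of y] in eventually_elim) (auto split: split_indicator)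
  ultimately show ?thesis by simp
qed

text \<open>Writing exp(-y) as the integral of exp(-t) over t > y reduces the integral to measures
  of sublevel sets of \<open>h\<close>, here V (t/k)^(a/p), and thus to a Gamma integral. The
  formula also works backwards: a known value of the integral determines \<open>V\<close>.\<close>

lemma nn_integral_exp_powr:
  fixes h :: "'a \<Rightarrow> real"
  assumes \<mu>: "sigma_finite_measure \<mu>" and h [measurable]: "h \<in> borel_measurable \<mu>" and h0: "\<And>x. x \<in> space \<mu> \<Longrightarrow> 0 \<le> h x"
    and V: "\<And>R. 0 < R \<Longrightarrow> emeasure \<mu> {x \<in> space \<mu>. h x < R} = ennreal (V * R powr a)" "0 \<le> V"
    and a: "0 < a" and p: "0 < p" and k: "0 < k"
  shows "(\<integral>\<^sup>+x. ennreal (exp (- (k * h x powr p))) \<partial>\<mu>) = ennreal (V * Gamma (a / p + 1) * k powr (- (a / p)))"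
proof -
  interpret sigma_finite_measure \<mu> by fact
  interpret P: pair_sigma_finite \<mu> lborel by standard
  have "(\<integral>\<^sup>+x. ennreal (exp (- (k * h x powr p))) \<partial>\<mu>) =
      (\<integral>\<^sup>+x. (\<integral>\<^sup>+t. ennreal (exp (- t)) * indicator {t. k * h x powr p < t} t \<partial>lborel) \<partial>\<mu>)"
    by (rule nn_integral_cong) (simp add: exp_minus_nn_integral h0 k less_imp_le greaterThan_def)
  also have "\<dots> = (\<integral>\<^sup>+t. (\<integral>\<^sup>+x. ennreal (exp (- t)) * indicator {t. k * h x powr p < t} t \<partial>\<mu>) \<partial>lborel)"
  proof (rule P.Fubini'[symmetric])
    have "(\<lambda>z. ennreal (exp (- snd z)) * indicator {z \<in> space (\<mu> \<Otimes>\<^sub>M lborel). k * h (fst z) powr p < snd z} z) \<in> borel_measurable (\<mu> \<Otimes>\<^sub>M lborel)"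
      by measurable
    then show "(\<lambda>(x, t). ennreal (exp (- t)) * indicator {t. k * h x powr p < t} t) \<in> borel_measurable (\<mu> \<Otimes>\<^sub>M lborel)"
      by (rule measurable_cong[THEN iffD1, rotated]) (auto split: split_indicator simp: space_pair_measure)
  qed
  also have "\<dots> = (\<integral>\<^sup>+t. ennreal (V * k powr (- (a / p))) * ennreal (indicator {0..} t * t powr (a / p + 1 - 1) / exp t) \<partial>lborel)"
  proof (rule nn_integral_cong_AE, use AE_lborel_singleton[of 0] in eventually_elim)
    case (elim t)
    have "(\<integral>\<^sup>+x. ennreal (exp (- t)) * indicator {t. k * h x powr p < t} t \<partial>\<mu>) = (\<integral>\<^sup>+x. ennreal (exp (- t)) * indicator {x \<in> space \<mu>. k * h x powr p < t} x \<partial>\<mu>)"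
      by (rule nn_integral_cong) (auto split: split_indicator)
    also have "\<dots> = ennreal (exp (- t)) * emeasure \<mu> {x \<in> space \<mu>. k * h x powr p < t}"
      by (rule nn_integral_cmult_indicator) measurable
    also have "\<dots> = ennreal (V * k powr (- (a / p))) * ennreal (indicator {0..} t * t powr (a / p + 1 - 1) / exp t)"
    proof (cases "0 < t")
      case True
      have "k * h x powr p < t \<longleftrightarrow> h x < (t / k) powr (1 / p)" if "x \<in> space \<mu>" for x
      proof -
        have "k * h x powr p < t \<longleftrightarrow> h x powr p < t / k" using k by (simp add: field_simps)
        also have "\<dots> \<longleftrightarrow> h x powr p < ((t / k) powr (1 / p)) powr p" using p True k by (simp add: powr_powr)
        also have "\<dots> \<longleftrightarrow> h x < (t / k) powr (1 / p)"
          using h0[OF that] p by (metis not_le powr_ge_zero powr_less_mono2 powr_mono2 less_imp_le)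
        finally show ?thesis .
      qed
      then have "{x \<in> space \<mu>. k * h x powr p < t} = {x \<in> space \<mu>. h x < (t / k) powr (1 / p)}" by auto
      then have "emeasure \<mu> {x \<in> space \<mu>. k * h x powr p < t} = ennreal (V * ((t / k) powr (1 / p)) powr a)"
        using V(1)[of "(t / k) powr (1 / p)"] True k by simp
      also have "((t / k) powr (1 / p)) powr a = t powr (a / p) * k powr (- (a / p))"
        using True k by (simp add: powr_powr powr_divide powr_minus_divide)
      finally show ?thesis
        using True V k by (simp add: exp_minus field_simps ennreal_mult[symmetric])
    next
      case False
      then have "\<not> k * h x powr p < t" for x using k by (simp add: not_less order_trans[of t 0])
      then show ?thesis using False elim by (simp split: split_indicator)
    qed
    finally show ?case .
  qed
  also have "\<dots> = ennreal (V * k powr (- (a / p))) * ennreal (Gamma (a / p + 1))"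
    using a p by (subst nn_integral_cmult) (auto simp: Gamma_conv_nn_integral_real add_pos_pos)
  also have "\<dots> = ennreal (V * Gamma (a / p + 1) * k powr (- (a / p)))"
    using V(2) a p by (subst ennreal_mult[symmetric]) (auto simp: ac_simps intro!: less_imp_le[OF Gamma_real_pos] add_pos_pos)
  finally show ?thesis .
qed

section \<open>Power weights and Gaussian moments\<close>

definition pow_measure :: "real \<Rightarrow> real measure"
  where "pow_measure r = density lborel (\<lambda>s. ennreal (\<bar>s\<bar> powr (r - 1)))"

lemma sets_pow_measure [simp, measurable_cong]: "sets (pow_measure r) = sets borel"
  and space_pow_measure [simp]: "space (pow_measure r) = UNIV"
  by (simp_all add: pow_measure_def)

lemma sigma_finite_pow_measure: "sigma_finite_measure (pow_measure r)"
  unfolding pow_measure_def by (subst sigma_finite_measure.sigma_finite_iff_density_finite[OF sigma_finite_lborel]) auto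

lemma nn_integral_pow_measure:
  "f \<in> borel_measurable borel \<Longrightarrow> (\<integral>\<^sup>+s. f s \<partial>pow_measure r) = (\<integral>\<^sup>+s. ennreal (\<bar>s\<bar> powr (r - 1)) * f s \<partial>lborel)"
  unfolding pow_measure_def by (rule nn_integral_density) auto

lemma nn_integral_powr_from_0:
  assumes "0 < r" "0 \<le> R"
  shows "(\<integral>\<^sup>+s. ennreal (\<bar>s\<bar> powr (r - 1)) * indicator {0<..<R} s \<partial>lborel) = ennreal (R powr r / r)"
proof -
  have "((\<lambda>x. x powr (r - 1)) has_integral (R powr (r - 1 + 1) / (r - 1 + 1))) {0..R}"
    using assms by (intro has_integral_powr_from_0) auto
  then have hi: "((\<lambda>x. x powr (r - 1)) has_integral (R powr r / r)) {0..R}" by simp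
  have "(\<integral>\<^sup>+x. indicator {0..R} x *\<^sub>R (x powr (r - 1)) \<partial>lborel) = ennreal (R powr r / r)"
  proof (intro nn_integral_has_integral_lborel)
    have "((\<lambda>x. if x \<in> {0..R} then x powr (r - 1) else 0) has_integral R powr r / r) UNIV"
      using hi by (simp only: has_integral_restrict_UNIV)
    then show "((\<lambda>x. indicator {0..R} x *\<^sub>R (x powr (r - 1))) has_integral R powr r / r) UNIV"
      by (rule has_integral_eq[rotated]) (auto split: split_indicator)
  qed auto
  moreover have "(\<integral>\<^sup>+x. indicator {0..R} x *\<^sub>R (x powr (r - 1)) \<partial>lborel) = (\<integral>\<^sup>+s. ennreal (\<bar>s\<bar> powr (r - 1)) * indicator {0<..<R} s \<partial>lborel)"
    by (rule nn_integral_cong_AE, use AE_lborel_singleton[of 0] AE_lborel_singleton[of R] in eventually_elim)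
       (auto split: split_indicator)
  ultimately show ?thesis by simp
qed

lemma pow_measure_ray:
  assumes "0 < r" "0 \<le> R"
  shows "emeasure (pow_measure r) {0<..<R} = ennreal (R powr r / r)"
    and "emeasure (pow_measure r) {-R<..<0} = ennreal (R powr r / r)"
proof -
  show 1: "emeasure (pow_measure r) {0<..<R} = ennreal (R powr r / r)"
    unfolding pow_measure_def by (subst emeasure_density) (auto simp: nn_integral_powr_from_0 assms)
  have "(\<integral>\<^sup>+s. ennreal (\<bar>s\<bar> powr (r - 1)) * indicator {0<..<R} s \<partial>distr lborel borel uminus) = (\<integral>\<^sup>+s. ennreal (\<bar>- s\<bar> powr (r - 1)) * indicator {0<..<R} (- s) \<partial>lborel)"
    by (subst nn_integral_distr) auto
  also have "\<dots> = (\<integral>\<^sup>+s. ennreal (\<bar>s\<bar> powr (r - 1)) * indicator {-R<..<0} s \<partial>lborel)"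
    by (rule nn_integral_cong) (auto split: split_indicator)
  finally show "emeasure (pow_measure r) {-R<..<0} = ennreal (R powr r / r)"
    unfolding pow_measure_def by (subst emeasure_density) (auto simp: nn_integral_powr_from_0 assms lborel_distr_uminus)
qed

lemma emeasure_pow_measure_singleton [simp]: "emeasure (pow_measure r) {s} = 0"
  unfolding pow_measure_def by (subst emeasure_density) (auto intro!: nn_integral_0_iff_AE[THEN iffD2] AE_lborel_singleton[THEN eventually_mono] simp: indicator_def)

lemma pow_measure_abs_less:
  assumes "0 < r" "0 < R"
  shows "emeasure (pow_measure r) {s. \<bar>s\<bar> < R} = ennreal (2 / r * R powr r)"
proof -
  have "{s :: real. \<bar>s\<bar> < R} = ({-R<..<0} \<union> {0<..<R}) \<union> {0}" using assms by auto
  moreover have "{0} \<in> null_sets (pow_measure r)" by (auto intro: null_setsI)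
  ultimately have "emeasure (pow_measure r) {s. \<bar>s\<bar> < R} = emeasure (pow_measure r) ({-R<..<0} \<union> {0<..<R})"
    by (simp only:) (rule emeasure_Un_null_set, auto)
  also have "\<dots> = emeasure (pow_measure r) {-R<..<0} + emeasure (pow_measure r) {0<..<R}"
    by (rule plus_emeasure[symmetric]) auto
  finally show ?thesis using assms by (simp add: pow_measure_ray ennreal_plus[symmetric] del: ennreal_plus)
qed

text \<open>The integral of exp(-s^2/2) against \<open>pow_measure r\<close>, in the form that the
  layer-cake formula yields: 2/r is the mass of the interval (-1, 1).\<close>

definition gauss_mass :: "real \<Rightarrow> real"
  where "gauss_mass r = 2 / r * Gamma (r / 2 + 1) * 2 powr (r / 2)"

lemma nn_integral_pow_measure_gauss:
  assumes "0 < r"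
  shows "(\<integral>\<^sup>+s. ennreal (exp (- s\<^sup>2 / 2)) \<partial>pow_measure r) = ennreal (gauss_mass r)"
proof -
  have "(\<integral>\<^sup>+s. ennreal (exp (- (1 / 2 * \<bar>s\<bar> powr 2))) \<partial>pow_measure r) = ennreal (2 / r * Gamma (r / 2 + 1) * (1 / 2) powr (- (r / 2)))"
    by (rule nn_integral_exp_powr) (use assms in \<open>auto simp: sigma_finite_pow_measure pow_measure_abs_less\<close>)
  moreover have "\<bar>s\<bar> powr 2 = s\<^sup>2" for s :: real by (cases "s = 0") (auto simp: powr_numeral)
  ultimately show ?thesis by (simp add: gauss_mass_def powr_minus powr_divide)
qed

text \<open>The absolute moment of order \<open>p\<close> of a standard normal variable. The shift
  to p + 1 comes from the exponent r - 1 in \<open>pow_measure\<close>.\<close>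

definition abs_moment :: "real \<Rightarrow> real"
  where "abs_moment p = gauss_mass (p + 1) / sqrt (2 * pi)"

lemma gauss_mass_pos: "0 < r \<Longrightarrow> 0 < gauss_mass r"
  by (simp add: gauss_mass_def Gamma_real_pos)

lemma abs_moment_pos: "0 \<le> p \<Longrightarrow> 0 < abs_moment p"
  by (simp add: abs_moment_def gauss_mass_pos)

lemma nn_integral_std_normal_abs_powr:
  assumes "0 \<le> p"
  shows "(\<integral>\<^sup>+x. ennreal (\<bar>x\<bar> powr p) \<partial>std_normal) = ennreal (abs_moment p)"
proof -
  have "(\<integral>\<^sup>+x. ennreal (\<bar>x\<bar> powr p) \<partial>std_normal) = (\<integral>\<^sup>+x. ennreal (std_normal_density x) * ennreal (\<bar>x\<bar> powr p) \<partial>lborel)"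
    unfolding std_normal_def by (rule nn_integral_density) auto
  also have "\<dots> = (\<integral>\<^sup>+x. ennreal (1 / sqrt (2 * pi)) * (ennreal (\<bar>x\<bar> powr (p + 1 - 1)) * ennreal (exp (- x\<^sup>2 / 2))) \<partial>lborel)"
    by (rule nn_integral_cong) (simp add: std_normal_density_def ennreal_mult[symmetric] ac_simps)
  also have "\<dots> = ennreal (1 / sqrt (2 * pi)) * (\<integral>\<^sup>+s. ennreal (exp (- s\<^sup>2 / 2)) \<partial>pow_measure (p + 1))"
    by (subst nn_integral_cmult) (auto simp: nn_integral_pow_measure)
  also have "\<dots> = ennreal (1 / sqrt (2 * pi)) * ennreal (gauss_mass (p + 1))"
    using assms by (subst nn_integral_pow_measure_gauss) auto
  also have "\<dots> = ennreal (abs_moment p)"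
    using gauss_mass_pos[of "p + 1"] assms by (simp add: abs_moment_def ennreal_mult[symmetric])
  finally show ?thesis .
qed

section \<open>Hausdorff measure on the sphere\<close>

text \<open>Surface measure, given as a density so that it lives on all Borel sets of the ambient
  space and can be compared with \<open>cone_measure\<close>.\<close>

definition sphere_measure :: "nat \<Rightarrow> seq measure"
  where "sphere_measure n = density (hausdorff_measure (real n - 1)) (indicator (unit_sphere n))"

text \<open>The directional law of a Gaussian vector weighted by the r-th power of its norm. This
  power is the Jacobian factor of the later substitution t = s/|g| in |t|^(r-1) dt.\<close>

definition cone_measure :: "nat \<Rightarrow> real \<Rightarrow> seq measure"
  where "cone_measure n r = distr (density (gauss n) (\<lambda>g. ennreal (norm g powr r))) borel sgn"

lemma sets_sphere_measure [simp, measurable_cong]: "sets (sphere_measure n) = sets borel"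
  by (simp add: sphere_measure_def)

lemma sets_cone_measure [simp, measurable_cong]: "sets (cone_measure n r) = sets borel"
  by (simp add: cone_measure_def)

lemma measurable_sgn_seq [measurable]: "(sgn :: seq \<Rightarrow> seq) \<in> borel_measurable borel"
proof -
  have "(\<lambda>x :: seq. inverse (norm x) *\<^sub>R x) \<in> borel_measurable borel" by measurable
  then show ?thesis by (simp add: sgn_div_norm[abs_def])
qed

lemma emeasure_sphere_measure:
  "A \<in> sets borel \<Longrightarrow> emeasure (sphere_measure n) A = hausdorff_outer (real n - 1) (unit_sphere n \<inter> A)"
  unfolding sphere_measure_def by (subst emeasure_restricted) (auto simp: emeasure_hausdorff_measure)

lemma nn_integral_cone_measure:
  assumes [measurable]: "f \<in> borel_measurable borel"
  shows "(\<integral>\<^sup>+u. f u \<partial>cone_measure n r) = (\<integral>\<^sup>+g. ennreal (norm g powr r) * f (sgn g) \<partial>gauss n)"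
  unfolding cone_measure_def by (subst nn_integral_distr) (auto simp: nn_integral_density)

lemma sgn_reflect: "norm a = 1 \<Longrightarrow> sgn (reflect a x) = reflect a (sgn x)"
  by (simp add: sgn_div_norm norm_reflect) (simp add: reflect_def scaleR_right_diff_distrib)

lemma distr_sphere_measure_reflect:
  assumes a: "a \<in> Rn n" "norm a = 1"
  shows "distr (sphere_measure n) borel (reflect a) = sphere_measure n"
proof (rule measure_eqI)
  fix A assume "A \<in> sets (distr (sphere_measure n) borel (reflect a))"
  then have [measurable]: "A \<in> sets borel" by simp
  have "unit_sphere n \<inter> reflect a -` A = reflect a ` (unit_sphere n \<inter> A)"
  proof (intro equalityI subsetI)
    fix x assume x: "x \<in> unit_sphere n \<inter> reflect a -` A"
    then have "x = reflect a (reflect a x)" "reflect a x \<in> unit_sphere n \<inter> A"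
      using a reflect_unit_sphere[of a n x] by (auto simp: reflect_reflect)
    then show "x \<in> reflect a ` (unit_sphere n \<inter> A)" by blast
  next
    fix x assume "x \<in> reflect a ` (unit_sphere n \<inter> A)"
    then show "x \<in> unit_sphere n \<inter> reflect a -` A"
      using a reflect_unit_sphere[of a n] by (auto simp: reflect_reflect)
  qed
  then have "hausdorff_outer (real n - 1) (unit_sphere n \<inter> reflect a -` A) = hausdorff_outer (real n - 1) (unit_sphere n \<inter> A)"
    using a by (simp add: hausdorff_outer_involution dist_reflect reflect_reflect)
  moreover have "reflect a -` A \<in> sets borel"
    using measurable_sets_borel[OF measurable_reflect, of A a] by simp
  ultimately show "emeasure (distr (sphere_measure n) borel (reflect a)) A = emeasure (sphere_measure n) A"
    by (subst emeasure_distr) (auto simp: emeasure_sphere_measure sphere_measure_def[THEN arg_cong, of space] cong: measurable_cong_sets)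
qed simp

lemma distr_cone_measure_reflect:
  assumes a: "a \<in> Rn n" "norm a = 1"
  shows "distr (cone_measure n r) borel (reflect a) = cone_measure n r"
proof (rule measure_eqI)
  fix A assume "A \<in> sets (distr (cone_measure n r) borel (reflect a))"
  then have [measurable]: "A \<in> sets borel" by simp
  have "emeasure (distr (cone_measure n r) borel (reflect a)) A = (\<integral>\<^sup>+u. indicator A u \<partial>distr (cone_measure n r) borel (reflect a))"
    by simp
  also have "\<dots> = (\<integral>\<^sup>+u. indicator A (reflect a u) \<partial>cone_measure n r)"
    by (rule nn_integral_distr) measurable
  also have "\<dots> = (\<integral>\<^sup>+g. ennreal (norm (reflect a g) powr r) * indicator A (sgn (reflect a g)) \<partial>gauss n)"
    using a by (subst nn_integral_cone_measure) (auto simp: norm_reflect sgn_reflect)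
  also have "\<dots> = (\<integral>\<^sup>+g. ennreal (norm g powr r) * indicator A (sgn g) \<partial>gauss n)"
    by (rule nn_integral_gauss_reflect[OF a, of "\<lambda>g. ennreal (norm g powr r) * indicator A (sgn g)"]) measurable
  also have "\<dots> = emeasure (cone_measure n r) A"
    by (subst nn_integral_cone_measure[symmetric]) auto
  finally show "emeasure (distr (cone_measure n r) borel (reflect a)) A = emeasure (cone_measure n r) A" .
qed simp

text \<open>The reflection that exchanges the two centres carries one ball onto the other.\<close>

lemma isotropic_ball:
  assumes [measurable_cong]: "sets \<mu> = sets borel"
    and inv: "\<And>a. a \<in> Rn n \<Longrightarrow> norm a = 1 \<Longrightarrow> distr \<mu> borel (reflect a) = \<mu>"
    and x: "x \<in> unit_sphere n" and y: "y \<in> unit_sphere n"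
  shows "emeasure \<mu> (ball x e) = emeasure \<mu> (ball y e)"
proof (cases "x = y")
  case False
  then obtain a where a: "a \<in> Rn n" "norm a = 1" "reflect a x = y" "reflect a y = x"
    using x y by (elim reflect_exists[rotated]) (auto simp: unit_sphere_iff)
  have "reflect a -` ball x e = ball y e"
  proof -
    have "dist x (reflect a z) = dist y z" for z
      using dist_reflect[OF a(2), of y z] a by simp
    then show ?thesis by auto
  qed
  moreover have "space \<mu> = UNIV" using sets_eq_imp_space_eq[OF assms(1)] by simp
  moreover have "emeasure (distr \<mu> borel (reflect a)) (ball x e) = emeasure \<mu> (reflect a -` ball x e \<inter> space \<mu>)"
    by (rule emeasure_distr) (auto cong: measurable_cong_sets simp: assms(1))
  ultimately show ?thesis using inv[OF a(1,2)] by simp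
qed simp

text \<open>If one ball were null, all balls of this radius centred on the sphere would be, and
  countably many of them, with centres in a dense subset, cover the sphere.\<close>

lemma isotropic_ball_nonzero:
  assumes s [measurable_cong]: "sets \<mu> = sets borel"
    and inv: "\<And>a. a \<in> Rn n \<Longrightarrow> norm a = 1 \<Longrightarrow> distr \<mu> borel (reflect a) = \<mu>"
    and x: "x \<in> unit_sphere n" and e: "0 < e" and S: "AE u in \<mu>. u \<in> unit_sphere n" and ne: "emeasure \<mu> UNIV \<noteq> 0"
  shows "emeasure \<mu> (ball x e) \<noteq> 0"
proof
  assume 0: "emeasure \<mu> (ball x e) = 0"
  obtain D where D: "countable D" "D \<subseteq> unit_sphere n" "unit_sphere n \<subseteq> closure D"
    using separable by blast
  have sp: "space \<mu> = UNIV" using sets_eq_imp_space_eq[OF s] by simp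
  have "ball d e \<in> null_sets \<mu>" if "d \<in> D" for d
    using isotropic_ball[OF s inv x, of d e] D(2) that 0 by (auto intro!: null_setsI simp: s)
  then have null: "(\<Union>d\<in>D. ball d e) \<in> null_sets \<mu>" using D(1) by (intro null_sets_UN') auto
  have cov: "unit_sphere n \<subseteq> (\<Union>d\<in>D. ball d e)"
  proof
    fix u assume "u \<in> unit_sphere n"
    then have "u \<in> closure D" using D by auto
    then obtain d where "d \<in> D" "dist d u < e" using e closure_approachable by blast
    then show "u \<in> (\<Union>d\<in>D. ball d e)" by auto
  qed
  have "AE u in \<mu>. \<not> True"
    using S AE_not_in[OF null]
  proof eventually_elim
    case (elim u) then show ?case using cov by blast
  qed
  then have "emeasure \<mu> {u \<in> space \<mu>. True} = 0" by (rule emeasure_eq_0_AE)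
  then show False using ne sp by simp
qed

text \<open>The norm lies between the modulus of a single coordinate and n times the largest one, so
  the moments of one normal variable bound the integral from both sides.\<close>

lemma nn_integral_gauss_norm_powr:
  assumes r: "0 \<le> r" and n: "0 < n"
  shows "(\<integral>\<^sup>+g. ennreal (norm g powr r) \<partial>gauss n) < \<infinity>" "(\<integral>\<^sup>+g. ennreal (norm g powr r) \<partial>gauss n) \<noteq> 0"
proof -
  have comp: "(\<integral>\<^sup>+g. ennreal (\<bar>coord g i\<bar> powr r) \<partial>gauss n) = ennreal (abs_moment r)" if "i < n" for i
    using nn_integral_distr[of "\<lambda>g. coord g i" "gauss n" borel "\<lambda>x. ennreal (\<bar>x\<bar> powr r)"]
    by (simp add: gauss_component[OF that] nn_integral_std_normal_abs_powr[OF r])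
  have "(\<integral>\<^sup>+g. ennreal (norm g powr r) \<partial>gauss n) \<le> (\<integral>\<^sup>+g. (\<Sum>i<n. ennreal (real n powr r) * ennreal (\<bar>coord g i\<bar> powr r)) \<partial>gauss n)"
  proof (intro nn_integral_mono_AE, use AE_gauss_Rn[of n] in eventually_elim)
    case (elim g)
    obtain i where i: "i < n" "\<And>j. j < n \<Longrightarrow> \<bar>coord g j\<bar> \<le> \<bar>coord g i\<bar>"
    proof -
      let ?F = "(\<lambda>j. \<bar>coord g j\<bar>) ` {..<n}"
      have F: "finite ?F" "?F \<noteq> {}" using n by auto
      obtain i where "i < n" "Max ?F = \<bar>coord g i\<bar>" using Max_in[OF F] by auto
      then show ?thesis using that[of i] Max_ge[OF F(1)] by auto
    qed
    have "norm g \<le> (\<Sum>j<n. \<bar>coord g j\<bar>)" by (rule norm_Rn_le[OF elim])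
    also have "\<dots> \<le> (\<Sum>j<n. \<bar>coord g i\<bar>)" by (rule sum_mono) (use i in auto)
    finally have "norm g powr r \<le> (real n * \<bar>coord g i\<bar>) powr r"
      using r by (intro powr_mono2) auto
    then have "ennreal (norm g powr r) \<le> ennreal (real n powr r) * ennreal (\<bar>coord g i\<bar> powr r)"
      by (simp add: powr_mult ennreal_mult[symmetric] ennreal_leI)
    also have "\<dots> \<le> (\<Sum>i<n. ennreal (real n powr r) * ennreal (\<bar>coord g i\<bar> powr r))"
      using i(1) by (intro member_le_sum) auto
    finally show ?case .
  qed
  also have "\<dots> = (\<Sum>i<n. ennreal (real n powr r) * ennreal (abs_moment r))"
    by (subst nn_integral_sum) (auto simp: nn_integral_cmult comp)
  also have "\<dots> < \<infinity>" by (simp add: ennreal_mult_less_top ennreal_mult[symmetric] of_nat_less_top flip: ennreal_of_nat_eq_real_of_nat)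
  finally show "(\<integral>\<^sup>+g. ennreal (norm g powr r) \<partial>gauss n) < \<infinity>" .
  have "ennreal (abs_moment r) \<le> (\<integral>\<^sup>+g. ennreal (norm g powr r) \<partial>gauss n)"
    unfolding comp[OF n, symmetric]
    by (intro nn_integral_mono ennreal_leI powr_mono2) (auto simp: abs_lookup_le_norm r)
  then show "(\<integral>\<^sup>+g. ennreal (norm g powr r) \<partial>gauss n) \<noteq> 0"
    using abs_moment_pos[OF r] by (metis ennreal_eq_0_iff le_zero_eq not_le)
qed

lemma sgn_unit_sphere: "g \<in> Rn n \<Longrightarrow> g \<noteq> 0 \<Longrightarrow> sgn g \<in> unit_sphere n"
  by (simp add: unit_sphere_iff sgn_div_norm Rn_scale)

text \<open>Surface measure and \<open>cone_measure\<close> are invariant under reflections, hence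
  give equal positive mass to balls of equal radius centred on the sphere, and Christensen's
  argument makes them proportional. The factor is the quotient of the total masses; only its
  positivity is recorded.\<close>

theorem nn_integral_sphere:
  assumes n: "2 \<le> n" and r: "0 < r"
  obtains c where "0 < c" "\<And>f. f \<in> borel_measurable borel \<Longrightarrow>
    (\<integral>\<^sup>+u. f u * indicator (unit_sphere n) u \<partial>hausdorff_measure (real n - 1)) =
      ennreal c * (\<integral>\<^sup>+g. ennreal (norm g powr r) * f (sgn g) \<partial>gauss n)"
proof -
  let ?\<mu> = "sphere_measure n" and ?\<nu> = "cone_measure n r"
  have sp: "space ?\<mu> = UNIV" "space ?\<nu> = UNIV" by (simp_all add: sphere_measure_def cone_measure_def)
  have U\<mu>: "emeasure ?\<mu> UNIV = hausdorff_outer (real n - 1) (unit_sphere n)"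
    by (simp add: emeasure_sphere_measure)
  have U\<nu>: "emeasure ?\<nu> UNIV = (\<integral>\<^sup>+g. ennreal (norm g powr r) \<partial>gauss n)"
    using nn_integral_cone_measure[of "\<lambda>_. 1" n r] sp by simp
  have fin: "finite_measure ?\<mu>" "finite_measure ?\<nu>"
    using hausdorff_sphere_finite[OF n] nn_integral_gauss_norm_powr(1)[of r n] n r
    by (auto intro!: finite_measureI simp: sp U\<mu> U\<nu>)
  have AE: "AE u in ?\<mu>. u \<in> unit_sphere n" "AE u in ?\<nu>. u \<in> unit_sphere n"
  proof -
    show "AE u in ?\<mu>. u \<in> unit_sphere n"
      unfolding sphere_measure_def by (subst AE_density) (auto split: split_indicator)
    show "AE u in ?\<nu>. u \<in> unit_sphere n"
      unfolding cone_measure_def using AE_gauss_Rn[of n]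
      by (subst AE_distr_iff) (auto simp: AE_density sgn_unit_sphere elim!: eventually_mono)
  qed
  have ne: "emeasure ?\<mu> UNIV \<noteq> 0" "emeasure ?\<nu> UNIV \<noteq> 0"
    unfolding U\<mu> U\<nu> using hausdorff_sphere_pos[OF n] nn_integral_gauss_norm_powr(2)[of r n] n r by auto
  \<comment> \<open>A reference centre at which the common ball masses are read off.\<close>
  have e: "\<e> 1 \<in> unit_sphere n" using n by (simp add: unit_sphere_iff)
  have nz: "emeasure ?\<mu> (ball (\<e> 1) d) \<noteq> 0" "emeasure ?\<nu> (ball (\<e> 1) d) \<noteq> 0" if "0 < d" for d
    by (rule isotropic_ball_nonzero[OF sets_sphere_measure distr_sphere_measure_reflect e that AE(1) ne(1)]
        isotropic_ball_nonzero[OF sets_cone_measure distr_cone_measure_reflect e that AE(2) ne(2)]; assumption)+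
  have eq: "scale_measure (emeasure ?\<nu> UNIV) ?\<mu> = scale_measure (emeasure ?\<mu> UNIV) ?\<nu>"
  proof (rule uniformly_distributed_measures_proportional[where S = "unit_sphere n"
        and g = "\<lambda>k. emeasure ?\<mu> (ball (\<e> 1) (1 / real (Suc k)))" and h = "\<lambda>k. emeasure ?\<nu> (ball (\<e> 1) (1 / real (Suc k)))"])
    show "unit_sphere n \<noteq> {}" using e by auto
    show "emeasure ?\<mu> (ball (\<e> 1) (1 / real (Suc k))) \<noteq> 0" "emeasure ?\<nu> (ball (\<e> 1) (1 / real (Suc k))) \<noteq> 0" for k
      by (rule nz, simp)+
  qed (use fin AE e in \<open>auto intro!: isotropic_ball[where n = n] distr_sphere_measure_reflect distr_cone_measure_reflect\<close>)
  obtain a b where ab: "emeasure ?\<nu> UNIV = ennreal a" "emeasure ?\<mu> UNIV = ennreal b" "0 < a" "0 < b"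
  proof -
    have "emeasure ?\<nu> UNIV \<noteq> \<infinity>" "emeasure ?\<mu> UNIV \<noteq> \<infinity>" using finite_measure.emeasure_finite[OF fin(1)] finite_measure.emeasure_finite[OF fin(2)] by simp_all
    then show ?thesis using that[of "enn2real (emeasure ?\<nu> UNIV)" "enn2real (emeasure ?\<mu> UNIV)"] ne
      by (simp add: enn2real_positive_iff less_top zero_less_iff_neq_zero)
  qed
  show ?thesis
  proof (rule that[of "b / a"])
    show "0 < b / a" using ab by simp
    fix f :: "seq \<Rightarrow> ennreal" assume f [measurable]: "f \<in> borel_measurable borel"
    have "(\<integral>\<^sup>+u. f u * indicator (unit_sphere n) u \<partial>hausdorff_measure (real n - 1)) = (\<integral>\<^sup>+u. f u \<partial>?\<mu>)"
      unfolding sphere_measure_def by (subst nn_integral_density) (auto simp: mult.commute)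
    also have "\<dots> = ennreal (1 / a) * (ennreal a * (\<integral>\<^sup>+u. f u \<partial>?\<mu>))"
      using ab by (simp add: mult.assoc[symmetric] ennreal_mult[symmetric])
    also have "ennreal a * (\<integral>\<^sup>+u. f u \<partial>?\<mu>) = ennreal b * (\<integral>\<^sup>+u. f u \<partial>?\<nu>)"
      using arg_cong[OF eq, of "\<lambda>M. integral\<^sup>N M f"] ab by (simp add: nn_integral_scale_measure)
    also have "ennreal (1 / a) * (ennreal b * (\<integral>\<^sup>+u. f u \<partial>?\<nu>)) = ennreal (b / a) * (\<integral>\<^sup>+u. f u \<partial>?\<nu>)"
      using ab by (simp add: mult.assoc[symmetric] ennreal_mult[symmetric])
    finally show "(\<integral>\<^sup>+u. f u * indicator (unit_sphere n) u \<partial>hausdorff_measure (real n - 1)) =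
      ennreal (b / a) * (\<integral>\<^sup>+g. ennreal (norm g powr r) * f (sgn g) \<partial>gauss n)"
      by (simp add: nn_integral_cone_measure)
  qed
qed

section \<open>The dual point process\<close>

lemma ecard_eq_0 [simp]: "ecard A = 0 \<longleftrightarrow> A = {}"
  by (simp add: ecard_def emeasure_count_space_eq_0)

lemma ecard_finite: "finite A \<Longrightarrow> ecard A = of_nat (card A)"
  by (simp add: ecard_def)

lemma ecard_infinite: "infinite A \<Longrightarrow> ecard A = \<infinity>"
  by (simp add: ecard_def)

lemma ecard_less_top: "ecard A < \<infinity> \<longleftrightarrow> finite A"
  by (cases "finite A") (auto simp: ecard_finite ecard_infinite of_nat_less_top)

lemma ecard_mono: "A \<subseteq> B \<Longrightarrow> ecard A \<le> ecard B"
  unfolding ecard_def by (rule emeasure_mono) auto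

lemma ecard_image: "inj_on f A \<Longrightarrow> ecard (f ` A) = ecard A"
  by (cases "finite A") (auto simp: ecard_finite ecard_infinite card_image finite_image_iff)

definition dual_hyperplane :: "nat \<Rightarrow> seq \<Rightarrow> seq set"
  where "dual_hyperplane n y = {x \<in> Rn n. inner x y = 1}"

lemma dual_hyperplane_eq:
  assumes "t \<noteq> 0"
  shows "hyperplane n u t = dual_hyperplane n (u /\<^sub>R t)"
  using assms by (auto simp: hyperplane_def dual_hyperplane_def field_simps)

lemma dual_hyperplane_sgn:
  assumes "y \<noteq> 0"
  shows "dual_hyperplane n y = hyperplane n (sgn y) (1 / norm y)"
  using assms by (subst dual_hyperplane_eq) (auto simp: sgn_div_norm)

text \<open>The foot y/|y|^2 of the perpendicular from the origin gives <z, y> = <y, y>. Its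
  translate by z - y then lies in the same hyperplane, which gives <z - y, z> = 0. Hence z - y is
  orthogonal to itself.\<close>

lemma dual_hyperplane_inj:
  assumes y: "y \<in> Rn n" "y \<noteq> 0" and z: "z \<in> Rn n" "z \<noteq> 0" and eq: "dual_hyperplane n y = dual_hyperplane n z"
  shows "y = z"
proof -
  have yy: "inner y y \<noteq> 0" using y by simp
  define x where "x = y /\<^sub>R inner y y"
  have x: "x \<in> Rn n" "inner x y = 1" using y yy by (auto simp: x_def Rn_scale)
  then have "x \<in> dual_hyperplane n y" by (simp add: dual_hyperplane_def)
  then have "x \<in> dual_hyperplane n z" by (simp only: eq)
  then have xz: "inner x z = 1" by (simp add: dual_hyperplane_def)
  define w where "w = z - inner z x *\<^sub>R y"
  have iy: "inner z y = inner y y" using xz yy by (simp add: x_def inner_commute field_simps)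
  have "inner (x + (z - y)) y = 1" using x by (simp add: inner_add_left inner_diff_left iy)
  then have "x + (z - y) \<in> dual_hyperplane n y"
    using x y z by (simp add: dual_hyperplane_def Rn_add Rn_diff)
  then have "x + (z - y) \<in> dual_hyperplane n z" by (simp only: eq)
  then have "inner (x + (z - y)) z = 1" by (simp add: dual_hyperplane_def)
  then have "inner (z - y) z = 0" using xz by (simp add: inner_add_left)
  moreover have "inner (z - y) y = 0" by (simp add: inner_diff_left iy)
  ultimately have "inner (z - y) (z - y) = 0" by (simp add: inner_diff_right)
  then show ?thesis by simp
qed

definition dual_points :: "nat \<Rightarrow> seq set"
  where "dual_points n = Rn n - {0}"

lemma dual_points_borel [measurable]: "dual_points n \<in> sets borel"
  by (simp add: dual_points_def)

lemma inj_on_dual_hyperplane: "inj_on (dual_hyperplane n) (dual_points n)"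
  by (auto intro!: inj_onI dual_hyperplane_inj simp: dual_points_def)

lemma hyperplane_dual_iff:
  assumes u: "u \<in> unit_sphere n" and A: "A \<subseteq> dual_points n"
  shows "hyperplane n u t \<in> dual_hyperplane n ` A \<longleftrightarrow> t \<noteq> 0 \<and> u /\<^sub>R t \<in> A"
proof
  assume *: "hyperplane n u t \<in> dual_hyperplane n ` A"
  then obtain y where y: "y \<in> A" "hyperplane n u t = dual_hyperplane n y" by auto
  have t: "t \<noteq> 0"
  proof
    assume "t = 0"
    then have "0 \<in> hyperplane n u t" by (simp add: hyperplane_def)
    then show False unfolding y(2) by (simp add: dual_hyperplane_def)
  qed
  have "u \<noteq> 0" using u by (auto simp: unit_sphere_iff)
  then have "u /\<^sub>R t \<in> dual_points n" using u t by (auto simp: dual_points_def unit_sphere_iff Rn_scale)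
  then have "u /\<^sub>R t = y"
    using y A inj_on_dual_hyperplane[of n] unfolding dual_hyperplane_eq[OF t] by (auto dest: inj_onD)
  then show "t \<noteq> 0 \<and> u /\<^sub>R t \<in> A" using t y by simp
next
  assume "t \<noteq> 0 \<and> u /\<^sub>R t \<in> A"
  then show "hyperplane n u t \<in> dual_hyperplane n ` A" by (auto simp: dual_hyperplane_eq)
qed

section \<open>Borel sets of hyperplanes and the intensity measure\<close>

lemma sets_hyperplane_borel: "sets (hyperplane_borel n) = sigma_sets (hyperplanes n)
    {U. U \<subseteq> hyperplanes n \<and> openin (top_of_set (unit_sphere n \<times> UNIV)) {(u, t). u \<in> unit_sphere n \<and> hyperplane n u t \<in> U}}"
  unfolding hyperplane_borel_def by (rule sets_measure_of) auto

lemma space_hyperplane_borel: "space (hyperplane_borel n) = hyperplanes n"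
  unfolding hyperplane_borel_def by (rule space_measure_of) auto

lemma hyperplane_in: "u \<in> unit_sphere n \<Longrightarrow> hyperplane n u t \<in> hyperplanes n"
  by (auto simp: hyperplanes_def)

text \<open>The generators are the sets with relatively open parameter sets, and passing to
  parameters commutes with complements and countable unions. The measurability of the integrand of
  the intensity rests on this.\<close>

lemma hyperplane_param_borel:
  assumes "B \<in> sets (hyperplane_borel n)"
  shows "{(u, t). u \<in> unit_sphere n \<and> hyperplane n u t \<in> B} \<in> sets (borel :: (seq \<times> real) measure)"
proof -
  have SU: "unit_sphere n \<times> (UNIV :: real set) \<in> sets borel"
    using closed_Times[OF closed_unit_sphere closed_UNIV] by (rule borel_closed)
  show ?thesis
    using assms unfolding sets_hyperplane_borel
  proof (induction rule: sigma_sets.induct)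
    case (Basic B)
    then obtain T where T: "open T" "{(u, t). u \<in> unit_sphere n \<and> hyperplane n u t \<in> B} = (unit_sphere n \<times> UNIV) \<inter> T"
      by (auto simp: openin_open)
    then show ?case using SU by auto
  next
    case Empty then show ?case by simp
  next
    case (Compl B)
    have "{(u, t). u \<in> unit_sphere n \<and> hyperplane n u t \<in> hyperplanes n - B} =
        unit_sphere n \<times> UNIV - {(u, t). u \<in> unit_sphere n \<and> hyperplane n u t \<in> B}"
      by (auto simp: hyperplane_in)
    then show ?case using Compl SU by auto
  next
    case (Union B)
    have "{(u, t). u \<in> unit_sphere n \<and> hyperplane n u t \<in> \<Union> (range B)} =
        (\<Union>i. {(u, t). u \<in> unit_sphere n \<and> hyperplane n u t \<in> B i})" by auto
    then show ?case using Union by auto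
  qed
qed

text \<open>For an open set the parameters of the image form a relatively open set, because u/t is
  continuous in (u, t) where t does not vanish. Complements and countable unions pass through the
  image since the map is injective on \<open>dual_points n\<close>.\<close>

lemma dual_hyperplane_image_sets:
  assumes "B \<in> sets borel"
  shows "dual_hyperplane n ` (B \<inter> dual_points n) \<in> sets (hyperplane_borel n)"
proof -
  have sub: "dual_hyperplane n ` (B \<inter> dual_points n) \<subseteq> hyperplanes n" for B
  proof
    fix H assume "H \<in> dual_hyperplane n ` (B \<inter> dual_points n)"
    then obtain y where y: "H = dual_hyperplane n y" "y \<in> Rn n" "y \<noteq> 0" by (auto simp: dual_points_def)
    then show "H \<in> hyperplanes n"
      by (auto simp: dual_hyperplane_sgn intro!: hyperplane_in sgn_unit_sphere)
  qed
  have op: "dual_hyperplane n ` (U \<inter> dual_points n) \<in> sets (hyperplane_borel n)" if U: "open U" for U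
  proof -
    have c: "continuous_on {p :: seq \<times> real. snd p \<noteq> 0} (\<lambda>p. inverse (snd p) *\<^sub>R fst p)"
      by (intro continuous_intros) auto
    have "open {p :: seq \<times> real. snd p \<noteq> 0}" by (intro open_Collect_neq continuous_intros)
    then have "open ((\<lambda>p :: seq \<times> real. inverse (snd p) *\<^sub>R fst p) -` U \<inter> {p. snd p \<noteq> 0})"
      using continuous_on_open_vimage[THEN iffD1, OF _ c] U by blast
    moreover have "(u \<in> unit_sphere n \<and> hyperplane n u t \<in> dual_hyperplane n ` (U \<inter> dual_points n)) \<longleftrightarrow>
        (u, t) \<in> (unit_sphere n \<times> UNIV) \<inter> ((\<lambda>p :: seq \<times> real. inverse (snd p) *\<^sub>R fst p) -` U \<inter> {p. snd p \<noteq> 0})" for u t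
    proof (cases "u \<in> unit_sphere n")
      case True
      show ?thesis unfolding hyperplane_dual_iff[OF True Int_lower2]
        using True by (auto simp: dual_points_def unit_sphere_iff Rn_scale)
    qed simp
    then have "{(u, t). u \<in> unit_sphere n \<and> hyperplane n u t \<in> dual_hyperplane n ` (U \<inter> dual_points n)} =
        (unit_sphere n \<times> UNIV) \<inter> ((\<lambda>p :: seq \<times> real. inverse (snd p) *\<^sub>R fst p) -` U \<inter> {p. snd p \<noteq> 0})"
      by (simp only: set_eq_iff split_paired_All mem_Collect_eq prod.case) blast
    ultimately show ?thesis
      unfolding sets_hyperplane_borel
      by (intro sigma_sets.Basic) (auto simp only: openin_open mem_Collect_eq intro!: sub exI)
  qed
  have "B \<in> sigma_sets UNIV {U. open U}" using assms by (simp add: borel_def)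
  then show ?thesis
  proof (induction rule: sigma_sets.induct)
    case (Basic B) then show ?case using op by auto
  next
    case (Compl B)
    have "dual_hyperplane n ` ((UNIV - B) \<inter> dual_points n) =
        dual_hyperplane n ` (UNIV \<inter> dual_points n) - dual_hyperplane n ` (B \<inter> dual_points n)"
      using inj_on_dual_hyperplane[of n] by (auto simp: inj_on_def)
    then show ?case using Compl op[of UNIV] by auto
  next
    case (Union B)
    have "dual_hyperplane n ` (\<Union> (range B) \<inter> dual_points n) = (\<Union>i. dual_hyperplane n ` (B i \<inter> dual_points n))" by auto
    then show ?case using Union by auto
  qed simp
qed

lemma hyperplane_intensity_integrand:
  assumes B: "B \<in> sets (hyperplane_borel n)"
  shows "(\<lambda>(u, t). indicator (unit_sphere n) u * (indicator B (hyperplane n u t) * ennreal (\<bar>t\<bar> powr (r - 1))))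
    \<in> borel_measurable ((borel :: seq measure) \<Otimes>\<^sub>M lborel)"
proof -
  let ?X = "{(u, t). u \<in> unit_sphere n \<and> hyperplane n u t \<in> B}"
  have [measurable]: "?X \<in> sets ((borel :: seq measure) \<Otimes>\<^sub>M lborel)"
    using hyperplane_param_borel[OF B] by (simp add: borel_prod[symmetric] cong: sets_pair_measure_cong)
  have "(\<lambda>p. indicator ?X p * ennreal (\<bar>snd p\<bar> powr (r - 1))) \<in> borel_measurable ((borel :: seq measure) \<Otimes>\<^sub>M lborel)"
    by measurable
  moreover have "(\<lambda>(u, t). indicator (unit_sphere n) u * (indicator B (hyperplane n u t) * ennreal (\<bar>t\<bar> powr (r - 1)))) =
    (\<lambda>p. indicator ?X p * ennreal (\<bar>snd p\<bar> powr (r - 1)))"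
    by (auto simp: fun_eq_iff split: split_indicator)
  ultimately show ?thesis by simp
qed

text \<open>The defining formula is the value of the measure once it is known to be countably
  additive; the interchange of series and integrals needs the joint measurability of the
  integrand.\<close>

lemma emeasure_hyperplane_intensity:
  assumes n: "2 \<le> n" and B: "B \<in> sets (hyperplane_borel n)"
  shows "emeasure (hyperplane_intensity n r \<gamma>) B = ennreal (\<gamma> / omega (real n)) *
    (\<integral>\<^sup>+u. (\<integral>\<^sup>+t. indicator B (hyperplane n u t) * ennreal (\<bar>t\<bar> powr (r - 1)) \<partial>lborel) * indicator (unit_sphere n) u
         \<partial>hausdorff_measure (real n - 1))"
proof -
  let ?H = "hausdorff_measure (real n - 1) :: seq measure"
  let ?f = "\<lambda>B. ennreal (\<gamma> / omega (real n)) *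
    (\<integral>\<^sup>+u. (\<integral>\<^sup>+t. indicator B (hyperplane n u t) * ennreal (\<bar>t\<bar> powr (r - 1)) \<partial>lborel) * indicator (unit_sphere n) u \<partial>?H)"
  have m1: "(\<lambda>t. indicator B (hyperplane n u t) * ennreal (\<bar>t\<bar> powr (r - 1))) \<in> borel_measurable lborel"
    if B: "B \<in> sets (hyperplane_borel n)" and u: "u \<in> unit_sphere n" for u B
    using measurable_Pair2[OF hyperplane_intensity_integrand[OF B, of r], of u] u by (simp add: cong: measurable_cong)
  have m2: "(\<lambda>u. (\<integral>\<^sup>+t. indicator B (hyperplane n u t) * ennreal (\<bar>t\<bar> powr (r - 1)) \<partial>lborel) * indicator (unit_sphere n) u) \<in> borel_measurable ?H"
    if B: "B \<in> sets (hyperplane_borel n)" for B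
  proof -
    have "(\<lambda>u. \<integral>\<^sup>+t. indicator (unit_sphere n) u * (indicator B (hyperplane n u t) * ennreal (\<bar>t\<bar> powr (r - 1))) \<partial>lborel) \<in> borel_measurable borel"
      using lborel.borel_measurable_nn_integral_fst[OF hyperplane_intensity_integrand[OF B, of r]] by simp
    moreover have "(\<integral>\<^sup>+t. indicator (unit_sphere n) u * (indicator B (hyperplane n u t) * ennreal (\<bar>t\<bar> powr (r - 1))) \<partial>lborel) =
        (\<integral>\<^sup>+t. indicator B (hyperplane n u t) * ennreal (\<bar>t\<bar> powr (r - 1)) \<partial>lborel) * indicator (unit_sphere n) u" for u
      by (auto split: split_indicator)
    ultimately show ?thesis by (simp cong: measurable_cong_sets)
  qed
  have ca: "countably_additive (sets (hyperplane_borel n)) ?f"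
  proof (rule countably_additiveI)
    fix A :: "nat \<Rightarrow> seq set set" assume A: "range A \<subseteq> sets (hyperplane_borel n)" and dis: "disjoint_family A"
    have Ai: "A i \<in> sets (hyperplane_borel n)" for i using A by auto
    have ind: "indicator (\<Union>i. A i) x = suminf (\<lambda>i. indicator (A i) x :: ennreal)" for x
      using suminf_indicator[OF dis] by simp
    have "(\<integral>\<^sup>+t. indicator (\<Union>i. A i) (hyperplane n u t) * ennreal (\<bar>t\<bar> powr (r - 1)) \<partial>lborel) * indicator (unit_sphere n) u =
        suminf (\<lambda>i. (\<integral>\<^sup>+t. indicator (A i) (hyperplane n u t) * ennreal (\<bar>t\<bar> powr (r - 1)) \<partial>lborel) * indicator (unit_sphere n) u)" for u
    proof (cases "u \<in> unit_sphere n")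
      case True
      then show ?thesis
        by (simp add: ind ennreal_suminf_multc[symmetric] nn_integral_suminf[OF m1[OF Ai True]] del: ennreal_suminf_multc)
    qed simp
    then have "?f (\<Union>i. A i) = ennreal (\<gamma> / omega (real n)) * suminf (\<lambda>i. (\<integral>\<^sup>+u. (\<integral>\<^sup>+t. indicator (A i) (hyperplane n u t) * ennreal (\<bar>t\<bar> powr (r - 1)) \<partial>lborel) * indicator (unit_sphere n) u \<partial>?H))"
      using nn_integral_suminf[of "\<lambda>i u. (\<integral>\<^sup>+t. indicator (A i) (hyperplane n u t) * ennreal (\<bar>t\<bar> powr (r - 1)) \<partial>lborel) * indicator (unit_sphere n) u" ?H, OF m2[OF Ai]]
      by simp
    then show "suminf (\<lambda>i. ?f (A i)) = ?f (\<Union>i. A i)" by simp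
  qed
  have "hyperplane_intensity n r \<gamma> = measure_of (hyperplanes n) (sets (hyperplane_borel n)) ?f"
    unfolding hyperplane_intensity_def ..
  moreover have "emeasure (measure_of (hyperplanes n) (sets (hyperplane_borel n)) ?f) B = ?f B"
    using ca B sets.sigma_algebra_axioms[of "hyperplane_borel n"]
    by (intro emeasure_measure_of_sigma) (auto simp: positive_def space_hyperplane_borel)
  ultimately show ?thesis by simp
qed

lemma sets_hyperplane_intensity: "sets (hyperplane_intensity n r \<gamma>) = sets (hyperplane_borel n)"
  unfolding hyperplane_intensity_def
  using sets.sets_measure_of_eq[of "hyperplane_borel n"] sets.space_closed[of "hyperplane_borel n"]
  by (subst sets_measure_of) (auto simp: space_hyperplane_borel[symmetric] sets.sigma_sets_eq)

lemma space_hyperplane_intensity: "space (hyperplane_intensity n r \<gamma>) = hyperplanes n"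
  using sets_eq_imp_space_eq[OF sets_hyperplane_intensity] space_hyperplane_borel by simp

text \<open>At s = 0 the quotient has the value 0, which concerns a null set only.\<close>

definition dual_intensity :: "nat \<Rightarrow> real \<Rightarrow> seq measure"
  where "dual_intensity n r = distr (gauss n \<Otimes>\<^sub>M pow_measure r) borel (\<lambda>(g, s). g /\<^sub>R s)"

lemma sets_dual_intensity [simp, measurable_cong]: "sets (dual_intensity n r) = sets borel"
  by (simp add: dual_intensity_def)

lemma space_dual_intensity [simp]: "space (dual_intensity n r) = UNIV"
  by (simp add: dual_intensity_def)

lemma measurable_scale_inverse [measurable]: "(\<lambda>(g :: seq, s). g /\<^sub>R s) \<in> borel_measurable (borel \<Otimes>\<^sub>M borel)"
  unfolding split_beta' by measurable

lemma nn_integral_dual_intensity: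
  assumes [measurable]: "f \<in> borel_measurable borel"
  shows "(\<integral>\<^sup>+y. f y \<partial>dual_intensity n r) = (\<integral>\<^sup>+g. (\<integral>\<^sup>+s. f (g /\<^sub>R s) \<partial>pow_measure r) \<partial>gauss n)"
proof -
  interpret P: sigma_finite_measure "pow_measure r" by (rule sigma_finite_pow_measure)
  have "(\<lambda>(g :: seq, s). g /\<^sub>R s) \<in> measurable (gauss n \<Otimes>\<^sub>M pow_measure r) borel"
    using measurable_scale_inverse by (simp cong: measurable_cong_sets sets_pair_measure_cong)
  note [measurable] = this
  have "(\<integral>\<^sup>+y. f y \<partial>dual_intensity n r) = (\<integral>\<^sup>+p. f (case p of (g, s) \<Rightarrow> g /\<^sub>R s) \<partial>(gauss n \<Otimes>\<^sub>M pow_measure r))"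
    unfolding dual_intensity_def by (rule nn_integral_distr) measurable
  also have "\<dots> = (\<integral>\<^sup>+g. (\<integral>\<^sup>+s. f (g /\<^sub>R s) \<partial>pow_measure r) \<partial>gauss n)"
    by (subst P.nn_integral_fst[symmetric]) (auto simp: split_beta')
  finally show ?thesis .
qed

lemma AE_gauss_nonzero: "0 < n \<Longrightarrow> AE g in gauss n. g \<noteq> 0"
proof -
  assume n: "0 < n"
  have "AE x in std_normal. x \<noteq> 0"
    unfolding std_normal_def by (subst AE_density) (auto intro: AE_lborel_singleton[THEN eventually_mono])
  then have "AE x in distr (gauss n) borel (\<lambda>g. coord g 0). x \<noteq> 0"
    unfolding gauss_component[OF n] .
  then have "AE g in gauss n. coord g 0 \<noteq> 0"
    by (rule AE_distrD[rotated]) measurable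
  then show ?thesis by eventually_elim auto
qed

text \<open>The integral over the sphere is replaced by one over a weighted Gaussian vector g.
  Substituting t = s/|g| in the integral over distances turns the dual point sgn g / t into g/s, and
  the powers of |g| cancel.\<close>

theorem hyperplane_intensity_dual:
  assumes n: "2 \<le> n" and r: "0 < r" and \<gamma>: "0 < \<gamma>"
  obtains c where "0 < c"
    "\<And>B. B \<in> sets borel \<Longrightarrow> emeasure (hyperplane_intensity n r \<gamma>) (dual_hyperplane n ` (B \<inter> dual_points n)) =
      ennreal c * emeasure (dual_intensity n r) B"
proof -
  obtain c0 where c0: "0 < c0" "\<And>f. f \<in> borel_measurable borel \<Longrightarrow>
    (\<integral>\<^sup>+u. f u * indicator (unit_sphere n) u \<partial>hausdorff_measure (real n - 1)) =
      ennreal c0 * (\<integral>\<^sup>+g. ennreal (norm g powr r) * f (sgn g) \<partial>gauss n)"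
    using nn_integral_sphere[OF n r] by blast
  have ng: "AE g in gauss n. g \<noteq> 0" using n by (intro AE_gauss_nonzero) auto
  have om: "0 < omega (real n)" using n by (simp add: omega_def Gamma_real_pos)
  show ?thesis
  proof (rule that[of "\<gamma> / omega (real n) * c0"])
    show "0 < \<gamma> / omega (real n) * c0" using om \<gamma> c0 by simp
    fix B :: "seq set" assume B [measurable]: "B \<in> sets borel"
    define f where "f u = (\<integral>\<^sup>+t. indicator B (u /\<^sub>R t) * ennreal (\<bar>t\<bar> powr (r - 1)) \<partial>lborel)" for u :: seq
    have [measurable]: "(\<lambda>(u :: seq, t :: real). u /\<^sub>R t) \<in> measurable (borel \<Otimes>\<^sub>M lborel) borel"
      using measurable_scale_inverse by (simp cong: measurable_cong_sets sets_pair_measure_cong)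
    have "(\<lambda>p. indicator B (case p of (u :: seq, t) \<Rightarrow> u /\<^sub>R t) * ennreal (\<bar>snd p\<bar> powr (r - 1))) \<in> borel_measurable (borel \<Otimes>\<^sub>M lborel)"
      by measurable
    from lborel.borel_measurable_nn_integral_fst[OF this] have [measurable]: "f \<in> borel_measurable borel"
      by (simp add: f_def[abs_def])
    have "(\<integral>\<^sup>+t. indicator (dual_hyperplane n ` (B \<inter> dual_points n)) (hyperplane n u t) * ennreal (\<bar>t\<bar> powr (r - 1)) \<partial>lborel) = f u"
      if "u \<in> unit_sphere n" for u
      unfolding f_def
    proof (rule nn_integral_cong_AE, use AE_lborel_singleton[of 0] in eventually_elim)
      case (elim t)
      have "u /\<^sub>R t \<in> dual_points n" using that elim by (auto simp: dual_points_def unit_sphere_iff Rn_scale)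
      then show ?case using hyperplane_dual_iff[OF that, of "B \<inter> dual_points n" t] elim by (auto split: split_indicator)
    qed
    then have "(\<integral>\<^sup>+u. (\<integral>\<^sup>+t. indicator (dual_hyperplane n ` (B \<inter> dual_points n)) (hyperplane n u t) * ennreal (\<bar>t\<bar> powr (r - 1)) \<partial>lborel) * indicator (unit_sphere n) u
         \<partial>hausdorff_measure (real n - 1)) = (\<integral>\<^sup>+u. f u * indicator (unit_sphere n) u \<partial>hausdorff_measure (real n - 1))"
      by (intro nn_integral_cong) (auto split: split_indicator)
    also have "\<dots> = ennreal c0 * (\<integral>\<^sup>+g. ennreal (norm g powr r) * f (sgn g) \<partial>gauss n)"
      by (rule c0) measurable
    also have "(\<integral>\<^sup>+g. ennreal (norm g powr r) * f (sgn g) \<partial>gauss n) = (\<integral>\<^sup>+g. (\<integral>\<^sup>+s. indicator B (g /\<^sub>R s) \<partial>pow_measure r) \<partial>gauss n)"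
    proof (rule nn_integral_cong_AE, use ng in eventually_elim)
      case (elim g)
      then have g: "0 < norm g" by simp
      have gm [measurable]: "(\<lambda>t :: real. u /\<^sub>R t) \<in> borel_measurable borel" for u :: seq by measurable
      \<comment> \<open>The affine substitution t = s/|g|. It produces 1/|g| from dt and the power r
        - 1 of 1/|g| from the weight, which together balance the factor |g|^r.\<close>
      have "f (sgn g) = ennreal \<bar>1 / norm g\<bar> * (\<integral>\<^sup>+s. indicator B (sgn g /\<^sub>R (0 + 1 / norm g * s)) * ennreal (\<bar>0 + 1 / norm g * s\<bar> powr (r - 1)) \<partial>lborel)"
        unfolding f_def using g by (intro nn_integral_real_affine) auto
      also have "(\<lambda>s. sgn g /\<^sub>R (0 + 1 / norm g * s)) = (\<lambda>s. g /\<^sub>R s)"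
        using g by (auto simp: sgn_div_norm fun_eq_iff divide_simps)
      also have "(\<lambda>s. indicator B (g /\<^sub>R s) * ennreal (\<bar>0 + 1 / norm g * s\<bar> powr (r - 1))) = (\<lambda>s. ennreal (norm g powr (1 - r)) * (ennreal (\<bar>s\<bar> powr (r - 1)) * indicator B (g /\<^sub>R s)))"
        using g by (auto simp: fun_eq_iff abs_mult powr_mult powr_divide ennreal_mult[symmetric] powr_diff split: split_indicator)
      also have "(\<integral>\<^sup>+s. ennreal (norm g powr (1 - r)) * (ennreal (\<bar>s\<bar> powr (r - 1)) * indicator B (g /\<^sub>R s)) \<partial>lborel) =
          ennreal (norm g powr (1 - r)) * (\<integral>\<^sup>+s. indicator B (g /\<^sub>R s) \<partial>pow_measure r)"
        by (subst nn_integral_cmult) (auto simp: nn_integral_pow_measure)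
      finally have fe: "f (sgn g) = ennreal \<bar>1 / norm g\<bar> * (ennreal (norm g powr (1 - r)) * (\<integral>\<^sup>+s. indicator B (g /\<^sub>R s) \<partial>pow_measure r))" .
      have "ennreal (norm g powr r) * f (sgn g) =
          (ennreal (norm g powr r) * ennreal \<bar>1 / norm g\<bar> * ennreal (norm g powr (1 - r))) * (\<integral>\<^sup>+s. indicator B (g /\<^sub>R s) \<partial>pow_measure r)"
        unfolding fe by (simp only: mult.assoc)
      also have "ennreal (norm g powr r) * ennreal \<bar>1 / norm g\<bar> * ennreal (norm g powr (1 - r)) = ennreal (norm g powr r * \<bar>1 / norm g\<bar> * norm g powr (1 - r))"
        by (subst ennreal_mult, simp, simp, subst ennreal_mult) auto
      also have "norm g powr r * \<bar>1 / norm g\<bar> * norm g powr (1 - r) = 1"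
        using g by (simp add: powr_diff)
      finally show ?case by simp
    qed
    also have "\<dots> = emeasure (dual_intensity n r) B"
      by (subst nn_integral_dual_intensity[symmetric]) auto
    finally have *: "(\<integral>\<^sup>+u. (\<integral>\<^sup>+t. indicator (dual_hyperplane n ` (B \<inter> dual_points n)) (hyperplane n u t) * ennreal (\<bar>t\<bar> powr (r - 1)) \<partial>lborel) * indicator (unit_sphere n) u
         \<partial>hausdorff_measure (real n - 1)) = ennreal c0 * emeasure (dual_intensity n r) B" .
    have "ennreal (\<gamma> / omega (real n) * c0) = ennreal (\<gamma> / omega (real n)) * ennreal c0"
      using om \<gamma> c0(1) by (intro ennreal_mult) auto
    then show "emeasure (hyperplane_intensity n r \<gamma>) (dual_hyperplane n ` (B \<inter> dual_points n)) =
      ennreal (\<gamma> / omega (real n) * c0) * emeasure (dual_intensity n r) B"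
      by (simp only: emeasure_hyperplane_intensity[OF n dual_hyperplane_image_sets[OF B]] * mult.assoc)
  qed
qed

definition dual_process :: "nat \<Rightarrow> seq set set \<Rightarrow> seq set"
  where "dual_process n \<H> = {y \<in> dual_points n. dual_hyperplane n y \<in> \<H>}"

text \<open>Dual points correspond bijectively to hyperplanes that miss the origin, so counts, their
  laws and their independence carry over. The hyperplanes through the origin have parameter t = 0,
  form a null set of the intensity and almost surely do not occur.\<close>

theorem poisson_process_dual:
  fixes M :: "'w measure"
  assumes n: "2 \<le> n" and r: "0 < r" and \<gamma>: "0 < \<gamma>" and X: "poisson_hyperplane_process n r \<gamma> M X"
  obtains c where "0 < c" "poisson_process M (scale_measure (ennreal c) (dual_intensity n r)) (\<lambda>\<omega>. dual_process n (X \<omega>))"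
    "AE \<omega> in M. X \<omega> = dual_hyperplane n ` dual_process n (X \<omega>)"
proof -
  interpret X: poisson_process M "hyperplane_intensity n r \<gamma>" X by fact
  obtain c where c: "0 < c" "\<And>B. B \<in> sets borel \<Longrightarrow> emeasure (hyperplane_intensity n r \<gamma>) (dual_hyperplane n ` (B \<inter> dual_points n)) =
      ennreal c * emeasure (dual_intensity n r) B"
    using hyperplane_intensity_dual[OF n r \<gamma>] by blast
  let ?\<Lambda> = "scale_measure (ennreal c) (dual_intensity n r)"
  let ?im = "\<lambda>B. dual_hyperplane n ` (B \<inter> dual_points n)"
  have im: "?im B \<in> sets (hyperplane_intensity n r \<gamma>)" if "B \<in> sets ?\<Lambda>" for B
    using that by (simp add: sets_hyperplane_intensity dual_hyperplane_image_sets)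
  have em: "emeasure (hyperplane_intensity n r \<gamma>) (?im B) = emeasure ?\<Lambda> B" if "B \<in> sets ?\<Lambda>" for B
    using that c(2)[of B] by simp
  have ec: "ecard (dual_process n H \<inter> B) = ecard (H \<inter> ?im B)" for H B
  proof -
    have "H \<inter> ?im B = dual_hyperplane n ` (dual_process n H \<inter> B)" by (auto simp: dual_process_def)
    moreover have "inj_on (dual_hyperplane n) (dual_process n H \<inter> B)"
      by (rule inj_on_subset[OF inj_on_dual_hyperplane[of n]]) (auto simp: dual_process_def)
    ultimately show ?thesis by (simp add: ecard_image)
  qed
  have pp: "poisson_process M ?\<Lambda> (\<lambda>\<omega>. dual_process n (X \<omega>))"
  proof (unfold_locales, unfold ec)
    show "dual_process n (X \<omega>) \<subseteq> space ?\<Lambda>" for \<omega> by (simp add: space_scale_measure)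
    show "(\<lambda>\<omega>. ecard (X \<omega> \<inter> ?im B)) \<in> borel_measurable M" if "B \<in> sets ?\<Lambda>" for B
      by (rule X.count_measurable[OF im[OF that]])
    show "X.prob {\<omega> \<in> space M. ecard (X \<omega> \<inter> ?im B) = of_nat k} = measure ?\<Lambda> B ^ k / fact k * exp (- measure ?\<Lambda> B)"
      if "B \<in> sets ?\<Lambda>" "emeasure ?\<Lambda> B < \<infinity>" for B k
      using X.count_poisson[OF im[OF that(1)], of k] that by (simp add: em measure_def)
    show "X.indep_vars (\<lambda>_. borel) (\<lambda>i \<omega>. ecard (X \<omega> \<inter> ?im (D i))) I"
      if "finite I" "\<And>i. i \<in> I \<Longrightarrow> D i \<in> sets ?\<Lambda>" "disjoint_family_on D I" for I :: "nat set" and D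
    proof (rule X.count_indep[OF that(1)])
      show "disjoint_family_on (\<lambda>i. ?im (D i)) I"
        using that(3) inj_on_dual_hyperplane[of n] unfolding disjoint_family_on_def inj_on_def by blast
    qed (use that im in auto)
  qed
  define N where "N = hyperplanes n - ?im UNIV"
  have N: "N \<in> sets (hyperplane_intensity n r \<gamma>)"
    using im[of UNIV] sets.top[of "hyperplane_intensity n r \<gamma>"] by (auto simp: N_def space_hyperplane_intensity space_scale_measure)
  have N0: "hyperplane n u t \<in> N \<longleftrightarrow> t = 0" if "u \<in> unit_sphere n" for u t
    using hyperplane_dual_iff[OF that, of "UNIV \<inter> dual_points n" t] that
    by (auto simp: N_def hyperplane_in dual_points_def unit_sphere_iff Rn_scale)
  have "emeasure (hyperplane_intensity n r \<gamma>) N = 0"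
  proof -
    have z: "(\<integral>\<^sup>+t. indicator N (hyperplane n u t) * ennreal (\<bar>t\<bar> powr (r - 1)) \<partial>lborel) * indicator (unit_sphere n) u = 0" for u
    proof (cases "u \<in> unit_sphere n")
      case True
      have "AE t in lborel. indicator N (hyperplane n u t) * ennreal (\<bar>t\<bar> powr (r - 1)) = 0"
        using AE_lborel_singleton[of "0 :: real"] by (rule eventually_mono) (simp add: N0[OF True])
      then have "(\<integral>\<^sup>+t. indicator N (hyperplane n u t) * ennreal (\<bar>t\<bar> powr (r - 1)) \<partial>lborel) = (\<integral>\<^sup>+t. 0 \<partial>(lborel :: real measure))"
        by (rule nn_integral_cong_AE)
      then show ?thesis by simp
    qed simp
    show ?thesis
      using N unfolding sets_hyperplane_intensity
      by (simp only: emeasure_hyperplane_intensity[OF n] z) simp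
  qed
  then have "X.prob {\<omega> \<in> space M. ecard (X \<omega> \<inter> N) = of_nat 0} = 1"
    using X.count_poisson[OF N, of 0] by (simp add: measure_def)
  moreover have "{\<omega> \<in> space M. ecard (X \<omega> \<inter> N) = of_nat 0} \<in> sets M"
    using X.count_measurable[OF N] by measurable
  ultimately have "AE \<omega> in M. ecard (X \<omega> \<inter> N) = of_nat 0"
    using X.AE_in_set_eq_1[of "{\<omega> \<in> space M. ecard (X \<omega> \<inter> N) = of_nat 0}"] by simp
  then have "AE \<omega> in M. X \<omega> = dual_hyperplane n ` dual_process n (X \<omega>)"
    using AE_space
  proof eventually_elim
    case (elim \<omega>)
    have "X \<omega> \<subseteq> hyperplanes n" using X.points[OF elim(2)] by (simp add: space_hyperplane_intensity)
    then have "X \<omega> \<subseteq> ?im UNIV" using elim(1) by (auto simp: N_def)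
    then show ?case by (auto simp: dual_process_def)
  qed
  then show ?thesis using that[OF c(1) pp] by blast
qed

section \<open>Tuples of points of a Poisson process\<close>

lemma poisson_series_sums:
  "(\<lambda>k. real k * (\<theta> ^ k / fact k * exp (- \<theta>))) sums \<theta>"
proof -
  have "(\<lambda>k. \<theta> ^ k / fact k) sums exp \<theta>"
    using exp_converges[of \<theta>] by (simp add: field_simps)
  then have "(\<lambda>k. (\<theta> * exp (- \<theta>)) * (\<theta> ^ k / fact k)) sums ((\<theta> * exp (- \<theta>)) * exp \<theta>)"
    by (rule sums_mult)
  then have "(\<lambda>k. real (Suc k) * (\<theta> ^ Suc k / fact (Suc k) * exp (- \<theta>))) sums \<theta>"
    by (simp add: field_simps exp_minus del: of_nat_Suc)
  then show ?thesis by (subst (asm) sums_Suc_iff) simp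
qed

lemma poisson_sums: "(\<lambda>k. \<theta> ^ k / fact k * exp (- \<theta>)) sums (1 :: real)"
proof -
  have "(\<lambda>k. \<theta> ^ k / fact k) sums exp \<theta>"
    using exp_converges[of \<theta>] by (simp add: field_simps)
  from sums_mult2[OF this, of "exp (- \<theta>)"] show ?thesis by (simp add: exp_minus)
qed

context
  fixes M :: "'w measure" and \<Theta> :: "'a measure" and X :: "'w \<Rightarrow> 'a set"
  assumes X: "poisson_process M \<Theta> X"
begin

interpretation poisson_process M \<Theta> X by (rule X)

text \<open>Only the probabilities of the finite values of a count are given. Since they sum to 1,
  an infinite count has probability 0, and any function of the count is integrated as a series over
  these values.\<close>

lemma poisson_count_nn_integral:
  assumes B: "B \<in> sets \<Theta>" "emeasure \<Theta> B < \<infinity>"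
  shows "(\<integral>\<^sup>+w. f (ecard (X w \<inter> B)) \<partial>M) = suminf (\<lambda>k. f (of_nat k) * ennreal (measure \<Theta> B ^ k / fact k * exp (- measure \<Theta> B)))"
    and poisson_AE_finite: "AE w in M. finite (X w \<inter> B)"
proof -
  note [measurable] = count_measurable[OF B(1)]
  define E where "E k = {w \<in> space M. ecard (X w \<inter> B) = of_nat k}" for k
  have E [measurable]: "E k \<in> sets M" for k unfolding E_def by measurable
  have PE: "emeasure M (E k) = ennreal (measure \<Theta> B ^ k / fact k * exp (- measure \<Theta> B))" for k
    using count_poisson[OF B, of k] by (simp add: E_def emeasure_eq_measure)
  have dis: "disjoint_family E" by (auto simp: E_def disjoint_family_on_def)
  have "emeasure M (\<Union>k. E k) = suminf (\<lambda>k. emeasure M (E k))"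
    by (rule suminf_emeasure[symmetric]) (use dis in auto)
  also have "\<dots> = 1"
    unfolding PE using poisson_sums[of "measure \<Theta> B"]
    by (subst suminf_ennreal2) (auto simp: sums_iff)
  finally have "emeasure M (\<Union>k. E k) = 1" .
  then have AE: "AE w in M. w \<in> (\<Union>k. E k)"
    by (subst AE_in_set_eq_1) (auto simp: measure_def)
  then show "AE w in M. finite (X w \<inter> B)"
    by eventually_elim (auto simp: E_def simp flip: ecard_less_top simp: of_nat_less_top)
  have "(\<integral>\<^sup>+w. f (ecard (X w \<inter> B)) \<partial>M) = (\<integral>\<^sup>+w. suminf (\<lambda>k. f (of_nat k) * indicator (E k) w) \<partial>M)"
  proof (rule nn_integral_cong_AE, use AE in eventually_elim)
    case (elim w)
    then obtain k where k: "w \<in> E k" by auto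
    then have "w \<in> E j \<longleftrightarrow> j = k" for j by (auto simp: E_def)
    then have "suminf (\<lambda>j. f (of_nat j) * indicator (E j) w) = suminf (\<lambda>j. if j = k then f (of_nat j) else 0)"
      by (intro suminf_cong) (auto split: split_indicator)
    also have "\<dots> = (\<Sum>j\<in>{k}. if j = k then f (of_nat j) else 0)" by (rule suminf_finite) auto
    finally show ?case using k by (simp add: E_def)
  qed
  also have "\<dots> = suminf (\<lambda>k. \<integral>\<^sup>+w. f (of_nat k) * indicator (E k) w \<partial>M)"
    by (rule nn_integral_suminf) measurable
  also have "\<dots> = suminf (\<lambda>k. f (of_nat k) * ennreal (measure \<Theta> B ^ k / fact k * exp (- measure \<Theta> B)))"
    by (intro suminf_cong) (simp add: nn_integral_cmult_indicator PE)
  finally show "(\<integral>\<^sup>+w. f (ecard (X w \<inter> B)) \<partial>M) = suminf (\<lambda>k. f (of_nat k) * ennreal (measure \<Theta> B ^ k / fact k * exp (- measure \<Theta> B)))" .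
qed

lemma poisson_count_mean:
  assumes B: "B \<in> sets \<Theta>" "emeasure \<Theta> B < \<infinity>"
  shows "(\<integral>\<^sup>+w. ecard (X w \<inter> B) \<partial>M) = emeasure \<Theta> B"
proof -
  have "(\<integral>\<^sup>+w. ecard (X w \<inter> B) \<partial>M) = suminf (\<lambda>k. ennreal (real k * (measure \<Theta> B ^ k / fact k * exp (- measure \<Theta> B))))"
  proof -
    have e: "of_nat k * ennreal p = ennreal (real k * p)" if "0 \<le> p" for k p
      using that by (simp add: ennreal_mult ennreal_of_nat_eq_real_of_nat)
    show ?thesis
      unfolding poisson_count_nn_integral(1)[OF B, of "\<lambda>x. x"] by (intro suminf_cong e) simp
  qed
  also have "\<dots> = ennreal (measure \<Theta> B)"
    using poisson_series_sums[of "measure \<Theta> B"] by (subst suminf_ennreal2) (auto simp: sums_iff)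
  also have "\<dots> = emeasure \<Theta> B" using B(2) by (intro emeasure_eq_ennreal_measure[symmetric]) simp
  finally show ?thesis .
qed

lemma poisson_count_prob:
  assumes B: "B \<in> sets \<Theta>" "emeasure \<Theta> B < \<infinity>"
  shows "(\<integral>\<^sup>+w. indicator {of_nat k} (ecard (X w \<inter> B)) \<partial>M) = ennreal (measure \<Theta> B ^ k / fact k * exp (- measure \<Theta> B))"
proof -
  have "(\<integral>\<^sup>+w. indicator {of_nat k} (ecard (X w \<inter> B)) \<partial>M) =
      suminf (\<lambda>j. if j = k then ennreal (measure \<Theta> B ^ j / fact j * exp (- measure \<Theta> B)) else 0)"
    unfolding poisson_count_nn_integral(1)[OF B] by (intro suminf_cong) auto
  also have "\<dots> = (\<Sum>j\<in>{k}. if j = k then ennreal (measure \<Theta> B ^ j / fact j * exp (- measure \<Theta> B)) else 0)"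
    by (rule suminf_finite) auto
  finally show ?thesis by simp
qed

lemma poisson_indep_nn_integral:
  fixes D :: "nat \<Rightarrow> 'a set" and f :: "nat \<Rightarrow> ennreal \<Rightarrow> ennreal"
  assumes I: "finite I" and D: "\<And>i. i \<in> I \<Longrightarrow> D i \<in> sets \<Theta>" and dis: "disjoint_family_on D I"
    and f: "\<And>i. i \<in> I \<Longrightarrow> f i \<in> borel_measurable borel"
  shows "(\<integral>\<^sup>+w. (\<Prod>i\<in>I. f i (ecard (X w \<inter> D i))) \<partial>M) = (\<Prod>i\<in>I. \<integral>\<^sup>+w. f i (ecard (X w \<inter> D i)) \<partial>M)"
proof (rule indep_vars_nn_integral[OF I])
  show "indep_vars (\<lambda>_. borel) (\<lambda>i w. f i (ecard (X w \<inter> D i))) I"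
    using indep_vars_compose2[OF count_indep[OF I D dis] f] by simp
qed simp

end

section \<open>Formulas of Mecke type for tuples of points\<close>

lemma ecard_PiE:
  assumes "finite I" "\<And>i. i \<in> I \<Longrightarrow> finite (S i)"
  shows "ecard (Pi\<^sub>E I S) = (\<Prod>i\<in>I. ecard (S i))"
  using assms by (simp add: ecard_finite finite_PiE card_PiE of_nat_prod)

lemma ecard_suminf: "disjoint_family A \<Longrightarrow> ecard (\<Union>i. A i) = suminf (\<lambda>i. ecard (A i))"
  unfolding ecard_def by (rule suminf_emeasure[symmetric]) auto

text \<open>Both sides are finite measures in \<open>A\<close> on the rectangle, so the identity
  extends from boxes to all measurable sets by the monotone class argument. The random weight
  \<open>G\<close> is carried along; finite counts wherever it does not vanish make differences of
  counts meaningful for complements.\<close>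

lemma tuples_in_rectangle:
  fixes M :: "'w measure" and \<Theta> :: "'a measure" and X :: "'w \<Rightarrow> 'a set" and D :: "nat \<Rightarrow> 'a set"
  assumes sf: "sigma_finite_measure \<Theta>" and I: "finite I"
    and D: "\<And>i. i \<in> I \<Longrightarrow> D i \<in> sets \<Theta>" "\<And>i. i \<in> I \<Longrightarrow> emeasure \<Theta> (D i) < \<infinity>"
    and G [measurable]: "G \<in> borel_measurable M" and Gfin: "\<And>w. w \<in> space M \<Longrightarrow> G w < \<infinity>"
    and cm: "\<And>B. B \<in> sets \<Theta> \<Longrightarrow> (\<lambda>w. ecard (X w \<inter> B)) \<in> borel_measurable M"
    and fin: "\<And>w i. w \<in> space M \<Longrightarrow> G w \<noteq> 0 \<Longrightarrow> i \<in> I \<Longrightarrow> finite (X w \<inter> D i)"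
    and c: "c < \<infinity>"
    and eq: "\<And>D'. (\<And>i. i \<in> I \<Longrightarrow> D' i \<in> sets \<Theta>) \<Longrightarrow> (\<And>i. i \<in> I \<Longrightarrow> D' i \<subseteq> D i) \<Longrightarrow>
      (\<integral>\<^sup>+w. (\<Prod>i\<in>I. ecard (X w \<inter> D' i)) * G w \<partial>M) = c * (\<Prod>i\<in>I. emeasure \<Theta> (D' i))"
    and A: "A \<in> sets (Pi\<^sub>M I (\<lambda>_. \<Theta>))"
  shows "(\<lambda>w. ecard (A \<inter> Pi\<^sub>E I D \<inter> (I \<rightarrow>\<^sub>E X w)) * G w) \<in> borel_measurable M \<and>
    (\<integral>\<^sup>+w. ecard (A \<inter> Pi\<^sub>E I D \<inter> (I \<rightarrow>\<^sub>E X w)) * G w \<partial>M) = c * emeasure (Pi\<^sub>M I (\<lambda>_. \<Theta>)) (A \<inter> Pi\<^sub>E I D)"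
proof -
  interpret sigma_finite_measure \<Theta> by fact
  interpret product_sigma_finite "\<lambda>_. \<Theta>" by standard
  let ?P = "Pi\<^sub>M I (\<lambda>_. \<Theta>)" and ?R = "Pi\<^sub>E I D"
  define n where "n A w = ecard (A \<inter> ?R \<inter> (I \<rightarrow>\<^sub>E X w)) * G w" for A w
  have R: "?R \<in> sets ?P" using I D by (intro sets_PiM_I_finite) auto
  have Rsub: "?R \<subseteq> space ?P" using sets.sets_into_space[OF R] .
  have Rfin: "emeasure ?P ?R < \<infinity>"
    using I D by (simp add: emeasure_PiM ennreal_prod_eq_top less_top[symmetric])
  have sub: "A \<inter> ?R \<in> sets ?P" if "A \<in> sets ?P" for A using that R by auto
  have nR_fin: "n A w < \<infinity>" if "w \<in> space M" for A w
  proof (cases "G w = 0")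
    case False
    have "?R \<inter> (I \<rightarrow>\<^sub>E X w) = Pi\<^sub>E I (\<lambda>i. X w \<inter> D i)" by (auto simp: PiE_iff)
    then have "finite (?R \<inter> (I \<rightarrow>\<^sub>E X w))" using I fin[OF that False] by (simp add: finite_PiE)
    then have "finite (A \<inter> ?R \<inter> (I \<rightarrow>\<^sub>E X w))" by (rule rev_finite_subset) auto
    then show ?thesis using Gfin[OF that] by (simp add: n_def ecard_finite ennreal_mult_less_top of_nat_less_top)
  qed (simp add: n_def)
  have basic: "n A \<in> borel_measurable M \<and> (\<integral>\<^sup>+w. n A w \<partial>M) = c * emeasure ?P (A \<inter> ?R)"
    if A: "A \<in> prod_algebra I (\<lambda>_. \<Theta>)" for A
  proof -
    obtain E where E: "A = Pi\<^sub>E I E" "\<And>i. i \<in> I \<Longrightarrow> E i \<in> sets \<Theta>"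
      using A unfolding prod_algebra_eq_finite[OF I] by auto
    define D' where "D' i = D i \<inter> E i" for i
    have D' [measurable]: "D' i \<in> sets \<Theta>" if "i \<in> I" for i using D E that by (auto simp: D'_def)
    have AR: "A \<inter> ?R = Pi\<^sub>E I D'" by (auto simp: E D'_def PiE_iff)
    have nA: "n A w = (\<Prod>i\<in>I. ecard (X w \<inter> D' i)) * G w" if w: "w \<in> space M" for w
    proof (cases "G w = 0")
      case False
      have "A \<inter> ?R \<inter> (I \<rightarrow>\<^sub>E X w) = Pi\<^sub>E I (\<lambda>i. X w \<inter> D' i)" unfolding AR by (auto simp: PiE_iff)
      moreover have "finite (X w \<inter> D' i)" if "i \<in> I" for i
        using fin[OF w False that] by (rule rev_finite_subset) (auto simp: D'_def)
      ultimately show ?thesis using I by (simp add: n_def ecard_PiE)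
    qed (simp add: n_def)
    have "(\<lambda>w. (\<Prod>i\<in>I. ecard (X w \<inter> D' i)) * G w) \<in> borel_measurable M"
      using cm[OF D'] by measurable
    then have "n A \<in> borel_measurable M" by (subst measurable_cong[OF nA])
    moreover have "(\<integral>\<^sup>+w. n A w \<partial>M) = c * (\<Prod>i\<in>I. emeasure \<Theta> (D' i))"
      using eq[of D'] D' by (simp add: nA D'_def cong: nn_integral_cong)
    moreover have "emeasure ?P (A \<inter> ?R) = (\<Prod>i\<in>I. emeasure \<Theta> (D' i))"
      unfolding AR using I D' by (intro emeasure_PiM) auto
    ultimately show ?thesis by simp
  qed
  have "n A \<in> borel_measurable M \<and> (\<integral>\<^sup>+w. n A w \<partial>M) = c * emeasure ?P (A \<inter> ?R)"
  proof (rule sigma_sets_induct_disjoint[where G = "prod_algebra I (\<lambda>_. \<Theta>)" and \<Omega> = "\<Pi>\<^sub>E i\<in>I. space \<Theta>"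
        and P = "\<lambda>A. n A \<in> borel_measurable M \<and> (\<integral>\<^sup>+w. n A w \<partial>M) = c * emeasure ?P (A \<inter> ?R)"])
    show "Int_stable (prod_algebra I (\<lambda>_. \<Theta>))" by (rule Int_stable_prod_algebra)
    show "prod_algebra I (\<lambda>_. \<Theta>) \<subseteq> Pow (\<Pi>\<^sub>E i\<in>I. space \<Theta>)" by (rule prod_algebra_sets_into_space)
    show "A \<in> sigma_sets (\<Pi>\<^sub>E i\<in>I. space \<Theta>) (prod_algebra I (\<lambda>_. \<Theta>))"
      using A by (simp add: sets_PiM)
  next
    show "n A \<in> borel_measurable M \<and> (\<integral>\<^sup>+w. n A w \<partial>M) = c * emeasure ?P (A \<inter> ?R)"
      if "A \<in> prod_algebra I (\<lambda>_. \<Theta>)" for A by (rule basic[OF that])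
  next
    show "n {} \<in> borel_measurable M \<and> (\<integral>\<^sup>+w. n {} w \<partial>M) = c * emeasure ?P ({} \<inter> ?R)"
      by (simp add: n_def[abs_def] ecard_finite)
  next
    fix A assume A: "A \<in> sigma_sets (\<Pi>\<^sub>E i\<in>I. space \<Theta>) (prod_algebra I (\<lambda>_. \<Theta>))"
      and IH: "n A \<in> borel_measurable M \<and> (\<integral>\<^sup>+w. n A w \<partial>M) = c * emeasure ?P (A \<inter> ?R)"
    let ?A' = "(\<Pi>\<^sub>E i\<in>I. space \<Theta>) - A" and ?S = "\<Pi>\<^sub>E i\<in>I. space \<Theta>"
    have As: "A \<in> sets ?P" using A by (simp add: sets_PiM)
    have S: "?S \<in> prod_algebra I (\<lambda>_. \<Theta>)" unfolding prod_algebra_eq_finite[OF I] by auto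
    have SR: "?S \<inter> ?R = ?R" using Rsub by (auto simp: space_PiM)
    note bS = basic[OF S]
    have add: "n ?A' w = n ?S w - n A w" if w: "w \<in> space M" for w
    proof -
      have "ecard (?S \<inter> ?R \<inter> (I \<rightarrow>\<^sub>E X w)) = ecard (?A' \<inter> ?R \<inter> (I \<rightarrow>\<^sub>E X w) \<union> A \<inter> ?R \<inter> (I \<rightarrow>\<^sub>E X w))"
        using Rsub by (intro arg_cong[where f = ecard]) (auto simp: space_PiM)
      also have "\<dots> = ecard (?A' \<inter> ?R \<inter> (I \<rightarrow>\<^sub>E X w)) + ecard (A \<inter> ?R \<inter> (I \<rightarrow>\<^sub>E X w))"
        unfolding ecard_def by (rule plus_emeasure[symmetric]) auto
      finally have "n ?S w = n ?A' w + n A w" by (simp add: n_def distrib_right)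
      then show ?thesis using nR_fin[OF w, of A] by simp
    qed
    have le: "n A w \<le> n ?S w" for w
      unfolding n_def SR by (intro mult_right_mono ecard_mono) auto
    have "n ?A' \<in> borel_measurable M"
      using IH bS by (subst measurable_cong[OF add]) auto
    have "(\<integral>\<^sup>+w. n ?A' w \<partial>M) = (\<integral>\<^sup>+w. n ?S w - n A w \<partial>M)"
      by (rule nn_integral_cong) (rule add)
    also have "\<dots> = (\<integral>\<^sup>+w. n ?S w \<partial>M) - (\<integral>\<^sup>+w. n A w \<partial>M)"
    proof (rule nn_integral_diff)
      have "emeasure ?P (A \<inter> ?R) \<le> emeasure ?P ?R" using R by (intro emeasure_mono) auto
      then show "(\<integral>\<^sup>+w. n A w \<partial>M) \<noteq> \<infinity>"
        using IH Rfin c by (auto simp: ennreal_mult_eq_top_iff less_top[symmetric] top_unique)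
    qed (use IH bS le in auto)
    also have "\<dots> = c * emeasure ?P (?S \<inter> ?R) - c * emeasure ?P (A \<inter> ?R)" using IH bS by simp
    also have "\<dots> = c * (emeasure ?P ?R - emeasure ?P (A \<inter> ?R))"
      unfolding SR using c Rfin by (intro ennreal_right_diff_distrib[symmetric]) auto
    also have "emeasure ?P ?R - emeasure ?P (A \<inter> ?R) = emeasure ?P (?R - A \<inter> ?R)"
      using R As Rfin emeasure_mono[of "A \<inter> ?R" ?R ?P]
      by (intro emeasure_Diff[symmetric]) (auto simp: less_top[symmetric] top_unique)
    also have "?R - A \<inter> ?R = ?A' \<inter> ?R" using Rsub by (auto simp: space_PiM)
    finally show "n ?A' \<in> borel_measurable M \<and> (\<integral>\<^sup>+w. n ?A' w \<partial>M) = c * emeasure ?P (?A' \<inter> ?R)"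
      using \<open>n ?A' \<in> borel_measurable M\<close> by simp
  next
    fix A :: "nat \<Rightarrow> (nat \<Rightarrow> 'a) set" assume dis: "disjoint_family A"
      and A: "range A \<subseteq> sigma_sets (\<Pi>\<^sub>E i\<in>I. space \<Theta>) (prod_algebra I (\<lambda>_. \<Theta>))"
      and IH: "\<And>k. n (A k) \<in> borel_measurable M \<and> (\<integral>\<^sup>+w. n (A k) w \<partial>M) = c * emeasure ?P (A k \<inter> ?R)"
    have As: "A k \<in> sets ?P" for k using A by (auto simp: sets_PiM)
    have IH': "n (A k) \<in> borel_measurable M" "(\<integral>\<^sup>+w. n (A k) w \<partial>M) = c * emeasure ?P (A k \<inter> ?R)" for k
      using IH by auto
    have sum: "n (\<Union>k. A k) w = suminf (\<lambda>k. n (A k) w)" for w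
    proof -
      have "(\<Union>k. A k) \<inter> ?R \<inter> (I \<rightarrow>\<^sub>E X w) = (\<Union>k. A k \<inter> ?R \<inter> (I \<rightarrow>\<^sub>E X w))" by auto
      then have "ecard ((\<Union>k. A k) \<inter> ?R \<inter> (I \<rightarrow>\<^sub>E X w)) = suminf (\<lambda>k. ecard (A k \<inter> ?R \<inter> (I \<rightarrow>\<^sub>E X w)))"
        by (simp only:) (rule ecard_suminf, use dis in \<open>unfold disjoint_family_on_def, blast\<close>)
      then show ?thesis by (simp add: n_def)
    qed
    have sum': "n (\<Union>k. A k) = (\<lambda>w. suminf (\<lambda>k. n (A k) w))" by (rule ext) (rule sum)
    have "(\<integral>\<^sup>+w. n (\<Union>k. A k) w \<partial>M) = suminf (\<lambda>k. c * emeasure ?P (A k \<inter> ?R))"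
      unfolding sum by (subst nn_integral_suminf) (auto simp: IH')
    also have "\<dots> = c * suminf (\<lambda>k. emeasure ?P (A k \<inter> ?R))" by simp
    also have "suminf (\<lambda>k. emeasure ?P (A k \<inter> ?R)) = emeasure ?P (\<Union>k. A k \<inter> ?R)"
      by (rule suminf_emeasure) (use sub[OF As] dis in \<open>auto simp: disjoint_family_on_def\<close>)
    also have "(\<Union>k. A k \<inter> ?R) = (\<Union>k. A k) \<inter> ?R" by auto
    finally show "n (\<Union>k. A k) \<in> borel_measurable M \<and> (\<integral>\<^sup>+w. n (\<Union>k. A k) w \<partial>M) = c * emeasure ?P ((\<Union>k. A k) \<inter> ?R)"
      unfolding sum' using IH'(1) by simp
  qed
  then show ?thesis by (simp add: n_def[abs_def])
qed

text \<open>Independence of counts is available for disjoint sets only, so the tuples with distinct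
  entries have to be exhausted by boxes with pairwise disjoint sides. Around such a tuple small
  balls are disjoint, and members of a countable basis fit into them.\<close>

lemma countable_rectangle_cover:
  fixes W :: "nat \<Rightarrow> 'a::{metric_space, second_countable_topology} set"
  assumes W: "(\<Union>k. W k) = UNIV" "\<And>k. W k \<in> sets borel" and E: "E \<in> sets borel" and I: "finite (I :: nat set)"
  obtains \<R> where "countable \<R>" "\<And>D i. D \<in> \<R> \<Longrightarrow> i \<in> I \<Longrightarrow> D i \<in> sets borel \<and> D i \<subseteq> E \<and> (\<exists>k. D i \<subseteq> W k)"
    "\<And>D. D \<in> \<R> \<Longrightarrow> disjoint_family_on D I"
    "\<And>T. T \<in> (I \<rightarrow>\<^sub>E E) \<Longrightarrow> inj_on T I \<Longrightarrow> \<exists>D\<in>\<R>. T \<in> Pi\<^sub>E I D"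
proof -
  obtain \<B> :: "'a set set" where \<B>: "countable \<B>" "topological_basis \<B>"
    using ex_countable_basis by blast
  define \<C> where "\<C> = (\<lambda>(U, k). U \<inter> W k \<inter> E) ` (\<B> \<times> (UNIV :: nat set))"
  define \<R> where "\<R> = {D \<in> I \<rightarrow>\<^sub>E \<C>. disjoint_family_on D I}"
  have "countable \<C>" unfolding \<C>_def using \<B>(1) by auto
  then have "countable (I \<rightarrow>\<^sub>E \<C>)" using I by (intro countable_PiE) auto
  then have c: "countable \<R>" unfolding \<R>_def by (rule countable_subset[rotated]) auto
  show ?thesis
  proof (rule that[OF c])
    fix D i assume D: "D \<in> \<R>" and i: "i \<in> I"
    then have "D i \<in> \<C>" by (auto simp: \<R>_def PiE_iff)
    then show "D i \<in> sets borel \<and> D i \<subseteq> E \<and> (\<exists>k. D i \<subseteq> W k)"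
      using W(2) E topological_basis_open[OF \<B>(2)] by (auto simp: \<C>_def intro!: sets.Int)
  next
    show "disjoint_family_on D I" if "D \<in> \<R>" for D using that by (simp add: \<R>_def)
  next
    fix T assume T: "T \<in> (I \<rightarrow>\<^sub>E E)" and inj: "inj_on T I"
    \<comment> \<open>Half the smallest distance between two entries; with a single entry any radius
      will do.\<close>
    have "\<exists>\<delta>>0. \<forall>i\<in>I. \<forall>j\<in>I. i \<noteq> j \<longrightarrow> 2 * \<delta> \<le> dist (T i) (T j)"
    proof (cases "\<exists>i\<in>I. \<exists>j\<in>I. i \<noteq> j")
      case True
      let ?S = "(\<lambda>(i, j). dist (T i) (T j)) ` {(i, j). i \<in> I \<and> j \<in> I \<and> i \<noteq> j}"
      have "finite {(i, j). i \<in> I \<and> j \<in> I \<and> i \<noteq> j}" by (rule finite_subset[of _ "I \<times> I"]) (use I in auto)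
      then have S: "finite ?S" "?S \<noteq> {}" using True by auto
      have "0 < Min ?S" using inj by (subst Min_gr_iff[OF S]) (auto dest: inj_onD)
      moreover have "Min ?S \<le> dist (T i) (T j)" if "i \<in> I" "j \<in> I" "i \<noteq> j" for i j
        by (rule Min_le[OF S(1)]) (use that in force)
      ultimately show ?thesis by (intro exI[of _ "Min ?S / 2"]) auto
    qed (auto intro: exI[of _ 1])
    then obtain \<delta> where \<delta>: "0 < \<delta>" "\<And>i j. i \<in> I \<Longrightarrow> j \<in> I \<Longrightarrow> i \<noteq> j \<Longrightarrow> 2 * \<delta> \<le> dist (T i) (T j)" by blast
    have "\<exists>U\<in>\<B>. T i \<in> U \<and> U \<subseteq> ball (T i) \<delta>" for i
      using topological_basisE[OF \<B>(2), of "ball (T i) \<delta>" "T i"] \<delta>(1) by (metis centre_in_ball open_ball)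
    then obtain U where U: "\<And>i. U i \<in> \<B>" "\<And>i. T i \<in> U i" "\<And>i. U i \<subseteq> ball (T i) \<delta>" by metis
    have "\<exists>k. T i \<in> W k" for i using W(1) by blast
    then obtain k where k: "\<And>i. T i \<in> W (k i)" by metis
    define D where "D = (\<lambda>i\<in>I. U i \<inter> W (k i) \<inter> E)"
    have "disjoint_family_on D I"
    proof (unfold disjoint_family_on_def, safe)
      fix i j x assume ij: "i \<in> I" "j \<in> I" "i \<noteq> j" and "x \<in> D i" "x \<in> D j"
      then have "dist (T i) x < \<delta>" "dist (T j) x < \<delta>" using U(3)[of i] U(3)[of j] by (auto simp: D_def)
      then have "dist (T i) (T j) < 2 * \<delta>" using dist_triangle2[of "T i" "T j" x] by simp
      then show "x \<in> {}" using \<delta>(2)[OF ij] by simp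
    qed
    moreover have "D \<in> I \<rightarrow>\<^sub>E \<C>" using U(1) by (auto simp: D_def \<C>_def)
    moreover have "T \<in> Pi\<^sub>E I D" using T U(2) k by (auto simp: D_def PiE_iff)
    ultimately show "\<exists>D\<in>\<R>. T \<in> Pi\<^sub>E I D" by (auto simp: \<R>_def)
  qed
qed

text \<open>The hypothesis \<open>eq\<close> is the identity for boxes with disjoint sides inside
  \<open>E\<close>. A set of tuples with distinct entries is cut into countably many disjoint
  pieces, each inside such a box, and the pieces are summed.\<close>

theorem tuples_weighted:
  fixes M :: "'w measure" and \<Theta> :: "'a::{metric_space, second_countable_topology} measure" and X :: "'w \<Rightarrow> 'a set"
    and I :: "nat set"
  assumes s [measurable_cong]: "sets \<Theta> = sets borel" and sf: "sigma_finite_measure \<Theta>" and I: "finite I"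
    and W: "(\<Union>k. W k) = UNIV" "\<And>k :: nat. W k \<in> sets borel" "\<And>k. emeasure \<Theta> (W k) < \<infinity>"
    and G [measurable]: "G \<in> borel_measurable M" and Gfin: "\<And>w. w \<in> space M \<Longrightarrow> G w < \<infinity>"
    and cm: "\<And>B. B \<in> sets \<Theta> \<Longrightarrow> (\<lambda>w. ecard (X w \<inter> B)) \<in> borel_measurable M"
    and fin: "\<And>w k. w \<in> space M \<Longrightarrow> G w \<noteq> 0 \<Longrightarrow> finite (X w \<inter> W k)"
    and c: "c < \<infinity>" and E: "E \<in> sets borel"
    and eq: "\<And>D. (\<And>i. i \<in> I \<Longrightarrow> D i \<in> sets \<Theta>) \<Longrightarrow> (\<And>i. i \<in> I \<Longrightarrow> D i \<subseteq> E \<and> emeasure \<Theta> (D i) < \<infinity>) \<Longrightarrow> disjoint_family_on D I \<Longrightarrow>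
      (\<integral>\<^sup>+w. (\<Prod>i\<in>I. ecard (X w \<inter> D i)) * G w \<partial>M) = c * (\<Prod>i\<in>I. emeasure \<Theta> (D i))"
    and A: "A \<in> sets (Pi\<^sub>M I (\<lambda>_. \<Theta>))" "A \<subseteq> {T \<in> I \<rightarrow>\<^sub>E E. inj_on T I}"
  shows "(\<lambda>w. ecard (A \<inter> (I \<rightarrow>\<^sub>E X w)) * G w) \<in> borel_measurable M \<and>
    (\<integral>\<^sup>+w. ecard (A \<inter> (I \<rightarrow>\<^sub>E X w)) * G w \<partial>M) = c * emeasure (Pi\<^sub>M I (\<lambda>_. \<Theta>)) A"
proof -
  let ?P = "Pi\<^sub>M I (\<lambda>_. \<Theta>)"
  obtain \<R> where \<R>: "countable \<R>" "\<And>D i. D \<in> \<R> \<Longrightarrow> i \<in> I \<Longrightarrow> D i \<in> sets borel \<and> D i \<subseteq> E \<and> (\<exists>k. D i \<subseteq> W k)"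
    "\<And>D. D \<in> \<R> \<Longrightarrow> disjoint_family_on D I"
    "\<And>T. T \<in> (I \<rightarrow>\<^sub>E E) \<Longrightarrow> inj_on T I \<Longrightarrow> \<exists>D\<in>\<R>. T \<in> Pi\<^sub>E I D"
    using countable_rectangle_cover[OF W(1,2) E I] by blast
  have rect: "(\<lambda>w. ecard (B \<inter> Pi\<^sub>E I D \<inter> (I \<rightarrow>\<^sub>E X w)) * G w) \<in> borel_measurable M \<and>
    (\<integral>\<^sup>+w. ecard (B \<inter> Pi\<^sub>E I D \<inter> (I \<rightarrow>\<^sub>E X w)) * G w \<partial>M) = c * emeasure ?P (B \<inter> Pi\<^sub>E I D)"
    if D: "D \<in> \<R>" and B: "B \<in> sets ?P" for B D
  proof (rule tuples_in_rectangle[OF sf I _ _ G Gfin cm _ c _ B])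
    fix i assume i: "i \<in> I"
    show "D i \<in> sets \<Theta>" using \<R>(2)[OF D i] s by simp
    obtain k where k: "D i \<subseteq> W k" using \<R>(2)[OF D i] by blast
    have "emeasure \<Theta> (D i) \<le> emeasure \<Theta> (W k)" using k W(2) s by (intro emeasure_mono) auto
    then show "emeasure \<Theta> (D i) < \<infinity>" using W(3)[of k] by (rule le_less_trans)
    show "finite (X w \<inter> D i)" if "w \<in> space M" "G w \<noteq> 0" for w
      using fin[OF that, of k] by (rule rev_finite_subset) (use k in auto)
  next
    fix D' assume D': "\<And>i. i \<in> I \<Longrightarrow> D' i \<in> sets \<Theta>" "\<And>i. i \<in> I \<Longrightarrow> D' i \<subseteq> D i"
    show "(\<integral>\<^sup>+w. (\<Prod>i\<in>I. ecard (X w \<inter> D' i)) * G w \<partial>M) = c * (\<Prod>i\<in>I. emeasure \<Theta> (D' i))"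
    proof (rule eq)
      fix i assume i: "i \<in> I"
      obtain k where k: "D i \<subseteq> W k" using \<R>(2)[OF D i] by blast
      have "emeasure \<Theta> (D' i) \<le> emeasure \<Theta> (W k)" using k D'(2)[OF i] W(2) s by (intro emeasure_mono) auto
      then have "emeasure \<Theta> (D' i) < \<infinity>" using W(3)[of k] by (rule le_less_trans)
      then show "D' i \<subseteq> E \<and> emeasure \<Theta> (D' i) < \<infinity>" using \<R>(2)[OF D i] D'(2)[OF i] by blast
    next
      show "disjoint_family_on D' I"
        using \<R>(3)[OF D] D'(2) unfolding disjoint_family_on_def by blast
    qed (use D' in auto)
  qed auto
  show ?thesis
  proof (cases "\<R> = {}")
    case True
    then have "A = {}" using A(2) \<R>(4) by blast
    then show ?thesis by (simp add: ecard_finite)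
  next
    case False
    define D where "D k = from_nat_into \<R> k" for k
    have D: "D k \<in> \<R>" for k using False by (simp add: D_def from_nat_into)
    have Dsets: "Pi\<^sub>E I (D k) \<in> sets ?P" for k
      using \<R>(2)[OF D] s I by (intro sets_PiM_I_finite) auto
    define B where "B k = A \<inter> disjointed (\<lambda>k. Pi\<^sub>E I (D k)) k" for k
    have Bs: "B k \<in> sets ?P" for k
    proof -
      have "range (disjointed (\<lambda>k. Pi\<^sub>E I (D k))) \<subseteq> sets ?P" using Dsets by (intro sets.range_disjointed_sets) blast
      then show ?thesis unfolding B_def using A(1) by (intro sets.Int) blast+
    qed
    have BD: "B k \<inter> Pi\<^sub>E I (D k) = B k" for k
      using disjointed_subset[of "\<lambda>k. Pi\<^sub>E I (D k)" k] by (auto simp: B_def)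
    have "A \<subseteq> (\<Union>k. Pi\<^sub>E I (D k))"
    proof
      fix T assume "T \<in> A"
      then obtain D' where D': "D' \<in> \<R>" "T \<in> Pi\<^sub>E I D'" using A(2) \<R>(4)[of T] by blast
      obtain k where "D k = D'" using from_nat_into_surj[OF \<R>(1) D'(1)] by (auto simp: D_def)
      then show "T \<in> (\<Union>k. Pi\<^sub>E I (D k))" using D' by auto
    qed
    then have AB: "A = (\<Union>k. B k)"
      using UN_disjointed_eq[of "\<lambda>k. Pi\<^sub>E I (D k)"] by (auto simp: B_def)
    have dis: "disjoint_family B"
      using disjoint_family_disjointed[of "\<lambda>k. Pi\<^sub>E I (D k)"] by (auto simp: B_def disjoint_family_on_def)
    have r: "(\<lambda>w. ecard (B k \<inter> (I \<rightarrow>\<^sub>E X w)) * G w) \<in> borel_measurable M"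
      "(\<integral>\<^sup>+w. ecard (B k \<inter> (I \<rightarrow>\<^sub>E X w)) * G w \<partial>M) = c * emeasure ?P (B k)" for k
      using rect[OF D Bs, of k k] unfolding BD by auto
    have sum: "(\<lambda>w. ecard (A \<inter> (I \<rightarrow>\<^sub>E X w)) * G w) = (\<lambda>w. suminf (\<lambda>k. ecard (B k \<inter> (I \<rightarrow>\<^sub>E X w)) * G w))"
    proof
      fix w
      have "A \<inter> (I \<rightarrow>\<^sub>E X w) = (\<Union>k. B k \<inter> (I \<rightarrow>\<^sub>E X w))" unfolding AB by auto
      then have "ecard (A \<inter> (I \<rightarrow>\<^sub>E X w)) = suminf (\<lambda>k. ecard (B k \<inter> (I \<rightarrow>\<^sub>E X w)))"
        by (simp only:) (rule ecard_suminf, use dis in \<open>unfold disjoint_family_on_def, blast\<close>)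
      then show "ecard (A \<inter> (I \<rightarrow>\<^sub>E X w)) * G w = suminf (\<lambda>k. ecard (B k \<inter> (I \<rightarrow>\<^sub>E X w)) * G w)" by simp
    qed
    have "(\<integral>\<^sup>+w. ecard (A \<inter> (I \<rightarrow>\<^sub>E X w)) * G w \<partial>M) = suminf (\<lambda>k. c * emeasure ?P (B k))"
      unfolding sum by (subst nn_integral_suminf) (auto simp: r)
    also have "\<dots> = c * suminf (\<lambda>k. emeasure ?P (B k))" by simp
    also have "suminf (\<lambda>k. emeasure ?P (B k)) = emeasure ?P A"
      unfolding AB by (rule suminf_emeasure) (use Bs dis in auto)
    finally have eqA: "(\<integral>\<^sup>+w. ecard (A \<inter> (I \<rightarrow>\<^sub>E X w)) * G w \<partial>M) = c * emeasure ?P A" .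
    have "(\<lambda>w. suminf (\<lambda>k. ecard (B k \<inter> (I \<rightarrow>\<^sub>E X w)) * G w)) \<in> borel_measurable M"
      by (rule borel_measurable_suminf_order) (rule r(1))
    then show ?thesis using eqA unfolding sum by (intro conjI)
  qed
qed

text \<open>Counts are finite only almost surely, while the monotone class argument needs finiteness
  at every point of the probability space. The indicator of this event is therefore made part of the
  weight.\<close>

definition locally_finite_event :: "'w measure \<Rightarrow> ('w \<Rightarrow> 'a set) \<Rightarrow> (nat \<Rightarrow> 'a set) \<Rightarrow> 'w set"
  where "locally_finite_event M X W = {w \<in> space M. \<forall>k. ecard (X w \<inter> W k) < \<infinity>}"

lemma poisson_locally_finite:
  assumes X: "poisson_process M \<Theta> X" and W: "\<And>k. W k \<in> sets \<Theta>" "\<And>k. emeasure \<Theta> (W k) < \<infinity>"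
  shows "locally_finite_event M X W \<in> sets M" "AE w in M. w \<in> locally_finite_event M X W"
proof -
  interpret poisson_process M \<Theta> X by fact
  have [measurable]: "(\<lambda>w. ecard (X w \<inter> W k)) \<in> borel_measurable M" for k by (rule count_measurable[OF W(1)])
  show "locally_finite_event M X W \<in> sets M" unfolding locally_finite_event_def by measurable
  have "AE w in M. \<forall>k. finite (X w \<inter> W k)"
    by (subst AE_all_countable) (auto intro: poisson_AE_finite[OF X W])
  then show "AE w in M. w \<in> locally_finite_event M X W"
    using AE_space by eventually_elim (auto simp: locally_finite_event_def ecard_less_top[unfolded infinity_ennreal_def])
qed

context
  fixes M :: "'w measure" and \<Theta> :: "'a::{metric_space, second_countable_topology} measure" and X :: "'w \<Rightarrow> 'a set"
    and I :: "nat set" and W :: "nat \<Rightarrow> 'a set" and K :: "'a set"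
  assumes X: "poisson_process M \<Theta> X"
    and s [measurable_cong]: "sets \<Theta> = sets borel" and sf: "sigma_finite_measure \<Theta>" and I: "finite I"
    and W: "(\<Union>k. W k) = UNIV" "\<And>k :: nat. W k \<in> sets borel" "\<And>k. emeasure \<Theta> (W k) < \<infinity>"
    and K: "K \<in> sets borel" "emeasure \<Theta> K < \<infinity>"
begin

interpretation poisson_process M \<Theta> X by (rule X)

private abbreviation "lf \<equiv> locally_finite_event M X W"

lemma lf_measurable: "lf \<in> sets M" and AE_lf: "AE w in M. w \<in> lf"
  using poisson_locally_finite[OF X, of W] W s by auto

text \<open>The points of the tuple lie outside \<open>K\<close>, so their numbers are independent
  of the event that \<open>K\<close> is empty. The expectation factors into the void probability and
  the means of the counts.\<close>

theorem tuples_void: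
  assumes A: "A \<in> sets (Pi\<^sub>M I (\<lambda>_. \<Theta>))" "A \<subseteq> {T \<in> I \<rightarrow>\<^sub>E - K. inj_on T I}"
  shows "(\<lambda>w. ecard (A \<inter> (I \<rightarrow>\<^sub>E X w)) * (indicator {0} (ecard (X w \<inter> K)) * indicator lf w)) \<in> borel_measurable M"
    and "(\<integral>\<^sup>+w. ecard (A \<inter> (I \<rightarrow>\<^sub>E X w)) * (indicator {0} (ecard (X w \<inter> K)) * indicator lf w) \<partial>M) =
      ennreal (exp (- measure \<Theta> K)) * emeasure (Pi\<^sub>M I (\<lambda>_. \<Theta>)) A"
proof -
  define G :: "'w \<Rightarrow> ennreal" where "G w = indicator {0} (ecard (X w \<inter> K)) * indicator lf w" for w
  have Ks: "K \<in> sets \<Theta>" using K s by simp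
  have cm: "(\<lambda>w. ecard (X w \<inter> B)) \<in> borel_measurable M" if "B \<in> sets \<Theta>" for B by (rule count_measurable[OF that])
  note [measurable] = cm[OF Ks] lf_measurable
  have G [measurable]: "G \<in> borel_measurable M" unfolding G_def by measurable
  have "(\<lambda>w. ecard (A \<inter> (I \<rightarrow>\<^sub>E X w)) * G w) \<in> borel_measurable M \<and>
    (\<integral>\<^sup>+w. ecard (A \<inter> (I \<rightarrow>\<^sub>E X w)) * G w \<partial>M) = ennreal (exp (- measure \<Theta> K)) * emeasure (Pi\<^sub>M I (\<lambda>_. \<Theta>)) A"
  proof (rule tuples_weighted[OF s sf I W G _ cm _ _ _ _ A])
    show "- K \<in> sets borel" using K by auto
    show "G w < \<infinity>" for w by (simp add: G_def split: split_indicator)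
    show "finite (X w \<inter> W k)" if "G w \<noteq> 0" for w k
      using that by (auto simp: G_def locally_finite_event_def ecard_less_top[unfolded infinity_ennreal_def] split: split_indicator_asm)
    fix D assume D: "\<And>i. i \<in> I \<Longrightarrow> D i \<in> sets \<Theta>" "\<And>i. i \<in> I \<Longrightarrow> D i \<subseteq> - K \<and> emeasure \<Theta> (D i) < \<infinity>" "disjoint_family_on D I"
    \<comment> \<open>A fresh index stands for the set \<open>K\<close> in the independent family;
      the function attached to it tests for the count 0.\<close>
    obtain j where j: "j \<notin> I" using ex_new_if_finite[OF infinite_UNIV_nat I] by blast
    define D' where "D' = D(j := K)"
    define f :: "nat \<Rightarrow> ennreal \<Rightarrow> ennreal" where "f i = (if i = j then indicator {0} else (\<lambda>x. x))" for i
    have D'I: "D' i = D i" "f i = (\<lambda>x. x)" if "i \<in> I" for i using that j by (auto simp: D'_def f_def)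
    have D'j: "D' j = K" "f j = indicator {0}" by (auto simp: D'_def f_def)
    have "(\<integral>\<^sup>+w. (\<Prod>i\<in>I. ecard (X w \<inter> D i)) * G w \<partial>M) = (\<integral>\<^sup>+w. (\<Prod>i\<in>insert j I. f i (ecard (X w \<inter> D' i))) \<partial>M)"
    proof (rule nn_integral_cong_AE, use AE_lf in eventually_elim)
      case (elim w)
      have "(\<Prod>i\<in>I. f i (ecard (X w \<inter> D' i))) = (\<Prod>i\<in>I. ecard (X w \<inter> D i))"
        by (rule prod.cong) (auto simp: D'I)
      then show ?case using elim I j by (simp add: G_def D'j mult.commute)
    qed
    also have "\<dots> = (\<Prod>i\<in>insert j I. \<integral>\<^sup>+w. f i (ecard (X w \<inter> D' i)) \<partial>M)"
    proof (rule poisson_indep_nn_integral[OF X])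
      show "disjoint_family_on D' (insert j I)"
        using D(2,3) j unfolding disjoint_family_on_def D'_def by auto
      show "D' i \<in> sets \<Theta>" if "i \<in> insert j I" for i using that D(1) Ks by (auto simp: D'_def)
    qed (use I in \<open>auto simp: f_def\<close>)
    also have "\<dots> = (\<integral>\<^sup>+w. indicator {0} (ecard (X w \<inter> K)) \<partial>M) * (\<Prod>i\<in>I. \<integral>\<^sup>+w. ecard (X w \<inter> D i) \<partial>M)"
      using I j by (simp add: D'j D'I cong: prod.cong)
    also have "(\<Prod>i\<in>I. \<integral>\<^sup>+w. ecard (X w \<inter> D i) \<partial>M) = (\<Prod>i\<in>I. emeasure \<Theta> (D i))"
      using D by (intro prod.cong refl poisson_count_mean[OF X]) auto
    also have "(\<integral>\<^sup>+w. indicator {0} (ecard (X w \<inter> K)) \<partial>M) = ennreal (exp (- measure \<Theta> K))"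
      using poisson_count_prob[OF X Ks K(2), of 0] by simp
    finally show "(\<integral>\<^sup>+w. (\<Prod>i\<in>I. ecard (X w \<inter> D i)) * G w \<partial>M) = ennreal (exp (- measure \<Theta> K)) * (\<Prod>i\<in>I. emeasure \<Theta> (D i))" .
  qed auto
  then show "(\<lambda>w. ecard (A \<inter> (I \<rightarrow>\<^sub>E X w)) * (indicator {0} (ecard (X w \<inter> K)) * indicator lf w)) \<in> borel_measurable M"
    and "(\<integral>\<^sup>+w. ecard (A \<inter> (I \<rightarrow>\<^sub>E X w)) * (indicator {0} (ecard (X w \<inter> K)) * indicator lf w) \<partial>M) =
      ennreal (exp (- measure \<Theta> K)) * emeasure (Pi\<^sub>M I (\<lambda>_. \<Theta>)) A"
    by (simp_all add: G_def)
qed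

text \<open>If all counts are at least 1 and, together with \<open>b\<close>, sum to the number of
  sets, then each is 1 and \<open>b\<close> is 0. This turns a product of counts under a constraint
  on the total into a product of independent events.\<close>

lemma prod_counts_full:
  fixes a :: "nat \<Rightarrow> nat"
  assumes "finite I"
  shows "(\<Prod>i\<in>I. a i) * of_bool ((\<Sum>i\<in>I. a i) + b = card I) = (\<Prod>i\<in>I. of_bool (a i = 1)) * of_bool (b = 0)"
proof (cases "\<exists>i\<in>I. a i = 0")
  case True
  then obtain i where i: "i \<in> I" "a i = 0" by blast
  have "(\<Prod>i\<in>I. a i) = 0" "(\<Prod>i\<in>I. of_bool (a i = 1) :: nat) = 0"
    by (rule prod_zero[OF assms], rule bexI[of _ i], use i in simp_all)+
  then show ?thesis by simp
next
  case False
  then have ge: "\<And>i. i \<in> I \<Longrightarrow> 1 \<le> a i" by (auto simp: Suc_le_eq)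
  show ?thesis
  proof (cases "(\<Sum>i\<in>I. a i) + b = card I")
    case True
    have "(\<Sum>i\<in>I. 1) \<le> (\<Sum>i\<in>I. a i)" by (rule sum_mono) (rule ge)
    then have b: "b = 0" and e: "(\<Sum>i\<in>I. a i) = card I" using True by auto
    have "a i = 1" if "i \<in> I" for i
    proof (rule ccontr)
      assume "a i \<noteq> 1"
      then have a1: "1 < a i" using ge[OF that] by linarith
      have "(\<Sum>i\<in>I. 1) < (\<Sum>i\<in>I. a i)"
        using ge that assms a1 by (intro sum_strict_mono_ex1 bexI[of _ i]) auto
      then show False using e by simp
    qed
    then show ?thesis using b by simp
  next
    case n: False
    have "\<exists>i\<in>I. a i \<noteq> 1" if "b = 0"
    proof (rule ccontr)
      assume "\<not> ?thesis"
      then have "(\<Sum>i\<in>I. a i) = (\<Sum>i\<in>I. 1)" by (intro sum.cong) auto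
      then show False using n that by simp
    qed
    then show ?thesis using n assms by auto
  qed
qed

text \<open>If \<open>K\<close> has exactly \<open>card I\<close> points, the product of the counts
  in disjoint subsets is the indicator of one point in each and none in the remainder. The Poisson
  probabilities \<theta> exp(-\<theta>) of the subsets and exp(-\<theta>') of the remainder
  recombine to the void probability of \<open>K\<close> times the product of the masses.\<close>

theorem tuples_full:
  assumes A: "A \<in> sets (Pi\<^sub>M I (\<lambda>_. \<Theta>))" "A \<subseteq> {T \<in> I \<rightarrow>\<^sub>E K. inj_on T I}"
  shows "(\<lambda>w. ecard (A \<inter> (I \<rightarrow>\<^sub>E X w)) * (indicator {of_nat (card I)} (ecard (X w \<inter> K)) * indicator lf w)) \<in> borel_measurable M"
    and "(\<integral>\<^sup>+w. ecard (A \<inter> (I \<rightarrow>\<^sub>E X w)) * (indicator {of_nat (card I)} (ecard (X w \<inter> K)) * indicator lf w) \<partial>M) =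
      ennreal (exp (- measure \<Theta> K)) * emeasure (Pi\<^sub>M I (\<lambda>_. \<Theta>)) A"
proof -
  define G :: "'w \<Rightarrow> ennreal" where "G w = indicator {of_nat (card I)} (ecard (X w \<inter> K)) * indicator lf w" for w
  have Ks: "K \<in> sets \<Theta>" using K s by simp
  have cm: "(\<lambda>w. ecard (X w \<inter> B)) \<in> borel_measurable M" if "B \<in> sets \<Theta>" for B by (rule count_measurable[OF that])
  note [measurable] = cm[OF Ks] lf_measurable
  have G [measurable]: "G \<in> borel_measurable M" unfolding G_def by measurable
  have "(\<lambda>w. ecard (A \<inter> (I \<rightarrow>\<^sub>E X w)) * G w) \<in> borel_measurable M \<and>
    (\<integral>\<^sup>+w. ecard (A \<inter> (I \<rightarrow>\<^sub>E X w)) * G w \<partial>M) = ennreal (exp (- measure \<Theta> K)) * emeasure (Pi\<^sub>M I (\<lambda>_. \<Theta>)) A"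
  proof (rule tuples_weighted[OF s sf I W G _ cm _ _ _ _ A])
    show "K \<in> sets borel" by (rule K)
    show "G w < \<infinity>" for w by (simp add: G_def split: split_indicator)
    show "finite (X w \<inter> W k)" if "G w \<noteq> 0" for w k
      using that by (auto simp: G_def locally_finite_event_def ecard_less_top[unfolded infinity_ennreal_def] split: split_indicator_asm)
    fix D assume D: "\<And>i. i \<in> I \<Longrightarrow> D i \<in> sets \<Theta>" "\<And>i. i \<in> I \<Longrightarrow> D i \<subseteq> K \<and> emeasure \<Theta> (D i) < \<infinity>" "disjoint_family_on D I"
    obtain j where j: "j \<notin> I" using ex_new_if_finite[OF infinite_UNIV_nat I] by blast
    \<comment> \<open>The remainder of \<open>K\<close>, added under a fresh index as a further
      member of the independent family.\<close>
    define K' where "K' = K - (\<Union>i\<in>I. D i)"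
    have UD: "(\<Union>i\<in>I. D i) \<in> sets \<Theta>" using D(1) I by auto
    have K's: "K' \<in> sets \<Theta>" using Ks UD by (auto simp: K'_def)
    have "emeasure \<Theta> K' \<le> emeasure \<Theta> K" using Ks by (intro emeasure_mono) (auto simp: K'_def)
    then have K'fin: "emeasure \<Theta> K' < \<infinity>" using K(2) by (rule le_less_trans)
    define D' where "D' = D(j := K')"
    define f :: "nat \<Rightarrow> ennreal \<Rightarrow> ennreal" where "f i = (if i = j then indicator {of_nat 0} else indicator {of_nat 1})" for i
    have D'I: "D' i = D i" "f i = indicator {of_nat 1}" if "i \<in> I" for i using that j by (auto simp: D'_def f_def)
    have D'j: "D' j = K'" "f j = indicator {of_nat 0}" by (auto simp: D'_def f_def)
    have AEK: "AE w in M. finite (X w \<inter> K)" by (rule poisson_AE_finite[OF X Ks K(2)])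
    have "(\<integral>\<^sup>+w. (\<Prod>i\<in>I. ecard (X w \<inter> D i)) * G w \<partial>M) = (\<integral>\<^sup>+w. (\<Prod>i\<in>insert j I. f i (ecard (X w \<inter> D' i))) \<partial>M)"
    proof (rule nn_integral_cong_AE, use AE_lf AEK in eventually_elim)
      case (elim w)
      define a where "a i = card (X w \<inter> D i)" for i
      define b where "b = card (X w \<inter> K')"
      have finD: "finite (X w \<inter> D i)" if "i \<in> I" for i
        using elim(2) by (rule rev_finite_subset) (use D(2)[OF that] in auto)
      have finK': "finite (X w \<inter> K')" using elim(2) by (rule rev_finite_subset) (auto simp: K'_def)
      have "X w \<inter> K = (\<Union>i\<in>I. X w \<inter> D i) \<union> (X w \<inter> K')" using D(2) by (auto simp: K'_def)
      moreover have "card ((\<Union>i\<in>I. X w \<inter> D i) \<union> (X w \<inter> K')) = card (\<Union>i\<in>I. X w \<inter> D i) + b"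
        unfolding b_def using finD I by (intro card_Un_disjoint finite_UN_I finK') (auto simp: K'_def)
      moreover have "card (\<Union>i\<in>I. X w \<inter> D i) = (\<Sum>i\<in>I. a i)"
        unfolding a_def using finD I D(3) by (intro card_UN_disjoint) (auto simp: disjoint_family_on_def)
      ultimately have cK: "card (X w \<inter> K) = (\<Sum>i\<in>I. a i) + b" by simp
      have "(\<Prod>i\<in>I. ecard (X w \<inter> D i)) * G w = of_nat (\<Prod>i\<in>I. a i) * indicator {of_nat (card I)} (of_nat ((\<Sum>i\<in>I. a i) + b) :: ennreal)"
        using elim finD by (simp add: G_def ecard_finite a_def[symmetric] cK of_nat_prod)
      also have "\<dots> = of_nat ((\<Prod>i\<in>I. a i) * of_bool ((\<Sum>i\<in>I. a i) + b = card I))"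
        by (auto split: split_indicator simp del: of_nat_add)
      also have "\<dots> = of_nat ((\<Prod>i\<in>I. of_bool (a i = 1)) * of_bool (b = 0))"
        unfolding prod_counts_full[OF I] ..
      also have "\<dots> = (\<Prod>i\<in>I. indicator {of_nat 1} (of_nat (a i) :: ennreal)) * indicator {of_nat 0} (of_nat b :: ennreal)"
        by (auto simp: of_nat_prod indicator_def intro!: prod.cong)
      also have "\<dots> = (\<Prod>i\<in>I. f i (ecard (X w \<inter> D' i))) * f j (ecard (X w \<inter> D' j))"
        using finK' finD by (simp add: D'j D'I ecard_finite a_def b_def cong: prod.cong)
      finally show ?case using I j by (simp add: mult.commute)
    qed
    also have "\<dots> = (\<Prod>i\<in>insert j I. \<integral>\<^sup>+w. f i (ecard (X w \<inter> D' i)) \<partial>M)"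
    proof (rule poisson_indep_nn_integral[OF X])
      show "disjoint_family_on D' (insert j I)"
        using D(3) j unfolding disjoint_family_on_def D'_def K'_def by auto
      show "D' i \<in> sets \<Theta>" if "i \<in> insert j I" for i using that D(1) K's by (auto simp: D'_def)
    qed (use I in \<open>auto simp: f_def\<close>)
    also have "\<dots> = (\<integral>\<^sup>+w. indicator {of_nat 0} (ecard (X w \<inter> K')) \<partial>M) * (\<Prod>i\<in>I. \<integral>\<^sup>+w. indicator {of_nat 1} (ecard (X w \<inter> D i)) \<partial>M)"
    proof -
      have "(\<Prod>i\<in>I. \<integral>\<^sup>+w. f i (ecard (X w \<inter> D' i)) \<partial>M) = (\<Prod>i\<in>I. \<integral>\<^sup>+w. indicator {of_nat 1} (ecard (X w \<inter> D i)) \<partial>M)"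
        by (rule prod.cong) (simp_all add: D'I)
      then show ?thesis by (simp only: prod.insert[OF I j] D'j)
    qed
    also have "\<dots> = ennreal (exp (- measure \<Theta> K')) * (\<Prod>i\<in>I. ennreal (measure \<Theta> (D i) * exp (- measure \<Theta> (D i))))"
      using D(1,2) poisson_count_prob[OF X K's K'fin, of 0]
      by (intro arg_cong2[where f = "(*)"] prod.cong) (auto simp: poisson_count_prob[OF X, of _ 1, simplified])
    also have "\<dots> = ennreal (exp (- measure \<Theta> K') * (\<Prod>i\<in>I. exp (- measure \<Theta> (D i)))) * (\<Prod>i\<in>I. ennreal (measure \<Theta> (D i)))"
      by (simp add: prod_ennreal ennreal_mult[symmetric] prod.distrib prod_nonneg ac_simps)
    also have "exp (- measure \<Theta> K') * (\<Prod>i\<in>I. exp (- measure \<Theta> (D i))) = exp (- (measure \<Theta> K' + (\<Sum>i\<in>I. measure \<Theta> (D i))))"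
      by (simp add: exp_sum[OF I, symmetric] mult_exp_exp sum_negf)
    also have "measure \<Theta> K' + (\<Sum>i\<in>I. measure \<Theta> (D i)) = measure \<Theta> K"
    proof -
      have "(\<Sum>i\<in>I. measure \<Theta> (D i)) = measure \<Theta> (\<Union>i\<in>I. D i)"
        using I D by (intro measure_finite_Union[symmetric]) (auto simp: less_top)
      moreover have "measure \<Theta> K' = measure \<Theta> K - measure \<Theta> (\<Union>i\<in>I. D i)"
        unfolding K'_def using K(2) Ks UD D(2) by (intro measure_Diff) (auto simp: less_top)
      ultimately show ?thesis by simp
    qed
    also have "(\<Prod>i\<in>I. ennreal (measure \<Theta> (D i))) = (\<Prod>i\<in>I. emeasure \<Theta> (D i))"
      using D(2) by (intro prod.cong refl emeasure_eq_ennreal_measure[symmetric]) (auto simp: less_top)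
    finally show "(\<integral>\<^sup>+w. (\<Prod>i\<in>I. ecard (X w \<inter> D i)) * G w \<partial>M) = ennreal (exp (- measure \<Theta> K)) * (\<Prod>i\<in>I. emeasure \<Theta> (D i))" .
  qed auto
  then show "(\<lambda>w. ecard (A \<inter> (I \<rightarrow>\<^sub>E X w)) * (indicator {of_nat (card I)} (ecard (X w \<inter> K)) * indicator lf w)) \<in> borel_measurable M"
    and "(\<integral>\<^sup>+w. ecard (A \<inter> (I \<rightarrow>\<^sub>E X w)) * (indicator {of_nat (card I)} (ecard (X w \<inter> K)) * indicator lf w) \<partial>M) =
      ennreal (exp (- measure \<Theta> K)) * emeasure (Pi\<^sub>M I (\<lambda>_. \<Theta>)) A"
    by (simp_all add: G_def)
qed

end

section \<open>Linear systems\<close>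

definition row_matrix :: "nat \<Rightarrow> (nat \<Rightarrow> seq) \<Rightarrow> real Matrix.mat"
  where "row_matrix m T = Matrix.mat m m (\<lambda>(i, j). coord (T i) j)"

definition row_det :: "nat \<Rightarrow> (nat \<Rightarrow> seq) \<Rightarrow> real"
  where "row_det m T = Determinant.det (row_matrix m T)"

text \<open>Since z ranges over \<open>Rn m\<close>, only the first \<open>m\<close> coordinates of
  the \<open>T i\<close> matter, even if these lie in a larger \<open>Rn n\<close>. For m < n this
  is what expresses the section of the cell by \<open>Rn m\<close>.\<close>

definition regular :: "nat \<Rightarrow> (nat \<Rightarrow> seq) \<Rightarrow> bool"
  where "regular m T \<longleftrightarrow> (\<forall>z\<in>Rn m. (\<forall>i<m. inner (T i) z = 0) \<longrightarrow> z = 0)"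

text \<open>The generalised cross product of the rows other than the i-th: its scalar product with a
  vector is the determinant with that vector as i-th row.\<close>

definition cofactor_vec :: "nat \<Rightarrow> (nat \<Rightarrow> seq) \<Rightarrow> nat \<Rightarrow> seq"
  where "cofactor_vec m T i = emb m (\<lambda>j. cofactor (row_matrix m T) i j)"

text \<open>Cramer's rule: the cofactor vectors divided by the determinant form the basis dual to
  the rows. The explicit formula makes the solution a measurable function of the rows.\<close>

definition solution :: "nat \<Rightarrow> (nat \<Rightarrow> seq) \<Rightarrow> (nat \<Rightarrow> real) \<Rightarrow> seq"
  where "solution m T s = (\<Sum>i<m. s i *\<^sub>R cofactor_vec m T i) /\<^sub>R row_det m T"

lemma row_matrix_carrier [simp]: "row_matrix m T \<in> carrier_mat m m"
  by (simp add: row_matrix_def)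

lemma row_matrix_dim [simp]: "dim_row (row_matrix m T) = m" "dim_col (row_matrix m T) = m"
  by (simp_all add: row_matrix_def)

lemma regular_iff_det: "regular m T \<longleftrightarrow> row_det m T \<noteq> 0"
proof -
  have mv: "row_matrix m T *\<^sub>v v = Matrix.vec m (\<lambda>i. inner (T i) (emb m (\<lambda>j. vec_index v j)))" if v: "v \<in> carrier_vec m" for v
    by (rule eq_vecI)
       (use v in \<open>auto simp: row_matrix_def scalar_prod_def inner_Rn'[OF emb_in_Rn] lookup_emb atLeast0LessThan intro!: sum.cong\<close>)
  have "row_det m T = 0 \<longleftrightarrow> (\<exists>v. v \<in> carrier_vec m \<and> v \<noteq> 0\<^sub>v m \<and> row_matrix m T *\<^sub>v v = 0\<^sub>v m)"
    unfolding row_det_def by (rule det_0_iff_vec_prod_zero) simp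
  also have "\<dots> \<longleftrightarrow> \<not> regular m T"
  proof
    assume "\<exists>v. v \<in> carrier_vec m \<and> v \<noteq> 0\<^sub>v m \<and> row_matrix m T *\<^sub>v v = 0\<^sub>v m"
    then obtain v where v: "v \<in> carrier_vec m" "v \<noteq> 0\<^sub>v m" "row_matrix m T *\<^sub>v v = 0\<^sub>v m" by blast
    let ?z = "emb m (\<lambda>j. vec_index v j)"
    have "inner (T i) ?z = 0" if "i < m" for i
      using arg_cong[OF v(3), of "\<lambda>x. vec_index x i"] that unfolding mv[OF v(1)] by simp
    moreover have "?z \<noteq> 0"
    proof
      assume z: "?z = 0"
      have "vec_index v j = 0" if "j < m" for j
        using arg_cong[OF z, of "\<lambda>x. coord x j"] that by (simp add: lookup_emb)
      then have "v = 0\<^sub>v m" using v(1) by (intro eq_vecI) auto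
      then show False using v by simp
    qed
    ultimately show "\<not> regular m T" unfolding regular_def using emb_in_Rn by blast
  next
    assume "\<not> regular m T"
    then obtain z where z: "z \<in> Rn m" "\<And>i. i < m \<Longrightarrow> inner (T i) z = 0" "z \<noteq> 0" by (auto simp: regular_def)
    let ?v = "Matrix.vec m (coord z)"
    have ez: "emb m (\<lambda>j. vec_index ?v j) = z" using emb_lookup[OF z(1)] by (metis (no_types, lifting) emb_cong index_vec)
    have "row_matrix m T *\<^sub>v ?v = 0\<^sub>v m"
      unfolding mv[OF vec_carrier] ez by (rule eq_vecI) (auto simp: z(2))
    moreover have "?v \<noteq> 0\<^sub>v m"
    proof
      assume v: "?v = 0\<^sub>v m"
      have "coord z j = 0" if "j < m" for j
        using arg_cong[OF v, of "\<lambda>x. vec_index x j"] that by simp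
      then have "z = 0" using z(1) by (intro poly_mapping_eqI) (metis Rn_iff lookup_zero not_le)
      then show False using z by simp
    qed
    ultimately show "\<exists>v. v \<in> carrier_vec m \<and> v \<noteq> 0\<^sub>v m \<and> row_matrix m T *\<^sub>v v = 0\<^sub>v m"
      by (intro exI[of _ ?v]) auto
  qed
  finally show ?thesis by blast
qed

lemma cofactor_row_upd:
  assumes "i < m" "j < m"
  shows "cofactor (row_matrix m (T(i := a))) i j = cofactor (row_matrix m T) i j"
proof -
  have "mat_delete (row_matrix m (T(i := a))) i j = mat_delete (row_matrix m T) i j"
  proof (rule eq_matI)
    fix i' j' assume "i' < dim_row (mat_delete (row_matrix m T) i j)" "j' < dim_col (mat_delete (row_matrix m T) i j)"
    then have b: "i' < m - 1" "j' < m - 1" by simp_all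
    define k l where "k = (if i' < i then i' else Suc i')" and "l = (if j' < j then j' else Suc j')"
    have kl: "k < m" "l < m" "k \<noteq> i" using b by (auto simp: k_def l_def)
    have "mat_delete (row_matrix m T') i j $$ (i', j') = coord (T' k) l" for T'
      unfolding mat_delete_def using b kl by (simp add: k_def[symmetric] l_def[symmetric]) (simp add: row_matrix_def)
    then show "mat_delete (row_matrix m (T(i := a))) i j $$ (i', j') = mat_delete (row_matrix m T) i j $$ (i', j')"
      using kl(3) by simp
  qed simp_all
  then show ?thesis by (simp add: cofactor_def)
qed

text \<open>Laplace expansion along the i-th row, whose cofactors do not involve that row.\<close>

lemma inner_cofactor_vec:
  assumes i: "i < m"
  shows "inner a (cofactor_vec m T i) = row_det m (T(i := a))"
proof -
  have "row_det m (T(i := a)) = (\<Sum>j<m. row_matrix m (T(i := a)) $$ (i, j) * cofactor (row_matrix m (T(i := a))) i j)"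
    unfolding row_det_def by (rule laplace_expansion_row) (use i in auto)
  also have "\<dots> = (\<Sum>j<m. coord a j * cofactor (row_matrix m T) i j)"
    using i cofactor_row_upd[OF i] by (intro sum.cong) (auto simp: row_matrix_def)
  also have "\<dots> = inner a (cofactor_vec m T i)"
    unfolding cofactor_vec_def inner_Rn'[OF emb_in_Rn] by (intro sum.cong) (auto simp: lookup_emb)
  finally show ?thesis ..
qed

lemma cofactor_vec_Rn [simp]: "cofactor_vec m T i \<in> Rn m"
  by (simp add: cofactor_vec_def)

lemma row_det_identical:
  assumes "i < m" "j < m" "i \<noteq> j" "T i = T j"
  shows "row_det m T = 0"
  unfolding row_det_def
  by (rule det_identical_rows[where i = i and j = j and n = m])
     (use assms in \<open>auto simp: row_matrix_def intro!: eq_vecI\<close>)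

lemma inner_cofactor_vec_other: "i < m \<Longrightarrow> k < m \<Longrightarrow> k \<noteq> i \<Longrightarrow> inner (T k) (cofactor_vec m T i) = 0"
  unfolding inner_cofactor_vec by (rule row_det_identical[of i m k]) auto

lemma inner_cofactor_vec_same: "i < m \<Longrightarrow> inner (T i) (cofactor_vec m T i) = row_det m T"
  by (simp add: inner_cofactor_vec)

lemma regular_inj: "regular m T \<Longrightarrow> inj_on T {..<m}"
  using row_det_identical[of _ m _ T] by (auto simp: inj_on_def regular_iff_det)

lemma solution_Rn [simp]: "solution m T s \<in> Rn m"
  by (auto simp: solution_def intro!: Rn_scale Rn_sum)

lemma inner_solution:
  assumes "regular m T" "k < m"
  shows "inner (T k) (solution m T s) = s k"
proof -
  have "inner (T k) (solution m T s) = (\<Sum>i<m. s i * inner (T k) (cofactor_vec m T i)) / row_det m T"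
    by (simp add: solution_def inner_sum_right divide_inverse mult.commute)
  also have "(\<Sum>i<m. s i * inner (T k) (cofactor_vec m T i)) = (\<Sum>i<m. if i = k then s k * row_det m T else 0)"
    using assms(2) by (intro sum.cong) (auto simp: inner_cofactor_vec_other inner_cofactor_vec_same)
  finally show ?thesis using assms by (simp add: regular_iff_det)
qed

lemma solution_unique:
  assumes "regular m T" "x \<in> Rn m" "\<And>i. i < m \<Longrightarrow> inner (T i) x = s i"
  shows "x = solution m T s"
proof -
  have "x - solution m T s \<in> Rn m" using assms by (auto intro: Rn_diff)
  moreover have "inner (T i) (x - solution m T s) = 0" if "i < m" for i
    using assms that by (simp add: inner_diff_right inner_solution)
  ultimately show ?thesis using assms(1) unfolding regular_def by auto
qed

lemma measurable_row_det [measurable]: "row_det m \<in> borel_measurable (Pi\<^sub>M {..<m} (\<lambda>_. borel))"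
proof -
  have lm: "(\<lambda>T. coord (T i :: seq) k) \<in> borel_measurable (Pi\<^sub>M {..<m} (\<lambda>_. borel))" if "i < m" for i k
    using that by (intro measurable_compose[OF measurable_component_singleton[of i "{..<m}" "\<lambda>_. borel"] measurable_lookup[of k]]) auto
  have pl: "p i < m" if "p permutes {0..<m}" "i < m" for p i
    using permutes_in_image[OF that(1), of i] that(2) by simp
  have eq: "row_det m T = (\<Sum>p\<in>{p. p permutes {0..<m}}. signof p * (\<Prod>i\<in>{0..<m}. coord (T i) (p i)))" for T
    unfolding row_det_def Determinant.det_def row_matrix_dim if_P[OF refl]
    by (intro sum.cong refl arg_cong2[where f = "(*)"] prod.cong) (auto simp: row_matrix_def pl)
  have "(\<lambda>T. \<Sum>p\<in>{p. p permutes {0..<m}}. signof p * (\<Prod>i\<in>{0..<m}. coord (T i :: seq) (p i)) :: real) \<in> borel_measurable (Pi\<^sub>M {..<m} (\<lambda>_. borel))"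
    by (intro borel_measurable_sum borel_measurable_times borel_measurable_const borel_measurable_prod lm) auto
  then show ?thesis unfolding eq[abs_def] .
qed

text \<open>The entries become determinants with a unit vector as i-th row, so their measurability
  follows from that of \<open>row_det\<close>.\<close>

lemma cofactor_vec_eq: "i < m \<Longrightarrow> cofactor_vec m T i = emb m (\<lambda>j\<in>{..<m}. row_det m (T(i := \<e> j)))"
  by (intro poly_mapping_eqI) (auto simp: lookup_emb inner_cofactor_vec[symmetric] simp: cofactor_vec_def)

lemma measurable_cofactor_vec:
  assumes "i < m"
  shows "(\<lambda>T. cofactor_vec m T i) \<in> borel_measurable (Pi\<^sub>M {..<m} (\<lambda>_. borel))"
proof -
  have upd: "(\<lambda>T. T(i := a)) \<in> measurable (Pi\<^sub>M {..<m} (\<lambda>_. borel)) (Pi\<^sub>M {..<m} (\<lambda>_. borel))" for a :: seq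
    by (rule measurable_fun_upd[where J = "{..<m}"]) (use assms in auto)
  have "(\<lambda>T. \<lambda>j\<in>{..<m}. row_det m (T(i := \<e> j))) \<in> measurable (Pi\<^sub>M {..<m} (\<lambda>_. borel)) (Pi\<^sub>M {..<m} (\<lambda>_. borel))"
    by (intro measurable_restrict measurable_compose[OF upd measurable_row_det])
  from measurable_compose[OF this measurable_emb] show ?thesis by (simp add: cofactor_vec_eq[OF assms])
qed

lemma measurable_solution [measurable]: "(\<lambda>T. solution m T s) \<in> borel_measurable (Pi\<^sub>M {..<m} (\<lambda>_. borel))"
proof -
  note measurable_cofactor_vec[measurable]
  have "(\<lambda>T. \<Sum>i<m. s i *\<^sub>R cofactor_vec m T i) \<in> borel_measurable (Pi\<^sub>M {..<m} (\<lambda>_. borel))"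
    by (intro borel_measurable_sum borel_measurable_scaleR borel_measurable_const measurable_cofactor_vec) auto
  then show ?thesis unfolding solution_def by measurable
qed

lemma measurable_regular [measurable]: "Measurable.pred (Pi\<^sub>M {..<m} (\<lambda>_. borel)) (regular m)"
  unfolding regular_iff_det[abs_def] by measurable

section \<open>Independence, orthogonal complements and dimension\<close>

lemma inner_eq_0_span:
  assumes "x \<in> span S" "\<And>y. y \<in> S \<Longrightarrow> inner y z = 0"
  shows "inner x z = 0"
  using assms(1) by (induction rule: span_induct_alt) (auto simp: inner_add_left assms(2))

text \<open>Padded by zero rows to a square matrix, fewer than \<open>n\<close> rows have
  determinant zero, and a singular matrix has a kernel vector.\<close>

lemma orthogonal_vector_exists:
  assumes S: "finite S" "card S < n"
  obtains d where "d \<in> Rn n" "d \<noteq> 0" "\<And>y. y \<in> S \<Longrightarrow> inner y d = 0"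
proof -
  obtain h where h: "bij_betw h {..<card S} S" using S by (metis ex_bij_betw_nat_finite atLeast0LessThan)
  define T where "T i = (if i < card S then h i else 0)" for i
  have "row_det n T = inner (T (n - 1)) (cofactor_vec n T (n - 1))"
    using S by (intro inner_cofactor_vec_same[symmetric]) auto
  also have "T (n - 1) = 0" using S by (simp add: T_def)
  finally have "\<not> regular n T" by (simp add: regular_iff_det)
  then obtain d where d: "d \<in> Rn n" "\<And>i. i < n \<Longrightarrow> inner (T i) d = 0" "d \<noteq> 0" by (auto simp: regular_def)
  have "inner y d = 0" if "y \<in> S" for y
  proof -
    have "y \<in> h ` {..<card S}" using bij_betw_imp_surj_on[OF h] that by simp
    then obtain i where "i < card S" "h i = y" by auto
    then show ?thesis using d(2)[of i] S by (auto simp: T_def)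
  qed
  then show ?thesis using that d by blast
qed

lemma span_unit_vectors: "Rn n \<subseteq> span (\<e> ` {..<n})"
proof
  fix x assume "x \<in> Rn n"
  then have "x = (\<Sum>k<n. Poly_Mapping.single k (coord x k))"
    by (intro poly_mapping_eq_sum_single) (auto simp: Rn_def)
  also have "\<dots> = (\<Sum>k<n. coord x k *\<^sub>R \<e> k)"
    by (intro sum.cong refl poly_mapping_eqI) (simp add: lookup_single when_def)
  also have "\<dots> \<in> span (\<e> ` {..<n})" by (intro span_sum span_scale span_base) auto
  finally show "x \<in> span (\<e> ` {..<n})" .
qed

lemma independent_Rn_bound:
  assumes "independent S" "S \<subseteq> Rn n"
  shows "finite S" "card S \<le> n"
proof -
  have "finite S \<and> card S \<le> card (\<e> ` {..<n})"
    using assms span_unit_vectors by (intro independent_span_bound) auto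
  moreover have "card (\<e> ` {..<n}) \<le> n" using card_image_le[of "{..<n}" \<e>] by simp
  ultimately show "finite S" "card S \<le> n" by auto
qed

text \<open>A nonzero vector orthogonal to all rows would lie outside their span and give n + 1
  independent vectors in \<open>Rn n\<close>.\<close>

lemma independent_full_regular:
  assumes S: "independent S" "S \<subseteq> Rn n" "card S = n" and h: "bij_betw h {..<n} S"
  shows "regular n h"
  unfolding regular_def
proof (intro ballI impI, rule ccontr)
  fix z assume z: "z \<in> Rn n" "\<forall>i<n. inner (h i) z = 0" "z \<noteq> 0"
  have "inner y z = 0" if "y \<in> S" for y
    using bij_betw_imp_surj_on[OF h] that z(2) by auto
  then have "z \<notin> span S" using inner_eq_0_span[of z S z] z(3) by auto
  then have "independent (insert z S)" "z \<notin> S" using S(1) independent_insertI span_base by blast+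
  then have "card (insert z S) \<le> n" using S(2) z(1) by (intro independent_Rn_bound) auto
  then show False using \<open>z \<notin> S\<close> S independent_Rn_bound[OF S(1,2)] by simp
qed

lemma biorthogonal_independent:
  assumes "\<And>i j. i \<in> I \<Longrightarrow> j \<in> I \<Longrightarrow> inner (b i) (d j) = (if i = j then 1 else 0)"
  shows "inj_on b I" "independent (b ` I)"
proof -
  show inj: "inj_on b I"
    by (rule inj_onI) (metis assms zero_neq_one)
  show "independent (b ` I)"
    unfolding dependent_def
  proof
    assume "\<exists>a\<in>b ` I. a \<in> span (b ` I - {a})"
    then obtain i where i: "i \<in> I" "b i \<in> span (b ` I - {b i})" by auto
    have "inner (b i) (d i) = 0"
      by (rule inner_eq_0_span[OF i(2)]) (use assms i in auto)
    then show False using assms[OF i(1) i(1)] by simp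
  qed
qed

lemma regular_independent:
  assumes "regular m T"
  shows "independent (T ` {..<m})"
proof (rule biorthogonal_independent(2))
  fix i j assume "i \<in> {..<m}" "j \<in> {..<m}"
  then show "inner (T i) (solution m T (\<lambda>k. if k = j then 1 else 0)) = (if i = j then 1 else 0)"
    using assms by (simp add: inner_solution)
qed

text \<open>\<open>S\<close> is extended to a basis \<open>B\<close>; the members of the dual basis
  that belong to B - S form a basis of the orthogonal complement.\<close>

lemma dim_orthogonal:
  assumes S: "independent S" "S \<subseteq> Rn n"
  shows "dim {d \<in> Rn n. \<forall>y\<in>S. inner y d = 0} = n - card S"
proof -
  obtain B where B: "S \<subseteq> B" "B \<subseteq> Rn n" "independent B" "Rn n \<subseteq> span B"
    using maximal_independent_subset_extend[OF S(2,1)] by blast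
  note finB = independent_Rn_bound[OF B(3,2)]
  have "inj_on \<e> {..<n} \<and> independent (\<e> ` {..<n})"
    using biorthogonal_independent[of "{..<n}" \<e> \<e>] by (simp add: lookup_single when_def eq_commute)
  then have e: "card (\<e> ` {..<n}) = n" "independent (\<e> ` {..<n})" by (auto simp: card_image)
  have "\<e> ` {..<n} \<subseteq> span B" using B(4) by auto
  then have "n \<le> card B" using independent_span_bound[OF finB(1) e(2)] e(1) by simp
  then have cB: "card B = n" using finB by simp
  obtain h where h: "bij_betw h {..<n} B" using finB cB by (metis ex_bij_betw_nat_finite atLeast0LessThan)
  have reg: "regular n h" by (rule independent_full_regular[OF B(3,2) cB h])
  have hRn: "h i \<in> Rn n" if "i < n" for i using h B(2) that by (auto simp: bij_betw_def)
  define d where "d j = solution n h (\<lambda>k. if k = j then 1 else 0)" for j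
  have d: "inner (h i) (d j) = (if i = j then 1 else 0)" if "i < n" for i j
    using inner_solution[OF reg that] by (simp add: d_def)
  define J where "J = {i. i < n \<and> h i \<notin> S}"
  define E where "E = {d \<in> Rn n. \<forall>y\<in>S. inner y d = 0}"
  have indJ: "inj_on d J" "independent (d ` J)"
    using biorthogonal_independent[of J d h] d by (auto simp: J_def inner_commute)
  have "card J = card (h ` J)"
    using h by (intro card_image[symmetric]) (auto simp: J_def bij_betw_def inj_on_def)
  also have "h ` J = B - S" using h by (auto simp: J_def bij_betw_def)
  also have "card (B - S) = n - card S" using B(1) finB cB by (simp add: card_Diff_subset finite_subset)
  finally have cJ: "card J = n - card S" .
  have hS: "\<exists>i<n. h i = y" if "y \<in> S" for y
  proof -
    have "y \<in> h ` {..<n}" using bij_betw_imp_surj_on[OF h] B(1) that by auto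
    then show ?thesis by auto
  qed
  have "d ` J \<subseteq> E"
  proof
    fix x assume "x \<in> d ` J"
    then obtain j where j: "x = d j" "j < n" "h j \<notin> S" by (auto simp: J_def)
    have "inner y (d j) = 0" if "y \<in> S" for y
      using hS[OF that] d j(3) that by auto
    then show "x \<in> E" by (simp add: E_def j d_def)
  qed
  moreover have "E \<subseteq> span (d ` J)"
  proof
    fix x assume x: "x \<in> E"
    define x' where "x' = (\<Sum>j\<in>J. inner (h j) x *\<^sub>R d j)"
    have fJ: "finite J" by (simp add: J_def)
    have x': "x' \<in> span (d ` J)" unfolding x'_def by (intro span_sum span_scale span_base) auto
    have x'Rn: "x' \<in> Rn n" unfolding x'_def by (intro Rn_sum Rn_scale) (simp add: d_def)
    have "inner (h i) (x - x') = 0" if i: "i < n" for i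
    proof -
      have "inner (h i) x' = (\<Sum>j\<in>J. if j = i then inner (h i) x else 0)"
        unfolding x'_def inner_sum_right by (intro sum.cong) (auto simp: d[OF i])
      also have "\<dots> = (if i \<in> J then inner (h i) x else 0)" using fJ by simp
      also have "\<dots> = inner (h i) x" using x i by (auto simp: J_def E_def)
      finally show ?thesis by (simp add: inner_diff_right)
    qed
    moreover have "x - x' \<in> Rn n" using x x'Rn by (auto simp: E_def intro: Rn_diff)
    ultimately have "x = x'" using reg unfolding regular_def by auto
    then show "x \<in> span (d ` J)" using x' by simp
  qed
  ultimately have "dim E = card (d ` J)"
    using indJ(2) by (intro dim_eq_card) (metis span_eq span_base span_mono span_span subset_antisym)+
  then show ?thesis using cJ indJ(1) by (simp add: card_image E_def)
qed

section \<open>Faces of the polar set\<close>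

definition polar :: "nat \<Rightarrow> seq set \<Rightarrow> seq set"
  where "polar n Y = {x \<in> Rn n. \<forall>y\<in>Y. inner x y \<le> 1}"

text \<open>The parameters (u, t) and (-u, -t) describe the same hyperplane and give its two
  half-spaces. If t is nonzero, the origin lies in the one with t > 0, which is <x, u/t> at most
  1.\<close>

lemma zero_cell_dual:
  assumes Y: "Y \<subseteq> dual_points n"
  shows "zero_cell n (dual_hyperplane n ` Y) = polar n Y"
proof (intro equalityI subsetI)
  fix x assume x: "x \<in> zero_cell n (dual_hyperplane n ` Y)"
  have "inner x y \<le> 1" if y: "y \<in> Y" for y
  proof -
    have y': "y \<in> Rn n" "y \<noteq> 0" using Y y by (auto simp: dual_points_def)
    define S where "S = {x \<in> Rn n. inner x (sgn y) \<le> 1 / norm y}"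
    have "S \<in> halfspaces n (dual_hyperplane n y)"
      unfolding halfspaces_def S_def using y' sgn_unit_sphere[OF y'] dual_hyperplane_sgn[OF y'(2), of n] by blast
    moreover have "0 \<in> S" by (simp add: S_def)
    ultimately have "x \<in> S" using x y by (auto simp: zero_cell_def)
    then show ?thesis using y' by (simp add: S_def sgn_div_norm divide_simps)
  qed
  then show "x \<in> polar n Y" using x by (simp add: polar_def zero_cell_def)
next
  fix x assume x: "x \<in> polar n Y"
  have "x \<in> S" if y: "y \<in> Y" and S: "S \<in> halfspaces n (dual_hyperplane n y)" "0 \<in> S" for y S
  proof -
    obtain u t where ut: "S = {x \<in> Rn n. inner x u \<le> t}" "u \<in> unit_sphere n" "dual_hyperplane n y = hyperplane n u t"
      using S(1) by (auto simp: halfspaces_def)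
    have "hyperplane n u t \<in> dual_hyperplane n ` {y}" using ut(3) by simp
    then have t: "t \<noteq> 0" "u /\<^sub>R t = y" using hyperplane_dual_iff[OF ut(2), of "{y}" t] Y y by auto
    have "0 \<le> t" using S(2) by (simp add: ut(1))
    then have "0 < t" using t by simp
    moreover have "inner x (u /\<^sub>R t) \<le> 1" using x y t by (simp add: polar_def)
    ultimately have "inner x u \<le> t" by (simp add: field_simps)
    then show ?thesis using x by (simp add: ut(1) polar_def)
  qed
  then show "x \<in> zero_cell n (dual_hyperplane n ` Y)" using x by (auto simp: zero_cell_def polar_def)
qed

lemma ecard_fibers_le:
  assumes k: "0 < k" and fib: "\<And>y. y \<in> f ` A \<Longrightarrow> finite {x \<in> A. f x = y} \<and> card {x \<in> A. f x = y} \<le> k"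
  shows "ecard A \<le> of_nat k * ecard (f ` A)"
proof (cases "finite (f ` A)")
  case True
  have A: "A = (\<Union>y\<in>f ` A. {x \<in> A. f x = y})" by auto
  then have fin: "finite A" using True fib by (metis (no_types, lifting) finite_UN)
  have "card A \<le> (\<Sum>y\<in>f ` A. card {x \<in> A. f x = y})"
    by (subst (1) A) (rule card_UN_le[OF True])
  also have "\<dots> \<le> (\<Sum>y\<in>f ` A. k)" by (rule sum_mono) (use fib in blast)
  finally have "card A \<le> k * card (f ` A)" by (simp add: mult.commute)
  then have "(of_nat (card A) :: ennreal) \<le> of_nat (k * card (f ` A))" by (simp only: of_nat_le_iff)
  then show ?thesis using True fin by (simp add: ecard_finite)
next
  case False
  then show ?thesis using k by (simp add: ecard_infinite ennreal_mult_top)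
qed

lemma ecard_fibers_ge:
  assumes fib: "\<And>y. y \<in> B \<Longrightarrow> \<exists>C\<subseteq>A. finite C \<and> card C = k \<and> f ` C \<subseteq> {y}" and k: "0 < k"
  shows "of_nat k * ecard B \<le> ecard A"
proof (cases "finite A")
  case True
  obtain C where C: "\<And>y. y \<in> B \<Longrightarrow> C y \<subseteq> A \<and> finite (C y) \<and> card (C y) = k \<and> f ` C y \<subseteq> {y}" using fib by metis
  have "B \<subseteq> f ` A"
  proof
    fix y assume y: "y \<in> B"
    then have "C y \<noteq> {}" using C[OF y] k by auto
    then obtain x where "x \<in> C y" by auto
    then have "x \<in> A" "f x = y" using C[OF y] by auto
    then show "y \<in> f ` A" by auto
  qed
  then have finB: "finite B" using True finite_surj by blast
  have "k * card B = (\<Sum>y\<in>B. card (C y))" using C by simp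
  also have "\<dots> = card (\<Union>y\<in>B. C y)"
  proof (rule card_UN_disjoint[symmetric])
    show "\<forall>y\<in>B. \<forall>j\<in>B. y \<noteq> j \<longrightarrow> C y \<inter> C j = {}"
    proof (intro ballI impI equals0I)
      fix y j x assume "y \<in> B" "j \<in> B" "y \<noteq> j" "x \<in> C y \<inter> C j"
      then have "f x = y" "f x = j" using C[of y] C[of j] by auto
      then show False using \<open>y \<noteq> j\<close> by simp
    qed
  qed (use finB C in auto)
  also have "\<dots> \<le> card A" using True C by (intro card_mono) auto
  finally have "(of_nat (k * card B) :: ennreal) \<le> of_nat (card A)" by (simp only: of_nat_le_iff)
  then show ?thesis using True finB by (simp add: ecard_finite)
qed (simp add: ecard_infinite)

lemma card_inj_tuples:
  assumes "finite S" "card S = n"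
  shows "finite {T \<in> {..<n} \<rightarrow>\<^sub>E S. inj_on T {..<n}}" "card {T \<in> {..<n} \<rightarrow>\<^sub>E S. inj_on T {..<n}} = fact n"
proof -
  show "finite {T \<in> {..<n} \<rightarrow>\<^sub>E S. inj_on T {..<n}}"
    by (rule finite_subset[of _ "{..<n} \<rightarrow>\<^sub>E S"]) (use assms in \<open>auto intro: finite_PiE\<close>)
  show "card {T \<in> {..<n} \<rightarrow>\<^sub>E S. inj_on T {..<n}} = fact n"
    using assms by (subst card_inj_on_subset_funcset) (auto simp: fact_prod_rev)
qed

text \<open>The hyperplane of \<open>y\<close> has distance 1/|y| from the origin, so
  \<open>fin\<close> says that only finitely many hyperplanes meet a given ball around the
  origin.\<close>

locale dual_configuration =
  fixes n :: nat and Y :: "seq set"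
  assumes Y: "Y \<subseteq> dual_points n" and fin: "\<And>\<delta>. 0 < \<delta> \<Longrightarrow> finite {y \<in> Y. \<delta> \<le> norm y}"
begin

lemma YRn: "y \<in> Y \<Longrightarrow> y \<in> Rn n"
  using Y by (auto simp: dual_points_def)

lemma finite_cap:
  assumes "0 < c" shows "finite {y \<in> Y. c \<le> inner z y}"
proof (cases "z = 0")
  case False
  have "{y \<in> Y. c \<le> inner z y} \<subseteq> {y \<in> Y. c / norm z \<le> norm y}"
  proof
    fix y assume y: "y \<in> {y \<in> Y. c \<le> inner z y}"
    then have "c \<le> norm z * norm y" using norm_cauchy_schwarz[of z y] by simp
    then show "y \<in> {y \<in> Y. c / norm z \<le> norm y}" using False y by (simp add: divide_le_eq mult.commute)
  qed
  then show ?thesis using fin[of "c / norm z"] False assms by (auto intro: finite_subset)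
qed (use assms in auto)

definition active :: "seq \<Rightarrow> seq set"
  where "active z = {y \<in> Y. inner z y = 1}"

lemma finite_active: "finite (active z)"
  using finite_cap[of 1 z] by (rule finite_subset[rotated]) (auto simp: active_def)

text \<open>Along \<open>d\<close> the active constraints keep their value. The constraints with |y|
  < 1/D cannot be violated by a vector of norm at most \<open>D\<close>, and only finitely many
  others remain, each with positive slack.\<close>

lemma small_step:
  assumes z: "z \<in> polar n Y" and d: "d \<in> Rn n" "\<And>y. y \<in> active z \<Longrightarrow> inner d y = 0"
  obtains \<tau> where "0 < \<tau>" "\<And>t. \<bar>t\<bar> \<le> \<tau> \<Longrightarrow> z + t *\<^sub>R d \<in> polar n Y"
proof -
  define D where "D = norm z + norm d + 1"
  have D: "0 < D" by (simp add: D_def add_nonneg_pos)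
  define F where "F = {y \<in> Y. 1 / D \<le> norm y} - active z"
  have finF: "finite F" using fin[of "1 / D"] D by (auto simp: F_def)
  \<comment> \<open>The inserted 1 keeps the moved point within norm \<open>D\<close> and the
    minimum over a nonempty set.\<close>
  define \<tau> where "\<tau> = Min (insert 1 ((\<lambda>y. (1 - inner z y) / (1 + \<bar>inner d y\<bar>)) ` F))"
  have pos: "0 < (1 - inner z y) / (1 + \<bar>inner d y\<bar>)" if "y \<in> F" for y
  proof -
    have "inner z y < 1" using z that by (auto simp: F_def polar_def active_def order.strict_iff_order)
    then show ?thesis by (simp add: add_pos_nonneg)
  qed
  have "0 < \<tau>" unfolding \<tau>_def using finF pos by (subst Min_gr_iff) auto
  moreover have "z + t *\<^sub>R d \<in> polar n Y" if t: "\<bar>t\<bar> \<le> \<tau>" for t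
  proof -
    have t1: "\<bar>t\<bar> \<le> 1" using t finF unfolding \<tau>_def by (meson Min_le finite_imageI finite_insert insertI1 order_trans)
    have "inner (z + t *\<^sub>R d) y \<le> 1" if y: "y \<in> Y" for y
    proof -
      consider "y \<in> active z" | "y \<in> F" | "norm y < 1 / D"
        using y unfolding F_def by (cases "norm y < 1 / D") (auto simp: not_less)
      then show ?thesis
      proof cases
        case 1 then show ?thesis using d(2)[OF 1] by (simp add: active_def inner_add_left)
      next
        case 2
        have "\<tau> \<le> (1 - inner z y) / (1 + \<bar>inner d y\<bar>)" unfolding \<tau>_def using finF 2 by (intro Min_le) auto
        then have "\<bar>t\<bar> \<le> (1 - inner z y) / (1 + \<bar>inner d y\<bar>)" using t by simp
        then have "\<bar>t\<bar> * (1 + \<bar>inner d y\<bar>) \<le> 1 - inner z y" by (simp add: pos_le_divide_eq add_pos_nonneg)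
        moreover have "t * inner d y \<le> \<bar>t\<bar> * (1 + \<bar>inner d y\<bar>)"
          by (rule order_trans[OF abs_ge_self]) (simp add: abs_mult algebra_simps)
        ultimately show ?thesis by (simp add: inner_add_left)
      next
        case 3
        have "norm (z + t *\<^sub>R d) \<le> norm z + \<bar>t\<bar> * norm d" using norm_triangle_ineq[of z "t *\<^sub>R d"] by simp
        also have "\<dots> \<le> norm z + 1 * norm d" using t1 by (intro add_left_mono mult_right_mono) auto
        also have "\<dots> \<le> D" by (simp add: D_def)
        finally have "norm (z + t *\<^sub>R d) * norm y \<le> D * (1 / D)" using 3 D by (intro mult_mono) auto
        then show ?thesis using norm_cauchy_schwarz[of "z + t *\<^sub>R d" y] D by simp
      qed
    qed
    then show ?thesis using z d by (simp add: polar_def Rn_add Rn_scale)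
  qed
  ultimately show ?thesis using that by blast
qed

text \<open>The number \<open>\<tau> y\<close> is the time at which the constraint \<open>y\<close>
  becomes active. Constraints that are met no later than \<open>y0\<close> have scalar product at
  least 1 with the point at time \<open>\<tau> y0\<close>, so they are finitely many and a first one
  exists.\<close>

lemma first_hit:
  assumes z: "z \<in> polar n Y" and d: "d \<in> Rn n" and y0: "y0 \<in> Y" "0 < inner d y0"
  obtains t y where "z + t *\<^sub>R d \<in> polar n Y" "y \<in> Y" "inner (z + t *\<^sub>R d) y = 1" "0 < inner d y"
proof -
  define \<tau> where "\<tau> y = (1 - inner z y) / inner d y" for y
  define F where "F = {y \<in> Y. 0 < inner d y \<and> \<tau> y \<le> \<tau> y0}"
  have "F \<subseteq> {y \<in> Y. 1 \<le> inner (z + \<tau> y0 *\<^sub>R d) y}"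
  proof
    fix y assume y: "y \<in> F"
    then have "1 - inner z y \<le> \<tau> y0 * inner d y" using pos_divide_le_eq[of "inner d y" "1 - inner z y" "\<tau> y0"] by (simp add: F_def \<tau>_def[of y])
    then show "y \<in> {y \<in> Y. 1 \<le> inner (z + \<tau> y0 *\<^sub>R d) y}" using y by (simp add: F_def inner_add_left)
  qed
  then have finF: "finite F" by (rule finite_subset) (rule finite_cap, simp)
  have "y0 \<in> F" using y0 by (simp add: F_def)
  then obtain y1 where y1: "y1 \<in> F" "\<And>y. y \<in> F \<Longrightarrow> \<tau> y1 \<le> \<tau> y"
    using finF by (metis arg_min_if_finite(1) arg_min_least empty_iff)
  have min: "\<tau> y1 \<le> \<tau> y" if "y \<in> Y" "0 < inner d y" for y
    using y1 that by (cases "y \<in> F") (force simp: F_def)+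
  have t0: "0 \<le> \<tau> y1" using y1(1) z by (auto simp: F_def \<tau>_def polar_def)
  have "inner (z + \<tau> y1 *\<^sub>R d) y \<le> 1" if y: "y \<in> Y" for y
  proof (cases "0 < inner d y")
    case True
    then have "\<tau> y1 * inner d y \<le> 1 - inner z y" using min[OF y True] by (simp add: \<tau>_def[of y] pos_le_divide_eq)
    then show ?thesis by (simp add: inner_add_left)
  next
    case False
    then have "\<tau> y1 * inner d y \<le> 0" using t0 by (simp add: mult_nonneg_nonpos)
    moreover have "inner z y \<le> 1" using z y by (simp add: polar_def)
    ultimately show ?thesis by (simp add: inner_add_left)
  qed
  then have "z + \<tau> y1 *\<^sub>R d \<in> polar n Y" using z d by (simp add: polar_def Rn_add Rn_scale)
  moreover have "inner (z + \<tau> y1 *\<^sub>R d) y1 = 1" using y1(1) by (simp add: F_def \<tau>_def inner_add_left)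
  ultimately show ?thesis using that y1(1) by (auto simp: F_def)
qed

text \<open>
  Moving inside the cell along directions orthogonal to the active constraints reaches a vertex, since
  \<open>Y\<close> spans; every step makes one more, linearly independent constraint active.
\<close>

lemma vertex_extension:
  assumes span: "\<And>d. d \<in> Rn n \<Longrightarrow> (\<forall>y\<in>Y. inner y d = 0) \<Longrightarrow> d = 0"
    and "z \<in> polar n Y" "S \<subseteq> active z" "independent S"
  shows "\<exists>v B. v \<in> polar n Y \<and> S \<subseteq> B \<and> B \<subseteq> active v \<and> independent B \<and> card B = n"
  using assms(2-)
proof (induction "n - card S" arbitrary: z S rule: less_induct)
  case less
  have SY: "S \<subseteq> Y" using less.prems by (auto simp: active_def)
  then have SR: "S \<subseteq> Rn n" using YRn by auto
  note finS = independent_Rn_bound[OF less.prems(3) SR]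
  show ?case
  proof (cases "card S = n")
    case True then show ?thesis using less.prems by blast
  next
    case False
    then have "card S < n" using finS by simp
    then obtain d0 where d0: "d0 \<in> Rn n" "d0 \<noteq> 0" "\<And>y. y \<in> S \<Longrightarrow> inner y d0 = 0"
      using orthogonal_vector_exists[OF finS(1)] by blast
    then obtain y0 where y0: "y0 \<in> Y" "inner y0 d0 \<noteq> 0" using span by blast
    \<comment> \<open>The sign is chosen such that the constraint \<open>y0\<close> is
      approached.\<close>
    define d where "d = (if 0 < inner y0 d0 then d0 else - d0)"
    have d: "d \<in> Rn n" "\<And>y. y \<in> S \<Longrightarrow> inner d y = 0" "0 < inner d y0"
      using d0 y0 by (auto simp: d_def Rn_uminus inner_commute)
    obtain t y where ty: "z + t *\<^sub>R d \<in> polar n Y" "y \<in> Y" "inner (z + t *\<^sub>R d) y = 1" "0 < inner d y"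
      using first_hit[OF less.prems(1) d(1) y0(1) d(3)] by blast
    have "y \<notin> span S"
    proof
      assume "y \<in> span S"
      then have "inner y d = 0" by (rule inner_eq_0_span) (use d(2) in \<open>simp add: inner_commute\<close>)
      then show False using ty(4) by (simp add: inner_commute)
    qed
    then have ind: "independent (insert y S)" and yS: "y \<notin> S" using less.prems(3) independent_insertI span_base by blast+
    have act: "insert y S \<subseteq> active (z + t *\<^sub>R d)"
      using less.prems(2) ty d(2) by (auto simp: active_def inner_add_left)
    have "n - card (insert y S) < n - card S" using yS finS \<open>card S < n\<close> by simp
    from less.hyps[OF this ty(1) act ind] show ?thesis by blast
  qed
qed

lemma dim_eq_subspace:
  assumes "A \<subseteq> E" "E \<subseteq> span A" shows "dim A = dim E"
  using assms by (intro span_eq_dim) (metis span_mono span_span subset_antisym)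

text \<open>A point \<open>z\<close> of the face with the fewest active constraints is relatively
  interior: at the midpoint of \<open>z\<close> and another point only constraints active at both
  are active, so minimality makes those of \<open>z\<close> active on the whole face. The directions
  of the face then form the orthogonal complement of \<open>active z\<close>, and \<open>U\<close>
  is a maximal independent subset of it.\<close>

lemma face_description:
  assumes F: "F face_of polar n Y" "F \<noteq> {}" and l: "dim {x - y | x y. x \<in> F \<and> y \<in> F} = l" "l \<le> n"
  obtains z U where "z \<in> F" "U \<subseteq> active z" "independent U" "card U = n - l" "F = {x \<in> polar n Y. \<forall>y\<in>U. inner x y = 1}"
proof -
  have FP: "F \<subseteq> polar n Y" and conv: "convex F"
    and seg: "\<And>a b x. a \<in> polar n Y \<Longrightarrow> b \<in> polar n Y \<Longrightarrow> x \<in> F \<Longrightarrow> x \<in> open_segment a b \<Longrightarrow> a \<in> F \<and> b \<in> F"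
    using F(1) by (auto simp: face_of_def)
  obtain z where z: "z \<in> F" "\<And>x. x \<in> F \<Longrightarrow> card (active z) \<le> card (active x)"
    using F(2) ex_has_least_nat[of "\<lambda>z. z \<in> F" _ "\<lambda>z. card (active z)"] by blast
  have zP: "z \<in> polar n Y" using z FP by auto
  define E where "E = {d \<in> Rn n. \<forall>y\<in>active z. inner y d = 0}"
  have FE: "x - z \<in> E" if x: "x \<in> F" for x
  proof -
    define m where "m = (1 / 2) *\<^sub>R x + (1 / 2) *\<^sub>R z"
    have mF: "m \<in> F" unfolding m_def using conv x z(1) by (intro convexD) auto
    have "active m \<subseteq> active x \<inter> active z"
    proof
      fix y assume y: "y \<in> active m"
      then have "inner x y \<le> 1" "inner z y \<le> 1" "y \<in> Y" using x z FP by (auto simp: active_def polar_def)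
      moreover have "(1 / 2) * inner x y + (1 / 2) * inner z y = 1" using y by (simp add: active_def m_def inner_add_left)
      ultimately show "y \<in> active x \<inter> active z" by (auto simp: active_def)
    qed
    moreover from this have "active m = active z"
      using z(2)[OF mF] finite_active by (intro card_subset_eq) (auto intro: antisym card_mono)
    ultimately have "active z \<subseteq> active x" by auto
    then have "inner y (x - z) = 0" if "y \<in> active z" for y
      using that by (auto simp: active_def inner_diff_right inner_commute)
    moreover have "x - z \<in> Rn n" using x zP FP by (auto simp: polar_def intro: Rn_diff)
    ultimately show ?thesis by (simp add: E_def)
  qed
  have E_sub: "subspace E" unfolding E_def using subspace_Rn[of n]
    by (auto simp: subspace_def inner_add_right)
  have step: "\<exists>t>0. z + t *\<^sub>R d \<in> F \<and> z - t *\<^sub>R d \<in> F" if d: "d \<in> E" for d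
  proof (cases "d = 0")
    case False
    have "inner d y = 0" if "y \<in> active z" for y using d that by (auto simp: E_def inner_commute)
    moreover have "d \<in> Rn n" using d by (simp add: E_def)
    ultimately obtain \<tau> where \<tau>: "0 < \<tau>" "\<And>t. \<bar>t\<bar> \<le> \<tau> \<Longrightarrow> z + t *\<^sub>R d \<in> polar n Y"
      using small_step[OF zP] by blast
    have P: "z + \<tau> *\<^sub>R d \<in> polar n Y" "z - \<tau> *\<^sub>R d \<in> polar n Y" using \<tau>(2)[of \<tau>] \<tau>(2)[of "- \<tau>"] \<tau>(1) by auto
    have "z = (1 - 1 / 2) *\<^sub>R (z + \<tau> *\<^sub>R d) + (1 / 2) *\<^sub>R (z - \<tau> *\<^sub>R d)"
      by (simp add: algebra_simps flip: scaleR_add_left)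
    moreover have "z + \<tau> *\<^sub>R d \<noteq> z - \<tau> *\<^sub>R d"
    proof
      assume "z + \<tau> *\<^sub>R d = z - \<tau> *\<^sub>R d"
      then have "(\<tau> + \<tau>) *\<^sub>R d = 0" by (simp add: scaleR_add_left)
      then show False using \<tau>(1) False by simp
    qed
    ultimately have "z \<in> open_segment (z + \<tau> *\<^sub>R d) (z - \<tau> *\<^sub>R d)"
      unfolding in_segment by (intro conjI exI[of _ "1 / 2"]) auto
    then show ?thesis using seg[OF P z(1)] \<tau>(1) by auto
  qed (use z in \<open>auto intro: exI[of _ 1]\<close>)
  have "dim {x - y | x y. x \<in> F \<and> y \<in> F} = dim E"
  proof (rule dim_eq_subspace)
    show "{x - y | x y. x \<in> F \<and> y \<in> F} \<subseteq> E"
    proof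
      fix w assume "w \<in> {x - y | x y. x \<in> F \<and> y \<in> F}"
      then obtain x y where w: "w = (x - z) - (y - z)" "x \<in> F" "y \<in> F" by auto
      show "w \<in> E" unfolding w(1) by (rule subspace_diff[OF E_sub FE[OF w(2)] FE[OF w(3)]])
    qed
    show "E \<subseteq> span {x - y | x y. x \<in> F \<and> y \<in> F}"
    proof
      fix d assume "d \<in> E"
      then obtain t where t: "0 < t" "z + t *\<^sub>R d \<in> F" using step by blast
      then have "(z + t *\<^sub>R d) - z \<in> span {x - y | x y. x \<in> F \<and> y \<in> F}" using z(1) by (intro span_base) blast
      then have "(1 / t) *\<^sub>R ((z + t *\<^sub>R d) - z) \<in> span {x - y | x y. x \<in> F \<and> y \<in> F}" by (rule span_scale)
      then show "d \<in> span {x - y | x y. x \<in> F \<and> y \<in> F}" using t by simp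
    qed
  qed
  then have dimE: "dim E = l" using l by simp
  obtain U where U: "U \<subseteq> active z" "independent U" "active z \<subseteq> span U"
    using maximal_independent_subset[of "active z"] by blast
  have URn: "U \<subseteq> Rn n" using U(1) YRn by (auto simp: active_def)
  have EU: "E = {d \<in> Rn n. \<forall>y\<in>U. inner y d = 0}"
    unfolding E_def using U inner_eq_0_span[of _ U] by blast
  have "n - card U = l" using dim_orthogonal[OF U(2) URn] dimE EU by simp
  then have cU: "card U = n - l" using independent_Rn_bound(2)[OF U(2) URn] l(2) by simp
  have "F = {x \<in> polar n Y. \<forall>y\<in>U. inner x y = 1}"
  proof (intro equalityI subsetI)
    fix x assume x: "x \<in> F"
    then have "x - z \<in> E" by (rule FE)
    then have xz: "inner y (x - z) = 0" if "y \<in> U" for y using that EU by auto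
    have "inner x y = 1" if y: "y \<in> U" for y
    proof -
      have "inner z y = 1" using y U(1) by (auto simp: active_def)
      then show ?thesis using xz[OF y] by (simp add: inner_diff_right inner_commute[of x y] inner_commute[of z y])
    qed
    then show "x \<in> {x \<in> polar n Y. \<forall>y\<in>U. inner x y = 1}" using x FP by auto
  next
    fix x assume x: "x \<in> {x \<in> polar n Y. \<forall>y\<in>U. inner x y = 1}"
    have "inner y (x - z) = 0" if y: "y \<in> U" for y
    proof -
      have "inner z y = 1" "inner x y = 1" using y x U(1) by (auto simp: active_def)
      then show ?thesis by (simp add: inner_diff_right inner_commute[of y])
    qed
    moreover have "x - z \<in> Rn n" using x zP by (auto simp: polar_def intro: Rn_diff)
    ultimately have "x - z \<in> E" by (simp add: EU)
    \<comment> \<open>The segment from \<open>x\<close> is prolonged a little beyond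
      \<open>z\<close>. Then \<open>z\<close> lies strictly between \<open>x\<close> and a point of
      the cell, so the face property puts \<open>x\<close> into \<open>F\<close>.\<close>
    then obtain t where t: "0 < t" "z - t *\<^sub>R (x - z) \<in> F" using step by blast
    show "x \<in> F"
    proof (cases "x = z")
      case False
      \<comment> \<open>The weight for which the convex combination of the prolonged end and
        \<open>x\<close> is \<open>z\<close>.\<close>
      define u where "u = t / (1 + t)"
      have u: "0 < u" "u < 1" "(1 + t) * u = t" using t by (auto simp: u_def)
      have "(1 - u) *\<^sub>R (z - t *\<^sub>R (x - z)) + u *\<^sub>R x = z + (u - (1 - u) * t) *\<^sub>R (x - z)"
        by (simp add: algebra_simps)
      also have "u - (1 - u) * t = 0" using u(3) by (simp add: algebra_simps)
      finally have "z = (1 - u) *\<^sub>R (z - t *\<^sub>R (x - z)) + u *\<^sub>R x" by simp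
      moreover have "z - t *\<^sub>R (x - z) \<noteq> x"
      proof
        assume "z - t *\<^sub>R (x - z) = x"
        then have "(1 + t) *\<^sub>R (x - z) = 0" by (simp add: algebra_simps)
        then show False using t False by simp
      qed
      ultimately have "z \<in> open_segment (z - t *\<^sub>R (x - z)) x"
        unfolding in_segment using u by blast
      then show ?thesis using seg[of "z - t *\<^sub>R (x - z)" x z] t z x FP by auto
    qed (use z in simp)
  qed
  then show ?thesis using that z(1) U cU by blast
qed

lemma active_constraints_face: "{x \<in> polar n Y. \<forall>y\<in>U. inner x y = 1} face_of polar n Y" if "U \<subseteq> Y"
proof -
  have conv: "convex {x \<in> polar n Y. \<forall>y\<in>U. inner x y = 1}"
  proof (rule convexI)
    fix x y and u v :: real assume x: "x \<in> {x \<in> polar n Y. \<forall>y\<in>U. inner x y = 1}" and y: "y \<in> {x \<in> polar n Y. \<forall>y\<in>U. inner x y = 1}"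
      and uv: "0 \<le> u" "0 \<le> v" "u + v = 1"
    have "u * inner x w + v * inner y w \<le> 1" if "w \<in> Y" for w
    proof -
      have "u * inner x w + v * inner y w \<le> u * 1 + v * 1"
        using x y that uv by (intro add_mono mult_left_mono) (auto simp: polar_def)
      then show ?thesis using uv by simp
    qed
    then show "u *\<^sub>R x + v *\<^sub>R y \<in> {x \<in> polar n Y. \<forall>y\<in>U. inner x y = 1}"
      using x y uv by (auto simp: polar_def inner_add_left intro!: Rn_add Rn_scale)
  qed
  have seg: "a \<in> {x \<in> polar n Y. \<forall>y\<in>U. inner x y = 1} \<and> b \<in> {x \<in> polar n Y. \<forall>y\<in>U. inner x y = 1}"
    if ab: "a \<in> polar n Y" "b \<in> polar n Y" and x: "x \<in> {x \<in> polar n Y. \<forall>y\<in>U. inner x y = 1}" "x \<in> open_segment a b" for a b x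
  proof -
    obtain u where u: "0 < u" "u < 1" "x = (1 - u) *\<^sub>R a + u *\<^sub>R b" using x(2) by (auto simp: in_segment)
    have "inner a y = 1 \<and> inner b y = 1" if y: "y \<in> U" for y
    proof -
      have le: "inner a y \<le> 1" "inner b y \<le> 1" using ab y \<open>U \<subseteq> Y\<close> by (auto simp: polar_def)
      have "(1 - u) * inner a y + u * inner b y = 1" using x(1) y by (simp add: u(3) inner_add_left)
      then have "(1 - u) * (1 - inner a y) + u * (1 - inner b y) = 0" by (simp add: algebra_simps)
      moreover have "0 \<le> (1 - u) * (1 - inner a y)" "0 \<le> u * (1 - inner b y)" using le u by simp_all
      ultimately have "(1 - u) * (1 - inner a y) = 0" "u * (1 - inner b y) = 0"
        by (simp_all add: add_nonneg_eq_0_iff)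
      then show ?thesis using u by simp
    qed
    then show ?thesis using ab by simp
  qed
  show ?thesis
    unfolding face_of_def
  proof (intro conjI ballI impI)
    fix a b x assume *: "a \<in> polar n Y" "b \<in> polar n Y" "x \<in> {x \<in> polar n Y. \<forall>y\<in>U. inner x y = 1}" "x \<in> open_segment a b"
    show "a \<in> {x \<in> polar n Y. \<forall>y\<in>U. inner x y = 1}" "b \<in> {x \<in> polar n Y. \<forall>y\<in>U. inner x y = 1}"
      using seg[OF *] by blast+
  qed (use conv in blast)+
qed

text \<open>An l-face is cut out by n - l independent active constraints, and these extend to n
  independent constraints \<open>B\<close> active at one point. Counting the (n-l)-subsets of all
  such sets \<open>B\<close> bounds the faces, and each \<open>B\<close> has n! orderings among the
  tuples. The count runs over the sets \<open>B\<close>, so several of them may belong to one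
  vertex.\<close>

theorem face_number_le:
  assumes span: "\<And>d. d \<in> Rn n \<Longrightarrow> (\<forall>y\<in>Y. inner y d = 0) \<Longrightarrow> d = 0" and l: "l \<le> n"
  shows "of_nat (fact n) * face_number l (polar n Y) \<le>
    of_nat (n choose l) * ecard {T \<in> {..<n} \<rightarrow>\<^sub>E Y. regular n T \<and> solution n T (\<lambda>_. 1) \<in> polar n Y}"
proof -
  define \<V> where "\<V> = {B. B \<subseteq> Y \<and> finite B \<and> independent B \<and> card B = n \<and> (\<exists>v\<in>polar n Y. B \<subseteq> active v)}"
  let ?O = "{T \<in> {..<n} \<rightarrow>\<^sub>E Y. regular n T \<and> solution n T (\<lambda>_. 1) \<in> polar n Y}"
  have VO: "of_nat (fact n) * ecard \<V> \<le> ecard ?O"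
  proof (rule ecard_fibers_ge[where f = "\<lambda>T. T ` {..<n}"])
    fix B assume "B \<in> \<V>"
    then obtain v where B: "B \<subseteq> Y" "finite B" "independent B" "card B = n" "v \<in> polar n Y" "B \<subseteq> active v"
      by (auto simp: \<V>_def)
    let ?C = "{T \<in> {..<n} \<rightarrow>\<^sub>E B. inj_on T {..<n}}"
    have im: "T ` {..<n} = B" if "T \<in> ?C" for T
      using that B by (intro card_subset_eq) (auto simp: card_image)
    have "?C \<subseteq> ?O"
    proof
      fix T assume T: "T \<in> ?C"
      have "bij_betw T {..<n} B" using T im[OF T] by (simp add: bij_betw_def)
      then have reg: "regular n T" using B YRn by (intro independent_full_regular[of B]) auto
      have "inner (T i) v = 1" if "i < n" for i using im[OF T] B(6) that by (auto simp: active_def inner_commute)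
      then have "v = solution n T (\<lambda>_. 1)" using B(5) by (intro solution_unique[OF reg]) (auto simp: polar_def)
      then show "T \<in> ?O" using T B(1,5) reg by (auto simp: PiE_iff)
    qed
    then show "\<exists>C\<subseteq>?O. finite C \<and> card C = fact n \<and> (\<lambda>T. T ` {..<n}) ` C \<subseteq> {B}"
      using card_inj_tuples[OF B(2,4)] im by (intro exI[of _ ?C]) auto
  qed simp
  have "face_number l (polar n Y) \<le> of_nat (n choose l) * ecard \<V>"
  proof (cases "finite \<V>")
    case False then show ?thesis using l by (simp add: ecard_infinite ennreal_mult_top)
  next
    case True
    define \<U> where "\<U> = (\<Union>B\<in>\<V>. {U. U \<subseteq> B \<and> card U = n - l})"
    have fB: "finite {U. U \<subseteq> B \<and> card U = n - l} \<and> card {U. U \<subseteq> B \<and> card U = n - l} = n choose l" if "B \<in> \<V>" for B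
      using that n_subsets[of B "n - l"] l by (auto simp: \<V>_def binomial_symmetric[OF l, symmetric])
    have finU: "finite \<U>" using True fB by (auto simp: \<U>_def)
    have "card \<U> \<le> (\<Sum>B\<in>\<V>. card {U. U \<subseteq> B \<and> card U = n - l})" unfolding \<U>_def by (rule card_UN_le[OF True])
    also have "\<dots> = card \<V> * (n choose l)" using fB by simp
    finally have cU: "card \<U> \<le> card \<V> * (n choose l)" .
    have "{F. F face_of polar n Y \<and> F \<noteq> {} \<and> dim {x - y | x y. x \<in> F \<and> y \<in> F} = l} \<subseteq>
        (\<lambda>U. {x \<in> polar n Y. \<forall>y\<in>U. inner x y = 1}) ` \<U>"
    proof
      fix F assume "F \<in> {F. F face_of polar n Y \<and> F \<noteq> {} \<and> dim {x - y | x y. x \<in> F \<and> y \<in> F} = l}"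
      then have F: "F face_of polar n Y" "F \<noteq> {}" "dim {x - y | x y. x \<in> F \<and> y \<in> F} = l" by auto
      obtain z U where U: "z \<in> F" "U \<subseteq> active z" "independent U" "card U = n - l" "F = {x \<in> polar n Y. \<forall>y\<in>U. inner x y = 1}"
        using face_description[OF F l] by blast
      have "z \<in> polar n Y" using U(1,5) by auto
      then obtain v B where B: "v \<in> polar n Y" "U \<subseteq> B" "B \<subseteq> active v" "independent B" "card B = n"
        using vertex_extension[OF span _ U(2,3)] by blast
      have BY: "B \<subseteq> Y" using B(3) by (auto simp: active_def)
      then have "finite B" using independent_Rn_bound(1)[OF B(4)] YRn by blast
      then have "B \<in> \<V>" using B BY by (auto simp: \<V>_def)
      then show "F \<in> (\<lambda>U. {x \<in> polar n Y. \<forall>y\<in>U. inner x y = 1}) ` \<U>"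
        using U(4,5) B(2) by (auto simp: \<U>_def)
    qed
    then have "face_number l (polar n Y) \<le> ecard ((\<lambda>U. {x \<in> polar n Y. \<forall>y\<in>U. inner x y = 1}) ` \<U>)"
      unfolding face_number_def by (rule ecard_mono)
    also have "\<dots> \<le> of_nat (card \<U>)"
      using finU card_image_le[OF finU] by (simp add: ecard_finite)
    also have "\<dots> \<le> of_nat (card \<V> * (n choose l))" using cU by (simp only: of_nat_le_iff)
    also have "\<dots> = of_nat (n choose l) * ecard \<V>" using True by (simp add: ecard_finite mult.commute)
    finally show ?thesis .
  qed
  then have "of_nat (fact n) * face_number l (polar n Y) \<le> of_nat (fact n) * (of_nat (n choose l) * ecard \<V>)"
    by (rule mult_left_mono) simp
  also have "\<dots> = of_nat (n choose l) * (of_nat (fact n) * ecard \<V>)" by (simp only: ac_simps)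
  also have "\<dots> \<le> of_nat (n choose l) * ecard ?O" using VO by (rule mult_left_mono) simp
  finally show ?thesis .
qed

text \<open>The strict inequalities make the constraints of \<open>T\<close> exactly the active ones
  at the solution \<open>x0 T\<close>, so they cut out a face \<open>\<phi> T\<close> of dimension n
  - m. Conversely this face determines the set of constraints, hence it comes from at most m!
  tuples.\<close>

theorem face_number_ge:
  assumes m: "m \<le> n"
  shows "ecard {T \<in> {..<m} \<rightarrow>\<^sub>E Y. regular m T \<and> (\<forall>y\<in>Y - T ` {..<m}. inner (solution m T (\<lambda>_. 1)) y < 1)} \<le>
    of_nat (fact m) * face_number (n - m) (polar n Y)"
proof -
  let ?O = "{T \<in> {..<m} \<rightarrow>\<^sub>E Y. regular m T \<and> (\<forall>y\<in>Y - T ` {..<m}. inner (solution m T (\<lambda>_. 1)) y < 1)}"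
  define x0 where "x0 T = solution m T (\<lambda>_. 1)" for T
  define \<phi> where "\<phi> T = {x \<in> polar n Y. \<forall>y\<in>T ` {..<m}. inner x y = 1}" for T
  have x0: "inner (x0 T) (T i) = 1" if "T \<in> ?O" "i < m" for T i
    using that inner_solution[of m T i "\<lambda>_. 1"] by (auto simp: x0_def inner_commute)
  have x0P: "x0 T \<in> polar n Y" if T: "T \<in> ?O" for T
  proof -
    have "inner (x0 T) y \<le> 1" if "y \<in> Y" for y
      using x0[OF T] T that by (cases "y \<in> T ` {..<m}") (auto simp: x0_def less_imp_le)
    then show ?thesis using Rn_mono[OF m] by (auto simp: polar_def x0_def)
  qed
  have x0\<phi>: "x0 T \<in> \<phi> T" if T: "T \<in> ?O" for T using x0P[OF T] x0[OF T] by (auto simp: \<phi>_def)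
  have act: "active (x0 T) = T ` {..<m}" if T: "T \<in> ?O" for T
  proof (intro equalityI subsetI)
    fix y assume y: "y \<in> active (x0 T)"
    show "y \<in> T ` {..<m}"
    proof (rule ccontr)
      assume "y \<notin> T ` {..<m}"
      moreover have "y \<in> Y" using y by (simp add: active_def)
      ultimately have "inner (x0 T) y < 1" using T unfolding x0_def by blast
      then show False using y by (simp add: active_def)
    qed
  next
    fix y assume "y \<in> T ` {..<m}"
    then obtain i where "i < m" "y = T i" by auto
    then show "y \<in> active (x0 T)" using T x0[OF T] by (auto simp: active_def PiE_iff)
  qed
  \<comment> \<open>The face contains only one point of \<open>Rn m\<close> because
    \<open>T'\<close> is regular, and the active set at that point is the image of the
    tuple.\<close>
  have same: "T ` {..<m} = T' ` {..<m}" if T: "T \<in> ?O" "T' \<in> ?O" "\<phi> T = \<phi> T'" for T T'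
  proof -
    have "x0 T \<in> \<phi> T'" using x0\<phi>[OF T(1)] T(3) by simp
    then have "x0 T = x0 T'"
      unfolding x0_def[of T'] using T(2) by (intro solution_unique) (auto simp: \<phi>_def x0_def inner_commute)
    then show ?thesis using act[OF T(1)] act[OF T(2)] by simp
  qed
  have A: "ecard ?O \<le> of_nat (fact m) * ecard (\<phi> ` ?O)"
  proof (rule ecard_fibers_le)
    fix F assume "F \<in> \<phi> ` ?O"
    then obtain T where T: "T \<in> ?O" "F = \<phi> T" by auto
    have inj: "inj_on T {..<m}" using T(1) by (auto intro: regular_inj)
    have sub: "{T' \<in> ?O. \<phi> T' = F} \<subseteq> {T' \<in> {..<m} \<rightarrow>\<^sub>E T ` {..<m}. inj_on T' {..<m}}"
    proof
      fix T' assume T': "T' \<in> {T' \<in> ?O. \<phi> T' = F}"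
      then have O': "T' \<in> ?O" and e: "\<phi> T' = \<phi> T" using T(2) by blast+
      note im = same[OF O' T(1) e]
      have "inj_on T' {..<m}" using O' by (auto intro: regular_inj)
      moreover have "T' \<in> {..<m} \<rightarrow>\<^sub>E T ` {..<m}"
        unfolding im[symmetric] using O' by (auto simp: PiE_def)
      ultimately show "T' \<in> {T' \<in> {..<m} \<rightarrow>\<^sub>E T ` {..<m}. inj_on T' {..<m}}" by blast
    qed
    have c: "finite {T' \<in> {..<m} \<rightarrow>\<^sub>E T ` {..<m}. inj_on T' {..<m}}" "card {T' \<in> {..<m} \<rightarrow>\<^sub>E T ` {..<m}. inj_on T' {..<m}} = fact m"
      using card_inj_tuples[of "T ` {..<m}" m] inj by (auto simp: card_image)
    show "finite {T' \<in> ?O. \<phi> T' = F} \<and> card {T' \<in> ?O. \<phi> T' = F} \<le> fact m"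
      using finite_subset[OF sub c(1)] card_mono[OF c(1) sub] unfolding c(2) by (rule conjI)
  qed simp
  have B: "ecard (\<phi> ` ?O) \<le> face_number (n - m) (polar n Y)"
    unfolding face_number_def
  proof (rule ecard_mono, rule image_subsetI)
    fix T assume T: "T \<in> ?O"
    have TY: "T ` {..<m} \<subseteq> Y" using T by auto
    have TRn: "T ` {..<m} \<subseteq> Rn n" using TY YRn by auto
    have ind: "independent (T ` {..<m})" using T regular_independent by blast
    have cT: "card (T ` {..<m}) = m" using T by (auto simp: card_image regular_inj)
    define E where "E = {d \<in> Rn n. \<forall>y\<in>T ` {..<m}. inner y d = 0}"
    have "dim {x - y | x y. x \<in> \<phi> T \<and> y \<in> \<phi> T} = dim E"
    proof (rule dim_eq_subspace)
      show "{x - y | x y. x \<in> \<phi> T \<and> y \<in> \<phi> T} \<subseteq> E"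
        by (auto simp: E_def \<phi>_def polar_def inner_diff_right inner_commute intro: Rn_diff)
      show "E \<subseteq> span {x - y | x y. x \<in> \<phi> T \<and> y \<in> \<phi> T}"
      proof
        fix d assume d: "d \<in> E"
        have dz: "inner d y = 0" if "y \<in> active (x0 T)" for y using d that act[OF T] by (auto simp: E_def inner_commute)
        obtain \<tau> where \<tau>: "0 < \<tau>" "\<And>t. \<bar>t\<bar> \<le> \<tau> \<Longrightarrow> x0 T + t *\<^sub>R d \<in> polar n Y"
          using small_step[OF x0P[OF T] _ dz] d by (auto simp: E_def)
        have "x0 T + \<tau> *\<^sub>R d \<in> \<phi> T"
          using \<tau>(2)[of \<tau>] \<tau>(1) x0[OF T] dz act[OF T] by (auto simp: \<phi>_def inner_add_left)
        then have "(x0 T + \<tau> *\<^sub>R d) - x0 T \<in> span {x - y | x y. x \<in> \<phi> T \<and> y \<in> \<phi> T}"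
          using x0\<phi>[OF T] by (intro span_base) blast
        then have "(1 / \<tau>) *\<^sub>R ((x0 T + \<tau> *\<^sub>R d) - x0 T) \<in> span {x - y | x y. x \<in> \<phi> T \<and> y \<in> \<phi> T}" by (rule span_scale)
        then show "d \<in> span {x - y | x y. x \<in> \<phi> T \<and> y \<in> \<phi> T}" using \<tau>(1) by simp
      qed
    qed
    also have "dim E = n - m" unfolding E_def using dim_orthogonal[OF ind TRn] cT by simp
    finally show "\<phi> T \<in> {F. F face_of polar n Y \<and> F \<noteq> {} \<and> dim {x - y | x y. x \<in> F \<and> y \<in> F} = n - m}"
      using active_constraints_face[OF TY] x0\<phi>[OF T] by (auto simp: \<phi>_def)
  qed
  show ?thesis by (rule order_trans[OF A mult_left_mono[OF B]]) simp
qed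

end

section \<open>Tuples of dual points\<close>

lemma PiM_scale_measure:
  fixes M :: "'a measure"
  assumes I: "finite I" and M: "sigma_finite_measure M" and S: "sigma_finite_measure (scale_measure c M)"
  shows "Pi\<^sub>M I (\<lambda>_. scale_measure c M) = scale_measure (c ^ card I) (Pi\<^sub>M I (\<lambda>_. M))"
proof -
  interpret M: product_sigma_finite "\<lambda>_. M" using M by (simp add: product_sigma_finite_def)
  interpret S: product_sigma_finite "\<lambda>_. scale_measure c M" using S by (simp add: product_sigma_finite_def)
  show ?thesis
  proof (rule S.PiM_eqI[OF I, symmetric])
    show "sets (scale_measure (c ^ card I) (Pi\<^sub>M I (\<lambda>_. M))) = sets (Pi\<^sub>M I (\<lambda>_. scale_measure c M))"
      unfolding sets_scale_measure by (rule sets_PiM_cong) auto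
    fix A assume "\<And>i. i \<in> I \<Longrightarrow> A i \<in> sets (scale_measure c M)"
    then show "emeasure (scale_measure (c ^ card I) (Pi\<^sub>M I (\<lambda>_. M))) (Pi\<^sub>E I A) = (\<Prod>i\<in>I. emeasure (scale_measure c M) (A i))"
      using I by (simp add: M.emeasure_PiM prod.distrib)
  qed
qed

text \<open>These sets exhaust the space and have finite intensity. The origin is included to make
  the union the whole space; it is a null set.\<close>

definition far :: "nat \<Rightarrow> seq set"
  where "far k = {y. y = 0 \<or> 1 / real (Suc k) \<le> norm y}"

lemma far_borel [measurable]: "far k \<in> sets borel"
  unfolding far_def by measurable

lemma far_UN: "(\<Union>k. far k) = UNIV"
proof -
  have "y \<in> (\<Union>k. far k)" for y
  proof (cases "y = 0")
    case False
    then obtain k where "1 / real (Suc k) < norm y" using nat_approx_posE[of "norm y"] by auto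
    then show ?thesis by (auto simp: far_def intro: less_imp_le)
  qed (simp add: far_def)
  then show ?thesis by blast
qed

lemma AE_pow_measure_nonzero: "AE s in pow_measure r. s \<noteq> 0"
  unfolding pow_measure_def by (subst AE_density) (auto intro: AE_lborel_singleton[THEN eventually_mono])

text \<open>The condition |g/s| at least \<delta> bounds |s| by |g|/\<delta>, so the mass is
  controlled by the r-th moment of the Gaussian norm. The factor 2 below gives a strict inequality,
  for which the mass is known.\<close>

lemma emeasure_dual_intensity_far:
  assumes r: "0 < r" and n: "0 < n"
  shows "emeasure (dual_intensity n r) (far k) < \<infinity>"
proof -
  define \<delta> where "\<delta> = 1 / real (Suc k)"
  have \<delta>: "0 < \<delta>" by (simp add: \<delta>_def)
  have ng: "AE g in gauss n. g \<noteq> 0" using n by (rule AE_gauss_nonzero)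
  have "emeasure (dual_intensity n r) (far k) = (\<integral>\<^sup>+y. indicator (far k) y \<partial>dual_intensity n r)" by simp
  also have "\<dots> = (\<integral>\<^sup>+g. (\<integral>\<^sup>+s. indicator (far k) (g /\<^sub>R s) \<partial>pow_measure r) \<partial>gauss n)"
    by (rule nn_integral_dual_intensity) measurable
  also have "\<dots> \<le> (\<integral>\<^sup>+g. ennreal (2 / r * (2 / \<delta>) powr r) * ennreal (norm g powr r) \<partial>gauss n)"
  proof (intro nn_integral_mono_AE, use ng in eventually_elim)
    case (elim g)
    then have g: "0 < norm g" by simp
    have "(\<integral>\<^sup>+s. indicator (far k) (g /\<^sub>R s) \<partial>pow_measure r) \<le> (\<integral>\<^sup>+s. indicator {s. \<bar>s\<bar> < 2 * norm g / \<delta>} s \<partial>pow_measure r)"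
    proof (intro nn_integral_mono_AE, use AE_pow_measure_nonzero in eventually_elim)
      case (elim s)
      have "\<bar>s\<bar> < 2 * norm g / \<delta>" if "g /\<^sub>R s \<in> far k"
      proof -
        have "\<delta> \<le> norm g / \<bar>s\<bar>" using that elim g by (auto simp: far_def \<delta>_def divide_inverse mult.commute)
        then have "\<delta> * \<bar>s\<bar> \<le> norm g" using elim by (simp add: pos_le_divide_eq)
        also have "\<dots> < 2 * norm g" using g by simp
        finally show ?thesis using \<delta> by (simp add: pos_less_divide_eq mult.commute)
      qed
      then show ?case by (auto split: split_indicator)
    qed
    also have "\<dots> = ennreal (2 / r * (2 * norm g / \<delta>) powr r)"
      using pow_measure_abs_less[OF r, of "2 * norm g / \<delta>"] g \<delta> by simp
    also have "2 / r * (2 * norm g / \<delta>) powr r = (2 / r * (2 / \<delta>) powr r) * norm g powr r"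
      using g \<delta> powr_mult[of "2 / \<delta>" "norm g" r] by simp
    also have "ennreal \<dots> = ennreal (2 / r * (2 / \<delta>) powr r) * ennreal (norm g powr r)"
      using r by (intro ennreal_mult) auto
    finally show ?case .
  qed
  also have "\<dots> = ennreal (2 / r * (2 / \<delta>) powr r) * (\<integral>\<^sup>+g. ennreal (norm g powr r) \<partial>gauss n)"
    by (rule nn_integral_cmult) measurable
  also have "\<dots> < \<infinity>"
    using nn_integral_gauss_norm_powr(1)[of r n] r n by (simp add: ennreal_mult_less_top)
  finally show ?thesis .
qed

lemma sigma_finite_scale_dual_intensity:
  assumes r: "0 < r" and n: "0 < n" and c: "c < \<infinity>"
  shows "sigma_finite_measure (scale_measure c (dual_intensity n r))"
proof
  show "\<exists>A. countable A \<and> A \<subseteq> sets (scale_measure c (dual_intensity n r)) \<and> \<Union> A = space (scale_measure c (dual_intensity n r)) \<and>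
      (\<forall>a\<in>A. emeasure (scale_measure c (dual_intensity n r)) a \<noteq> \<infinity>)"
  proof (intro exI[of _ "range far"] conjI ballI)
    fix a assume "a \<in> range far"
    then obtain k where "a = far k" by auto
    then have "emeasure (scale_measure c (dual_intensity n r)) a < \<infinity>"
      using emeasure_dual_intensity_far[OF r n, of k] c by (simp add: ennreal_mult_less_top)
    then show "emeasure (scale_measure c (dual_intensity n r)) a \<noteq> \<infinity>" by simp
  qed (auto simp: far_UN space_scale_measure)
qed

lemma sigma_finite_dual_intensity: "0 < r \<Longrightarrow> 0 < n \<Longrightarrow> sigma_finite_measure (dual_intensity n r)"
  using sigma_finite_scale_dual_intensity[of r n 1] by simp

text \<open>The product of images is the image of the product, which is checked on rectangles. The
  distances are integrated last, so that for fixed distances the inner integral is over a Gaussian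
  matrix and its invariance can be used.\<close>

theorem nn_integral_PiM_dual_intensity:
  fixes f :: "(nat \<Rightarrow> seq) \<Rightarrow> ennreal" and m :: nat
  assumes r: "0 < r" and n: "0 < n" and f [measurable]: "f \<in> borel_measurable (Pi\<^sub>M {..<m} (\<lambda>_. borel))"
  shows "(\<integral>\<^sup>+T. f T \<partial>Pi\<^sub>M {..<m} (\<lambda>_. dual_intensity n r)) =
    (\<integral>\<^sup>+s. (\<integral>\<^sup>+A. f (\<lambda>i\<in>{..<m}. A i /\<^sub>R s i) \<partial>Pi\<^sub>M {..<m} (\<lambda>_. gauss n)) \<partial>Pi\<^sub>M {..<m} (\<lambda>_. pow_measure r))"
proof -
  interpret D: product_sigma_finite "\<lambda>_. dual_intensity n r"
    using sigma_finite_dual_intensity[OF r n] by (simp add: product_sigma_finite_def)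
  interpret R: product_sigma_finite "\<lambda>_. pow_measure r"
    using sigma_finite_pow_measure by (simp add: product_sigma_finite_def)
  interpret G: product_prob_space "\<lambda>_. gauss n" "{..<m}" by standard
  define PG PR where "PG = Pi\<^sub>M {..<m} (\<lambda>_. gauss n)" and "PR = Pi\<^sub>M {..<m} (\<lambda>_. pow_measure r)"
  interpret PR: sigma_finite_measure PR unfolding PR_def by (rule R.sigma_finite) simp
  interpret PG: prob_space PG unfolding PG_def by (rule prob_space_PiM) (rule prob_space_gauss)
  interpret P: pair_sigma_finite PR PG by standard
  have sPG [measurable_cong]: "sets PG = sets (Pi\<^sub>M {..<m} (\<lambda>_. borel))" unfolding PG_def by (rule sets_PiM_cong) auto
  have sPR [measurable_cong]: "sets PR = sets (Pi\<^sub>M {..<m} (\<lambda>_. borel))" unfolding PR_def by (rule sets_PiM_cong) auto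
  have sD: "sets (Pi\<^sub>M {..<m} (\<lambda>_. dual_intensity n r)) = sets (Pi\<^sub>M {..<m} (\<lambda>_. borel))" by (rule sets_PiM_cong) auto
  define h where "h = (\<lambda>p :: (nat \<Rightarrow> real) \<times> (nat \<Rightarrow> seq). \<lambda>i\<in>{..<m}. snd p i /\<^sub>R fst p i)"
  have h [measurable]: "h \<in> measurable (PR \<Otimes>\<^sub>M PG) (Pi\<^sub>M {..<m} (\<lambda>_. borel))"
  proof -
    have "(\<lambda>p. snd p i /\<^sub>R fst p i) \<in> borel_measurable (PR \<Otimes>\<^sub>M PG)" if i: "i \<in> {..<m}" for i
    proof -
      have [measurable]: "(\<lambda>A. A i) \<in> borel_measurable PG" "(\<lambda>s. s i) \<in> borel_measurable PR"
        using measurable_component_singleton[OF i] by (simp_all cong: measurable_cong_sets add: sPG sPR)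
      show ?thesis by measurable
    qed
    then show ?thesis unfolding h_def by (rule measurable_restrict)
  qed
  have eq: "distr (PR \<Otimes>\<^sub>M PG) (Pi\<^sub>M {..<m} (\<lambda>_. borel)) h = Pi\<^sub>M {..<m} (\<lambda>_. dual_intensity n r)"
  proof (rule D.PiM_eqI)
    show "sets (distr (PR \<Otimes>\<^sub>M PG) (Pi\<^sub>M {..<m} (\<lambda>_. borel)) h) = sets (Pi\<^sub>M {..<m} (\<lambda>_. dual_intensity n r))" by (simp add: sD)
    fix B assume "\<And>i. i \<in> {..<m} \<Longrightarrow> B i \<in> sets (dual_intensity n r)"
    then have B [measurable]: "\<And>i. i \<in> {..<m} \<Longrightarrow> B i \<in> sets borel" by simp
    have BP: "Pi\<^sub>E {..<m} B \<in> sets (Pi\<^sub>M {..<m} (\<lambda>_. borel))" using B by (intro sets_PiM_I_finite) auto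
    note [measurable] = BP
    have "emeasure (distr (PR \<Otimes>\<^sub>M PG) (Pi\<^sub>M {..<m} (\<lambda>_. borel)) h) (Pi\<^sub>E {..<m} B) = (\<integral>\<^sup>+T. indicator (Pi\<^sub>E {..<m} B) T \<partial>distr (PR \<Otimes>\<^sub>M PG) (Pi\<^sub>M {..<m} (\<lambda>_. borel)) h)"
      using BP by simp
    also have "\<dots> = (\<integral>\<^sup>+p. indicator (Pi\<^sub>E {..<m} B) (h p) \<partial>(PR \<Otimes>\<^sub>M PG))"
      by (rule nn_integral_distr) measurable
    also have "\<dots> = (\<integral>\<^sup>+s. (\<integral>\<^sup>+A. indicator (Pi\<^sub>E {..<m} B) (h (s, A)) \<partial>PG) \<partial>PR)"
      by (rule PG.nn_integral_fst[symmetric]) measurable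
    also have "\<dots> = (\<integral>\<^sup>+s. (\<Prod>i<m. \<integral>\<^sup>+g. indicator (B i) (g /\<^sub>R s i) \<partial>gauss n) \<partial>PR)"
    proof (rule nn_integral_cong)
      fix s
      have "(\<integral>\<^sup>+A. indicator (Pi\<^sub>E {..<m} B) (h (s, A)) \<partial>PG) = (\<integral>\<^sup>+A. (\<Prod>i<m. indicator (B i) (A i /\<^sub>R s i)) \<partial>PG)"
      proof (rule nn_integral_cong)
        fix A
        show "indicator (Pi\<^sub>E {..<m} B) (h (s, A)) = (\<Prod>i<m. indicator (B i) (A i /\<^sub>R s i) :: ennreal)"
        proof (cases "\<forall>i<m. A i /\<^sub>R s i \<in> B i")
          case True then show ?thesis by (auto simp: h_def PiE_iff indicator_def)
        next
          case False
          then obtain i where i: "i < m" "A i /\<^sub>R s i \<notin> B i" by auto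
          then have "(\<Prod>i<m. indicator (B i) (A i /\<^sub>R s i) :: ennreal) = 0" by (intro prod_zero) (auto intro!: bexI[of _ i])
          then show ?thesis using i by (auto simp: h_def PiE_iff indicator_def)
        qed
      qed
      also have "\<dots> = (\<Prod>i<m. \<integral>\<^sup>+g. indicator (B i) (g /\<^sub>R s i) \<partial>gauss n)"
        unfolding PG_def by (rule G.product_nn_integral_prod) auto
      finally show "(\<integral>\<^sup>+A. indicator (Pi\<^sub>E {..<m} B) (h (s, A)) \<partial>PG) = (\<Prod>i<m. \<integral>\<^sup>+g. indicator (B i) (g /\<^sub>R s i) \<partial>gauss n)" .
    qed
    also have "\<dots> = (\<Prod>i<m. \<integral>\<^sup>+s. (\<integral>\<^sup>+g. indicator (B i) (g /\<^sub>R s) \<partial>gauss n) \<partial>pow_measure r)"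
      unfolding PR_def
    proof (rule R.product_nn_integral_prod)
      fix i assume "i \<in> {..<m}"
      then have [measurable]: "B i \<in> sets borel" by (rule B)
      show "(\<lambda>s. \<integral>\<^sup>+g. indicator (B i) (g /\<^sub>R s) \<partial>gauss n) \<in> borel_measurable (pow_measure r)"
        by (rule gauss.borel_measurable_nn_integral) measurable
    qed simp
    also have "\<dots> = (\<Prod>i\<in>{..<m}. emeasure (dual_intensity n r) (B i))"
    proof (rule prod.cong)
      fix i assume "i \<in> {..<m}"
      then have [measurable]: "B i \<in> sets borel" by (rule B)
      interpret Q: pair_sigma_finite "gauss n" "pow_measure r"
        by (simp add: pair_sigma_finite_def gauss.sigma_finite_measure_axioms sigma_finite_pow_measure)
      have "(\<integral>\<^sup>+s. (\<integral>\<^sup>+g. indicator (B i) (g /\<^sub>R s) \<partial>gauss n) \<partial>pow_measure r) = (\<integral>\<^sup>+g. (\<integral>\<^sup>+s. indicator (B i) (g /\<^sub>R s) \<partial>pow_measure r) \<partial>gauss n)"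
        by (rule Q.Fubini') (simp add: split_beta')
      also have "\<dots> = (\<integral>\<^sup>+y. indicator (B i) y \<partial>dual_intensity n r)"
        by (rule nn_integral_dual_intensity[symmetric]) measurable
      finally show "(\<integral>\<^sup>+s. (\<integral>\<^sup>+g. indicator (B i) (g /\<^sub>R s) \<partial>gauss n) \<partial>pow_measure r) = emeasure (dual_intensity n r) (B i)" by simp
    qed simp
    finally show "emeasure (distr (PR \<Otimes>\<^sub>M PG) (Pi\<^sub>M {..<m} (\<lambda>_. borel)) h) (Pi\<^sub>E {..<m} B) = (\<Prod>i\<in>{..<m}. emeasure (dual_intensity n r) (B i))" .
  qed simp
  have "(\<integral>\<^sup>+T. f T \<partial>Pi\<^sub>M {..<m} (\<lambda>_. dual_intensity n r)) = (\<integral>\<^sup>+p. f (h p) \<partial>(PR \<Otimes>\<^sub>M PG))"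
    unfolding eq[symmetric] by (rule nn_integral_distr) measurable
  also have "\<dots> = (\<integral>\<^sup>+s. (\<integral>\<^sup>+A. f (h (s, A)) \<partial>PG) \<partial>PR)"
    by (rule PG.nn_integral_fst[symmetric]) measurable
  finally show ?thesis by (simp add: h_def PG_def PR_def)
qed

section \<open>Gaussian linear systems\<close>

lemma gauss_orthogonal_null:
  assumes w: "w \<in> Rn n" "w \<noteq> 0"
  shows "AE g in gauss n. inner g w \<noteq> 0"
proof -
  have n: "0 < n"
  proof (rule ccontr)
    assume "\<not> 0 < n"
    then have "w = 0" using w by (intro poly_mapping_eqI) (simp add: Rn_iff)
    then show False using w by simp
  qed
  have "(\<integral>\<^sup>+g. indicator {0} (inner g w) \<partial>gauss n) = (\<integral>\<^sup>+x. indicator {0} (norm w * x) \<partial>std_normal)"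
    by (rule nn_integral_gauss_inner[OF w(1) n]) measurable
  also have "\<dots> = (\<integral>\<^sup>+x. indicator {0} x \<partial>std_normal)"
    using w by (intro nn_integral_cong) (auto split: split_indicator)
  also have "\<dots> = 0"
    unfolding std_normal_def by (subst nn_integral_density)
      (auto intro!: nn_integral_0_iff_AE[THEN iffD2] AE_lborel_singleton[THEN eventually_mono])
  finally have "AE g in gauss n. indicator {0} (inner g w) = (0 :: ennreal)"
    by (subst (asm) nn_integral_0_iff_AE) auto
  then show ?thesis by eventually_elim (auto split: split_indicator_asm)
qed

text \<open>Deleting the last row and column leaves the smaller system. For k regular rows the
  cofactor vector of the next row is therefore nonzero.\<close>

lemma cofactor_vec_last: "coord (cofactor_vec (Suc k) T k) k = row_det k T"
proof -
  have "mat_delete (row_matrix (Suc k) T) k k = row_matrix k T"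
    by (rule eq_matI) (auto simp: mat_delete_def row_matrix_def)
  then show ?thesis
    by (simp add: cofactor_vec_def lookup_emb cofactor_def row_det_def)
qed

lemma cofactor_vec_upd: "i < m \<Longrightarrow> cofactor_vec m (T(i := a)) i = cofactor_vec m T i"
  unfolding cofactor_vec_def by (rule emb_cong) (simp add: cofactor_row_upd)

lemma cofactor_vec_nonzero: "regular k T \<Longrightarrow> cofactor_vec (Suc k) T k \<noteq> 0"
  using cofactor_vec_last[of k T] by (auto simp: regular_iff_det)

lemma measurable_PiM_gauss:
  "f \<in> measurable (Pi\<^sub>M I (\<lambda>_. borel)) N \<Longrightarrow> f \<in> measurable (Pi\<^sub>M I (\<lambda>_. gauss n)) N"
proof -
  assume f: "f \<in> measurable (Pi\<^sub>M I (\<lambda>_. borel)) N"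
  have "sets (Pi\<^sub>M I (\<lambda>_. gauss n)) = sets (Pi\<^sub>M I (\<lambda>_. borel))" by (rule sets_PiM_cong) auto
  then show ?thesis using f by (simp cong: measurable_cong_sets)
qed

lemma measurable_regular_solution:
  assumes [measurable]: "(\<phi> :: real \<Rightarrow> ennreal) \<in> borel_measurable borel"
  shows "(\<lambda>A. indicator {A. regular m A} A * \<phi> (norm (solution m A s))) \<in> borel_measurable (Pi\<^sub>M {..<m} (\<lambda>_. borel))"
proof -
  have "(\<lambda>A. if regular m A then \<phi> (norm (solution m A s)) else 0) \<in> borel_measurable (Pi\<^sub>M {..<m} (\<lambda>_. borel))"
    by measurable
  then show ?thesis by (rule measurable_cong[THEN iffD1, rotated]) auto
qed

lemma AE_PiM_insert_gauss:
  assumes P: "Measurable.pred (Pi\<^sub>M {..<Suc k} (\<lambda>_. borel)) P"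
    and AE: "AE T in Pi\<^sub>M {..<k} (\<lambda>_. gauss n). AE g in gauss n. P (T(k := g))"
  shows "AE T in Pi\<^sub>M {..<Suc k} (\<lambda>_. gauss n). P T"
proof -
  interpret G: product_prob_space "\<lambda>_. gauss n" "{..<k}" by standard
  have ins: "{..<Suc k} = insert k {..<k}" by auto
  have [measurable]: "Measurable.pred (Pi\<^sub>M (insert k {..<k}) (\<lambda>_. gauss n)) P"
    using P unfolding ins by (rule measurable_PiM_gauss)
  have "(\<lambda>T. if P T then 0 else 1 :: ennreal) \<in> borel_measurable (Pi\<^sub>M (insert k {..<k}) (\<lambda>_. gauss n))" by measurable
  also have "(\<lambda>T. if P T then 0 else 1 :: ennreal) = indicator {T. \<not> P T}" by (auto simp: fun_eq_iff)
  finally have Im: "(indicator {T. \<not> P T} :: _ \<Rightarrow> ennreal) \<in> borel_measurable (Pi\<^sub>M (insert k {..<k}) (\<lambda>_. gauss n))" .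
  have "(\<integral>\<^sup>+T. indicator {T. \<not> P T} T \<partial>Pi\<^sub>M (insert k {..<k}) (\<lambda>_. gauss n)) =
      (\<integral>\<^sup>+T. (\<integral>\<^sup>+g. indicator {T. \<not> P T} (T(k := g)) \<partial>gauss n) \<partial>Pi\<^sub>M {..<k} (\<lambda>_. gauss n))"
    by (rule G.product_nn_integral_insert[OF _ _ Im]) simp_all
  also have "\<dots> = (\<integral>\<^sup>+T. 0 \<partial>Pi\<^sub>M {..<k} (\<lambda>_. gauss n))"
  proof (rule nn_integral_cong_AE, use AE in eventually_elim)
    case (elim T)
    have "(\<integral>\<^sup>+g. indicator {T. \<not> P T} (T(k := g)) \<partial>gauss n) = (\<integral>\<^sup>+g. 0 \<partial>gauss n)"
      by (rule nn_integral_cong_AE, use elim in eventually_elim) simp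
    then show ?case by simp
  qed
  finally have "(\<integral>\<^sup>+T. indicator {T. \<not> P T} T \<partial>Pi\<^sub>M (insert k {..<k}) (\<lambda>_. gauss n)) = 0" by simp
  then have "AE T in Pi\<^sub>M (insert k {..<k}) (\<lambda>_. gauss n). indicator {T. \<not> P T} T = (0 :: ennreal)"
    using nn_integral_0_iff_AE[OF Im] by simp
  then show ?thesis unfolding ins by eventually_elim (auto split: split_indicator_asm)
qed

text \<open>Given k regular rows, the next determinant is the scalar product of the new row with a
  fixed nonzero vector of \<open>Rn n\<close>, which almost surely does not vanish.\<close>

lemma AE_regular: "k \<le> n \<Longrightarrow> AE T in Pi\<^sub>M {..<k} (\<lambda>_. gauss n). regular k T"
proof (induction k)
  case 0 then show ?case by (auto simp: regular_def Rn_iff intro!: AE_I2 poly_mapping_eqI)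
next
  case (Suc k)
  show ?case
  proof (rule AE_PiM_insert_gauss[OF measurable_regular])
    have "AE T in Pi\<^sub>M {..<k} (\<lambda>_. gauss n). regular k T" using Suc by simp
    then show "AE T in Pi\<^sub>M {..<k} (\<lambda>_. gauss n). AE g in gauss n. regular (Suc k) (T(k := g))"
    proof eventually_elim
      case (elim T)
      have "cofactor_vec (Suc k) T k \<in> Rn n" using Rn_mono[OF Suc.prems] by auto
      from gauss_orthogonal_null[OF this cofactor_vec_nonzero[OF elim]] show ?case
        by eventually_elim (simp add: regular_iff_det inner_cofactor_vec)
    qed
  qed
qed

text \<open>If only the last entry of the right-hand side is nonzero, the solution is \<rho> w / <g,
  w> with g the last row and w the cofactor vector of the other rows. For fixed other rows <g,
  w>/|w| is standard normal, so the norm has the law of \<rho>/|N|.\<close>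

lemma nn_integral_solution_last:
  fixes \<phi> :: "real \<Rightarrow> ennreal"
  assumes k: "Suc k \<le> n" and \<rho>: "0 < \<rho>" and \<phi> [measurable]: "\<phi> \<in> borel_measurable borel"
  shows "(\<integral>\<^sup>+A. indicator {A. regular (Suc k) A} A * \<phi> (norm (solution (Suc k) A (\<lambda>i. if i = k then \<rho> else 0))) \<partial>Pi\<^sub>M {..<Suc k} (\<lambda>_. gauss n))
    = (\<integral>\<^sup>+x. \<phi> (\<rho> / \<bar>x\<bar>) \<partial>std_normal)"
proof -
  interpret G: product_prob_space "\<lambda>_. gauss n" "{..<k}" by standard
  have ins: "{..<Suc k} = insert k {..<k}" by auto
  define F where "F A = indicator {A. regular (Suc k) A} A * \<phi> (norm (solution (Suc k) A (\<lambda>i. if i = k then \<rho> else 0)))" for A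
  have "F \<in> borel_measurable (Pi\<^sub>M {..<Suc k} (\<lambda>_. borel))"
    unfolding F_def by (rule measurable_regular_solution[OF \<phi>])
  then have Fm: "F \<in> borel_measurable (Pi\<^sub>M (insert k {..<k}) (\<lambda>_. gauss n))"
    unfolding ins by (rule measurable_PiM_gauss)
  have sol: "solution (Suc k) A (\<lambda>i. if i = k then \<rho> else 0) = (\<rho> / row_det (Suc k) A) *\<^sub>R cofactor_vec (Suc k) A k" for A
    by (simp add: solution_def if_distrib[of "\<lambda>x. x *\<^sub>R _"] cong: if_cong) (simp add: divide_inverse mult.commute)
  have "(\<integral>\<^sup>+A. F A \<partial>Pi\<^sub>M (insert k {..<k}) (\<lambda>_. gauss n)) = (\<integral>\<^sup>+T. (\<integral>\<^sup>+g. F (T(k := g)) \<partial>gauss n) \<partial>Pi\<^sub>M {..<k} (\<lambda>_. gauss n))"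
    by (rule G.product_nn_integral_insert[OF _ _ Fm]) auto
  also have "\<dots> = (\<integral>\<^sup>+T. (\<integral>\<^sup>+x. \<phi> (\<rho> / \<bar>x\<bar>) \<partial>std_normal) \<partial>Pi\<^sub>M {..<k} (\<lambda>_. gauss n))"
  proof (rule nn_integral_cong_AE, use AE_regular[of k n] k in simp, elim eventually_mono)
    fix T assume reg: "regular k T"
    define w where "w = cofactor_vec (Suc k) T k"
    have w: "w \<noteq> 0" "w \<in> Rn n" using cofactor_vec_nonzero[OF reg] Rn_mono[OF k] by (auto simp: w_def)
    have "F (T(k := g)) = indicator (- {0}) (inner g w) * \<phi> (\<rho> * norm w / \<bar>inner g w\<bar>)" for g
    proof -
      have "row_det (Suc k) (T(k := g)) = inner g w" by (simp add: w_def inner_cofactor_vec)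
      moreover have "cofactor_vec (Suc k) (T(k := g)) k = w" by (simp add: w_def cofactor_vec_upd)
      ultimately show ?thesis using \<rho> by (simp add: F_def sol regular_iff_det abs_mult indicator_def)
    qed
    then have "(\<integral>\<^sup>+g. F (T(k := g)) \<partial>gauss n) = (\<integral>\<^sup>+g. indicator (- {0}) (inner g w) * \<phi> (\<rho> * norm w / \<bar>inner g w\<bar>) \<partial>gauss n)" by simp
    also have "\<dots> = (\<integral>\<^sup>+x. indicator (- {0}) (norm w * x) * \<phi> (\<rho> * norm w / \<bar>norm w * x\<bar>) \<partial>std_normal)"
      using k by (intro nn_integral_gauss_inner[OF w(2), where f = "\<lambda>y. indicator (- {0}) y * \<phi> (\<rho> * norm w / \<bar>y\<bar>)"]) auto
    also have "\<dots> = (\<integral>\<^sup>+x. \<phi> (\<rho> / \<bar>x\<bar>) \<partial>std_normal)"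
    proof -
      have "AE x in std_normal. x \<noteq> 0"
        unfolding std_normal_def by (subst AE_density) (auto intro: AE_lborel_singleton[THEN eventually_mono])
      then show ?thesis
        by (intro nn_integral_cong_AE, eventually_elim) (use w in \<open>simp add: abs_mult indicator_def\<close>)
    qed
    finally show "(\<integral>\<^sup>+g. F (T(k := g)) \<partial>gauss n) = (\<integral>\<^sup>+x. \<phi> (\<rho> / \<bar>x\<bar>) \<partial>std_normal)" .
  qed
  also have "\<dots> = (\<integral>\<^sup>+x. \<phi> (\<rho> / \<bar>x\<bar>) \<partial>std_normal)"
    using prob_space.emeasure_space_1[OF prob_space_PiM[OF prob_space_gauss], of "{..<k}" "\<lambda>_. n"] by simp
  finally show ?thesis unfolding F_def ins .
qed

lemma inner_mix: "i < m \<Longrightarrow> inner (mix m w A i) z = mix m w (\<lambda>k. inner (A k) z) i"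
  by (simp add: mix_def inner_diff_left inner_sum_left)

lemma regular_mix_imp:
  assumes w: "(\<Sum>i<m. (w i)\<^sup>2) = 1" and A: "regular m A"
  shows "regular m (mix m w A)"
  unfolding regular_def
proof (intro ballI impI)
  fix z assume z: "z \<in> Rn m" "\<forall>i<m. inner (mix m w A i) z = 0"
  have "inner (A i) z = 0" if i: "i < m" for i
  proof -
    have "inner (A i) z = mix m w (mix m w (\<lambda>k. inner (A k) z)) i" by (simp add: mix_mix[OF w i])
    also have "\<dots> = mix m w (\<lambda>_. 0) i"
      using z(2) by (intro fun_cong[OF mix_cong]) (simp flip: inner_mix)
    also have "\<dots> = 0" using i by (simp add: mix_def)
    finally show ?thesis .
  qed
  then show "z = 0" using A z(1) by (auto simp: regular_def)
qed

lemma regular_cong: "(\<And>i. i < m \<Longrightarrow> A i = B i) \<Longrightarrow> regular m A = regular m B"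
  by (simp add: regular_def)

lemma regular_mix:
  assumes w: "(\<Sum>i<m. (w i)\<^sup>2) = 1"
  shows "regular m (mix m w A) \<longleftrightarrow> regular m A"
  using regular_mix_imp[OF w, of A] regular_mix_imp[OF w, of "mix m w A"]
    regular_cong[of m "mix m w (mix m w A)" A] mix_mix[OF w] by auto

text \<open>A reflection of R^m takes the right-hand side \<open>s\<close> to a multiple of the last
  unit vector. Its mirror vector \<open>w\<close> serves to mix the rows: the mixed system has the
  same solution, the special right-hand side \<open>s'\<close> and rows of the same law.\<close>

theorem nn_integral_solution:
  fixes \<phi> :: "real \<Rightarrow> ennreal"
  assumes m: "1 \<le> m" "m \<le> n" and s: "0 < norm (emb m s)" and \<phi> [measurable]: "\<phi> \<in> borel_measurable borel"
  shows "(\<integral>\<^sup>+A. indicator {A. regular m A} A * \<phi> (norm (solution m A s)) \<partial>Pi\<^sub>M {..<m} (\<lambda>_. gauss n))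
    = (\<integral>\<^sup>+x. \<phi> (norm (emb m s) / \<bar>x\<bar>) \<partial>std_normal)"
proof -
  define k where "k = m - 1"
  have k: "m = Suc k" "k < m" using m by (auto simp: k_def)
  define \<rho> where "\<rho> = norm (emb m s)"
  define s' where "s' = (\<lambda>i. if i = k then \<rho> else 0)"
  have last: "(\<integral>\<^sup>+A. indicator {A. regular m A} A * \<phi> (norm (solution m A s')) \<partial>Pi\<^sub>M {..<m} (\<lambda>_. gauss n)) = (\<integral>\<^sup>+x. \<phi> (\<rho> / \<bar>x\<bar>) \<partial>std_normal)"
    unfolding s'_def k(1) using m(2) s k by (intro nn_integral_solution_last) (auto simp: \<rho>_def)
  have es': "emb m s' = \<rho> *\<^sub>R \<e> k"
    using k by (intro poly_mapping_eqI) (auto simp: lookup_emb s'_def lookup_single when_def)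
  show ?thesis
  proof (cases "emb m s = emb m s'")
    case True
    have "s i = s' i" if "i < m" for i
      using arg_cong[OF True, of "\<lambda>x. coord x i"] that by (simp add: lookup_emb)
    then have "solution m A s = solution m A s'" for A by (simp add: solution_def)
    then show ?thesis using last by (simp add: \<rho>_def)
  next
    case False
    have "norm (emb m s) = norm (emb m s')" using s by (simp add: es' \<rho>_def)
    then obtain a where a: "a \<in> Rn m" "norm a = 1" "reflect a (emb m s) = emb m s'"
      using False by (elim reflect_exists) auto
    define w where "w = coord a"
    have w: "(\<Sum>i<m. (w i)\<^sup>2) = 1"
      using a(2) unfolding norm_Rn[OF a(1)] w_def by simp
    have ms: "mix m w s i = s' i" if i: "i < m" for i
    proof -
      have "s' i = coord (reflect a (emb m s)) i" using a(3) i by (simp add: lookup_emb)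
      also have "\<dots> = s i - 2 * inner (emb m s) a * w i"
        using i by (simp add: reflect_def lookup_minus lookup_emb w_def)
      also have "inner (emb m s) a = (\<Sum>j<m. w j * s j)"
        unfolding inner_Rn[OF emb_in_Rn] by (intro sum.cong) (auto simp: lookup_emb w_def)
      finally show ?thesis using i by (simp add: mix_def mult.commute mult.left_commute)
    qed
    have sol: "solution m A s = solution m (mix m w A) s'" if A: "regular m A" for A
    proof (rule solution_unique)
      show "regular m (mix m w A)" using A by (simp add: regular_mix[OF w])
      show "inner (mix m w A i) (solution m A s) = s' i" if i: "i < m" for i
      proof -
        have "inner (mix m w A i) (solution m A s) = mix m w (\<lambda>k. inner (A k) (solution m A s)) i" by (rule inner_mix[OF i])
        also have "mix m w (\<lambda>k. inner (A k) (solution m A s)) = mix m w s"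
          by (rule mix_cong) (simp add: inner_solution[OF A])
        finally show ?thesis by (simp add: ms[OF i])
      qed
    qed simp
    define F where "F A = indicator {A. regular m A} A * \<phi> (norm (solution m A s'))" for A
    have "F \<in> borel_measurable (Pi\<^sub>M {..<m} (\<lambda>_. borel))"
      unfolding F_def by (rule measurable_regular_solution[OF \<phi>])
    then have Fm [measurable]: "F \<in> borel_measurable (Pi\<^sub>M {..<m} (\<lambda>_. gauss n))" by (rule measurable_PiM_gauss)
    have sg: "sets (Pi\<^sub>M {..<m} (\<lambda>_. gauss n)) = sets (Pi\<^sub>M {..<m} (\<lambda>_. borel))" by (rule sets_PiM_cong) auto
    have mm: "mix m w \<in> measurable (Pi\<^sub>M {..<m} (\<lambda>_. gauss n)) (Pi\<^sub>M {..<m} (\<lambda>_. gauss n))"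
      using measurable_mix[of m w] by (simp cong: measurable_cong_sets add: sg)
    have "indicator {A. regular m A} A * \<phi> (norm (solution m A s)) = F (mix m w A)" for A
      by (cases "regular m A") (simp_all add: F_def regular_mix[OF w] sol)
    then have "(\<integral>\<^sup>+A. indicator {A. regular m A} A * \<phi> (norm (solution m A s)) \<partial>Pi\<^sub>M {..<m} (\<lambda>_. gauss n)) = (\<integral>\<^sup>+A. F (mix m w A) \<partial>Pi\<^sub>M {..<m} (\<lambda>_. gauss n))"
      by simp
    also have "\<dots> = (\<integral>\<^sup>+A. F A \<partial>distr (Pi\<^sub>M {..<m} (\<lambda>_. gauss n)) (Pi\<^sub>M {..<m} (\<lambda>_. gauss n)) (mix m w))"
      by (rule nn_integral_distr[symmetric]) (use mm Fm in auto)
    also have "\<dots> = (\<integral>\<^sup>+x. \<phi> (\<rho> / \<bar>x\<bar>) \<partial>std_normal)"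
      unfolding gauss_PiM_mix[OF w] F_def by (rule last)
    finally show ?thesis by (simp add: \<rho>_def)
  qed
qed

section \<open>The integral over vertex positions\<close>

lemma distr_pow_measure_scale:
  assumes R: "0 < R"
  shows "distr (pow_measure r) borel (\<lambda>x. x / R) = scale_measure (ennreal (R powr r)) (pow_measure r)"
proof (rule measure_eqI)
  fix B assume "B \<in> sets (distr (pow_measure r) borel (\<lambda>x. x / R))"
  then have B [measurable]: "B \<in> sets borel" by simp
  have "emeasure (distr (pow_measure r) borel (\<lambda>x. x / R)) B = (\<integral>\<^sup>+y. indicator B y \<partial>distr (pow_measure r) borel (\<lambda>x. x / R))" by simp
  also have "\<dots> = (\<integral>\<^sup>+x. ennreal (\<bar>x\<bar> powr (r - 1)) * indicator B (x / R) \<partial>lborel)"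
    by (subst nn_integral_distr) (auto intro: nn_integral_pow_measure)
  also have "\<dots> = ennreal \<bar>R\<bar> * (\<integral>\<^sup>+x. ennreal (\<bar>0 + R * x\<bar> powr (r - 1)) * indicator B ((0 + R * x) / R) \<partial>lborel)"
    by (rule nn_integral_real_affine) (use R in auto)
  also have "\<dots> = (\<integral>\<^sup>+x. ennreal \<bar>R\<bar> * (ennreal (\<bar>0 + R * x\<bar> powr (r - 1)) * indicator B ((0 + R * x) / R)) \<partial>lborel)"
    by (rule nn_integral_cmult[symmetric]) measurable
  also have "\<dots> = (\<integral>\<^sup>+x. ennreal (R powr r) * (ennreal (\<bar>x\<bar> powr (r - 1)) * indicator B x) \<partial>lborel)"
  proof (rule nn_integral_cong)
    fix x :: real
    have "R * (R * \<bar>x\<bar>) powr (r - 1) = R powr r * \<bar>x\<bar> powr (r - 1)"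
      using R by (simp add: powr_mult powr_diff)
    then have "ennreal \<bar>R\<bar> * ennreal (\<bar>0 + R * x\<bar> powr (r - 1)) = ennreal (R powr r) * ennreal (\<bar>x\<bar> powr (r - 1))"
      using R by (simp add: ennreal_mult[symmetric] abs_mult)
    then show "ennreal \<bar>R\<bar> * (ennreal (\<bar>0 + R * x\<bar> powr (r - 1)) * indicator B ((0 + R * x) / R)) = ennreal (R powr r) * (ennreal (\<bar>x\<bar> powr (r - 1)) * indicator B x)"
      using R by (simp add: mult.assoc[symmetric])
  qed
  also have "\<dots> = ennreal (R powr r) * (\<integral>\<^sup>+x. indicator B x \<partial>pow_measure r)"
    by (subst nn_integral_cmult, measurable) (simp only: nn_integral_pow_measure[OF borel_measurable_indicator[OF B]])
  finally show "emeasure (distr (pow_measure r) borel (\<lambda>x. x / R)) B = emeasure (scale_measure (ennreal (R powr r)) (pow_measure r)) B" by simp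
qed simp

context
  fixes r :: real and m :: nat and \<eta> :: "(nat \<Rightarrow> real) measure"
  assumes r: "0 < r" and m: "0 < m"
  defines "\<eta> \<equiv> Pi\<^sub>M {..<m} (\<lambda>_. pow_measure r)"
begin

interpretation R: product_sigma_finite "\<lambda>_ :: nat. pow_measure r"
  using sigma_finite_pow_measure by (simp add: product_sigma_finite_def)

private lemma sets_eta [measurable_cong]: "sets \<eta> = sets (Pi\<^sub>M {..<m} (\<lambda>_. borel))"
  unfolding \<eta>_def by (rule sets_PiM_cong) auto

private lemma norm_emb_measurable [measurable]: "(\<lambda>s. norm (emb m s)) \<in> borel_measurable \<eta>"
  using measurable_emb[of m] by (simp cong: measurable_cong_sets add: sets_eta)

private lemma sigma_finite_eta: "sigma_finite_measure \<eta>"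
  unfolding \<eta>_def by (rule R.sigma_finite) simp

text \<open>Each factor of the product is homogeneous of degree \<open>r\<close> under scaling,
  hence the product measure of degree m r.\<close>

private lemma ball_scale:
  assumes R: "0 < R"
  shows "emeasure \<eta> {s \<in> space \<eta>. norm (emb m s) < R} = ennreal (R powr (real m * r)) * emeasure \<eta> {s \<in> space \<eta>. norm (emb m s) < 1}"
proof -
  let ?B = "{s \<in> space \<eta>. norm (emb m s) < 1}" and ?N = "Pi\<^sub>M {..<m} (\<lambda>_. borel :: real measure)"
  let ?f = "\<lambda>x. \<lambda>i\<in>{..<m}. x i / R"
  have S: "sigma_finite_measure (scale_measure (ennreal (R powr r)) (pow_measure r))"
  proof
    from sigma_finite_measure.sigma_finite_countable[OF sigma_finite_pow_measure[of r]]
    obtain A where A: "countable A" "A \<subseteq> sets (pow_measure r)" "\<Union> A = space (pow_measure r)" "\<forall>a\<in>A. emeasure (pow_measure r) a \<noteq> \<infinity>" by auto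
    then show "\<exists>A. countable A \<and> A \<subseteq> sets (scale_measure (ennreal (R powr r)) (pow_measure r)) \<and>
        \<Union> A = space (scale_measure (ennreal (R powr r)) (pow_measure r)) \<and> (\<forall>a\<in>A. emeasure (scale_measure (ennreal (R powr r)) (pow_measure r)) a \<noteq> \<infinity>)"
      by (intro exI[of _ A]) (auto simp: space_scale_measure ennreal_mult_eq_top_iff)
  qed
  have "distr \<eta> ?N ?f = Pi\<^sub>M {..<m} (\<lambda>_. distr (pow_measure r) borel (\<lambda>x. x / R))"
    unfolding \<eta>_def
    by (rule distr_PiM_componentwise)
       (use S in \<open>auto simp: R.product_sigma_finite_axioms product_sigma_finite_def distr_pow_measure_scale[OF R]\<close>)
  also have "\<dots> = scale_measure (ennreal (R powr r) ^ card {..<m}) \<eta>"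
    unfolding distr_pow_measure_scale[OF R] \<eta>_def by (rule PiM_scale_measure) (use S sigma_finite_pow_measure in auto)
  finally have D: "distr \<eta> ?N ?f = scale_measure (ennreal (R powr r) ^ m) \<eta>" by simp
  have f: "?f \<in> measurable \<eta> ?N" by measurable
  have B: "?B \<in> sets ?N" unfolding sets_eta[symmetric] by measurable
  have "emb m (?f s) = emb m s /\<^sub>R R" for s
    by (rule poly_mapping_eqI) (auto simp: lookup_emb scaleR_poly_mapping.rep_eq divide_inverse)
  then have "norm (emb m (?f s)) < 1 \<longleftrightarrow> norm (emb m s) < R" for s
    using R by (simp add: field_simps)
  moreover have "space \<eta> = space ?N" by (rule sets_eq_imp_space_eq) (rule sets_eta)
  ultimately have pre: "?f -` ?B \<inter> space \<eta> = {s \<in> space \<eta>. norm (emb m s) < R}"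
    using measurable_space[OF f] by auto
  have "emeasure \<eta> {s \<in> space \<eta>. norm (emb m s) < R} = emeasure (distr \<eta> ?N ?f) ?B"
    unfolding emeasure_distr[OF f B] pre ..
  also have "\<dots> = ennreal (R powr r) ^ m * emeasure \<eta> ?B" by (simp add: D)
  also have "ennreal (R powr r) ^ m = ennreal (R powr (real m * r))"
    using R by (simp add: ennreal_power powr_realpow[symmetric] powr_powr mult.commute)
  finally show ?thesis .
qed

private lemma gauss_eta: "(\<integral>\<^sup>+s. ennreal (exp (- (1 / 2 * norm (emb m s) powr 2))) \<partial>\<eta>) = ennreal (gauss_mass r ^ m)"
proof -
  have "ennreal (exp (- (1 / 2 * norm (emb m s) powr 2))) = (\<Prod>i<m. ennreal (exp (- (s i)\<^sup>2 / 2)))" for s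
  proof -
    have "norm (emb m s) powr 2 = (norm (emb m s))\<^sup>2" by (cases "emb m s = 0") (auto simp: powr_numeral)
    also have "\<dots> = (\<Sum>i<m. (s i)\<^sup>2)"
      by (simp add: norm_Rn[OF emb_in_Rn] sum_nonneg lookup_emb)
    finally show ?thesis by (simp add: prod_ennreal exp_sum[symmetric] sum_distrib_left sum_negf)
  qed
  then have "(\<integral>\<^sup>+s. ennreal (exp (- (1 / 2 * norm (emb m s) powr 2))) \<partial>\<eta>) = (\<Prod>i<m. \<integral>\<^sup>+x. ennreal (exp (- x\<^sup>2 / 2)) \<partial>pow_measure r)"
    unfolding \<eta>_def by (subst R.product_nn_integral_prod[symmetric]) auto
  also have "\<dots> = ennreal (gauss_mass r ^ m)"
    using nn_integral_pow_measure_gauss[OF r] gauss_mass_pos[OF r] by (simp add: ennreal_power less_imp_le)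
  finally show ?thesis .
qed

text \<open>The mass of the Euclidean unit ball under the product of the weights |s|^(r-1) ds, found
  as for the Lebesgue volume of the ball: the Gaussian integral is computed once as a product and
  once by the layer-cake formula.\<close>

definition unit_volume :: real
  where "unit_volume = gauss_mass r ^ m / (Gamma (real m * r / 2 + 1) * 2 powr (real m * r / 2))"

private lemma ball_volume:
  assumes R: "0 < R"
  shows "emeasure \<eta> {s \<in> space \<eta>. norm (emb m s) < R} = ennreal (unit_volume * R powr (real m * r))"
proof -
  let ?B = "{s \<in> space \<eta>. norm (emb m s) < 1}"
  define v where "v = enn2real (emeasure \<eta> ?B)"
  \<comment> \<open>On the unit ball the Gaussian integrand is at least exp(-1/2), so the volume is
    finite; only then can it be written as a real number \<open>v\<close>.\<close>
  have "ennreal (exp (- 1 / 2)) * emeasure \<eta> ?B = (\<integral>\<^sup>+s. ennreal (exp (- 1 / 2)) * indicator ?B s \<partial>\<eta>)"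
    by (rule nn_integral_cmult_indicator[symmetric]) measurable
  also have "\<dots> \<le> (\<integral>\<^sup>+s. ennreal (exp (- (1 / 2 * norm (emb m s) powr 2))) \<partial>\<eta>)"
  proof (rule nn_integral_mono)
    fix s
    show "ennreal (exp (- 1 / 2)) * indicator ?B s \<le> ennreal (exp (- (1 / 2 * norm (emb m s) powr 2)))"
      using powr_mono2[of 2 "norm (emb m s)" 1] by (auto split: split_indicator intro!: ennreal_leI)
  qed
  also have "\<dots> < \<infinity>" unfolding gauss_eta by simp
  finally have "emeasure \<eta> ?B < \<infinity>" by (cases "emeasure \<eta> ?B = 0") (auto simp: ennreal_mult_less_top)
  then have v: "emeasure \<eta> ?B = ennreal v" by (simp add: v_def)
  have v0: "0 \<le> v" by (simp add: v_def)
  have ball: "emeasure \<eta> {s \<in> space \<eta>. norm (emb m s) < R} = ennreal (v * R powr (real m * r))" if "0 < R" for R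
    using v0 by (simp add: ball_scale[OF that] v ennreal_mult mult.commute)
  have "ennreal (gauss_mass r ^ m) = ennreal (v * Gamma (real m * r / 2 + 1) * (1 / 2) powr (- (real m * r / 2)))"
    unfolding gauss_eta[symmetric] using r m v0 by (intro nn_integral_exp_powr[OF sigma_finite_eta]) (auto simp: ball)
  moreover have G: "0 < Gamma (real m * r / 2 + 1)" using r by (intro Gamma_real_pos add_nonneg_pos) auto
  ultimately have "gauss_mass r ^ m = v * Gamma (real m * r / 2 + 1) * (1 / 2) powr (- (real m * r / 2))"
    using v0 gauss_mass_pos[OF r] by (subst (asm) ennreal_inj) auto
  also have "(1 / 2) powr (- (real m * r / 2)) = 2 powr (real m * r / 2)"
    by (simp add: powr_minus powr_divide)
  finally have "v = unit_volume" using G by (simp add: unit_volume_def)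
  then show ?thesis using ball[OF R] by simp
qed

private lemma AE_eta_nonzero: "AE s in \<eta>. (\<forall>i<m. s i \<noteq> 0)"
proof -
  have "AE s in \<eta>. s i \<noteq> 0" if i: "i < m" for i
  proof (rule AE_I)
    let ?N = "Pi\<^sub>E {..<m} (\<lambda>j. if j = i then {0 :: real} else UNIV)"
    show "{s \<in> space \<eta>. \<not> s i \<noteq> 0} \<subseteq> ?N" by (auto simp: \<eta>_def space_PiM PiE_iff extensional_def)
    have "emeasure \<eta> ?N = (\<Prod>j<m. emeasure (pow_measure r) (if j = i then {0} else UNIV))"
      unfolding \<eta>_def by (rule R.emeasure_PiM) auto
    also have "\<dots> = 0" using i by (intro prod_zero) (auto intro!: bexI[of _ i])
    finally show "emeasure \<eta> ?N = 0" .
    show "?N \<in> sets \<eta>" unfolding sets_eta by (intro sets_PiM_I_finite) auto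
  qed
  then have "AE s in \<eta>. \<forall>i\<in>{..<m}. s i \<noteq> 0" by (subst AE_finite_all) auto
  then show ?thesis by eventually_elim auto
qed

text \<open>For a fixed vector of distances the norm of the solution is distributed like |s|/|N|.
  Integrating over the distances first, by the layer-cake formula with exponent r, yields \<Gamma>(m
  + 1) = m! and leaves the moment of |N| of order m r.\<close>

theorem nn_integral_exp_solution:
  assumes n: "m \<le> n" and k: "0 < k"
  shows "(\<integral>\<^sup>+T. indicator {T. regular m T} T * ennreal (exp (- (k * norm (solution m T (\<lambda>_. 1)) powr r))) \<partial>Pi\<^sub>M {..<m} (\<lambda>_. dual_intensity n r))
    = ennreal (unit_volume * fact m * k powr (- real m) * abs_moment (real m * r))"
proof -
  define \<phi> where "\<phi> x = ennreal (exp (- (k * x powr r)))" for x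
  have \<phi> [measurable]: "\<phi> \<in> borel_measurable borel" unfolding \<phi>_def by measurable
  define F where "F T = indicator {T. regular m T} T * \<phi> (norm (solution m T (\<lambda>_. 1)))" for T
  have Fm: "F \<in> borel_measurable (Pi\<^sub>M {..<m} (\<lambda>_. borel))"
    unfolding F_def by (rule measurable_regular_solution) measurable
  interpret std: sigma_finite_measure std_normal unfolding std_normal_def
    by (rule prob_space_imp_sigma_finite) (simp add: prob_space_normal_density)
  interpret E: sigma_finite_measure \<eta> by (rule sigma_finite_eta)
  interpret P: pair_sigma_finite std_normal \<eta> by standard
  have std [measurable_cong]: "sets std_normal = sets borel" by (simp add: std_normal_def)
  have "(\<integral>\<^sup>+T. F T \<partial>Pi\<^sub>M {..<m} (\<lambda>_. dual_intensity n r)) =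
      (\<integral>\<^sup>+s. (\<integral>\<^sup>+A. F (\<lambda>i\<in>{..<m}. A i /\<^sub>R s i) \<partial>Pi\<^sub>M {..<m} (\<lambda>_. gauss n)) \<partial>\<eta>)"
    unfolding \<eta>_def by (rule nn_integral_PiM_dual_intensity[OF r _ Fm]) (use m n in auto)
  also have "\<dots> = (\<integral>\<^sup>+s. (\<integral>\<^sup>+x. \<phi> (norm (emb m s) / \<bar>x\<bar>) \<partial>std_normal) \<partial>\<eta>)"
  proof (rule nn_integral_cong_AE, use AE_eta_nonzero in eventually_elim)
    case (elim s)
    have "emb m s \<noteq> 0"
    proof
      assume "emb m s = 0"
      then have "coord (emb m s) 0 = 0" by simp
      then show False using elim m by (simp add: lookup_emb)
    qed
    then have h: "0 < norm (emb m s)" by simp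
    let ?T = "\<lambda>A. \<lambda>i\<in>{..<m}. A i /\<^sub>R s i"
    have reg: "regular m (?T A) \<longleftrightarrow> regular m A" for A
      using elim by (auto simp: regular_def)
    have "solution m (?T A) (\<lambda>_. 1) = solution m A s" if "regular m A" for A
      by (rule solution_unique[symmetric, OF _ solution_Rn]) (use that elim in \<open>auto simp: reg inner_solution\<close>)
    then have "F (?T A) = indicator {A. regular m A} A * \<phi> (norm (solution m A s))" for A
      by (cases "regular m A") (auto simp: F_def reg)
    then show ?case using nn_integral_solution[OF _ n h \<phi>] m by simp
  qed
  also have "\<dots> = (\<integral>\<^sup>+x. (\<integral>\<^sup>+s. \<phi> (norm (emb m s) / \<bar>x\<bar>) \<partial>\<eta>) \<partial>std_normal)"
    by (rule P.Fubini') measurable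
  also have "\<dots> = (\<integral>\<^sup>+x. ennreal (unit_volume * fact m * k powr (- real m)) * ennreal (\<bar>x\<bar> powr (real m * r)) \<partial>std_normal)"
  proof (rule nn_integral_cong_AE)
    have "AE x in std_normal. x \<noteq> 0"
      unfolding std_normal_def by (subst AE_density) (auto intro: AE_lborel_singleton[THEN eventually_mono])
    then show "AE x in std_normal. (\<integral>\<^sup>+s. \<phi> (norm (emb m s) / \<bar>x\<bar>) \<partial>\<eta>) =
        ennreal (unit_volume * fact m * k powr (- real m)) * ennreal (\<bar>x\<bar> powr (real m * r))"
    proof eventually_elim
      case (elim x)
      have u: "0 \<le> unit_volume"
        using r gauss_mass_pos[OF r] by (auto simp: unit_volume_def intro!: divide_nonneg_nonneg mult_nonneg_nonneg less_imp_le[OF Gamma_real_pos] add_nonneg_pos)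
      have "(\<integral>\<^sup>+s. \<phi> (norm (emb m s) / \<bar>x\<bar>) \<partial>\<eta>) = (\<integral>\<^sup>+s. ennreal (exp (- ((k * \<bar>x\<bar> powr - r) * norm (emb m s) powr r))) \<partial>\<eta>)"
        using elim by (simp add: \<phi>_def powr_divide powr_minus divide_inverse mult_ac powr_mult inverse_powr)
      also have "\<dots> = ennreal (unit_volume * Gamma (real m * r / r + 1) * (k * \<bar>x\<bar> powr - r) powr (- (real m * r / r)))"
        using r m k elim u by (intro nn_integral_exp_powr[OF sigma_finite_eta]) (auto simp: ball_volume)
      also have "unit_volume * Gamma (real m * r / r + 1) * (k * \<bar>x\<bar> powr - r) powr (- (real m * r / r)) =
          (unit_volume * fact m * k powr (- real m)) * \<bar>x\<bar> powr (real m * r)"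
        using r k elim Gamma_fact[of m, where 'a = real] by (simp add: powr_mult powr_powr add.commute mult.commute)
      finally show ?case using u k by (simp add: ennreal_mult)
    qed
  qed
  also have "\<dots> = ennreal (unit_volume * fact m * k powr (- real m)) * ennreal (abs_moment (real m * r))"
    using r by (simp add: nn_integral_cmult nn_integral_std_normal_abs_powr)
  also have "\<dots> = ennreal (unit_volume * fact m * k powr (- real m) * abs_moment (real m * r))"
    using r abs_moment_pos[of "real m * r"] by (intro ennreal_mult''[symmetric]) auto
  finally show ?thesis by (simp add: F_def \<phi>_def)
qed

end

section \<open>Conical neighbourhoods of half-spaces\<close>

text \<open>For e = 0 this is the half-space of the dual points whose hyperplanes separate
  \<open>q\<close> from the origin or contain \<open>q\<close>. For e > 0 it contains the
  half-spaces of all nearby points, for e < 0 it is contained in them; the term in |y| is the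
  Cauchy-Schwarz error.\<close>

definition cone_cap :: "seq \<Rightarrow> real \<Rightarrow> seq set"
  where "cone_cap q e = {y. 1 \<le> inner q y + e * norm q * norm y}"

lemma cone_cap_borel [measurable]: "cone_cap q e \<in> sets borel"
  unfolding cone_cap_def by measurable

lemma nn_integral_dual_intensity_reflect:
  assumes a: "a \<in> Rn n" "norm a = 1" and [measurable]: "f \<in> borel_measurable borel"
  shows "(\<integral>\<^sup>+y. f (reflect a y) \<partial>dual_intensity n r) = (\<integral>\<^sup>+y. f y \<partial>dual_intensity n r)"
proof -
  interpret P: sigma_finite_measure "pow_measure r" by (rule sigma_finite_pow_measure)
  have [measurable]: "reflect a \<in> borel_measurable borel" unfolding reflect_def[abs_def] by measurable
  have "(\<integral>\<^sup>+y. f (reflect a y) \<partial>dual_intensity n r) = (\<integral>\<^sup>+g. (\<integral>\<^sup>+s. f (reflect a g /\<^sub>R s) \<partial>pow_measure r) \<partial>gauss n)"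
    by (subst nn_integral_dual_intensity) (auto simp: reflect_def scaleR_diff_right mult_ac)
  also have "\<dots> = (\<integral>\<^sup>+g. (\<integral>\<^sup>+s. f (g /\<^sub>R s) \<partial>pow_measure r) \<partial>gauss n)"
    by (rule nn_integral_gauss_reflect[OF a, where f = "\<lambda>g. \<integral>\<^sup>+s. f (g /\<^sub>R s) \<partial>pow_measure r"]) (rule P.borel_measurable_nn_integral, measurable)
  finally show ?thesis by (simp add: nn_integral_dual_intensity)
qed

lemma nn_integral_dual_intensity_scale:
  assumes R: "0 < R" and [measurable]: "f \<in> borel_measurable borel"
  shows "(\<integral>\<^sup>+y. f (R *\<^sub>R y) \<partial>dual_intensity n r) = ennreal (R powr r) * (\<integral>\<^sup>+y. f y \<partial>dual_intensity n r)"
proof -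
  interpret P: sigma_finite_measure "pow_measure r" by (rule sigma_finite_pow_measure)
  have "(\<integral>\<^sup>+s. f (R *\<^sub>R (g /\<^sub>R s)) \<partial>pow_measure r) = ennreal (R powr r) * (\<integral>\<^sup>+s. f (g /\<^sub>R s) \<partial>pow_measure r)" for g
  proof -
    have "(\<integral>\<^sup>+s. f (R *\<^sub>R (g /\<^sub>R s)) \<partial>pow_measure r) = (\<integral>\<^sup>+s. f (g /\<^sub>R s) \<partial>distr (pow_measure r) borel (\<lambda>x. x / R))"
      using R by (subst nn_integral_distr) (auto simp: divide_inverse mult.commute)
    then show ?thesis unfolding distr_pow_measure_scale[OF R] by (simp add: nn_integral_scale_measure)
  qed
  then show ?thesis
    by (simp add: nn_integral_dual_intensity nn_integral_cmult P.borel_measurable_nn_integral split_beta')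
qed

definition north :: seq
  where "north = \<e> 0"

lemma north_Rn: "0 < n \<Longrightarrow> north \<in> Rn n"
  unfolding north_def Rn_iff by (metis lookup_single_not_eq not_less)

lemma norm_north [simp]: "norm north = 1"
  using norm_Rn[OF north_Rn[of 1]] by (simp add: north_def)

lemma north_nonzero [simp]: "north \<noteq> 0"
  using norm_north by force

definition cap_mass :: "nat \<Rightarrow> real \<Rightarrow> real \<Rightarrow> real"
  where "cap_mass n r e = measure (dual_intensity n r) (cone_cap north e)"

context
  fixes n :: nat and r :: real
  assumes n: "0 < n" and r: "0 < r"
begin

text \<open>For parameters up to 1 the points of the cap have norm at least 1/(2|q|).\<close>

lemma emeasure_cone_cap_finite:
  assumes q: "q \<noteq> 0" and e: "e \<le> 1"
  shows "emeasure (dual_intensity n r) (cone_cap q e) < \<infinity>"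
proof -
  have nq: "0 < norm q" using q by simp
  obtain k where k: "1 / real (Suc k) < 1 / (2 * norm q)" using nat_approx_posE[of "1 / (2 * norm q)"] nq by auto
  have "cone_cap q e \<subseteq> far k"
  proof
    fix y assume "y \<in> cone_cap q e"
    then have "1 \<le> inner q y + e * norm q * norm y" by (simp add: cone_cap_def)
    also have "\<dots> \<le> norm q * norm y + 1 * norm q * norm y"
      using e by (intro add_mono mult_right_mono) (auto intro: norm_cauchy_schwarz)
    finally have "1 / (2 * norm q) \<le> norm y" using nq by (simp add: field_simps)
    then show "y \<in> far k" using k by (simp add: far_def)
  qed
  then have "emeasure (dual_intensity n r) (cone_cap q e) \<le> emeasure (dual_intensity n r) (far k)"
    by (rule emeasure_mono) simp
  also have "\<dots> < \<infinity>" by (rule emeasure_dual_intensity_far[OF r n])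
  finally show ?thesis .
qed

lemma cap_mass_eq: "e \<le> 1 \<Longrightarrow> emeasure (dual_intensity n r) (cone_cap north e) = ennreal (cap_mass n r e)"
  using emeasure_cone_cap_finite[of "north" e] by (simp add: cap_mass_def emeasure_eq_ennreal_measure)

text \<open>A reflection moves \<open>q\<close> to a multiple of \<open>north\<close>, and the
  intensity is homogeneous of degree r, which accounts for the power of the norm.\<close>

lemma emeasure_cone_cap:
  assumes q: "q \<in> Rn n" "q \<noteq> 0" and e: "e \<le> 1"
  shows "emeasure (dual_intensity n r) (cone_cap q e) = ennreal (norm q powr r * cap_mass n r e)"
proof -
  define u where "u = norm q *\<^sub>R north"
  have u: "u \<in> Rn n" "norm u = norm q" using n by (auto simp: u_def intro!: Rn_scale north_Rn)
  have "emeasure (dual_intensity n r) (cone_cap q e) = emeasure (dual_intensity n r) (cone_cap u e)"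
  proof (cases "q = u")
    case False
    obtain a where a: "a \<in> Rn n" "norm a = 1" "reflect a q = u" using reflect_exists[OF _ False q(1) u(1)] u by metis
    have "indicator (cone_cap u e) (reflect a y) = (indicator (cone_cap q e) y :: ennreal)" for y
      using a inner_reflect[OF a(2), of q y] norm_reflect[OF a(2), of y] u by (simp add: cone_cap_def indicator_def)
    then show ?thesis using nn_integral_dual_intensity_reflect[OF a(1,2), of "indicator (cone_cap u e)" r] by simp
  qed simp
  also have "\<dots> = (\<integral>\<^sup>+y. indicator (cone_cap north e) (norm q *\<^sub>R y) \<partial>dual_intensity n r)"
  proof -
    have "indicator (cone_cap u e) y = (indicator (cone_cap north e) (norm q *\<^sub>R y) :: ennreal)" for y
      by (simp add: cone_cap_def u_def indicator_def mult_ac)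
    then show ?thesis by (simp flip: nn_integral_indicator)
  qed
  also have "\<dots> = ennreal (norm q powr r) * ennreal (cap_mass n r e)"
    using q by (subst nn_integral_dual_intensity_scale) (auto simp: cap_mass_eq[OF e])
  finally show ?thesis by (simp add: ennreal_mult cap_mass_def)
qed

text \<open>For fixed g the condition <g, u>/s at least 1 says that s lies between 0 and <g, u>, a
  set of mass |<g, u>|^r / r; the scalar product with a unit vector is standard normal.\<close>

lemma cap_mass_0: "cap_mass n r 0 = abs_moment r / r"
proof -
  have pw: "emeasure (pow_measure r) {s. 1 \<le> x / s} = ennreal (\<bar>x\<bar> powr r / r)" if x: "x \<noteq> 0" for x
  proof -
    define N where "N = (if 0 < x then {0<..<\<bar>x\<bar>} else {-\<bar>x\<bar><..<0})"
    have "{s. 1 \<le> x / s} = N \<union> {x}" using x by (auto simp: N_def le_divide_eq)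
    moreover have "{x} \<in> null_sets (pow_measure r)" by (auto intro: null_setsI)
    ultimately have "emeasure (pow_measure r) {s. 1 \<le> x / s} = emeasure (pow_measure r) N"
      by (simp only:, intro emeasure_Un_null_set) (auto simp: N_def)
    then show ?thesis using pow_measure_ray[OF r, of "\<bar>x\<bar>"] by (simp add: N_def split: if_splits)
  qed
  have "ennreal (cap_mass n r 0) = (\<integral>\<^sup>+y. indicator (cone_cap north 0) y \<partial>dual_intensity n r)"
    by (simp add: cap_mass_eq)
  also have "\<dots> = (\<integral>\<^sup>+g. (\<integral>\<^sup>+s. indicator (cone_cap north 0) (g /\<^sub>R s) \<partial>pow_measure r) \<partial>gauss n)"
    by (rule nn_integral_dual_intensity) measurable
  also have "\<dots> = (\<integral>\<^sup>+g. ennreal (1 / r) * ennreal (\<bar>inner g north\<bar> powr r) \<partial>gauss n)"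
  proof (rule nn_integral_cong_AE)
    have "AE g in gauss n. inner g north \<noteq> 0" by (rule gauss_orthogonal_null[OF north_Rn[OF n]]) simp
    then show "AE g in gauss n. (\<integral>\<^sup>+s. indicator (cone_cap north 0) (g /\<^sub>R s) \<partial>pow_measure r) =
        ennreal (1 / r) * ennreal (\<bar>inner g north\<bar> powr r)"
    proof eventually_elim
      case (elim g)
      have "(\<integral>\<^sup>+s. indicator (cone_cap north 0) (g /\<^sub>R s) \<partial>pow_measure r) = (\<integral>\<^sup>+s. indicator {s. 1 \<le> inner g north / s} s \<partial>pow_measure r)"
        by (intro nn_integral_cong) (simp add: cone_cap_def indicator_def inner_commute divide_inverse mult.commute)
      also have "\<dots> = emeasure (pow_measure r) {s. 1 \<le> inner g north / s}"
        by (rule nn_integral_indicator) measurable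
      finally show ?case using r by (simp add: pw[OF elim] ennreal_mult[symmetric])
    qed
  qed
  also have "\<dots> = ennreal (1 / r) * (\<integral>\<^sup>+g. ennreal (\<bar>inner g north\<bar> powr r) \<partial>gauss n)"
    by (rule nn_integral_cmult) measurable
  also have "(\<integral>\<^sup>+g. ennreal (\<bar>inner g north\<bar> powr r) \<partial>gauss n) = (\<integral>\<^sup>+x. ennreal (\<bar>norm north * x\<bar> powr r) \<partial>std_normal)"
    by (rule nn_integral_gauss_inner[where f = "\<lambda>x. ennreal (\<bar>x\<bar> powr r)"]) (use n in \<open>auto intro: north_Rn\<close>)
  also have "\<dots> = ennreal (abs_moment r)" using r nn_integral_std_normal_abs_powr[of r] by simp
  also have "ennreal (1 / r) * ennreal (abs_moment r) = ennreal (abs_moment r / r)"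
    using r abs_moment_pos[of r] by (simp add: ennreal_mult[symmetric])
  finally show ?thesis using r abs_moment_pos[of r] by (subst (asm) ennreal_inj) (auto simp: cap_mass_def)
qed

lemma cap_mass_decreasing: "(\<lambda>j. cap_mass n r (1 / real (Suc j))) \<longlonglongrightarrow> cap_mass n r 0"
proof -
  let ?K = "\<lambda>j. cone_cap north (1 / real (Suc j))"
  have eq: "(\<Inter>j. ?K j) = cone_cap north 0"
  proof (intro equalityI subsetI)
    fix y assume y: "y \<in> (\<Inter>j. ?K j)"
    have "(\<lambda>j. inner north y + 1 / real (Suc j) * norm north * norm y) \<longlonglongrightarrow> inner north y + 0 * norm north * norm y"
      by (intro tendsto_intros LIMSEQ_Suc[OF lim_1_over_n])
    then have "1 \<le> inner north y + 0 * norm north * norm y"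
      by (rule LIMSEQ_le_const) (use y in \<open>auto simp: cone_cap_def\<close>)
    then show "y \<in> cone_cap north 0" by (simp add: cone_cap_def)
  next
    fix y assume "y \<in> cone_cap north 0"
    then show "y \<in> (\<Inter>j. ?K j)" by (auto simp: cone_cap_def intro: add_increasing2)
  qed
  have "decseq ?K"
    by (rule decseq_SucI) (auto simp: cone_cap_def elim!: order_trans intro!: mult_right_mono divide_left_mono)
  then have "(\<lambda>j. emeasure (dual_intensity n r) (?K j)) \<longlonglongrightarrow> emeasure (dual_intensity n r) (\<Inter>j. ?K j)"
    using emeasure_cone_cap_finite[of "north"] by (intro Lim_emeasure_decseq) (auto simp: less_top)
  then have "(\<lambda>j. ennreal (cap_mass n r (1 / real (Suc j)))) \<longlonglongrightarrow> ennreal (cap_mass n r 0)"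
    unfolding eq by (subst (asm) (1 2) cap_mass_eq) auto
  then show ?thesis by (subst (asm) tendsto_ennreal_iff) (auto simp: cap_mass_def)
qed

text \<open>The caps increase only to the open half-space. The bounding hyperplane is null, since
  for each g at most one value of s leads to it.\<close>

lemma cap_mass_increasing: "(\<lambda>j. cap_mass n r (- (1 / real (Suc j)))) \<longlonglongrightarrow> cap_mass n r 0"
proof -
  let ?K = "\<lambda>j. cone_cap north (- (1 / real (Suc j)))" and ?H = "{y. inner north y = 1}"
  have "cone_cap north 0 \<subseteq> (\<Union>j. ?K j) \<union> ?H"
  proof
    fix y assume "y \<in> cone_cap north 0"
    then have y: "1 \<le> inner north y" by (simp add: cone_cap_def)
    show "y \<in> (\<Union>j. ?K j) \<union> ?H"
    proof (cases "inner north y = 1")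
      case False
      then have y1: "1 < inner north y" using y by simp
      then have ny: "0 < norm y" by auto
      obtain j where "1 / real (Suc j) < (inner north y - 1) / norm y"
        using nat_approx_posE[of "(inner north y - 1) / norm y"] y1 ny by auto
      then have "1 / real (Suc j) * norm y < inner north y - 1" by (simp only: pos_less_divide_eq[OF ny])
      then have "y \<in> ?K j" by (simp add: cone_cap_def)
      then show ?thesis by blast
    qed simp
  qed
  moreover have "?K j \<subseteq> cone_cap north 0" for j by (auto simp: cone_cap_def elim!: order_trans)
  ultimately have eq: "cone_cap north 0 \<union> ?H = (\<Union>j. ?K j) \<union> ?H" by blast
  have "emeasure (dual_intensity n r) ?H = (\<integral>\<^sup>+y. indicator ?H y \<partial>dual_intensity n r)" by simp
  also have "\<dots> = (\<integral>\<^sup>+g. (\<integral>\<^sup>+s. indicator ?H (g /\<^sub>R s) \<partial>pow_measure r) \<partial>gauss n)"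
    by (rule nn_integral_dual_intensity) measurable
  also have "\<dots> \<le> (\<integral>\<^sup>+g. (\<integral>\<^sup>+s. indicator {inner north g} s \<partial>pow_measure r) \<partial>gauss n)"
    by (intro nn_integral_mono) (auto simp: indicator_def field_simps)
  finally have H: "?H \<in> null_sets (dual_intensity n r)" by (auto intro: null_setsI)
  have U: "emeasure (dual_intensity n r) (\<Union>j. ?K j) = emeasure (dual_intensity n r) (cone_cap north 0)"
    using emeasure_Un_null_set[OF _ H, of "\<Union>j. ?K j"] emeasure_Un_null_set[OF _ H, of "cone_cap north 0"] eq by simp
  have "incseq ?K"
    by (rule incseq_SucI) (auto simp: cone_cap_def elim!: order_trans intro!: mult_right_mono divide_left_mono)
  then have "(\<lambda>j. emeasure (dual_intensity n r) (?K j)) \<longlonglongrightarrow> emeasure (dual_intensity n r) (\<Union>j. ?K j)"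
    by (intro Lim_emeasure_incseq) auto
  then have "(\<lambda>j. ennreal (cap_mass n r (- (1 / real (Suc j))))) \<longlonglongrightarrow> ennreal (cap_mass n r 0)"
    unfolding U by (subst (asm) (1 2) cap_mass_eq) (auto intro: order_trans[of _ 0])
  then show ?thesis by (subst (asm) tendsto_ennreal_iff) (auto simp: cap_mass_def)
qed

text \<open>The balls have radius proportional to the norm of their centres, so that the relative
  distortion is the same in all cells; countably many centres from a dense subset suffice.\<close>

lemma cell_partition:
  assumes \<epsilon>: "0 < \<epsilon>" "\<epsilon> < 1"
  obtains q :: "nat \<Rightarrow> seq" and C :: "nat \<Rightarrow> seq set"
  where "\<And>j. q j \<in> Rn n - {0}" "disjoint_family C" "\<And>j. C j \<in> sets borel" "Rn n - {0} \<subseteq> (\<Union>j. C j)"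
    "\<And>j x. x \<in> C j \<Longrightarrow> norm (x - q j) < \<epsilon> * norm (q j)"
proof -
  obtain D where D: "countable D" "D \<subseteq> Rn n - {0}" "Rn n - {0} \<subseteq> closure D" using separable by metis
  have "north \<in> Rn n - {0}" using north_Rn[OF n] by simp
  then have ne: "D \<noteq> {}" using D(3) by auto
  define q where "q = from_nat_into D"
  have q: "q j \<in> Rn n - {0}" for j using from_nat_into[OF ne, of j] D(2) by (auto simp: q_def)
  define B where "B j = {x. norm (x - q j) < \<epsilon> * norm (q j)}" for j
  have "Rn n - {0} \<subseteq> (\<Union>j. B j)"
  proof
    fix x assume x: "x \<in> Rn n - {0}"
    then have nx: "0 < norm x" by simp
    \<comment> \<open>The radius is measured by the norm of the centre, which is at least |x|/2;
      approximation up to half of \<epsilon> |x| is therefore enough.\<close>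
    then have "0 < \<epsilon> * norm x / 2" using \<epsilon> by simp
    then obtain y where y: "y \<in> D" "dist y x < \<epsilon> * norm x / 2" using x D(3) closure_approachable[of x D] by blast
    then obtain j where j: "y = q j" using from_nat_into_surj[OF D(1)] by (metis q_def)
    have "norm x \<le> norm y + norm (x - y)" by norm
    then have "norm x - \<epsilon> * norm x / 2 \<le> norm y" using y(2) by (simp add: dist_norm norm_minus_commute)
    moreover have "\<epsilon> * norm x \<le> 1 * norm x" using \<epsilon> nx by (intro mult_right_mono) auto
    ultimately have "norm x / 2 \<le> norm y" by simp
    then have "\<epsilon> * (norm x / 2) \<le> \<epsilon> * norm y" using \<epsilon> by (intro mult_left_mono) auto
    then have "x \<in> B j" using y(2) by (simp add: B_def j dist_norm norm_minus_commute)
    then show "x \<in> (\<Union>j. B j)" by blast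
  qed
  then have cover: "Rn n - {0} \<subseteq> (\<Union>j. disjointed B j)" by (simp add: UN_disjointed_eq)
  have "range B \<subseteq> sets borel" unfolding B_def by auto
  then have "disjointed B j \<in> sets borel" for j using sets.range_disjointed_sets by blast
  from that[OF q disjoint_family_disjointed this cover] show ?thesis
    using disjointed_subset[of B] by (fastforce simp: B_def)
qed

end

text \<open>By Cauchy-Schwarz, replacing \<open>x\<close> by \<open>q\<close> changes the scalar
  product with \<open>y\<close> by at most |x - q| |y|. The last claim is strict because the cap
  does not contain 0.\<close>

lemma cell_cap:
  assumes x: "norm (x - q) < \<epsilon> * norm q"
  shows "inner x y = 1 \<Longrightarrow> y \<in> cone_cap q \<epsilon>" "1 \<le> inner x y \<Longrightarrow> y \<in> cone_cap q \<epsilon>" "y \<in> cone_cap q (- \<epsilon>) \<Longrightarrow> 1 < inner x y"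
proof -
  have c: "\<bar>inner (x - q) y\<bar> \<le> norm (x - q) * norm y" by (rule Cauchy_Schwarz_ineq2)
  have le: "norm (x - q) * norm y \<le> \<epsilon> * norm q * norm y" using x by (intro mult_right_mono) auto
  show 2: "y \<in> cone_cap q \<epsilon>" if "1 \<le> inner x y"
    using that c le by (simp add: cone_cap_def inner_diff_left)
  then show "inner x y = 1 \<Longrightarrow> y \<in> cone_cap q \<epsilon>" by simp
  show "1 < inner x y" if y: "y \<in> cone_cap q (- \<epsilon>)"
  proof -
    have "y \<noteq> 0" using y by (auto simp: cone_cap_def)
    then have "norm (x - q) * norm y < \<epsilon> * norm q * norm y" using x by (intro mult_strict_right_mono) auto
    then show ?thesis using y c by (simp add: cone_cap_def inner_diff_left)
  qed
qed

section \<open>Expected numbers of vertices and faces\<close>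

text \<open>The mean number of ordered \<open>m\<close>-tuples with regular rows when a tuple with
  solution x is counted with weight exp(-c b |x|^r); the scale c of the intensity does not appear in
  it.\<close>

definition face_mean :: "nat \<Rightarrow> real \<Rightarrow> real \<Rightarrow> real"
  where "face_mean m r b = unit_volume r m * fact m * b powr (- real m) * abs_moment (real m * r)"

context
  fixes n :: nat and r c :: real and M :: "'w measure" and Y :: "'w \<Rightarrow> seq set" and \<Lambda> :: "seq measure"
  assumes n: "0 < n" and r: "0 < r" and c: "0 < c"
  defines "\<Lambda> \<equiv> scale_measure (ennreal c) (dual_intensity n r)"
  assumes Y: "poisson_process M \<Lambda> Y"
begin

interpretation poisson_process M \<Lambda> Y by (rule Y)

private lemma sets_L [simp, measurable_cong]: "sets \<Lambda> = sets borel" by (simp add: \<Lambda>_def)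
private lemma sigma_finite_L: "sigma_finite_measure \<Lambda>"
  unfolding \<Lambda>_def by (rule sigma_finite_scale_dual_intensity[OF r n]) simp
private lemma far_finite: "emeasure \<Lambda> (far k) < \<infinity>"
  using emeasure_dual_intensity_far[OF r n, of k] by (simp add: \<Lambda>_def ennreal_mult_less_top)

private lemma AE_locally_finite: "AE w in M. w \<in> locally_finite_event M Y far"
  using poisson_locally_finite(2)[OF Y _ far_finite] by simp

private lemma cap_L:
  assumes "q \<in> Rn n - {0}" "e \<le> 1"
  shows "emeasure \<Lambda> (cone_cap q e) < \<infinity>" "measure \<Lambda> (cone_cap q e) = c * (norm q powr r * cap_mass n r e)"
proof -
  have "emeasure \<Lambda> (cone_cap q e) = ennreal (c * (norm q powr r * cap_mass n r e))"
    using c assms by (simp add: \<Lambda>_def emeasure_cone_cap[OF n r] ennreal_mult cap_mass_def)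
  moreover have "0 \<le> c * (norm q powr r * cap_mass n r e)" using c by (simp add: cap_mass_def)
  ultimately show "emeasure \<Lambda> (cone_cap q e) < \<infinity>" "measure \<Lambda> (cone_cap q e) = c * (norm q powr r * cap_mass n r e)"
    by (simp_all add: measure_def)
qed

context
  fixes m :: nat
  assumes m: "1 \<le> m" "m \<le> n"
begin

private lemma sets_P [measurable_cong]: "sets (Pi\<^sub>M {..<m} (\<lambda>_. \<Lambda>)) = sets (Pi\<^sub>M {..<m} (\<lambda>_. borel))" by (rule sets_PiM_cong) auto

private abbreviation "weight k T \<equiv> ennreal (exp (- (k * norm (solution m T (\<lambda>_. 1)) powr r)))"

text \<open>The product intensity contributes c^m, and the factor c in the exponent contributes
  c^-m.\<close>

private lemma nn_integral_weight:
  assumes b: "0 < b"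
  shows "(\<integral>\<^sup>+T. indicator {T. regular m T} T * weight (c * b) T \<partial>Pi\<^sub>M {..<m} (\<lambda>_. \<Lambda>)) = ennreal (face_mean m r b)"
proof -
  have "Pi\<^sub>M {..<m} (\<lambda>_. \<Lambda>) = scale_measure (ennreal c ^ card {..<m}) (Pi\<^sub>M {..<m} (\<lambda>_. dual_intensity n r))"
    unfolding \<Lambda>_def by (rule PiM_scale_measure) (use sigma_finite_L sigma_finite_dual_intensity[OF r n] in \<open>auto simp: \<Lambda>_def\<close>)
  moreover have sD: "sets (Pi\<^sub>M {..<m} (\<lambda>_. dual_intensity n r)) = sets (Pi\<^sub>M {..<m} (\<lambda>_. borel))" by (rule sets_PiM_cong) auto
  moreover have "(\<lambda>T. indicator {T. regular m T} T * weight (c * b) T) \<in> borel_measurable (Pi\<^sub>M {..<m} (\<lambda>_. dual_intensity n r))"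
    using measurable_regular_solution[of "\<lambda>x. ennreal (exp (- (c * b * x powr r)))" m "\<lambda>_. 1"]
    by (simp cong: measurable_cong_sets add: sD)
  ultimately have "(\<integral>\<^sup>+T. indicator {T. regular m T} T * weight (c * b) T \<partial>Pi\<^sub>M {..<m} (\<lambda>_. \<Lambda>)) =
      ennreal c ^ m * (\<integral>\<^sup>+T. indicator {T. regular m T} T * weight (c * b) T \<partial>Pi\<^sub>M {..<m} (\<lambda>_. dual_intensity n r))"
    by (simp add: nn_integral_scale_measure)
  also have "\<dots> = ennreal (c ^ m) * ennreal (unit_volume r m * fact m * (c * b) powr (- real m) * abs_moment (real m * r))"
    using m n b c by (subst nn_integral_exp_solution[OF r]) (auto simp: ennreal_power)
  also have "\<dots> = ennreal (c ^ m * (unit_volume r m * fact m * (c * b) powr (- real m) * abs_moment (real m * r)))"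
    using c by (simp add: ennreal_mult')
  also have "c ^ m * (unit_volume r m * fact m * (c * b) powr (- real m) * abs_moment (real m * r)) = face_mean m r b"
    using b c by (simp add: face_mean_def powr_mult powr_minus powr_realpow)
  finally show ?thesis .
qed

section \<open>Tuples sorted by the cell that contains their solution\<close>

context
  fixes \<epsilon> :: real and q :: "nat \<Rightarrow> seq" and C :: "nat \<Rightarrow> seq set" and A :: "nat \<Rightarrow> (nat \<Rightarrow> seq) set"
  assumes \<epsilon>: "0 < \<epsilon>" "\<epsilon> < 1" and q: "\<And>j. q j \<in> Rn n - {0}" and C: "disjoint_family C" "\<And>j. C j \<in> sets borel" "Rn n - {0} \<subseteq> (\<Union>j. C j)"
    "\<And>j x. x \<in> C j \<Longrightarrow> norm (x - q j) < \<epsilon> * norm (q j)"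
  defines "A j \<equiv> {T \<in> space (Pi\<^sub>M {..<m} (\<lambda>_. borel)). regular m T \<and> solution m T (\<lambda>_. 1) \<in> C j}"
begin

private lemma A_sets: "A j \<in> sets (Pi\<^sub>M {..<m} (\<lambda>_. \<Lambda>))"
proof -
  note [measurable] = C(2)
  show ?thesis unfolding A_def sets_P by measurable
qed

private lemma A_disjoint: "disjoint_family A"
  using C(1) unfolding disjoint_family_on_def A_def by blast

private lemma A_Union: "(\<Union>j. A j) = {T \<in> {..<m} \<rightarrow>\<^sub>E UNIV. regular m T}"
proof -
  have "solution m T (\<lambda>_. 1) \<in> (\<Union>j. C j)" if T: "regular m T" for T
  proof -
    have "solution m T (\<lambda>_. 1) \<in> Rn n" using Rn_mono[OF m(2)] solution_Rn by auto
    moreover have "solution m T (\<lambda>_. 1) \<noteq> 0" using inner_solution[OF T, of 0 "\<lambda>_. 1"] m by auto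
    ultimately show ?thesis using C(3) by blast
  qed
  then show ?thesis by (auto simp: A_def space_PiM)
qed

private lemma weight_cells: "suminf (\<lambda>j. \<integral>\<^sup>+T. weight k T * indicator (A j) T \<partial>Pi\<^sub>M {..<m} (\<lambda>_. \<Lambda>)) = (\<integral>\<^sup>+T. indicator {T. regular m T} T * weight k T \<partial>Pi\<^sub>M {..<m} (\<lambda>_. \<Lambda>))"
proof -
  have [measurable]: "A j \<in> sets (Pi\<^sub>M {..<m} (\<lambda>_. \<Lambda>))" for j by (rule A_sets)
  have [measurable]: "(\<lambda>T. weight k T) \<in> borel_measurable (Pi\<^sub>M {..<m} (\<lambda>_. \<Lambda>))" by measurable
  have "suminf (\<lambda>j. \<integral>\<^sup>+T. weight k T * indicator (A j) T \<partial>Pi\<^sub>M {..<m} (\<lambda>_. \<Lambda>)) = (\<integral>\<^sup>+T. suminf (\<lambda>j. weight k T * indicator (A j) T) \<partial>Pi\<^sub>M {..<m} (\<lambda>_. \<Lambda>))"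
    by (rule nn_integral_suminf[symmetric]) measurable
  also have "\<dots> = (\<integral>\<^sup>+T. indicator {T. regular m T} T * weight k T \<partial>Pi\<^sub>M {..<m} (\<lambda>_. \<Lambda>))"
  proof (rule nn_integral_cong)
    fix T assume "T \<in> space (Pi\<^sub>M {..<m} (\<lambda>_. \<Lambda>))"
    then have "T \<in> {..<m} \<rightarrow>\<^sub>E UNIV" by (auto simp: space_PiM PiE_iff)
    then show "suminf (\<lambda>j. weight k T * indicator (A j) T) = indicator {T. regular m T} T * weight k T"
      unfolding ennreal_suminf_cmult suminf_indicator[OF A_disjoint] A_Union by (simp add: indicator_def)
  qed
  finally show ?thesis .
qed

private lemma A_props:
  assumes "T \<in> A j"
  shows "regular m T" "norm (solution m T (\<lambda>_. 1) - q j) < \<epsilon> * norm (q j)" "\<And>i. i < m \<Longrightarrow> inner (solution m T (\<lambda>_. 1)) (T i) = 1"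
    "T \<in> extensional {..<m}" "inj_on T {..<m}"
  using assms C(4) inner_solution[of m T] regular_inj[of m T] by (auto simp: A_def inner_commute space_PiM PiE_iff)

text \<open>The points of a tuple satisfy <x, y> = 1 and thus lie outside the inner cap, so
  \<open>tuples_void\<close> applies with this fixed set. On the cell |x| is at most (1 +
  \<epsilon>)|q|, which bounds the void probability by the weight of the tuple.\<close>

private lemma void_cell:
  shows "(\<lambda>w. ecard (A j \<inter> ({..<m} \<rightarrow>\<^sub>E Y w)) * (indicator {0} (ecard (Y w \<inter> cone_cap (q j) (- \<epsilon>))) * indicator (locally_finite_event M Y far) w)) \<in> borel_measurable M" (is ?m)
    and "(\<integral>\<^sup>+w. ecard (A j \<inter> ({..<m} \<rightarrow>\<^sub>E Y w)) * (indicator {0} (ecard (Y w \<inter> cone_cap (q j) (- \<epsilon>))) * indicator (locally_finite_event M Y far) w) \<partial>M)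
      \<le> (\<integral>\<^sup>+T. weight (c * (cap_mass n r (- \<epsilon>) * (1 + \<epsilon>) powr - r)) T * indicator (A j) T \<partial>Pi\<^sub>M {..<m} (\<lambda>_. \<Lambda>))" (is ?le)
proof -
  let ?K = "cone_cap (q j) (- \<epsilon>)"
  have K: "emeasure \<Lambda> ?K < \<infinity>" using \<epsilon> by (intro cap_L(1)[OF q]) auto
  have sub: "A j \<subseteq> {T \<in> {..<m} \<rightarrow>\<^sub>E - ?K. inj_on T {..<m}}"
  proof
    fix T assume T: "T \<in> A j"
    have "T i \<notin> ?K" if "i < m" for i using cell_cap(3)[OF A_props(2)[OF T], of "T i"] A_props(3)[OF T that] by auto
    then show "T \<in> {T \<in> {..<m} \<rightarrow>\<^sub>E - ?K. inj_on T {..<m}}" using A_props(4,5)[OF T] by (simp add: PiE_iff)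
  qed
  note tv = tuples_void[where W = far, OF Y sets_L sigma_finite_L finite_lessThan far_UN far_borel far_finite cone_cap_borel K A_sets sub]
  show ?m by (rule tv(1))
  have "(\<integral>\<^sup>+w. ecard (A j \<inter> ({..<m} \<rightarrow>\<^sub>E Y w)) * (indicator {0} (ecard (Y w \<inter> ?K)) * indicator (locally_finite_event M Y far) w) \<partial>M)
      = (\<integral>\<^sup>+T. ennreal (exp (- measure \<Lambda> ?K)) * indicator (A j) T \<partial>Pi\<^sub>M {..<m} (\<lambda>_. \<Lambda>))"
    unfolding tv(2) by (rule nn_integral_cmult_indicator[symmetric, OF A_sets])
  also have "\<dots> \<le> (\<integral>\<^sup>+T. weight (c * (cap_mass n r (- \<epsilon>) * (1 + \<epsilon>) powr - r)) T * indicator (A j) T \<partial>Pi\<^sub>M {..<m} (\<lambda>_. \<Lambda>))"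
  proof (rule nn_integral_mono)
    fix T
    show "ennreal (exp (- measure \<Lambda> ?K)) * indicator (A j) T \<le> weight (c * (cap_mass n r (- \<epsilon>) * (1 + \<epsilon>) powr - r)) T * indicator (A j) T"
    proof (cases "T \<in> A j")
      case True
      let ?x = "solution m T (\<lambda>_. 1)"
      have "norm ?x \<le> norm (q j) + norm (?x - q j)" by norm
      then have "norm ?x \<le> (1 + \<epsilon>) * norm (q j)" using A_props(2)[OF True] by (simp add: algebra_simps)
      then have "norm ?x powr r \<le> ((1 + \<epsilon>) * norm (q j)) powr r" using r by (intro powr_mono2) auto
      also have "\<dots> = (1 + \<epsilon>) powr r * norm (q j) powr r" using \<epsilon> by (simp add: powr_mult)
      finally have "norm ?x powr r * (1 + \<epsilon>) powr - r \<le> norm (q j) powr r" using \<epsilon> by (simp add: powr_minus field_simps)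
      then have "c * cap_mass n r (- \<epsilon>) * (norm ?x powr r * (1 + \<epsilon>) powr - r) \<le> c * cap_mass n r (- \<epsilon>) * norm (q j) powr r"
        using c by (intro mult_left_mono) (auto simp: cap_mass_def)
      then show ?thesis using True \<epsilon> by (simp add: cap_L(2)[OF q] mult_ac)
    qed simp
  qed
  finally show ?le .
qed

text \<open>The points of a tuple lie in the outer cap, so \<open>tuples_full\<close> applies. On
  the cell |x| is at least (1 - \<epsilon>)|q|, which bounds the weight of the tuple by the void
  probability.\<close>

private lemma full_cell:
  shows "(\<lambda>w. ecard (A j \<inter> ({..<m} \<rightarrow>\<^sub>E Y w)) * (indicator {of_nat m} (ecard (Y w \<inter> cone_cap (q j) \<epsilon>)) * indicator (locally_finite_event M Y far) w)) \<in> borel_measurable M" (is ?m)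
    and "(\<integral>\<^sup>+T. weight (c * (cap_mass n r \<epsilon> * (1 - \<epsilon>) powr - r)) T * indicator (A j) T \<partial>Pi\<^sub>M {..<m} (\<lambda>_. \<Lambda>)) \<le>
      (\<integral>\<^sup>+w. ecard (A j \<inter> ({..<m} \<rightarrow>\<^sub>E Y w)) * (indicator {of_nat m} (ecard (Y w \<inter> cone_cap (q j) \<epsilon>)) * indicator (locally_finite_event M Y far) w) \<partial>M)" (is ?le)
proof -
  let ?K = "cone_cap (q j) \<epsilon>"
  have K: "emeasure \<Lambda> ?K < \<infinity>" using \<epsilon> by (intro cap_L(1)[OF q]) auto
  have sub: "A j \<subseteq> {T \<in> {..<m} \<rightarrow>\<^sub>E ?K. inj_on T {..<m}}"
  proof
    fix T assume T: "T \<in> A j"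
    have "T i \<in> ?K" if "i < m" for i using cell_cap(1)[OF A_props(2)[OF T], of "T i"] A_props(3)[OF T that] by auto
    then show "T \<in> {T \<in> {..<m} \<rightarrow>\<^sub>E ?K. inj_on T {..<m}}" using A_props(4,5)[OF T] by (simp add: PiE_iff)
  qed
  note tf = tuples_full[where W = far, OF Y sets_L sigma_finite_L finite_lessThan far_UN far_borel far_finite cone_cap_borel K A_sets sub, unfolded card_lessThan]
  show ?m by (rule tf(1))
  have "(\<integral>\<^sup>+T. weight (c * (cap_mass n r \<epsilon> * (1 - \<epsilon>) powr - r)) T * indicator (A j) T \<partial>Pi\<^sub>M {..<m} (\<lambda>_. \<Lambda>)) \<le> (\<integral>\<^sup>+T. ennreal (exp (- measure \<Lambda> ?K)) * indicator (A j) T \<partial>Pi\<^sub>M {..<m} (\<lambda>_. \<Lambda>))"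
  proof (rule nn_integral_mono)
    fix T
    show "weight (c * (cap_mass n r \<epsilon> * (1 - \<epsilon>) powr - r)) T * indicator (A j) T \<le> ennreal (exp (- measure \<Lambda> ?K)) * indicator (A j) T"
    proof (cases "T \<in> A j")
      case True
      let ?x = "solution m T (\<lambda>_. 1)"
      have "norm (q j) \<le> norm ?x + norm (?x - q j)" by norm
      then have "(1 - \<epsilon>) * norm (q j) \<le> norm ?x" using A_props(2)[OF True] by (simp add: algebra_simps)
      then have "((1 - \<epsilon>) * norm (q j)) powr r \<le> norm ?x powr r" using r \<epsilon> by (intro powr_mono2) auto
      then have "(1 - \<epsilon>) powr r * norm (q j) powr r \<le> norm ?x powr r" using \<epsilon> by (simp add: powr_mult)
      then have "norm (q j) powr r \<le> norm ?x powr r * (1 - \<epsilon>) powr - r" using \<epsilon> by (simp add: powr_minus field_simps)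
      then have "c * cap_mass n r \<epsilon> * norm (q j) powr r \<le> c * cap_mass n r \<epsilon> * (norm ?x powr r * (1 - \<epsilon>) powr - r)"
        using c by (intro mult_left_mono) (auto simp: cap_mass_def)
      then show ?thesis using True \<epsilon> by (simp add: cap_L(2)[OF q] mult_ac)
    qed simp
  qed
  also have "\<dots> = (\<integral>\<^sup>+w. ecard (A j \<inter> ({..<m} \<rightarrow>\<^sub>E Y w)) * (indicator {of_nat m} (ecard (Y w \<inter> ?K)) * indicator (locally_finite_event M Y far) w) \<partial>M)"
    unfolding tf(2) by (rule nn_integral_cmult_indicator[OF A_sets])
  finally show ?le .
qed

private lemma A_part: "disjoint_family (\<lambda>j. S \<inter> A j)"
  using A_disjoint by (auto simp: disjoint_family_on_def)

text \<open>A dual point in the inner cap would violate its constraint at every position in the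
  cell, so a tuple whose solution belongs to the polar set leaves this cap empty.\<close>

lemma vertices_le_cells:
  "(\<integral>\<^sup>+w. ecard {T \<in> {..<m} \<rightarrow>\<^sub>E Y w. regular m T \<and> solution m T (\<lambda>_. 1) \<in> polar n (Y w)} \<partial>M)
    \<le> (\<integral>\<^sup>+T. indicator {T. regular m T} T * weight (c * (cap_mass n r (- \<epsilon>) * (1 + \<epsilon>) powr - r)) T \<partial>Pi\<^sub>M {..<m} (\<lambda>_. \<Lambda>))"
proof -
  let ?O = "\<lambda>w. {T \<in> {..<m} \<rightarrow>\<^sub>E Y w. regular m T \<and> solution m T (\<lambda>_. 1) \<in> polar n (Y w)}"
  let ?G = "\<lambda>j w. indicator {0} (ecard (Y w \<inter> cone_cap (q j) (- \<epsilon>))) * indicator (locally_finite_event M Y far) w :: ennreal"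
  have "(\<integral>\<^sup>+w. ecard (?O w) \<partial>M) \<le> (\<integral>\<^sup>+w. suminf (\<lambda>j. ecard (A j \<inter> ({..<m} \<rightarrow>\<^sub>E Y w)) * ?G j w) \<partial>M)"
  proof (rule nn_integral_mono_AE, use AE_locally_finite in eventually_elim)
    case (elim w)
    have "?O w = (\<Union>j. ?O w \<inter> A j)" using A_Union by (auto simp: PiE_iff set_eq_iff)
    then have "ecard (?O w) = suminf (\<lambda>j. ecard (?O w \<inter> A j))" using ecard_suminf[OF A_part, of "?O w"] by simp
    also have "\<dots> \<le> suminf (\<lambda>j. ecard (A j \<inter> ({..<m} \<rightarrow>\<^sub>E Y w)) * ?G j w)"
    proof (rule suminf_le)
      fix j
      show "ecard (?O w \<inter> A j) \<le> ecard (A j \<inter> ({..<m} \<rightarrow>\<^sub>E Y w)) * ?G j w"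
      proof (cases "?O w \<inter> A j = {}")
        case False
        then obtain T where T: "T \<in> A j" "solution m T (\<lambda>_. 1) \<in> polar n (Y w)" by auto
        have "Y w \<inter> cone_cap (q j) (- \<epsilon>) = {}"
        proof (intro equals0I)
          fix y assume "y \<in> Y w \<inter> cone_cap (q j) (- \<epsilon>)"
          then show False using cell_cap(3)[OF A_props(2)[OF T(1)], of y] T(2) by (auto simp: polar_def not_le[symmetric])
        qed
        then have "?G j w = 1" using elim by simp
        then show ?thesis by (auto intro: ecard_mono)
      next
        case True
        then show ?thesis by (simp only: ecard_eq_0[THEN iffD2]) simp
      qed
    qed auto
    finally show ?case .
  qed
  also have "\<dots> = suminf (\<lambda>j. \<integral>\<^sup>+w. ecard (A j \<inter> ({..<m} \<rightarrow>\<^sub>E Y w)) * ?G j w \<partial>M)"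
    by (rule nn_integral_suminf) (rule void_cell(1))
  also have "\<dots> \<le> suminf (\<lambda>j. \<integral>\<^sup>+T. weight (c * (cap_mass n r (- \<epsilon>) * (1 + \<epsilon>) powr - r)) T * indicator (A j) T \<partial>Pi\<^sub>M {..<m} (\<lambda>_. \<Lambda>))"
    by (intro suminf_le void_cell(2)) auto
  finally show ?thesis unfolding weight_cells .
qed

text \<open>If the outer cap contains exactly \<open>m\<close> dual points, these are the points of
  the tuple; all others lie outside the cap and satisfy their constraints strictly at the
  solution.\<close>

lemma cells_le_faces:
  "(\<integral>\<^sup>+T. indicator {T. regular m T} T * weight (c * (cap_mass n r \<epsilon> * (1 - \<epsilon>) powr - r)) T \<partial>Pi\<^sub>M {..<m} (\<lambda>_. \<Lambda>)) \<le>
    (\<integral>\<^sup>+w. ecard {T \<in> {..<m} \<rightarrow>\<^sub>E Y w. regular m T \<and> (\<forall>y\<in>Y w - T ` {..<m}. inner (solution m T (\<lambda>_. 1)) y < 1)} \<partial>M)"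
proof -
  let ?O = "\<lambda>w. {T \<in> {..<m} \<rightarrow>\<^sub>E Y w. regular m T \<and> (\<forall>y\<in>Y w - T ` {..<m}. inner (solution m T (\<lambda>_. 1)) y < 1)}"
  let ?G = "\<lambda>j w. indicator {of_nat m} (ecard (Y w \<inter> cone_cap (q j) \<epsilon>)) * indicator (locally_finite_event M Y far) w :: ennreal"
  have "(\<integral>\<^sup>+T. indicator {T. regular m T} T * weight (c * (cap_mass n r \<epsilon> * (1 - \<epsilon>) powr - r)) T \<partial>Pi\<^sub>M {..<m} (\<lambda>_. \<Lambda>))
      \<le> suminf (\<lambda>j. \<integral>\<^sup>+w. ecard (A j \<inter> ({..<m} \<rightarrow>\<^sub>E Y w)) * ?G j w \<partial>M)"
    unfolding weight_cells[symmetric] by (intro suminf_le full_cell(2)) auto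
  also have "\<dots> = (\<integral>\<^sup>+w. suminf (\<lambda>j. ecard (A j \<inter> ({..<m} \<rightarrow>\<^sub>E Y w)) * ?G j w) \<partial>M)"
    by (rule nn_integral_suminf[symmetric]) (rule full_cell(1))
  also have "\<dots> \<le> (\<integral>\<^sup>+w. ecard (?O w) \<partial>M)"
  proof (rule nn_integral_mono)
    fix w
    have "suminf (\<lambda>j. ecard (A j \<inter> ({..<m} \<rightarrow>\<^sub>E Y w)) * ?G j w) \<le> suminf (\<lambda>j. ecard (?O w \<inter> A j))"
    proof (rule suminf_le)
      fix j
      show "ecard (A j \<inter> ({..<m} \<rightarrow>\<^sub>E Y w)) * ?G j w \<le> ecard (?O w \<inter> A j)"
      proof (cases "ecard (Y w \<inter> cone_cap (q j) \<epsilon>) = of_nat m")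
        case True
        then have fin: "finite (Y w \<inter> cone_cap (q j) \<epsilon>)" using ecard_less_top[of "Y w \<inter> cone_cap (q j) \<epsilon>"] of_nat_less_top[of m] by simp
        then have card: "card (Y w \<inter> cone_cap (q j) \<epsilon>) = m" using True by (simp add: ecard_finite)
        have "T \<in> ?O w" if T: "T \<in> A j" "T \<in> {..<m} \<rightarrow>\<^sub>E Y w" for T
        proof -
          have sub: "T ` {..<m} \<subseteq> Y w \<inter> cone_cap (q j) \<epsilon>"
            using cell_cap(1)[OF A_props(2)[OF T(1)]] A_props(3)[OF T(1)] T(2) by (auto simp: PiE_iff)
          have "T ` {..<m} = Y w \<inter> cone_cap (q j) \<epsilon>"
            by (rule card_subset_eq[OF fin sub]) (simp add: card_image[OF A_props(5)[OF T(1)]] card)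
          then have "inner (solution m T (\<lambda>_. 1)) y < 1" if "y \<in> Y w - T ` {..<m}" for y
            using cell_cap(2)[OF A_props(2)[OF T(1)], of y] that by force
          then show ?thesis using T A_props(1)[OF T(1)] by auto
        qed
        then have "ecard (A j \<inter> ({..<m} \<rightarrow>\<^sub>E Y w)) \<le> ecard (?O w \<inter> A j)" by (intro ecard_mono) auto
        then show ?thesis by (auto simp: indicator_def)
      qed simp
    qed auto
    also have "\<dots> = ecard (\<Union>j. ?O w \<inter> A j)" by (rule ecard_suminf[OF A_part, symmetric])
    also have "\<dots> \<le> ecard (?O w)" by (rule ecard_mono) auto
    finally show "suminf (\<lambda>j. ecard (A j \<inter> ({..<m} \<rightarrow>\<^sub>E Y w)) * ?G j w) \<le> ecard (?O w)" .
  qed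
  finally show ?thesis .
qed

end

private lemma face_mean_tendsto:
  assumes b: "b \<longlonglongrightarrow> cap_mass n r 0"
  shows "(\<lambda>j. ennreal (face_mean m r (b j))) \<longlonglongrightarrow> ennreal (face_mean m r (cap_mass n r 0))"
proof -
  have "cap_mass n r 0 \<noteq> 0" using cap_mass_0[OF n r] abs_moment_pos[of r] r by simp
  then show ?thesis unfolding face_mean_def using b by (intro tendsto_intros) auto
qed

text \<open>Used for s = 1 and s = -1, the outer and the inner caps. The parameter 1/(j+2) stays
  below 1, as the cells require.\<close>

private lemma cap_tendsto:
  assumes b: "(\<lambda>j. cap_mass n r (s * (1 / real (Suc (Suc j))))) \<longlonglongrightarrow> cap_mass n r 0" and s: "\<bar>s\<bar> \<le> 1"
  shows "(\<lambda>j. cap_mass n r (s * (1 / real (Suc (Suc j)))) * (1 - s * (1 / real (Suc (Suc j)))) powr - r) \<longlonglongrightarrow> cap_mass n r 0"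
    "eventually (\<lambda>j. 0 < cap_mass n r (s * (1 / real (Suc (Suc j)))) * (1 - s * (1 / real (Suc (Suc j)))) powr - r) sequentially"
proof -
  have "(\<lambda>j. 1 / real (Suc (Suc j))) \<longlonglongrightarrow> 0" by real_asymp
  then have "(\<lambda>j. cap_mass n r (s * (1 / real (Suc (Suc j)))) * (1 - s * (1 / real (Suc (Suc j)))) powr - r) \<longlonglongrightarrow> cap_mass n r 0 * (1 - s * 0) powr - r"
    by (intro tendsto_mult[OF b] tendsto_powr tendsto_intros) auto
  then show t: "(\<lambda>j. cap_mass n r (s * (1 / real (Suc (Suc j)))) * (1 - s * (1 / real (Suc (Suc j)))) powr - r) \<longlonglongrightarrow> cap_mass n r 0" by simp
  have "0 < cap_mass n r 0" using cap_mass_0[OF n r] abs_moment_pos[of r] r by simp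
  then show "eventually (\<lambda>j. 0 < cap_mass n r (s * (1 / real (Suc (Suc j)))) * (1 - s * (1 / real (Suc (Suc j)))) powr - r) sequentially"
    by (rule order_tendstoD(1)[OF t])
qed

text \<open>The cell bound holds for every \<epsilon> and its right-hand side is continuous in the
  mass of the cap, so \<epsilon> may tend to 0.\<close>

theorem vertices_expectation_le:
  "(\<integral>\<^sup>+w. ecard {T \<in> {..<m} \<rightarrow>\<^sub>E Y w. regular m T \<and> solution m T (\<lambda>_. 1) \<in> polar n (Y w)} \<partial>M) \<le> ennreal (face_mean m r (cap_mass n r 0))"
proof (rule tendsto_lowerbound)
  let ?b = "\<lambda>j. cap_mass n r (- 1 * (1 / real (Suc (Suc j)))) * (1 - - 1 * (1 / real (Suc (Suc j)))) powr - r"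
  have l: "(\<lambda>j. cap_mass n r (- 1 * (1 / real (Suc (Suc j))))) \<longlonglongrightarrow> cap_mass n r 0"
    using LIMSEQ_Suc[OF cap_mass_increasing[OF n r]] by simp
  from cap_tendsto(1)[OF l] show "(\<lambda>j. ennreal (face_mean m r (?b j))) \<longlonglongrightarrow> ennreal (face_mean m r (cap_mass n r 0))"
    by (intro face_mean_tendsto) auto
  have "eventually (\<lambda>j. 0 < ?b j) sequentially" by (rule cap_tendsto(2)[OF l]) simp
  then show "eventually (\<lambda>j. (\<integral>\<^sup>+w. ecard {T \<in> {..<m} \<rightarrow>\<^sub>E Y w. regular m T \<and> solution m T (\<lambda>_. 1) \<in> polar n (Y w)} \<partial>M)
      \<le> ennreal (face_mean m r (?b j))) sequentially"
  proof eventually_elim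
    case (elim j)
    have e: "0 < 1 / real (Suc (Suc j))" "1 / real (Suc (Suc j)) < 1" by auto
    obtain q C where qC: "\<And>j. q j \<in> Rn n - {0}" "disjoint_family C" "\<And>j :: nat. C j \<in> sets borel" "Rn n - {0} \<subseteq> (\<Union>j. C j)"
      "\<And>i x. x \<in> C i \<Longrightarrow> norm (x - q i) < 1 / real (Suc (Suc j)) * norm (q i)" using cell_partition[OF n r e] by metis
    show ?case using vertices_le_cells[OF e qC] nn_integral_weight[OF elim] by simp
  qed
qed simp

theorem faces_expectation_ge:
  "ennreal (face_mean m r (cap_mass n r 0)) \<le>
    (\<integral>\<^sup>+w. ecard {T \<in> {..<m} \<rightarrow>\<^sub>E Y w. regular m T \<and> (\<forall>y\<in>Y w - T ` {..<m}. inner (solution m T (\<lambda>_. 1)) y < 1)} \<partial>M)"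
proof (rule tendsto_upperbound)
  let ?b = "\<lambda>j. cap_mass n r (1 * (1 / real (Suc (Suc j)))) * (1 - 1 * (1 / real (Suc (Suc j)))) powr - r"
  have l: "(\<lambda>j. cap_mass n r (1 * (1 / real (Suc (Suc j))))) \<longlonglongrightarrow> cap_mass n r 0"
    using LIMSEQ_Suc[OF cap_mass_decreasing[OF n r]] by simp
  from cap_tendsto(1)[OF l] show "(\<lambda>j. ennreal (face_mean m r (?b j))) \<longlonglongrightarrow> ennreal (face_mean m r (cap_mass n r 0))"
    by (intro face_mean_tendsto) auto
  have "eventually (\<lambda>j. 0 < ?b j) sequentially" by (rule cap_tendsto(2)[OF l]) simp
  then show "eventually (\<lambda>j. ennreal (face_mean m r (?b j)) \<le>
      (\<integral>\<^sup>+w. ecard {T \<in> {..<m} \<rightarrow>\<^sub>E Y w. regular m T \<and> (\<forall>y\<in>Y w - T ` {..<m}. inner (solution m T (\<lambda>_. 1)) y < 1)} \<partial>M)) sequentially"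
  proof eventually_elim
    case (elim j)
    have e: "0 < 1 / real (Suc (Suc j))" "1 / real (Suc (Suc j)) < 1" by auto
    obtain q C where qC: "\<And>j. q j \<in> Rn n - {0}" "disjoint_family C" "\<And>j :: nat. C j \<in> sets borel" "Rn n - {0} \<subseteq> (\<Union>j. C j)"
      "\<And>i x. x \<in> C i \<Longrightarrow> norm (x - q i) < 1 / real (Suc (Suc j)) * norm (q i)" using cell_partition[OF n r e] by metis
    show ?case using cells_le_faces[OF e qC] nn_integral_weight[OF elim] by simp
  qed
qed simp

end

end

section \<open>Bounds for the expected face numbers\<close>

text \<open>Subsets of finite but arbitrarily large mass t are avoided with probability exp(-t),
  which bounds the probability of avoiding \<open>B\<close>.\<close>

lemma poisson_hits_infinite:
  assumes Y: "poisson_process M \<Lambda> Y" and B: "B \<in> sets \<Lambda>" "emeasure \<Lambda> B = \<infinity>"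
    and W: "\<And>k :: nat. W k \<in> sets \<Lambda>" "\<And>k. emeasure \<Lambda> (W k) < \<infinity>" "incseq W" "B \<subseteq> (\<Union>k. W k)"
  shows "AE w in M. Y w \<inter> B \<noteq> {}"
proof -
  interpret poisson_process M \<Lambda> Y by fact
  have [measurable]: "(\<lambda>w. ecard (Y w \<inter> B)) \<in> borel_measurable M" by (rule count_measurable[OF B(1)])
  define p where "p = (\<integral>\<^sup>+w. indicator {0} (ecard (Y w \<inter> B)) \<partial>M)"
  have "(\<lambda>k. emeasure \<Lambda> (B \<inter> W k)) \<longlonglongrightarrow> emeasure \<Lambda> (\<Union>k. B \<inter> W k)"
    using B(1) W(1,3) by (intro Lim_emeasure_incseq) (auto simp: incseq_def)
  moreover have "(\<Union>k. B \<inter> W k) = B" using W(4) by auto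
  ultimately have lim: "(\<lambda>k. emeasure \<Lambda> (B \<inter> W k)) \<longlonglongrightarrow> \<infinity>" using B(2) by simp
  have "p \<le> ennreal (exp (- real t))" for t :: nat
  proof -
    have "eventually (\<lambda>k. ennreal (real t) < emeasure \<Lambda> (B \<inter> W k)) sequentially"
      by (rule order_tendstoD(1)[OF lim]) simp
    then obtain k where k: "ennreal (real t) < emeasure \<Lambda> (B \<inter> W k)" by (auto simp: eventually_sequentially)
    have "emeasure \<Lambda> (B \<inter> W k) \<le> emeasure \<Lambda> (W k)" using W(1) by (intro emeasure_mono) auto
    also have "\<dots> < \<infinity>" by (rule W(2))
    finally have fin: "emeasure \<Lambda> (B \<inter> W k) < \<infinity>" .
    then have t: "real t \<le> measure \<Lambda> (B \<inter> W k)"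
      using k by (subst (asm) emeasure_eq_ennreal_measure) (auto simp: ennreal_less_iff)
    have "p \<le> (\<integral>\<^sup>+w. indicator {of_nat 0} (ecard (Y w \<inter> (B \<inter> W k))) \<partial>M)"
      unfolding p_def by (intro nn_integral_mono) (auto simp: indicator_def)
    also have "\<dots> = ennreal (exp (- measure \<Lambda> (B \<inter> W k)))"
      using B(1) W(1) fin by (subst poisson_count_prob[OF Y]) auto
    also have "\<dots> \<le> ennreal (exp (- real t))" using t by (intro ennreal_leI) simp
    finally show ?thesis .
  qed
  moreover have "(\<lambda>t. ennreal (exp (- real t))) \<longlonglongrightarrow> ennreal 0"
    by (intro tendsto_ennrealI) real_asymp
  ultimately have "p \<le> ennreal 0" by (intro LIMSEQ_le_const) auto
  then have "AE w in M. indicator {0} (ecard (Y w \<inter> B)) = (0 :: ennreal)"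
    unfolding p_def by (subst nn_integral_0_iff_AE[symmetric]) auto
  then show ?thesis by eventually_elim (auto split: split_indicator_asm)
qed

lemma emeasure_std_normal_interval:
  assumes "a < b"
  shows "emeasure std_normal {a<..<b} \<noteq> 0"
proof
  assume "emeasure std_normal {a<..<b} = 0"
  then have "AE x in lborel. x \<notin> {a<..<b}"
    unfolding std_normal_def by (subst (asm) emeasure_density)
      (auto simp: nn_integral_0_iff_AE normal_density_pos[of 1, THEN not_le[THEN iffD2]] ennreal_eq_0_iff indicator_def not_le elim!: eventually_mono split: if_splits)
  then have "emeasure lborel {a<..<b} = 0" by (subst (asm) AE_iff_measurable[where N = "{a<..<b}"]) auto
  then show False using assms by simp
qed

text \<open>Vectors chosen one from each of these cones form the rows of a strictly diagonally
  dominant matrix. The cones serve to show that the dual points almost surely span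
  \<open>Rn n\<close>.\<close>

definition dominant_cone :: "nat \<Rightarrow> nat \<Rightarrow> seq set"
  where "dominant_cone n i = {y. (\<Sum>j\<in>{..<n} - {i}. \<bar>coord y j\<bar>) < \<bar>coord y i\<bar>}"

lemma dominant_cone_borel [measurable]: "dominant_cone n i \<in> sets borel"
  unfolding dominant_cone_def by measurable

text \<open>In the equation of the row that belongs to the largest |coordinate| of \<open>d\<close>,
  the diagonal term outweighs all others.\<close>

lemma dominant_cone_spans:
  assumes d: "d \<in> Rn n" and y: "\<And>i. i < n \<Longrightarrow> y i \<in> dominant_cone n i \<inter> Rn n \<and> inner (y i) d = 0"
  shows "d = 0"
proof (rule ccontr)
  assume "d \<noteq> 0"
  define D where "D = (\<lambda>i. \<bar>coord d i\<bar>)"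
  have ne: "\<exists>k<n. D k \<noteq> 0"
  proof (rule ccontr)
    assume "\<not> (\<exists>k<n. D k \<noteq> 0)"
    then have "d = 0" using d by (intro poly_mapping_eqI) (auto simp: D_def Rn_iff not_less)
    then show False using \<open>d \<noteq> 0\<close> by simp
  qed
  then obtain i where i: "i < n" "\<And>k. k < n \<Longrightarrow> D k \<le> D i"
    using obtains_MAX[of "{..<n}" D] by (metis Max_ge finite_imageI finite_lessThan image_eqI lessThan_iff empty_iff)
  have Di: "0 < D i" using ne i by (auto simp: D_def intro: less_le_trans)
  define Z where "Z = (\<lambda>j. coord (y i) j)"
  have "0 = (\<Sum>j<n. Z j * coord d j)" using y[OF i(1)] inner_Rn[of "y i" n d] by (simp add: Z_def)
  also have "\<dots> = Z i * coord d i + (\<Sum>j\<in>{..<n} - {i}. Z j * coord d j)"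
    using i by (intro sum.remove) auto
  finally have "\<bar>Z i\<bar> * D i = \<bar>\<Sum>j\<in>{..<n} - {i}. Z j * coord d j\<bar>" by (simp add: D_def abs_mult[symmetric])
  also have "\<dots> \<le> (\<Sum>j\<in>{..<n} - {i}. \<bar>Z j * coord d j\<bar>)" by (rule sum_abs)
  also have "\<dots> \<le> (\<Sum>j\<in>{..<n} - {i}. \<bar>Z j\<bar> * D i)"
    by (rule sum_mono) (use i in \<open>auto simp: D_def abs_mult intro!: mult_left_mono\<close>)
  also have "\<dots> < \<bar>Z i\<bar> * D i"
    using y[OF i(1)] Di by (auto simp: dominant_cone_def Z_def sum_distrib_right[symmetric])
  finally show False by simp
qed

text \<open>The cone is invariant under nonzero scaling, so its mass is its Gaussian mass times the
  infinite total mass of \<open>pow_measure r\<close>.\<close>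

lemma emeasure_dominant_cone:
  assumes i: "i < n" and r: "0 < r"
  shows "emeasure (dual_intensity n r) (dominant_cone n i) = \<infinity>"
proof -
  interpret P: sigma_finite_measure "pow_measure r" by (rule sigma_finite_pow_measure)
  \<comment> \<open>A box inside the cone: the i-th coordinate exceeds 1, the other n - 1 are below
    1/n.\<close>
  define B where "B j = (if j = i then {1<..<2} else {0<..<1 / real n})" for j
  have n: "0 < n" using i by simp
  have B0: "(\<Prod>j<n. emeasure std_normal (B j)) \<noteq> 0"
    using n by (auto simp: B_def emeasure_std_normal_interval)
  have "(\<Prod>j<n. emeasure std_normal (B j)) = emeasure (Pi\<^sub>M {..<n} (\<lambda>_. std_normal)) (Pi\<^sub>E {..<n} B)"
    by (rule std_normal_PiM.emeasure_PiM[symmetric]) (auto simp: B_def)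
  also have "\<dots> \<le> emeasure (Pi\<^sub>M {..<n} (\<lambda>_. std_normal)) (emb n -` dominant_cone n i \<inter> space (Pi\<^sub>M {..<n} (\<lambda>_. std_normal)))"
  proof (rule emeasure_mono)
    show "emb n -` dominant_cone n i \<inter> space (Pi\<^sub>M {..<n} (\<lambda>_. std_normal)) \<in> sets (Pi\<^sub>M {..<n} (\<lambda>_. std_normal))"
      by (rule measurable_sets[OF measurable_emb_std_normal]) simp
    show "Pi\<^sub>E {..<n} B \<subseteq> emb n -` dominant_cone n i \<inter> space (Pi\<^sub>M {..<n} (\<lambda>_. std_normal))"
    proof
      fix T assume T: "T \<in> Pi\<^sub>E {..<n} B"
      have Tj: "\<bar>coord (emb n T) j\<bar> \<le> 1 / real n" if "j \<in> {..<n} - {i}" for j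
        using PiE_mem[OF T, of j] that by (auto simp: lookup_emb B_def)
      have "(\<Sum>j\<in>{..<n} - {i}. \<bar>coord (emb n T) j\<bar>) \<le> (\<Sum>j\<in>{..<n} - {i}. 1 / real n)" by (rule sum_mono) (rule Tj)
      also have "\<dots> \<le> 1" using n i by (simp add: card_Diff_singleton divide_le_eq)
      also have "\<dots> < \<bar>coord (emb n T) i\<bar>" using PiE_mem[OF T, of i] i by (auto simp: lookup_emb B_def)
      finally show "T \<in> emb n -` dominant_cone n i \<inter> space (Pi\<^sub>M {..<n} (\<lambda>_. std_normal))"
        using T by (auto simp: dominant_cone_def space_PiM PiE_iff)
    qed
  qed
  also have "\<dots> = emeasure (gauss n) (dominant_cone n i)"
    unfolding gauss_def by (rule emeasure_distr[symmetric]) auto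
  finally have G: "emeasure (gauss n) (dominant_cone n i) \<noteq> 0" using B0 by auto
  have "ennreal (2 / r * real k powr r) \<le> emeasure (pow_measure r) UNIV" if "0 < k" for k :: nat
    using pow_measure_abs_less[OF r, of "real k"] that emeasure_mono[of "{s. \<bar>s\<bar> < real k}" UNIV "pow_measure r"] by simp
  then have le: "eventually (\<lambda>k. ennreal (2 / r * real k powr r) \<le> emeasure (pow_measure r) UNIV) sequentially"
    by (intro eventually_sequentiallyI[of 1]) auto
  have "filterlim (\<lambda>k. 2 / r * real k powr r) at_top sequentially" using r by real_asymp
  then have "(\<lambda>k. ennreal (2 / r * real k powr r)) \<longlonglongrightarrow> \<infinity>" by (simp add: ennreal_tendsto_top_eq_at_top)
  from tendsto_upperbound[OF this le] have U: "emeasure (pow_measure r) UNIV = \<infinity>" by (simp add: top_unique)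
  have "emeasure (dual_intensity n r) (dominant_cone n i) = (\<integral>\<^sup>+y. indicator (dominant_cone n i) y \<partial>dual_intensity n r)" by simp
  also have "\<dots> = (\<integral>\<^sup>+g. (\<integral>\<^sup>+s. indicator (dominant_cone n i) (g /\<^sub>R s) \<partial>pow_measure r) \<partial>gauss n)"
    by (rule nn_integral_dual_intensity) measurable
  also have "\<dots> = (\<integral>\<^sup>+g. (\<integral>\<^sup>+s. indicator (dominant_cone n i) g \<partial>pow_measure r) \<partial>gauss n)"
  proof (rule nn_integral_cong, rule nn_integral_cong_AE)
    fix g
    show "AE s in pow_measure r. indicator (dominant_cone n i) (g /\<^sub>R s) = (indicator (dominant_cone n i) g :: ennreal)"
      using AE_pow_measure_nonzero
    proof eventually_elim
      case (elim s)
      have "g /\<^sub>R s \<in> dominant_cone n i \<longleftrightarrow> g \<in> dominant_cone n i"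
        using elim by (simp add: dominant_cone_def scaleR_poly_mapping.rep_eq abs_mult sum_distrib_left[symmetric])
      then show ?case by (simp add: indicator_def)
    qed
  qed
  also have "\<dots> = (\<integral>\<^sup>+g. \<infinity> * indicator (dominant_cone n i) g \<partial>gauss n)" using U by (simp add: mult.commute)
  also have "\<dots> = \<infinity> * emeasure (gauss n) (dominant_cone n i)" by (rule nn_integral_cmult_indicator) simp
  also have "\<dots> = \<infinity>" using G by (simp add: ennreal_top_mult)
  finally show ?thesis .
qed

text \<open>The integral is a supremum over simple functions, and multiplication by a positive
  constant permutes these. The face numbers and tuple counts are integrated in this sense, without a
  claim of measurability.\<close>

lemma nn_integral_cmult_nonmeasurable:
  assumes a: "0 < a"
  shows "(\<integral>\<^sup>+x. ennreal a * f x \<partial>M) = ennreal a * (\<integral>\<^sup>+x. f x \<partial>M)"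
proof -
  have le: "ennreal a * (\<integral>\<^sup>+x. f x \<partial>M) \<le> (\<integral>\<^sup>+x. ennreal a * f x \<partial>M)" for a f
  proof -
    have "ennreal a * (\<integral>\<^sup>+x. f x \<partial>M) = (SUP g\<in>{g. simple_function M g \<and> g \<le> f}. ennreal a * integral\<^sup>S M g)"
      unfolding nn_integral_def by (rule SUP_mult_left_ennreal)
    also have "\<dots> \<le> (\<integral>\<^sup>+x. ennreal a * f x \<partial>M)"
    proof (rule SUP_least)
      fix g assume "g \<in> {g. simple_function M g \<and> g \<le> f}"
      then have g: "simple_function M g" "g \<le> f" by auto
      have "ennreal a * integral\<^sup>S M g = (\<integral>\<^sup>+x. ennreal a * g x \<partial>M)"
        using g(1) by (simp add: nn_integral_cmult nn_integral_eq_simple_integral borel_measurable_simple_function)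
      also have "\<dots> \<le> (\<integral>\<^sup>+x. ennreal a * f x \<partial>M)"
        using g(2) by (intro nn_integral_mono mult_left_mono) (auto simp: le_fun_def)
      finally show "ennreal a * integral\<^sup>S M g \<le> (\<integral>\<^sup>+x. ennreal a * f x \<partial>M)" .
    qed
    finally show ?thesis .
  qed
  have inv: "ennreal (1 / a) * (ennreal a * y) = y" "ennreal a * (ennreal (1 / a) * y) = y" for y
    using a by (simp_all add: mult.assoc[symmetric] ennreal_mult[symmetric])
  have "ennreal (1 / a) * (\<integral>\<^sup>+x. ennreal a * f x \<partial>M) \<le> (\<integral>\<^sup>+x. f x \<partial>M)"
    using le[of "1 / a" "\<lambda>x. ennreal a * f x"] by (simp only: inv)
  then have "ennreal a * (ennreal (1 / a) * (\<integral>\<^sup>+x. ennreal a * f x \<partial>M)) \<le> ennreal a * (\<integral>\<^sup>+x. f x \<partial>M)"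
    by (rule mult_left_mono) simp
  then show ?thesis using le[of a f] by (simp add: inv)
qed

text \<open>The factorials pass from ordered tuples to sets of constraints. The upper bound also
  needs that the dual points span, so that every face reaches a point with n independent active
  constraints; this holds as every dominant cone has infinite intensity.\<close>

theorem expected_face_number_bounds:
  fixes M :: "'w measure"
  assumes n: "2 \<le> n" and r: "0 < r" and \<gamma>: "0 < \<gamma>" and X: "poisson_hyperplane_process n r \<gamma> M X" and l: "l < n"
  shows "ennreal (face_mean (n - l) r (abs_moment r / r) / fact (n - l)) \<le> expected_face_number n l M X"
    and "expected_face_number n l M X \<le> ennreal (real (n choose l) * (face_mean n r (abs_moment r / r) / fact n))"
proof -
  obtain c where c: "0 < c" and Y: "poisson_process M (scale_measure (ennreal c) (dual_intensity n r)) (\<lambda>w. dual_process n (X w))"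
    and XY: "AE w in M. X w = dual_hyperplane n ` dual_process n (X w)"
    using poisson_process_dual[OF n r \<gamma> X] by blast
  define Y' where "Y' w = dual_process n (X w)" for w
  note Y = Y[folded Y'_def]
  have n0: "0 < n" using n by simp
  have cap: "cap_mass n r 0 = abs_moment r / r" by (rule cap_mass_0[OF n0 r])
  have mean0: "0 \<le> face_mean m r b" if "0 < m" for m b
    unfolding face_mean_def unit_volume_def[OF r that]
    using r gauss_mass_pos[OF r] by (intro mult_nonneg_nonneg divide_nonneg_nonneg less_imp_le[OF abs_moment_pos] less_imp_le[OF Gamma_real_pos] zero_le_power) (auto intro!: add_nonneg_pos)
  have far_fin: "emeasure (scale_measure (ennreal c) (dual_intensity n r)) (far k) < \<infinity>" for k
    using emeasure_dual_intensity_far[OF r n0, of k] by (simp add: ennreal_mult_less_top)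
  have "1 / real (Suc j) \<le> 1 / real (Suc i)" if "i \<le> j" for i j using that by (simp add: frac_le)
  then have "incseq far" unfolding incseq_def far_def by (blast intro: order_trans)
  then have "AE w in M. Y' w \<inter> dominant_cone n i \<noteq> {}" if "i < n" for i
    using c by (intro poisson_hits_infinite[OF Y _ _ _ far_fin]) (auto simp: emeasure_dominant_cone[OF that r] far_UN ennreal_mult_top)
  then have cones: "AE w in M. \<forall>i\<in>{..<n}. Y' w \<inter> dominant_cone n i \<noteq> {}" by (subst AE_finite_all) auto
  have lf: "AE w in M. w \<in> locally_finite_event M Y' far"
    by (rule poisson_locally_finite(2)[OF Y _ far_fin]) simp
  have conf: "dual_configuration n (Y' w)" if "w \<in> locally_finite_event M Y' far" for w
  proof
    show "Y' w \<subseteq> dual_points n" by (auto simp: Y'_def dual_process_def)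
    fix \<delta> :: real assume "0 < \<delta>"
    then obtain k where "1 / real (Suc k) < \<delta>" using nat_approx_posE by blast
    then have "{y \<in> Y' w. \<delta> \<le> norm y} \<subseteq> Y' w \<inter> far k" by (auto simp: far_def)
    moreover have "finite (Y' w \<inter> far k)" using that by (simp add: locally_finite_event_def ecard_less_top[unfolded infinity_ennreal_def])
    ultimately show "finite {y \<in> Y' w. \<delta> \<le> norm y}" by (rule finite_subset)
  qed
  have zc: "AE w in M. face_number l (zero_cell n (X w)) = face_number l (polar n (Y' w))"
    using XY by eventually_elim (metis (no_types, lifting) Y'_def dual_process_def mem_Collect_eq subsetI zero_cell_dual)
  have E: "expected_face_number n l M X = (\<integral>\<^sup>+w. face_number l (polar n (Y' w)) \<partial>M)"
    unfolding expected_face_number_def by (rule nn_integral_cong_AE) (rule zc)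
  define m where "m = n - l"
  have m: "1 \<le> m" "m \<le> n" "n - m = l" using l by (auto simp: m_def)
  have "ennreal (face_mean m r (abs_moment r / r) / fact m) \<le> (\<integral>\<^sup>+w. face_number l (polar n (Y' w)) \<partial>M)"
  proof -
    let ?O = "\<lambda>w. {T \<in> {..<m} \<rightarrow>\<^sub>E Y' w. regular m T \<and> (\<forall>y\<in>Y' w - T ` {..<m}. inner (solution m T (\<lambda>_. 1)) y < 1)}"
    have "ennreal (face_mean m r (abs_moment r / r)) \<le> (\<integral>\<^sup>+w. ecard (?O w) \<partial>M)"
      using faces_expectation_ge[OF n0 r c Y m(1,2)] by (simp add: cap)
    also have "\<dots> \<le> (\<integral>\<^sup>+w. ennreal (fact m) * face_number l (polar n (Y' w)) \<partial>M)"
    proof (rule nn_integral_mono_AE, use lf in eventually_elim)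
      case (elim w)
      then show ?case using dual_configuration.face_number_ge[OF conf m(2), of w]
        by (simp add: m(3) ennreal_of_nat_eq_real_of_nat)
    qed
    also have "\<dots> = ennreal (fact m) * (\<integral>\<^sup>+w. face_number l (polar n (Y' w)) \<partial>M)"
      by (rule nn_integral_cmult_nonmeasurable) simp
    finally have "ennreal (1 / fact m) * ennreal (face_mean m r (abs_moment r / r)) \<le>
        ennreal (1 / fact m) * (ennreal (fact m) * (\<integral>\<^sup>+w. face_number l (polar n (Y' w)) \<partial>M))"
      by (rule mult_left_mono) simp
    then show ?thesis by (simp add: mult.assoc[symmetric] ennreal_mult[symmetric] mean0 Suc_le_lessD[OF m(1)[unfolded One_nat_def]])
  qed
  then show "ennreal (face_mean (n - l) r (abs_moment r / r) / fact (n - l)) \<le> expected_face_number n l M X" by (simp add: E m_def)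
  let ?V = "\<lambda>w. {T \<in> {..<n} \<rightarrow>\<^sub>E Y' w. regular n T \<and> solution n T (\<lambda>_. 1) \<in> polar n (Y' w)}"
  have "ennreal (fact n) * (\<integral>\<^sup>+w. face_number l (polar n (Y' w)) \<partial>M) = (\<integral>\<^sup>+w. ennreal (fact n) * face_number l (polar n (Y' w)) \<partial>M)"
    by (rule nn_integral_cmult_nonmeasurable[symmetric]) simp
  also have "\<dots> \<le> (\<integral>\<^sup>+w. ennreal (real (n choose l)) * ecard (?V w) \<partial>M)"
  proof (rule nn_integral_mono_AE, use lf cones in eventually_elim)
    case (elim w)
    interpret dual_configuration n "Y' w" by (rule conf) (rule elim)
    have "d = 0" if d: "d \<in> Rn n" "\<forall>y\<in>Y' w. inner y d = 0" for d
    proof -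
      have "\<forall>i<n. \<exists>y. y \<in> Y' w \<inter> dominant_cone n i" using elim(2) by blast
      then obtain y where "\<forall>i<n. y i \<in> Y' w \<inter> dominant_cone n i" by metis
      then show ?thesis using d YRn by (intro dominant_cone_spans[OF d(1), of y]) auto
    qed
    from face_number_le[OF this] show ?case using l by (simp add: ennreal_of_nat_eq_real_of_nat)
  qed
  also have "\<dots> = ennreal (real (n choose l)) * (\<integral>\<^sup>+w. ecard (?V w) \<partial>M)"
    using l by (intro nn_integral_cmult_nonmeasurable) simp
  also have "\<dots> \<le> ennreal (real (n choose l)) * ennreal (face_mean n r (abs_moment r / r))"
    using vertices_expectation_le[OF n0 r c Y, of n] n by (intro mult_left_mono) (auto simp: cap)
  finally have "ennreal (1 / fact n) * (ennreal (fact n) * (\<integral>\<^sup>+w. face_number l (polar n (Y' w)) \<partial>M)) \<le>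
      ennreal (1 / fact n) * (ennreal (real (n choose l)) * ennreal (face_mean n r (abs_moment r / r)))"
    by (rule mult_left_mono) simp
  then show "expected_face_number n l M X \<le> ennreal (real (n choose l) * (face_mean n r (abs_moment r / r) / fact n))"
    by (simp add: E mult.assoc[symmetric] ennreal_mult[symmetric] mean0[OF n0] mult.commute)
qed

section \<open>Asymptotics\<close>

lemma Gamma_midpoint:
  fixes x y :: real assumes "0 < x" "0 < y"
  shows "(Gamma ((x + y) / 2))\<^sup>2 \<le> Gamma x * Gamma y"
proof -
  have "(ln \<circ> Gamma) ((1 - 1 / 2) *\<^sub>R x + (1 / 2) *\<^sub>R y) \<le> (1 - 1 / 2) * (ln \<circ> Gamma) x + (1 / 2) * (ln \<circ> Gamma) y"
    by (rule convex_onD[OF log_convex_Gamma_real]) (use assms in auto)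
  then have "2 * ln (Gamma ((x + y) / 2)) \<le> ln (Gamma x) + ln (Gamma y)" by (simp add: field_simps)
  moreover have pos: "0 < Gamma ((x + y) / 2)" "0 < Gamma x" "0 < Gamma y" using assms by (auto intro: Gamma_real_pos)
  ultimately have "ln ((Gamma ((x + y) / 2))\<^sup>2) \<le> ln (Gamma x * Gamma y)"
    by (simp add: ln_mult ln_realpow)
  then show ?thesis using pos by (simp only: ln_le_cancel_iff zero_less_power mult_pos_pos)
qed

definition gamma_ratio :: "real \<Rightarrow> real"
  where "gamma_ratio y = Gamma (y + 1 / 2) / Gamma (y + 1)"

text \<open>The midpoint inequality for log-convexity is applied to y, y + 1 and to y + 1/2, y +
  3/2; the functional equation of \<Gamma> reduces both to the two values in the quotient.\<close>

lemma gamma_ratio_bounds: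
  assumes y: "0 < y"
  shows "gamma_ratio y \<le> y powr (- 1 / 2)" "(y + 1 / 2) powr (- 1 / 2) \<le> gamma_ratio y"
proof -
  have pos: "0 < Gamma y" "0 < Gamma (y + 1 / 2)" "0 < Gamma (y + 1)" using y by (auto intro: Gamma_real_pos)
  have p: "x powr (- 1 / 2) = sqrt (1 / x)" if "0 < x" for x :: real
  proof -
    have "x powr (- 1 / 2) = inverse (x powr (1 / 2))" using powr_minus[of x "1 / 2"] by simp
    also have "\<dots> = sqrt (1 / x)" using that by (simp add: powr_half_sqrt real_sqrt_divide inverse_eq_divide)
    finally show ?thesis .
  qed
  have "(Gamma (y + 1 / 2))\<^sup>2 \<le> Gamma y * Gamma (y + 1)"
    using Gamma_midpoint[of y "y + 1"] y by (simp add: field_simps)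
  also have "Gamma y * Gamma (y + 1) = (Gamma (y + 1))\<^sup>2 / y"
    using y Gamma_plus1[of y] by (simp add: power2_eq_square nonpos_Ints_def)
  finally have "(Gamma (y + 1 / 2))\<^sup>2 / (Gamma (y + 1))\<^sup>2 \<le> 1 / y"
    using pos by (subst pos_divide_le_eq) auto
  then have "(gamma_ratio y)\<^sup>2 \<le> 1 / y" by (simp add: gamma_ratio_def power_divide)
  then show "gamma_ratio y \<le> y powr (- 1 / 2)" unfolding p[OF y] by (rule real_le_rsqrt)
  have "(Gamma (y + 1))\<^sup>2 \<le> Gamma (y + 1 / 2) * Gamma (y + 1 / 2 + 1)"
  proof -
    have eq: "(y + 1 / 2 + (y + 1 / 2 + 1)) / 2 = y + 1" by simp
    show ?thesis by (rule Gamma_midpoint[of "y + 1 / 2" "y + 1 / 2 + 1", unfolded eq]) (use y in auto)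
  qed
  also have "\<dots> = (y + 1 / 2) * (Gamma (y + 1 / 2))\<^sup>2"
    using y Gamma_plus1[of "y + 1 / 2"] by (auto simp: power2_eq_square nonpos_Ints_def)
  finally have "1 / (y + 1 / 2) * (Gamma (y + 1))\<^sup>2 \<le> (Gamma (y + 1 / 2))\<^sup>2"
    using y by (simp add: pos_divide_le_eq mult.commute)
  then have "1 / (y + 1 / 2) \<le> (gamma_ratio y)\<^sup>2"
    using pos by (simp add: gamma_ratio_def power_divide pos_le_divide_eq)
  moreover have "0 \<le> gamma_ratio y" using pos by (simp add: gamma_ratio_def)
  ultimately show "(y + 1 / 2) powr (- 1 / 2) \<le> gamma_ratio y"
    using y by (subst p) (auto intro: real_le_lsqrt)
qed

text \<open>The constant omega_(r+1)/kappa_r, written with \<open>gamma_ratio\<close> so that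
  explicit bounds of order sqrt r are available when r grows with the dimension.\<close>

definition growth :: "real \<Rightarrow> real"
  where "growth r = 2 * sqrt pi / gamma_ratio (r / 2)"

lemma omega_over_kappa: "0 < r \<Longrightarrow> omega (r + 1) / kappa r = growth r"
  by (simp add: omega_def kappa_def growth_def gamma_ratio_def add_divide_distrib powr_add powr_half_sqrt)

lemma growth_pos: "0 < r \<Longrightarrow> 0 < growth r"
  by (auto simp: growth_def gamma_ratio_def intro!: divide_pos_pos mult_pos_pos Gamma_real_pos)

lemma growth_bounds:
  assumes r: "0 < r"
  shows "2 * sqrt pi * (r / 2) powr (1 / 2) \<le> growth r" "growth r \<le> 2 * sqrt pi * (r / 2 + 1 / 2) powr (1 / 2)"
proof -
  have g: "0 < gamma_ratio (r / 2)" using r by (auto simp: gamma_ratio_def intro!: divide_pos_pos Gamma_real_pos)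
  have "1 / (r / 2) powr (- 1 / 2) \<le> 1 / gamma_ratio (r / 2)" "1 / gamma_ratio (r / 2) \<le> 1 / (r / 2 + 1 / 2) powr (- 1 / 2)"
    using gamma_ratio_bounds[of "r / 2"] r g by (auto intro!: divide_left_mono mult_pos_pos)
  then have *: "(r / 2) powr (1 / 2) \<le> 1 / gamma_ratio (r / 2)" "1 / gamma_ratio (r / 2) \<le> (r / 2 + 1 / 2) powr (1 / 2)"
    by (simp_all add: powr_minus_divide)
  show "2 * sqrt pi * (r / 2) powr (1 / 2) \<le> growth r" "growth r \<le> 2 * sqrt pi * (r / 2 + 1 / 2) powr (1 / 2)"
    unfolding growth_def using mult_left_mono[OF *(1), of "2 * sqrt pi"] mult_left_mono[OF *(2), of "2 * sqrt pi"] by simp_all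
qed

text \<open>The power 2^(mr/2) in \<open>unit_volume\<close> cancels against the one in the moment
  of order m r, and the quotient of \<open>gauss_mass r\<close> and \<open>abs_moment r / r\<close>
  is \<open>growth r\<close>.\<close>

lemma face_mean_eq:
  assumes m: "0 < m" and r: "0 < r"
  shows "face_mean m r (abs_moment r / r) / fact m = growth r ^ m * gamma_ratio (real m * r / 2) / sqrt pi"
proof -
  define a where "a = abs_moment r / r"
  have a: "0 < a" using r abs_moment_pos[of r] by (simp add: a_def)
  have mom: "abs_moment p = Gamma (p / 2 + 1 / 2) * 2 powr (p / 2) / sqrt pi" if p: "0 < p" for p
  proof -
    have "Gamma ((p + 1) / 2 + 1) = (p + 1) / 2 * Gamma ((p + 1) / 2)" using p by (intro Gamma_plus1) (auto simp: nonpos_Ints_def)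
    then have "gauss_mass (p + 1) = Gamma (p / 2 + 1 / 2) * (sqrt 2 * 2 powr (p / 2))"
      using p by (simp add: gauss_mass_def add_divide_distrib[of p 1] powr_add powr_half_sqrt) (simp add: field_simps)
    then show ?thesis by (simp add: abs_moment_def real_sqrt_mult)
  qed
  have "gauss_mass r / a = growth r"
    using r Gamma_real_pos[of "r / 2 + 1 / 2"] by (simp add: a_def mom gauss_mass_def growth_def gamma_ratio_def)
  then have g: "gauss_mass r ^ m * a powr - real m = growth r ^ m"
    using a by (simp add: powr_minus powr_realpow divide_inverse[symmetric] power_divide[symmetric])
  have "face_mean m r a / fact m = (gauss_mass r ^ m * a powr - real m) * (abs_moment (real m * r) / (Gamma (real m * r / 2 + 1) * 2 powr (real m * r / 2)))"
    by (simp add: face_mean_def unit_volume_def[OF r m])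
  also have "\<dots> = growth r ^ m * gamma_ratio (real m * r / 2) / sqrt pi"
    using m r unfolding g by (subst mom) (auto simp: gamma_ratio_def)
  finally show ?thesis by (simp add: a_def)
qed

text \<open>The binomial coefficient is replaced by n^l; like the powers of n r, it is of polynomial
  size for fixed l.\<close>

theorem expected_face_number_real_bounds:
  assumes n: "2 \<le> n" and r: "0 < r" and \<gamma>: "0 < \<gamma>" and X: "poisson_hyperplane_process n r \<gamma> M X" and l: "l < n"
  shows "growth r ^ (n - l) * ((real n - real l) * r / 2 + 1 / 2) powr (- 1 / 2) / sqrt pi \<le> enn2real (expected_face_number n l M X)"
    and "enn2real (expected_face_number n l M X) \<le> real n ^ l * growth r ^ n * (real n * r / 2) powr (- 1 / 2) / sqrt pi"
proof -
  let ?E = "expected_face_number n l M X"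
  note b = expected_face_number_bounds[OF n r \<gamma> X l]
  have fin: "?E < \<infinity>" by (rule le_less_trans[OF b(2)]) simp
  have g: "0 < growth r" by (rule growth_pos[OF r])
  have m: "0 < n - l" "0 < n" using l by auto
  have gr: "0 \<le> gamma_ratio y" if "0 < y" for y
    using gamma_ratio_bounds(2)[OF that] powr_ge_zero[of "y + 1 / 2" "- 1 / 2"] by linarith
  have "growth r ^ (n - l) * ((real n - real l) * r / 2 + 1 / 2) powr (- 1 / 2) / sqrt pi \<le> growth r ^ (n - l) * gamma_ratio (real (n - l) * r / 2) / sqrt pi"
    using gamma_ratio_bounds(2)[of "real (n - l) * r / 2"] m r g l by (intro divide_right_mono mult_left_mono) (auto simp: of_nat_diff)
  also have "\<dots> \<le> enn2real ?E"
    using enn2real_mono[OF b(1)] fin m r g gr[of "real (n - l) * r / 2"] by (simp add: face_mean_eq)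
  finally show "growth r ^ (n - l) * ((real n - real l) * r / 2 + 1 / 2) powr (- 1 / 2) / sqrt pi \<le> enn2real ?E" .
  have "enn2real ?E \<le> real (n choose l) * (growth r ^ n * gamma_ratio (real n * r / 2) / sqrt pi)"
    using enn2real_mono[OF b(2)] m r g gr[of "real n * r / 2"] by (simp add: face_mean_eq)
  also have "\<dots> \<le> real (n ^ l) * (growth r ^ n * (real n * r / 2) powr (- 1 / 2) / sqrt pi)"
    using gamma_ratio_bounds(1)[of "real n * r / 2"] gr[of "real n * r / 2"] binomial_le_pow[of l n] m r g l
    by (intro mult_mono divide_right_mono mult_left_mono) (auto simp flip: of_nat_power)
  finally show "enn2real ?E \<le> real n ^ l * growth r ^ n * (real n * r / 2) powr (- 1 / 2) / sqrt pi" by (simp add: mult.assoc)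
qed

lemma root_lower_limit:
  fixes g r L :: real assumes g: "0 < g" and r: "0 < r"
  shows "(\<lambda>n. (g powr (real n - L) * (((real n - L) * r / 2 + 1 / 2) powr (- 1 / 2) / sqrt pi)) powr (1 / real n)) \<longlonglongrightarrow> g"
proof -
  have "(\<lambda>n. 1 - L / real n) \<longlonglongrightarrow> 1" by real_asymp
  then have "(\<lambda>n. g powr (1 - L / real n)) \<longlonglongrightarrow> g powr 1" using g by (intro tendsto_powr tendsto_const) auto
  moreover have "(\<lambda>n. (((real n - L) * r / 2 + 1 / 2) powr (- 1 / 2) / sqrt pi) powr (1 / real n)) \<longlonglongrightarrow> 1" using r by real_asymp
  ultimately have lim: "(\<lambda>n. g powr (1 - L / real n) * (((real n - L) * r / 2 + 1 / 2) powr (- 1 / 2) / sqrt pi) powr (1 / real n)) \<longlonglongrightarrow> g powr 1 * 1"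
    by (rule tendsto_mult)
  have eq: "g powr (1 - L / real n) * (((real n - L) * r / 2 + 1 / 2) powr (- 1 / 2) / sqrt pi) powr (1 / real n) =
      (g powr (real n - L) * (((real n - L) * r / 2 + 1 / 2) powr (- 1 / 2) / sqrt pi)) powr (1 / real n)" if "n \<ge> 1" for n
  proof -
    have "(real n - L) / real n = 1 - L / real n" using that by (simp add: field_simps)
    then show ?thesis using g by (subst powr_mult) (simp_all add: powr_powr)
  qed
  have "g powr 1 * 1 = g" using g by simp
  from Lim_transform_eventually[OF lim eventually_sequentiallyI[of 1, OF eq], unfolded this] show ?thesis .
qed

lemma root_upper_limit:
  fixes g r L :: real assumes g: "0 < g" and r: "0 < r"
  shows "(\<lambda>n. (g powr real n * (real n powr L * (real n * r / 2) powr (- 1 / 2) / sqrt pi)) powr (1 / real n)) \<longlonglongrightarrow> g"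
proof -
  have lim: "(\<lambda>n. g * (real n powr L * (real n * r / 2) powr (- 1 / 2) / sqrt pi) powr (1 / real n)) \<longlonglongrightarrow> g * 1"
    using r by (intro tendsto_mult tendsto_const) real_asymp
  have eq: "g * (real n powr L * (real n * r / 2) powr (- 1 / 2) / sqrt pi) powr (1 / real n) =
      (g powr real n * (real n powr L * (real n * r / 2) powr (- 1 / 2) / sqrt pi)) powr (1 / real n)" if "n \<ge> 1" for n
    using that g by (subst powr_mult) (auto simp: powr_powr)
  from Lim_transform_eventually[OF lim eventually_sequentiallyI[of 1, OF eq]] show ?thesis by simp
qed

text \<open>For r = b n the constant \<open>growth r\<close> varies with n and is replaced by its
  explicit lower bound 2 sqrt(pi b n / 2); the factor n^(-1/2) removes its growth.\<close>

lemma root_lower_limit_linear: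
  fixes b L :: real assumes "0 < b"
  shows "(\<lambda>n. real n powr (- 1 / 2) * ((2 * sqrt pi * (b * real n / 2) powr (1 / 2)) powr (real n - L) * (((real n - L) * (b * real n) / 2 + 1 / 2) powr (- 1 / 2) / sqrt pi)) powr (1 / real n))
    \<longlonglongrightarrow> 2 * sqrt pi * (b / 2) powr (1 / 2)"
  using assms by (real_asymp simp: sqrt_def)

lemma root_upper_limit_linear:
  fixes b L :: real assumes "0 < b"
  shows "(\<lambda>n. real n powr (- 1 / 2) * ((2 * sqrt pi * (b * real n / 2 + 1 / 2) powr (1 / 2)) powr real n * (real n powr L * (real n * (b * real n) / 2) powr (- 1 / 2) / sqrt pi)) powr (1 / real n))
    \<longlonglongrightarrow> 2 * sqrt pi * (b / 2) powr (1 / 2)"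
  using assms by (real_asymp simp: sqrt_def)

text \<open>The numbers \<open>g\<close> and \<open>h\<close> allow one statement for both regimes:
  for fixed r both are \<open>growth r\<close>, for r = b n they are its explicit bounds.\<close>

lemma root_expected_face_number_bounds:
  fixes l :: nat
  assumes n: "2 \<le> n" and r: "0 < r" and \<gamma>: "0 < \<gamma>" and X: "poisson_hyperplane_process n r \<gamma> M X" and l: "l < n"
    and g: "0 < g" "g \<le> growth r" "growth r \<le> h"
  shows "(g powr (real n - real l) * (((real n - real l) * r / 2 + 1 / 2) powr (- 1 / 2) / sqrt pi)) powr (1 / real n) \<le> root n (enn2real (expected_face_number n l M X))" (is "?A powr _ \<le> _")
    and "root n (enn2real (expected_face_number n l M X)) \<le> (h powr real n * (real n powr real l * (real n * r / 2) powr (- 1 / 2) / sqrt pi)) powr (1 / real n)" (is "_ \<le> ?B powr _")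
proof -
  note b = expected_face_number_real_bounds[OF n r \<gamma> X l]
  have "?A \<le> growth r ^ (n - l) * ((real n - real l) * r / 2 + 1 / 2) powr (- 1 / 2) / sqrt pi"
    using g l powr_realpow[of g "n - l"] by (auto simp: of_nat_diff power_mono intro!: divide_right_mono mult_right_mono)
  then have "root n ?A \<le> root n (enn2real (expected_face_number n l M X))" using b(1) n by (intro real_root_le_mono) auto
  then show "?A powr (1 / real n) \<le> root n (enn2real (expected_face_number n l M X))" using n by (simp add: root_powr_inverse)
  have "real n ^ l * growth r ^ n * (real n * r / 2) powr (- 1 / 2) / sqrt pi \<le> real n ^ l * h ^ n * (real n * r / 2) powr (- 1 / 2) / sqrt pi"
    using g by (intro divide_right_mono mult_right_mono mult_left_mono power_mono) auto
  also have "\<dots> = ?B" using g n by (simp add: powr_realpow mult_ac)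
  finally have "root n (enn2real (expected_face_number n l M X)) \<le> root n ?B" using b(2) n by (intro real_root_le_mono) auto
  then show "root n (enn2real (expected_face_number n l M X)) \<le> ?B powr (1 / real n)" using n by (simp add: root_powr_inverse)
qed

theorem theorem1p2:
  fixes l :: nat
  shows "(\<forall>(r :: real) (\<gamma> :: nat \<Rightarrow> real) (M :: nat \<Rightarrow> 'w measure)
            (X :: nat \<Rightarrow> 'w \<Rightarrow> (nat \<Rightarrow>\<^sub>0 real) set set).
          r > 0 \<longrightarrow>
          (\<forall>n\<ge>2. \<gamma> n > 0 \<and> poisson_hyperplane_process n r (\<gamma> n) (M n) (X n)) \<longrightarrow>
          (\<lambda>n. root n (enn2real (expected_face_number n l (M n) (X n))))
            \<longlonglongrightarrow> omega (r + 1) / kappa r)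
       \<and> (\<forall>(b :: real) (\<gamma> :: nat \<Rightarrow> real) (M :: nat \<Rightarrow> 'w measure)
            (X :: nat \<Rightarrow> 'w \<Rightarrow> (nat \<Rightarrow>\<^sub>0 real) set set).
          b > 0 \<longrightarrow>
          (\<forall>n\<ge>2. \<gamma> n > 0 \<and> poisson_hyperplane_process n (b * real n) (\<gamma> n) (M n) (X n)) \<longrightarrow>
          (\<lambda>n. real n powr (- 1 / 2) * root n (enn2real (expected_face_number n l (M n) (X n))))
            \<longlonglongrightarrow> sqrt (2 * pi * b))"
proof (intro conjI allI impI)
  fix r :: real and \<gamma> :: "nat \<Rightarrow> real" and M :: "nat \<Rightarrow> 'w measure" and X :: "nat \<Rightarrow> 'w \<Rightarrow> (nat \<Rightarrow>\<^sub>0 real) set set"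
  assume r: "0 < r" and X: "\<forall>n\<ge>2. \<gamma> n > 0 \<and> poisson_hyperplane_process n r (\<gamma> n) (M n) (X n)"
  have g: "0 < growth r" by (rule growth_pos[OF r])
  \<comment> \<open>The bounds require both n at least 2 and l < n.\<close>
  have ev: "eventually (\<lambda>n. 2 \<le> n \<and> l < n) sequentially" by (rule eventually_sequentiallyI[of "l + 2"]) auto
  note bounds = root_expected_face_number_bounds[where l = l, OF _ r _ _ _ g order.refl order.refl]
  show "(\<lambda>n. root n (enn2real (expected_face_number n l (M n) (X n)))) \<longlonglongrightarrow> omega (r + 1) / kappa r"
    unfolding omega_over_kappa[OF r]
  proof (rule tendsto_sandwich[OF _ _ root_lower_limit[OF g r, of "real l"] root_upper_limit[OF g r, of "real l"]])
    show "eventually (\<lambda>n. (growth r powr (real n - real l) * (((real n - real l) * r / 2 + 1 / 2) powr (- 1 / 2) / sqrt pi)) powr (1 / real n)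
        \<le> root n (enn2real (expected_face_number n l (M n) (X n)))) sequentially"
      using ev by eventually_elim (use X in \<open>blast intro: bounds(1)\<close>)
    show "eventually (\<lambda>n. root n (enn2real (expected_face_number n l (M n) (X n))) \<le>
        (growth r powr real n * (real n powr real l * (real n * r / 2) powr (- 1 / 2) / sqrt pi)) powr (1 / real n)) sequentially"
      using ev by eventually_elim (use X in \<open>blast intro: bounds(2)\<close>)
  qed
next
  fix b :: real and \<gamma> :: "nat \<Rightarrow> real" and M :: "nat \<Rightarrow> 'w measure" and X :: "nat \<Rightarrow> 'w \<Rightarrow> (nat \<Rightarrow>\<^sub>0 real) set set"
  assume b: "0 < b" and X: "\<forall>n\<ge>2. \<gamma> n > 0 \<and> poisson_hyperplane_process n (b * real n) (\<gamma> n) (M n) (X n)"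
  have ev: "eventually (\<lambda>n. 2 \<le> n \<and> l < n) sequentially" by (rule eventually_sequentiallyI[of "l + 2"]) auto
  have "sqrt (2 * pi * b) = sqrt (4 * (pi * (b / 2)))" by simp
  also have "\<dots> = 2 * sqrt pi * (b / 2) powr (1 / 2)" using b by (simp only: real_sqrt_mult powr_half_sqrt) simp
  finally have lim: "sqrt (2 * pi * b) = 2 * sqrt pi * (b / 2) powr (1 / 2)" .
  show "(\<lambda>n. real n powr (- 1 / 2) * root n (enn2real (expected_face_number n l (M n) (X n)))) \<longlonglongrightarrow> sqrt (2 * pi * b)"
    unfolding lim
  proof (rule tendsto_sandwich[OF _ _ root_lower_limit_linear[OF b, of "real l"] root_upper_limit_linear[OF b, of "real l"]])
    have bounds: "((2 * sqrt pi * (b * real n / 2) powr (1 / 2)) powr (real n - real l) * (((real n - real l) * (b * real n) / 2 + 1 / 2) powr (- 1 / 2) / sqrt pi)) powr (1 / real n)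
          \<le> root n (enn2real (expected_face_number n l (M n) (X n)))"
        "root n (enn2real (expected_face_number n l (M n) (X n)))
          \<le> ((2 * sqrt pi * (b * real n / 2 + 1 / 2) powr (1 / 2)) powr real n * (real n powr real l * (real n * (b * real n) / 2) powr (- 1 / 2) / sqrt pi)) powr (1 / real n)"
      if n: "2 \<le> n \<and> l < n" for n
    proof -
      have r: "0 < b * real n" using b n by simp
      have g: "0 < 2 * sqrt pi * (b * real n / 2) powr (1 / 2)" using b n by (intro mult_pos_pos) auto
      have "0 < \<gamma> n" "poisson_hyperplane_process n (b * real n) (\<gamma> n) (M n) (X n)" "2 \<le> n" "l < n" using X n by auto
      note * = root_expected_face_number_bounds[OF this(3) r this(1,2,4) g growth_bounds[OF r]]
      show "((2 * sqrt pi * (b * real n / 2) powr (1 / 2)) powr (real n - real l) * (((real n - real l) * (b * real n) / 2 + 1 / 2) powr (- 1 / 2) / sqrt pi)) powr (1 / real n)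
          \<le> root n (enn2real (expected_face_number n l (M n) (X n)))" by (rule *(1))
      show "root n (enn2real (expected_face_number n l (M n) (X n)))
          \<le> ((2 * sqrt pi * (b * real n / 2 + 1 / 2) powr (1 / 2)) powr real n * (real n powr real l * (real n * (b * real n) / 2) powr (- 1 / 2) / sqrt pi)) powr (1 / real n)" by (rule *(2))
    qed
    show "eventually (\<lambda>n. real n powr (- 1 / 2) * ((2 * sqrt pi * (b * real n / 2) powr (1 / 2)) powr (real n - real l) *
          (((real n - real l) * (b * real n) / 2 + 1 / 2) powr (- 1 / 2) / sqrt pi)) powr (1 / real n)
        \<le> real n powr (- 1 / 2) * root n (enn2real (expected_face_number n l (M n) (X n)))) sequentially"
      using ev by eventually_elim (intro mult_left_mono bounds powr_ge_zero)
    show "eventually (\<lambda>n. real n powr (- 1 / 2) * root n (enn2real (expected_face_number n l (M n) (X n))) \<le>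
        real n powr (- 1 / 2) * ((2 * sqrt pi * (b * real n / 2 + 1 / 2) powr (1 / 2)) powr real n *
          (real n powr real l * (real n * (b * real n) / 2) powr (- 1 / 2) / sqrt pi)) powr (1 / real n)) sequentially"
      using ev by eventually_elim (intro mult_left_mono bounds powr_ge_zero)
  qed
qed

end
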